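(* Let $(K,v)$ be a valued field. The following are equivalent: (1) $(K,v)$ is henselian; (2) $(Kv_\Delta,\bar v)$ is t-henselian for every coarsening $v_\Delta$ of $v$; (3) for every coarsening $v_\Delta$ of $v$, every polynomial map $P:(Kv_\Delta)^n\to(Kv_\Delta)^n$, and every $a\in (Kv_\Delta)^n$ at which the Jacobian determinant of $P$ is non-zero, and every $\bar v$-open $U\subseteq (Kv_\Delta)^n$ with $a\in U$, the set $P(U)$ has non-empty interior; (4) for every coarsening $v_\Delta$ of $v$, every polynomial map $P:(Kv_\Delta)^n\to(Kv_\Delta)^n$ whose Jacobian determinant is not identically zero, and every (non-empty) $\bar v$-open $U\subseteq (Kv_\Delta)^n$, the set $P(U)$ has non-empty interior.
   Context: A coarsening of $v$ is a valuation $w$ on $K$ with $\mathcal O_v\subseteq\mathcal O_w$; for a coarsening $v_\Delta$, $Kv_\Delta$ denotes its residue field and $\bar v$ the valuation induced by $v$ on $Kv_\Delta$ (valuation ring $\mathcal O_v/\mathcal M_{v_\Delta}$). Topologies on $(Kv_\Delta)^n$ are the product of the valuation topology of $\bar v$. A valued field $(F,w)$ is t-henselian if for every $n\geq 1$ there is a $w$-open neighbourhood $U$ of $0$ such that every polynomial $X^{n+1}+X^n+a_{n-1}X^{n-1}+\dots+a_0$ with all $a_i\in U$ has a root in $F$. *)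

theory Defs
  imports
    "HOL-Algebra.Algebra"
    "HOL-Combinatorics.Permutations"
    "HOL-Analysis.Function_Topology"
begin

record 'g ogroup = "'g monoid" +
  ole :: "'g \<Rightarrow> 'g \<Rightarrow> bool" (infixl \<open>\<preceq>\<index>\<close> 50)

definition oless :: "('g, 'h) ogroup_scheme \<Rightarrow> 'g \<Rightarrow> 'g \<Rightarrow> bool" (infixl \<open>\<prec>\<index>\<close> 50)
  where "x \<prec>\<^bsub>G\<^esub> y \<longleftrightarrow> x \<preceq>\<^bsub>G\<^esub> y \<and> x \<noteq> y"

locale ordered_abelian_group = comm_group G for G :: "('g, 'h) ogroup_scheme" (structure) +
  assumes ole_refl: "x \<in> carrier G \<Longrightarrow> x \<preceq> x"
    and ole_antisym:
      "\<lbrakk>x \<in> carrier G; y \<in> carrier G; x \<preceq> y; y \<preceq> x\<rbrakk> \<Longrightarrow> x = y"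
    and ole_trans:
      "\<lbrakk>x \<in> carrier G; y \<in> carrier G; z \<in> carrier G; x \<preceq> y; y \<preceq> z\<rbrakk> \<Longrightarrow> x \<preceq> z"
    and ole_total: "\<lbrakk>x \<in> carrier G; y \<in> carrier G\<rbrakk> \<Longrightarrow> x \<preceq> y \<or> y \<preceq> x"
    and ole_mult:
      "\<lbrakk>x \<in> carrier G; y \<in> carrier G; z \<in> carrier G; x \<preceq> y\<rbrakk> \<Longrightarrow> x \<otimes> z \<preceq> y \<otimes> z"

text \<open>Krull valuations of arbitrary rank. The ordered group is written multiplicatively, as every
  group of HOL-Algebra, but ordered additively: elements of large value are small, so the valuation
  ring is \<open>v x \<ge> \<one>\<close>. The value \<open>v \<zero> = \<infinity>\<close> is not represented: \<open>v\<close> matters only on the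
  non-zero elements and \<open>\<zero>\<close> is treated separately. The map \<open>v\<close> need not be onto, that is, the value
  group is the image of the non-zero elements.\<close>

locale valued_field = K: field K + G: ordered_abelian_group G
  for K :: "('a, 'k) ring_scheme" (structure) and G :: "('g, 'h) ogroup_scheme" (structure)
    and v :: "'a \<Rightarrow> 'g" +
  assumes val_closed: "x \<in> carrier K - {\<zero>\<^bsub>K\<^esub>} \<Longrightarrow> v x \<in> carrier G"
    and val_mult: "\<lbrakk>x \<in> carrier K - {\<zero>\<^bsub>K\<^esub>}; y \<in> carrier K - {\<zero>\<^bsub>K\<^esub>}\<rbrakk>
      \<Longrightarrow> v (x \<otimes>\<^bsub>K\<^esub> y) = v x \<otimes>\<^bsub>G\<^esub> v y"
    and val_add: "\<lbrakk>x \<in> carrier K - {\<zero>\<^bsub>K\<^esub>}; y \<in> carrier K - {\<zero>\<^bsub>K\<^esub>}; x \<oplus>\<^bsub>K\<^esub> y \<noteq> \<zero>\<^bsub>K\<^esub>\<rbrakk>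
      \<Longrightarrow> v x \<preceq>\<^bsub>G\<^esub> v (x \<oplus>\<^bsub>K\<^esub> y) \<or> v y \<preceq>\<^bsub>G\<^esub> v (x \<oplus>\<^bsub>K\<^esub> y)"

definition val_set :: "('a, 'k) ring_scheme \<Rightarrow> ('g, 'h) ogroup_scheme \<Rightarrow> ('a \<Rightarrow> 'g) \<Rightarrow> 'a set"
  where "val_set K G v = {x \<in> carrier K. x = \<zero>\<^bsub>K\<^esub> \<or> \<one>\<^bsub>G\<^esub> \<preceq>\<^bsub>G\<^esub> v x}"

definition val_ring ::
  "('a, 'k) ring_scheme \<Rightarrow> ('g, 'h) ogroup_scheme \<Rightarrow> ('a \<Rightarrow> 'g) \<Rightarrow> ('a, 'k) ring_scheme"
  where "val_ring K G v = K\<lparr>carrier := val_set K G v\<rparr>"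

definition val_ideal :: "('a, 'k) ring_scheme \<Rightarrow> ('g, 'h) ogroup_scheme \<Rightarrow> ('a \<Rightarrow> 'g) \<Rightarrow> 'a set"
  where "val_ideal K G v = {x \<in> carrier K. x = \<zero>\<^bsub>K\<^esub> \<or> \<one>\<^bsub>G\<^esub> \<prec>\<^bsub>G\<^esub> v x}"

definition residue_field ::
  "('a, 'k) ring_scheme \<Rightarrow> ('g, 'h) ogroup_scheme \<Rightarrow> ('a \<Rightarrow> 'g) \<Rightarrow> 'a set ring"
  where "residue_field K G v = val_ring K G v Quot val_ideal K G v"

definition coarsening ::
  "('a, 'k) ring_scheme \<Rightarrow> ('g, 'h) ogroup_scheme \<Rightarrow> ('a \<Rightarrow> 'g)
    \<Rightarrow> ('d, 'e) ogroup_scheme \<Rightarrow> ('a \<Rightarrow> 'd) \<Rightarrow> bool"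
  where "coarsening K G v H w \<longleftrightarrow> valued_field K H w \<and> val_set K G v \<subseteq> val_set K H w"

text \<open>The valuation induced by \<open>v\<close> on the residue field of a coarsening. The elements of this residue
  field are cosets of the maximal ideal of the coarsening, and \<open>v\<close> is constant on each of them except
  the zero coset, whose value is irrelevant. Its valuation ring is determined in
  \<open>val_set_induced_val\<close> below.\<close>

definition induced_val :: "('a \<Rightarrow> 'g) \<Rightarrow> 'a set \<Rightarrow> 'g"
  where "induced_val v C = v (SOME x. x \<in> C)"

text \<open>The radii of the balls range over the values of non-zero field elements and not over all of the
  group, since the image of \<open>v\<close> need not be cofinal in it. The inequality is strict, so that the
  trivial valuation induces the discrete topology.\<close>

definition val_ball ::
  "('a, 'k) ring_scheme \<Rightarrow> ('g, 'h) ogroup_scheme \<Rightarrow> ('a \<Rightarrow> 'g) \<Rightarrow> 'a \<Rightarrow> 'a \<Rightarrow> 'a set"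
  where "val_ball F G v a c = {x \<in> carrier F. x = a \<or> v c \<prec>\<^bsub>G\<^esub> v (x \<ominus>\<^bsub>F\<^esub> a)}"

definition val_topology ::
  "('a, 'k) ring_scheme \<Rightarrow> ('g, 'h) ogroup_scheme \<Rightarrow> ('a \<Rightarrow> 'g) \<Rightarrow> 'a topology"
  where "val_topology F G v = topology_generated_by
    {val_ball F G v a c | a c. a \<in> carrier F \<and> c \<in> carrier F - {\<zero>\<^bsub>F\<^esub>}}"

text \<open>Points of the \<open>n\<close>-th power of \<open>F\<close> are extensional functions on \<open>{..<n}\<close>.\<close>

definition val_topology_pow ::
  "('a, 'k) ring_scheme \<Rightarrow> ('g, 'h) ogroup_scheme \<Rightarrow> ('a \<Rightarrow> 'g) \<Rightarrow> nat \<Rightarrow> (nat \<Rightarrow> 'a) topology"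
  where "val_topology_pow F G v n = product_topology (\<lambda>_. val_topology F G v) {..<n}"

definition up_eval :: "('a, 'k) ring_scheme \<Rightarrow> (nat \<Rightarrow> 'a) \<Rightarrow> 'a \<Rightarrow> 'a"
  where "up_eval R f x = UnivPoly.eval R R (\<lambda>c. c) x f"

definition up_deriv :: "('a, 'k) ring_scheme \<Rightarrow> (nat \<Rightarrow> 'a) \<Rightarrow> nat \<Rightarrow> 'a"
  where "up_deriv R f = (\<lambda>i. [Suc i] \<cdot>\<^bsub>R\<^esub> coeff (UP R) f (Suc i))"

text \<open>Hensel's lemma: a simple zero of the reduction of \<open>f\<close> lifts to a zero of \<open>f\<close>.\<close>

definition henselian :: "('a, 'k) ring_scheme \<Rightarrow> ('g, 'h) ogroup_scheme \<Rightarrow> ('a \<Rightarrow> 'g) \<Rightarrow> bool"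
  where "henselian K G v \<longleftrightarrow>
    (let R = val_ring K G v; M = val_ideal K G v in
      \<forall>f \<in> carrier (UP R). \<forall>a \<in> carrier R.
        up_eval R f a \<in> M \<and> up_eval R (up_deriv R f) a \<notin> M \<longrightarrow>
        (\<exists>b \<in> carrier R. up_eval R f b = \<zero>\<^bsub>R\<^esub> \<and> b \<ominus>\<^bsub>R\<^esub> a \<in> M))"

definition t_henselian :: "('a, 'k) ring_scheme \<Rightarrow> ('g, 'h) ogroup_scheme \<Rightarrow> ('a \<Rightarrow> 'g) \<Rightarrow> bool"
  where "t_henselian F G v \<longleftrightarrow>
    (\<forall>n \<ge> 1. \<exists>U. openin (val_topology F G v) U \<and> \<zero>\<^bsub>F\<^esub> \<in> U \<and>
      (\<forall>f \<in> carrier (UP F).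
        deg F f = n + 1 \<and> coeff (UP F) f (n + 1) = \<one>\<^bsub>F\<^esub> \<and> coeff (UP F) f n = \<one>\<^bsub>F\<^esub> \<and>
        (\<forall>i < n. coeff (UP F) f i \<in> U) \<longrightarrow>
        (\<exists>x \<in> carrier F. up_eval F f x = \<zero>\<^bsub>F\<^esub>)))"

text \<open>Polynomials in \<open>n\<close> indeterminates are the elements of \<open>ring.indexed_pset\<close> with index set
  \<open>{..<n}\<close>: functions from monomials (multisets of indices) to coefficients. Evaluation at a
  point and partial derivatives are not in the library.\<close>

definition mpoly_set :: "('a, 'k) ring_scheme \<Rightarrow> nat \<Rightarrow> (nat multiset \<Rightarrow> 'a) set"
  where "mpoly_set F n = ring.indexed_pset F {..<n} (carrier F)"

definition mpoly_eval ::
  "('a, 'k) ring_scheme \<Rightarrow> nat \<Rightarrow> (nat multiset \<Rightarrow> 'a) \<Rightarrow> (nat \<Rightarrow> 'a) \<Rightarrow> 'a"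
  where "mpoly_eval F n f x =
    (\<Oplus>\<^bsub>F\<^esub>m \<in> {m. f m \<noteq> \<zero>\<^bsub>F\<^esub>}. f m \<otimes>\<^bsub>F\<^esub> (\<Otimes>\<^bsub>F\<^esub>i \<in> {..<n}. x i [^]\<^bsub>F\<^esub> count m i))"

definition mpoly_deriv ::
  "('a, 'k) ring_scheme \<Rightarrow> nat \<Rightarrow> (nat multiset \<Rightarrow> 'a) \<Rightarrow> nat multiset \<Rightarrow> 'a"
  where "mpoly_deriv F j f = (\<lambda>m. [Suc (count m j)] \<cdot>\<^bsub>F\<^esub> f (add_mset j m))"

definition poly_map ::
  "('a, 'k) ring_scheme \<Rightarrow> nat \<Rightarrow> (nat \<Rightarrow> nat multiset \<Rightarrow> 'a) \<Rightarrow> (nat \<Rightarrow> 'a) \<Rightarrow> nat \<Rightarrow> 'a"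
  where "poly_map F n P x = (\<lambda>i\<in>{..<n}. mpoly_eval F n (P i) x)"

definition jacobian_det ::
  "('a, 'k) ring_scheme \<Rightarrow> nat \<Rightarrow> (nat \<Rightarrow> nat multiset \<Rightarrow> 'a) \<Rightarrow> (nat \<Rightarrow> 'a) \<Rightarrow> 'a"
  where "jacobian_det F n P x =
    (\<Oplus>\<^bsub>F\<^esub>\<sigma> \<in> {\<sigma>. \<sigma> permutes {..<n}}. [sign \<sigma>] \<cdot>\<^bsub>F\<^esub>
      (\<Otimes>\<^bsub>F\<^esub>i \<in> {..<n}. mpoly_eval F n (mpoly_deriv F (\<sigma> i) (P i)) x))"

text \<open>Both properties below concern a tuple \<open>P\<close> of polynomials rather than the function it defines,
  because over a finite field the function does not determine the Jacobian determinant. \<open>Not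
  identically zero\<close> is meant for the Jacobian determinant as a function on the \<open>n\<close>-th power
  of \<open>F\<close>.\<close>

definition interior_image_at_regular_points ::
  "('a, 'k) ring_scheme \<Rightarrow> ('g, 'h) ogroup_scheme \<Rightarrow> ('a \<Rightarrow> 'g) \<Rightarrow> bool"
  where "interior_image_at_regular_points F G v \<longleftrightarrow>
    (\<forall>n P a U. (\<forall>i < n. P i \<in> mpoly_set F n) \<and>
      a \<in> {..<n} \<rightarrow>\<^sub>E carrier F \<and> jacobian_det F n P a \<noteq> \<zero>\<^bsub>F\<^esub> \<and>
      openin (val_topology_pow F G v n) U \<and> a \<in> U \<longrightarrow>
      val_topology_pow F G v n interior_of (poly_map F n P ` U) \<noteq> {})"

definition interior_image_of_open_sets ::
  "('a, 'k) ring_scheme \<Rightarrow> ('g, 'h) ogroup_scheme \<Rightarrow> ('a \<Rightarrow> 'g) \<Rightarrow> bool"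
  where "interior_image_of_open_sets F G v \<longleftrightarrow>
    (\<forall>n P U. (\<forall>i < n. P i \<in> mpoly_set F n) \<and>
      (\<exists>x \<in> {..<n} \<rightarrow>\<^sub>E carrier F. jacobian_det F n P x \<noteq> \<zero>\<^bsub>F\<^esub>) \<and>
      openin (val_topology_pow F G v n) U \<and> U \<noteq> {} \<longrightarrow>
      val_topology_pow F G v n interior_of (poly_map F n P ` U) \<noteq> {})"

context valued_field begin

lemma val_one: "v \<one>\<^bsub>K\<^esub> = \<one>\<^bsub>G\<^esub>"
proof -
  have c: "v \<one>\<^bsub>K\<^esub> \<in> carrier G" by (rule val_closed) simp
  have "v \<one>\<^bsub>K\<^esub> \<otimes>\<^bsub>G\<^esub> v \<one>\<^bsub>K\<^esub> = v \<one>\<^bsub>K\<^esub>"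
    using val_mult[of "\<one>\<^bsub>K\<^esub>" "\<one>\<^bsub>K\<^esub>"] by simp
  then show ?thesis using c by (metis G.l_cancel_one)
qed

lemma val_minus_one: "v (\<ominus>\<^bsub>K\<^esub> \<one>\<^bsub>K\<^esub>) = \<one>\<^bsub>G\<^esub>"
proof -
  let ?m = "\<ominus>\<^bsub>K\<^esub> \<one>\<^bsub>K\<^esub>"
  have m: "?m \<in> carrier K - {\<zero>\<^bsub>K\<^esub>}"
    using K.minus_minus[of "\<one>\<^bsub>K\<^esub>"] K.minus_zero by fastforce
  then have c: "v ?m \<in> carrier G" by (rule val_closed)
  have "?m \<otimes>\<^bsub>K\<^esub> ?m = \<one>\<^bsub>K\<^esub>" by (simp add: K.l_minus K.r_minus)
  then have e: "v ?m \<otimes>\<^bsub>G\<^esub> v ?m = \<one>\<^bsub>G\<^esub>" using val_mult[OF m m] val_one by simp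
  show ?thesis
    using G.ole_total[OF c G.one_closed] G.ole_mult[OF c G.one_closed c]
      G.ole_mult[OF G.one_closed c c] G.ole_antisym[OF c G.one_closed] e c by auto
qed

lemma val_minus: "x \<in> carrier K - {\<zero>\<^bsub>K\<^esub>} \<Longrightarrow> v (\<ominus>\<^bsub>K\<^esub> x) = v x"
proof -
  assume x: "x \<in> carrier K - {\<zero>\<^bsub>K\<^esub>}"
  have m: "\<ominus>\<^bsub>K\<^esub> \<one>\<^bsub>K\<^esub> \<in> carrier K - {\<zero>\<^bsub>K\<^esub>}"
    using K.minus_minus[of "\<one>\<^bsub>K\<^esub>"] K.minus_zero by fastforce
  have "\<ominus>\<^bsub>K\<^esub> x = \<ominus>\<^bsub>K\<^esub> \<one>\<^bsub>K\<^esub> \<otimes>\<^bsub>K\<^esub> x" using x by (simp add: K.l_minus)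
  then show ?thesis using val_mult[OF m x] val_minus_one val_closed[OF x] by simp
qed

lemma val_inv:
  assumes x: "x \<in> carrier K - {\<zero>\<^bsub>K\<^esub>}"
  shows "inv\<^bsub>K\<^esub> x \<in> carrier K - {\<zero>\<^bsub>K\<^esub>}" "v (inv\<^bsub>K\<^esub> x) = inv\<^bsub>G\<^esub> v x"
    "x \<otimes>\<^bsub>K\<^esub> inv\<^bsub>K\<^esub> x = \<one>\<^bsub>K\<^esub>"
proof -
  have u: "x \<in> Units K" using x K.field_Units by simp
  then show i: "inv\<^bsub>K\<^esub> x \<in> carrier K - {\<zero>\<^bsub>K\<^esub>}"
    using K.Units_inv_Units K.field_Units by blast
  show e: "x \<otimes>\<^bsub>K\<^esub> inv\<^bsub>K\<^esub> x = \<one>\<^bsub>K\<^esub>" using u by simp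
  have "v x \<otimes>\<^bsub>G\<^esub> v (inv\<^bsub>K\<^esub> x) = \<one>\<^bsub>G\<^esub>" using val_mult[OF x i] e val_one by simp
  then show "v (inv\<^bsub>K\<^esub> x) = inv\<^bsub>G\<^esub> v x"
    using val_closed[OF x] val_closed[OF i] by (metis G.inv_unique' G.m_comm)
qed

lemma ole_pos_iff:
  assumes "x \<in> carrier G" shows "\<one>\<^bsub>G\<^esub> \<preceq>\<^bsub>G\<^esub> inv\<^bsub>G\<^esub> x \<longleftrightarrow> x \<preceq>\<^bsub>G\<^esub> \<one>\<^bsub>G\<^esub>"
  using G.ole_mult[of "\<one>\<^bsub>G\<^esub>" "inv\<^bsub>G\<^esub> x" x] G.ole_mult[of x "\<one>\<^bsub>G\<^esub>" "inv\<^bsub>G\<^esub> x"] assms by auto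

lemma ole_mult_pos:
  assumes "x \<in> carrier G" "y \<in> carrier G" "\<one>\<^bsub>G\<^esub> \<preceq>\<^bsub>G\<^esub> x"
  shows "y \<preceq>\<^bsub>G\<^esub> x \<otimes>\<^bsub>G\<^esub> y"
  using G.ole_mult[of "\<one>\<^bsub>G\<^esub>" x y] assms by auto

lemma val_set_subring: "subring (val_set K G v) K"
proof (rule K.subringI)
  show "val_set K G v \<subseteq> carrier K" by (auto simp: val_set_def)
  show "\<one>\<^bsub>K\<^esub> \<in> val_set K G v" by (auto simp: val_set_def val_one G.ole_refl)
  fix x assume x: "x \<in> val_set K G v"
  then show "\<ominus>\<^bsub>K\<^esub> x \<in> val_set K G v"
    using val_minus[of x] by (cases "x = \<zero>\<^bsub>K\<^esub>") (auto simp: val_set_def)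
  fix y assume y: "y \<in> val_set K G v"
  show "x \<otimes>\<^bsub>K\<^esub> y \<in> val_set K G v"
  proof (cases "x = \<zero>\<^bsub>K\<^esub> \<or> y = \<zero>\<^bsub>K\<^esub>")
    case True then show ?thesis using x y by (auto simp: val_set_def)
  next
    case False
    then have "x \<in> carrier K - {\<zero>\<^bsub>K\<^esub>}" "y \<in> carrier K - {\<zero>\<^bsub>K\<^esub>}" "\<one>\<^bsub>G\<^esub> \<preceq>\<^bsub>G\<^esub> v x" "\<one>\<^bsub>G\<^esub> \<preceq>\<^bsub>G\<^esub> v y"
      using x y by (auto simp: val_set_def)
    moreover from this have "\<one>\<^bsub>G\<^esub> \<preceq>\<^bsub>G\<^esub> v x \<otimes>\<^bsub>G\<^esub> v y"
      using ole_mult_pos[of "v x" "v y"] val_closed G.ole_trans[of "\<one>\<^bsub>G\<^esub>" "v y" "v x \<otimes>\<^bsub>G\<^esub> v y"]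
      by (meson G.m_closed G.one_closed)
    ultimately show ?thesis using val_mult by (auto simp: val_set_def)
  qed
  show "x \<oplus>\<^bsub>K\<^esub> y \<in> val_set K G v"
  proof (cases "x = \<zero>\<^bsub>K\<^esub> \<or> y = \<zero>\<^bsub>K\<^esub> \<or> x \<oplus>\<^bsub>K\<^esub> y = \<zero>\<^bsub>K\<^esub>")
    case True then show ?thesis using x y by (auto simp: val_set_def)
  next
    case False
    then have *: "x \<in> carrier K - {\<zero>\<^bsub>K\<^esub>}" "y \<in> carrier K - {\<zero>\<^bsub>K\<^esub>}" "\<one>\<^bsub>G\<^esub> \<preceq>\<^bsub>G\<^esub> v x" "\<one>\<^bsub>G\<^esub> \<preceq>\<^bsub>G\<^esub> v y"
      "x \<oplus>\<^bsub>K\<^esub> y \<in> carrier K - {\<zero>\<^bsub>K\<^esub>}"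
      using x y by (auto simp: val_set_def)
    then have "\<one>\<^bsub>G\<^esub> \<preceq>\<^bsub>G\<^esub> v (x \<oplus>\<^bsub>K\<^esub> y)"
      using val_add[of x y] val_closed by (metis (full_types) DiffD2 G.ole_trans G.one_closed singletonI)
    then show ?thesis using * by (auto simp: val_set_def)
  qed
qed

lemma val_add_strict:
  assumes "x \<in> carrier K - {\<zero>\<^bsub>K\<^esub>}" "y \<in> carrier K - {\<zero>\<^bsub>K\<^esub>}" "x \<oplus>\<^bsub>K\<^esub> y \<noteq> \<zero>\<^bsub>K\<^esub>"
    "g \<in> carrier G" "g \<prec>\<^bsub>G\<^esub> v x" "g \<prec>\<^bsub>G\<^esub> v y"
  shows "g \<prec>\<^bsub>G\<^esub> v (x \<oplus>\<^bsub>K\<^esub> y)"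
proof -
  have "x \<oplus>\<^bsub>K\<^esub> y \<in> carrier K - {\<zero>\<^bsub>K\<^esub>}" using assms by auto
  then have c: "v (x \<oplus>\<^bsub>K\<^esub> y) \<in> carrier G" "v x \<in> carrier G" "v y \<in> carrier G"
    using val_closed assms by auto
  from val_add[OF assms(1-3)] show ?thesis
    using c assms(4-6) unfolding oless_def by (metis G.ole_trans G.ole_antisym)
qed

lemma val_ideal_mult:
  assumes x: "x \<in> val_set K G v" and y: "y \<in> val_ideal K G v"
  shows "x \<otimes>\<^bsub>K\<^esub> y \<in> val_ideal K G v"
proof (cases "x = \<zero>\<^bsub>K\<^esub> \<or> y = \<zero>\<^bsub>K\<^esub>")
  case True then show ?thesis using x y by (auto simp: val_set_def val_ideal_def)
next
  case False
  then have *: "x \<in> carrier K - {\<zero>\<^bsub>K\<^esub>}" "y \<in> carrier K - {\<zero>\<^bsub>K\<^esub>}" "\<one>\<^bsub>G\<^esub> \<preceq>\<^bsub>G\<^esub> v x" "\<one>\<^bsub>G\<^esub> \<prec>\<^bsub>G\<^esub> v y"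
    using x y by (auto simp: val_set_def val_ideal_def)
  have c: "v x \<in> carrier G" "v y \<in> carrier G" using * val_closed by auto
  have l: "v y \<preceq>\<^bsub>G\<^esub> v x \<otimes>\<^bsub>G\<^esub> v y" using ole_mult_pos c * by blast
  then have "\<one>\<^bsub>G\<^esub> \<prec>\<^bsub>G\<^esub> v x \<otimes>\<^bsub>G\<^esub> v y"
    using * c unfolding oless_def by (metis G.m_closed G.ole_antisym G.ole_trans G.one_closed)
  then show ?thesis using * val_mult by (auto simp: val_ideal_def)
qed

lemma val_ideal_subset: "val_ideal K G v \<subseteq> val_set K G v"
  by (auto simp: val_ideal_def val_set_def oless_def)

lemma val_ring_cring: "cring (val_ring K G v)"
  unfolding val_ring_def
  using K.subcring_iff[OF subringE(1)[OF val_set_subring]] K.subcringI'[OF val_set_subring] by simp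

lemma val_ideal_ideal: "ideal (val_ideal K G v) (val_ring K G v)"
proof -
  interpret R: cring "val_ring K G v" by (rule val_ring_cring)
  have add: "x \<oplus>\<^bsub>K\<^esub> y \<in> val_ideal K G v" if "x \<in> val_ideal K G v" "y \<in> val_ideal K G v" for x y
    using that val_add_strict[of x y "\<one>\<^bsub>G\<^esub>"]
    by (cases "x = \<zero>\<^bsub>K\<^esub> \<or> y = \<zero>\<^bsub>K\<^esub> \<or> x \<oplus>\<^bsub>K\<^esub> y = \<zero>\<^bsub>K\<^esub>") (auto simp: val_ideal_def)
  have inv: "inv\<^bsub>add_monoid (val_ring K G v)\<^esub> x \<in> val_ideal K G v" if x: "x \<in> val_ideal K G v" for x
  proof -
    have "x \<in> carrier (val_ring K G v)" using x val_ideal_subset by (auto simp: val_ring_def)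
    then have "\<ominus>\<^bsub>val_ring K G v\<^esub> x = (\<ominus>\<^bsub>val_ring K G v\<^esub> \<one>\<^bsub>val_ring K G v\<^esub>) \<otimes>\<^bsub>val_ring K G v\<^esub> x"
      by (simp add: R.l_minus)
    moreover have "\<ominus>\<^bsub>val_ring K G v\<^esub> \<one>\<^bsub>val_ring K G v\<^esub> \<in> val_set K G v"
      using R.a_inv_closed[OF R.one_closed] by (simp add: val_ring_def)
    ultimately show ?thesis using val_ideal_mult x by (simp add: val_ring_def a_inv_def)
  qed
  show ?thesis
  proof (rule idealI)
    show "ring (val_ring K G v)" by (rule R.ring_axioms)
    show "subgroup (val_ideal K G v) (add_monoid (val_ring K G v))"
      using add inv val_ideal_subset
      by (intro subgroup.intro) (auto simp: val_ring_def val_ideal_def)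
    fix a x assume "a \<in> val_ideal K G v" and "x \<in> carrier (val_ring K G v)"
    then show "x \<otimes>\<^bsub>val_ring K G v\<^esub> a \<in> val_ideal K G v"
      and "a \<otimes>\<^bsub>val_ring K G v\<^esub> x \<in> val_ideal K G v"
      using val_ideal_mult[of x a] val_ideal_subset R.m_comm[of x a] by (auto simp: val_ring_def)
  qed
qed

lemma val_unit:
  assumes "x \<in> val_set K G v" "x \<notin> val_ideal K G v"
  shows "x \<in> carrier K - {\<zero>\<^bsub>K\<^esub>}" "v x = \<one>\<^bsub>G\<^esub>" "inv\<^bsub>K\<^esub> x \<in> val_set K G v"
proof -
  show x: "x \<in> carrier K - {\<zero>\<^bsub>K\<^esub>}" and e: "v x = \<one>\<^bsub>G\<^esub>"
    using assms by (auto simp: val_set_def val_ideal_def oless_def)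
  show "inv\<^bsub>K\<^esub> x \<in> val_set K G v"
    using val_inv[OF x] e by (auto simp: val_set_def G.ole_refl)
qed

lemma val_ideal_maximal: "maximalideal (val_ideal K G v) (val_ring K G v)"
proof (rule maximalidealI)
  interpret R: cring "val_ring K G v" by (rule val_ring_cring)
  show "ideal (val_ideal K G v) (val_ring K G v)" by (rule val_ideal_ideal)
  have "\<one>\<^bsub>K\<^esub> \<in> val_set K G v" using R.one_closed by (simp add: val_ring_def)
  moreover have "\<one>\<^bsub>K\<^esub> \<notin> val_ideal K G v" by (auto simp: val_ideal_def oless_def val_one)
  ultimately show "carrier (val_ring K G v) \<noteq> val_ideal K G v" by (auto simp: val_ring_def)
  fix J assume J: "ideal J (val_ring K G v)" "val_ideal K G v \<subseteq> J" "J \<subseteq> carrier (val_ring K G v)"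
  show "J = val_ideal K G v \<or> J = carrier (val_ring K G v)"
  proof (cases "J = val_ideal K G v")
    case False
    then obtain x where x: "x \<in> J" "x \<notin> val_ideal K G v" "x \<in> val_set K G v"
      using J by (auto simp: val_ring_def)
    note u = val_unit[OF x(3,2)]
    have "x \<otimes>\<^bsub>val_ring K G v\<^esub> inv\<^bsub>K\<^esub> x \<in> J"
      using ideal.I_r_closed[OF J(1) x(1)] u by (simp add: val_ring_def)
    then have "\<one>\<^bsub>val_ring K G v\<^esub> \<in> J" using val_inv(3)[OF u(1)] by (simp add: val_ring_def)
    then show ?thesis using ideal.one_imp_carrier[OF J(1)] by blast
  qed simp
qed

lemma residue_field_field: "field (residue_field K G v)"
  unfolding residue_field_def
  using maximalideal.quotient_is_field[OF val_ideal_maximal val_ring_cring] .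


lemma val_add_eq:
  assumes x: "x \<in> carrier K - {\<zero>\<^bsub>K\<^esub>}" and y: "y \<in> carrier K"
    and lt: "y = \<zero>\<^bsub>K\<^esub> \<or> v x \<prec>\<^bsub>G\<^esub> v y"
  shows "x \<oplus>\<^bsub>K\<^esub> y \<noteq> \<zero>\<^bsub>K\<^esub>" "v (x \<oplus>\<^bsub>K\<^esub> y) = v x"
proof -
  have "x \<oplus>\<^bsub>K\<^esub> y \<noteq> \<zero>\<^bsub>K\<^esub> \<and> v (x \<oplus>\<^bsub>K\<^esub> y) = v x"
  proof (cases "y = \<zero>\<^bsub>K\<^esub>")
    case True then show ?thesis using x by simp
  next
    case False
    then have y': "y \<in> carrier K - {\<zero>\<^bsub>K\<^esub>}" and l: "v x \<prec>\<^bsub>G\<^esub> v y" using y lt by auto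
    have n: "x \<oplus>\<^bsub>K\<^esub> y \<noteq> \<zero>\<^bsub>K\<^esub>"
    proof
      assume "x \<oplus>\<^bsub>K\<^esub> y = \<zero>\<^bsub>K\<^esub>"
      then have "x = \<ominus>\<^bsub>K\<^esub> y" using x y by (simp add: K.sum_zero_eq_neg)
      then show False using val_minus[OF y'] l by (simp add: oless_def)
    qed
    have s: "x \<oplus>\<^bsub>K\<^esub> y \<in> carrier K - {\<zero>\<^bsub>K\<^esub>}" using n x y by auto
    note c = val_closed[OF x] val_closed[OF y'] val_closed[OF s]
    have le: "v x \<preceq>\<^bsub>G\<^esub> v (x \<oplus>\<^bsub>K\<^esub> y)"
      using val_add[OF x y' n] l c unfolding oless_def by (metis G.ole_trans)
    have "\<not> v x \<prec>\<^bsub>G\<^esub> v (x \<oplus>\<^bsub>K\<^esub> y)"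
    proof
      assume a: "v x \<prec>\<^bsub>G\<^esub> v (x \<oplus>\<^bsub>K\<^esub> y)"
      have my: "\<ominus>\<^bsub>K\<^esub> y \<in> carrier K - {\<zero>\<^bsub>K\<^esub>}"
        using y' K.minus_minus[of y] K.minus_zero by fastforce
      have e: "(x \<oplus>\<^bsub>K\<^esub> y) \<oplus>\<^bsub>K\<^esub> \<ominus>\<^bsub>K\<^esub> y = x" using x y by (simp add: K.a_assoc K.r_neg)
      have "v x \<prec>\<^bsub>G\<^esub> v x"
        using val_add_strict[OF s my _ c(1) a] val_minus[OF y'] l e x by auto
      then show False by (simp add: oless_def)
    qed
    then show ?thesis using n le by (auto simp: oless_def)
  qed
  then show "x \<oplus>\<^bsub>K\<^esub> y \<noteq> \<zero>\<^bsub>K\<^esub>" "v (x \<oplus>\<^bsub>K\<^esub> y) = v x" by auto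
qed

end

lemma coarsening_val_ideal:
  assumes "valued_field K G v" and c: "coarsening K G v H w"
  shows "val_ideal K H w \<subseteq> val_ideal K G v"
proof
  interpret V: valued_field K G v by fact
  interpret W: valued_field K H w using c by (simp add: coarsening_def)
  fix x assume x: "x \<in> val_ideal K H w"
  show "x \<in> val_ideal K G v"
  proof (rule ccontr)
    assume n: "x \<notin> val_ideal K G v"
    then have x0: "x \<in> carrier K - {\<zero>\<^bsub>K\<^esub>}" using x by (auto simp: val_ideal_def)
    have "v x \<preceq>\<^bsub>G\<^esub> \<one>\<^bsub>G\<^esub>"
      using n x0 V.G.ole_total[OF V.val_closed[OF x0] V.G.one_closed] V.G.ole_refl
      by (auto simp: val_ideal_def oless_def)
    then have "inv\<^bsub>K\<^esub> x \<in> val_set K G v"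
      using V.val_inv[OF x0] V.ole_pos_iff[OF V.val_closed[OF x0]] by (auto simp: val_set_def)
    then have "inv\<^bsub>K\<^esub> x \<in> val_set K H w" using c by (auto simp: coarsening_def)
    then have "inv\<^bsub>K\<^esub> x \<otimes>\<^bsub>K\<^esub> x \<in> val_ideal K H w" using W.val_ideal_mult x by blast
    then have "\<one>\<^bsub>K\<^esub> \<in> val_ideal K H w"
      using V.val_inv[OF x0] x0 by (simp add: V.K.m_comm)
    then show False by (auto simp: val_ideal_def oless_def W.val_one)
  qed
qed

lemma carrier_residue_field:
  "carrier (residue_field K G v) = (\<lambda>x. val_ideal K G v +>\<^bsub>val_ring K G v\<^esub> x) ` val_set K G v"
  by (auto simp: residue_field_def FactRing_def A_RCOSETS_def' val_ring_def)

lemma val_coset: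
  "val_ideal K G v +>\<^bsub>val_ring K G v\<^esub> x = {m \<oplus>\<^bsub>K\<^esub> x | m. m \<in> val_ideal K G v}"
  by (auto simp: a_r_coset_def' val_ring_def)

lemma zero_residue_field: "\<zero>\<^bsub>residue_field K G v\<^esub> = val_ideal K G v"
  by (simp add: residue_field_def FactRing_def)

lemma induced_val_coset:
  assumes "valued_field K G v" and c: "coarsening K G v H w"
    and x: "x \<in> carrier K" "x \<notin> val_ideal K H w"
  shows "induced_val v (val_ideal K H w +>\<^bsub>val_ring K H w\<^esub> x) = v x"
proof -
  interpret V: valued_field K G v by fact
  interpret W: valued_field K H w using c by (simp add: coarsening_def)
  have x0: "x \<in> carrier K - {\<zero>\<^bsub>K\<^esub>}" using x by (auto simp: val_ideal_def)
  have "v y = v x" if y: "y \<in> val_ideal K H w +>\<^bsub>val_ring K H w\<^esub> x" for y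
  proof -
    obtain m where m: "m \<in> val_ideal K H w" "y = m \<oplus>\<^bsub>K\<^esub> x" using y by (auto simp: val_coset)
    have mK: "m \<in> carrier K" using m by (auto simp: val_ideal_def)
    have "m = \<zero>\<^bsub>K\<^esub> \<or> v x \<prec>\<^bsub>G\<^esub> v m"
    proof (rule ccontr)
      assume a: "\<not> (m = \<zero>\<^bsub>K\<^esub> \<or> v x \<prec>\<^bsub>G\<^esub> v m)"
      then have m0: "m \<in> carrier K - {\<zero>\<^bsub>K\<^esub>}" using mK by auto
      note i = V.val_inv[OF m0] 
      have "v m \<preceq>\<^bsub>G\<^esub> v x"
        using a V.G.ole_total[OF V.val_closed[OF m0] V.val_closed[OF x0]]
          V.G.ole_refl[OF V.val_closed[OF m0]] by (auto simp: oless_def)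
      then have "v m \<otimes>\<^bsub>G\<^esub> inv\<^bsub>G\<^esub> v m \<preceq>\<^bsub>G\<^esub> v x \<otimes>\<^bsub>G\<^esub> inv\<^bsub>G\<^esub> v m"
        using V.G.ole_mult[OF V.val_closed[OF m0] V.val_closed[OF x0] V.G.inv_closed[OF V.val_closed[OF m0]]]
        by blast
      then have "\<one>\<^bsub>G\<^esub> \<preceq>\<^bsub>G\<^esub> v (x \<otimes>\<^bsub>K\<^esub> inv\<^bsub>K\<^esub> m)"
        using V.val_mult[OF x0 i(1)] i(2) V.val_closed m0 by simp
      then have "x \<otimes>\<^bsub>K\<^esub> inv\<^bsub>K\<^esub> m \<in> val_set K G v" using x0 i(1) by (auto simp: val_set_def)
      then have "x \<otimes>\<^bsub>K\<^esub> inv\<^bsub>K\<^esub> m \<in> val_set K H w" using c by (auto simp: coarsening_def)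
      then have "x \<otimes>\<^bsub>K\<^esub> inv\<^bsub>K\<^esub> m \<otimes>\<^bsub>K\<^esub> m \<in> val_ideal K H w" using W.val_ideal_mult m by blast
      moreover have "inv\<^bsub>K\<^esub> m \<otimes>\<^bsub>K\<^esub> m = \<one>\<^bsub>K\<^esub>" using i m0 by (simp add: V.K.m_comm)
      ultimately have "x \<in> val_ideal K H w"
        using i(1) m0 x0 by (simp add: V.K.m_assoc)
      then show False using x by simp
    qed
    then have "v (x \<oplus>\<^bsub>K\<^esub> m) = v x" using V.val_add_eq[OF x0 mK] by blast
    then show ?thesis using m(2) mK x0 by (simp add: V.K.a_comm)
  qed
  moreover have "x \<in> val_ideal K H w +>\<^bsub>val_ring K H w\<^esub> x"
    unfolding val_coset using x by (auto simp: val_ideal_def intro!: exI[of _ "\<zero>\<^bsub>K\<^esub>"])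
  ultimately show ?thesis unfolding induced_val_def by (metis someI)
qed

lemma val_set_induced_val:
  assumes "valued_field K G v" and c: "coarsening K G v H w"
  shows "val_set (residue_field K H w) G (induced_val v)
    = (\<lambda>x. val_ideal K H w +>\<^bsub>val_ring K H w\<^esub> x) ` val_set K G v" (is "?L = ?q ` _")
proof -
  interpret V: valued_field K G v by fact
  interpret W: valued_field K H w using c by (simp add: coarsening_def)
  interpret I: ideal "val_ideal K H w" "val_ring K H w" by (rule W.val_ideal_ideal)
  have z: "?q x = val_ideal K H w" if "x \<in> val_ideal K H w" for x
    using that by (rule I.a_rcos_const)
  have z0: "\<zero>\<^bsub>K\<^esub> \<in> val_ideal K H w" "\<zero>\<^bsub>K\<^esub> \<in> val_set K G v"
    by (auto simp: val_ideal_def val_set_def)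
  have sub: "val_set K G v \<subseteq> val_set K H w" using c by (simp add: coarsening_def)
  show ?thesis
  proof (intro equalityI subsetI)
    fix y assume "y \<in> ?L"
    then obtain x where x: "x \<in> val_set K H w" "y = ?q x"
      and o: "y = val_ideal K H w \<or> \<one>\<^bsub>G\<^esub> \<preceq>\<^bsub>G\<^esub> induced_val v y"
      by (auto simp: val_set_def[of "residue_field K H w"] carrier_residue_field zero_residue_field)
    show "y \<in> ?q ` val_set K G v"
    proof (cases "y = val_ideal K H w")
      case True then show ?thesis using z[OF z0(1)] z0(2) by blast
    next
      case False
      then have n: "x \<notin> val_ideal K H w" using z x by auto
      moreover have "x \<in> carrier K" using x by (auto simp: val_set_def)
      ultimately have "x \<in> val_set K G v"
        using o False induced_val_coset[OF assms(1) c, of x] x by (auto simp: val_set_def)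
      then show ?thesis using x by blast
    qed
  next
    fix y assume "y \<in> ?q ` val_set K G v"
    then obtain x where x: "x \<in> val_set K G v" "y = ?q x" by auto
    show "y \<in> ?L"
    proof (cases "x \<in> val_ideal K H w")
      case True
      then show ?thesis using x z sub
        by (auto simp: val_set_def[of "residue_field K H w"] carrier_residue_field zero_residue_field)
    next
      case False
      then have "induced_val v y = v x" "x \<noteq> \<zero>\<^bsub>K\<^esub>"
        using induced_val_coset[OF assms(1) c, of x] x z0 by (auto simp: val_set_def)
      moreover have "y \<in> carrier (residue_field K H w)" using x sub by (auto simp: carrier_residue_field)
      ultimately show ?thesis using x by (auto simp: val_set_def)
    qed
  qed
qed

lemma valued_field_induced_val:
  assumes "valued_field K G v" and c: "coarsening K G v H w"
  shows "valued_field (residue_field K H w) G (induced_val v)"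
proof -
  interpret V: valued_field K G v by fact
  interpret W: valued_field K H w using c by (simp add: coarsening_def)
  interpret I: ideal "val_ideal K H w" "val_ring K H w" by (rule W.val_ideal_ideal)
  interpret F: field "residue_field K H w" by (rule W.residue_field_field)
  let ?q = "\<lambda>x. val_ideal K H w +>\<^bsub>val_ring K H w\<^esub> x"
  have z: "?q x = val_ideal K H w" if "x \<in> val_ideal K H w" for x
    using that by (rule I.a_rcos_const)
  have rep: "\<exists>x. x \<in> val_set K H w \<and> x \<notin> val_ideal K H w \<and> x \<in> carrier K - {\<zero>\<^bsub>K\<^esub>} \<and> y = ?q x \<and> induced_val v y = v x"
    if y: "y \<in> carrier (residue_field K H w) - {\<zero>\<^bsub>residue_field K H w\<^esub>}" for y
  proof -
    obtain x where x: "x \<in> val_set K H w" "y = ?q x" using y by (auto simp: carrier_residue_field)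
    have "x \<notin> val_ideal K H w" using y x z by (auto simp: zero_residue_field)
    moreover from this have "x \<in> carrier K - {\<zero>\<^bsub>K\<^esub>}" using x by (auto simp: val_set_def val_ideal_def)
    ultimately show ?thesis using x induced_val_coset[OF assms(1) c, of x] by auto
  qed
  have mul: "?q x \<otimes>\<^bsub>residue_field K H w\<^esub> ?q y = ?q (x \<otimes>\<^bsub>K\<^esub> y)" if "x \<in> val_set K H w" "y \<in> val_set K H w" for x y
    using I.rcoset_mult_add[of x y] that by (simp add: residue_field_def FactRing_def val_ring_def)
  have add: "?q x \<oplus>\<^bsub>residue_field K H w\<^esub> ?q y = ?q (x \<oplus>\<^bsub>K\<^esub> y)" if "x \<in> val_set K H w" "y \<in> val_set K H w" for x y
    using I.a_rcos_sum[of x y] that by (simp add: residue_field_def FactRing_def val_ring_def)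
  show ?thesis
  proof (intro valued_field.intro valued_field_axioms.intro)
    show "field (residue_field K H w)" by (rule W.residue_field_field)
    show "ordered_abelian_group G" by (rule V.G.ordered_abelian_group_axioms)
  next
    fix x assume "x \<in> carrier (residue_field K H w) - {\<zero>\<^bsub>residue_field K H w\<^esub>}"
    then show "induced_val v x \<in> carrier G" using rep V.val_closed by metis
  next
    fix x y assume xy: "x \<in> carrier (residue_field K H w) - {\<zero>\<^bsub>residue_field K H w\<^esub>}"
      "y \<in> carrier (residue_field K H w) - {\<zero>\<^bsub>residue_field K H w\<^esub>}"
    obtain a b where a: "a \<in> val_set K H w" "a \<notin> val_ideal K H w" "a \<in> carrier K - {\<zero>\<^bsub>K\<^esub>}" "x = ?q a" "induced_val v x = v a"
      and b: "b \<in> val_set K H w" "b \<notin> val_ideal K H w" "b \<in> carrier K - {\<zero>\<^bsub>K\<^esub>}" "y = ?q b" "induced_val v y = v b"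
      using rep xy by metis
    have "x \<otimes>\<^bsub>residue_field K H w\<^esub> y = ?q (a \<otimes>\<^bsub>K\<^esub> b)" using mul a b by simp
    moreover have "x \<otimes>\<^bsub>residue_field K H w\<^esub> y \<noteq> \<zero>\<^bsub>residue_field K H w\<^esub>"
      using xy F.integral by blast
    ultimately have "a \<otimes>\<^bsub>K\<^esub> b \<notin> val_ideal K H w" using z by (auto simp: zero_residue_field)
    then show "induced_val v (x \<otimes>\<^bsub>residue_field K H w\<^esub> y) = induced_val v x \<otimes>\<^bsub>G\<^esub> induced_val v y"
      using induced_val_coset[OF assms(1) c, of "a \<otimes>\<^bsub>K\<^esub> b"] a b V.val_mult mul by auto
    assume n: "x \<oplus>\<^bsub>residue_field K H w\<^esub> y \<noteq> \<zero>\<^bsub>residue_field K H w\<^esub>"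
    have "x \<oplus>\<^bsub>residue_field K H w\<^esub> y = ?q (a \<oplus>\<^bsub>K\<^esub> b)" using add a b by simp
    with n have nn: "a \<oplus>\<^bsub>K\<^esub> b \<notin> val_ideal K H w" using z by (auto simp: zero_residue_field)
    then have "a \<oplus>\<^bsub>K\<^esub> b \<noteq> \<zero>\<^bsub>K\<^esub>" by (auto simp: val_ideal_def)
    then show "induced_val v x \<preceq>\<^bsub>G\<^esub> induced_val v (x \<oplus>\<^bsub>residue_field K H w\<^esub> y) \<or>
       induced_val v y \<preceq>\<^bsub>G\<^esub> induced_val v (x \<oplus>\<^bsub>residue_field K H w\<^esub> y)"
      using induced_val_coset[OF assms(1) c, of "a \<oplus>\<^bsub>K\<^esub> b"] nn a b V.val_add add by auto
  qed
qed

text \<open>A statement about all coarsenings of a valuation on \<open>K\<close> can be restricted to value groups whose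
  elements are sets of elements of \<open>K\<close>: up to equivalence, that is, up to having the same valuation
  ring, they give all coarsenings.\<close>

lemma coarsening_value_group:
  fixes K :: "('a, 'k) ring_scheme" and H :: "('d, 'e) ogroup_scheme"
  assumes c: "coarsening K G v H w"
  shows "\<exists>(H' :: 'a set ogroup) w'. coarsening K G v H' w' \<and> val_set K H' w' = val_set K H w
    \<and> val_ideal K H' w' = val_ideal K H w"
proof -
  interpret W: valued_field K H w using c by (simp add: coarsening_def)
  let ?N = "carrier K - {\<zero>\<^bsub>K\<^esub>}"
  define p where "p x = {y \<in> ?N. w y = w x}" for x
  define rep where "rep A = (SOME y. y \<in> A)" for A :: "'a set"
  have rep_in: "rep (p x) \<in> p x" if "x \<in> ?N" for x
  proof -
    have "x \<in> p x" using that by (simp add: p_def)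
    then show ?thesis unfolding rep_def by (rule someI)
  qed
  have rep: "rep (p x) \<in> ?N" "w (rep (p x)) = w x" if "x \<in> ?N" for x
    using rep_in[OF that] by (auto simp: p_def)
  have pe: "p x = p y \<longleftrightarrow> w x = w y" if "x \<in> ?N" "y \<in> ?N" for x y
    using that by (metis p_def rep(2))
  define H' :: "'a set ogroup" where "H' = \<lparr>carrier = p ` ?N,
    monoid.mult = (\<lambda>A B. p (rep A \<otimes>\<^bsub>K\<^esub> rep B)), one = p \<one>\<^bsub>K\<^esub>, ole = (\<lambda>A B. w (rep A) \<preceq>\<^bsub>H\<^esub> w (rep B))\<rparr>"
  have mN: "x \<otimes>\<^bsub>K\<^esub> y \<in> ?N" if "x \<in> ?N" "y \<in> ?N" for x y
    using that W.K.integral by auto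
  have mult: "p x \<otimes>\<^bsub>H'\<^esub> p y = p (x \<otimes>\<^bsub>K\<^esub> y)" if "x \<in> ?N" "y \<in> ?N" for x y
    using pe[OF mN[OF rep(1)[OF that(1)] rep(1)[OF that(2)]] mN[OF that]] that rep W.val_mult
    by (simp add: H'_def)
  have ole: "p x \<preceq>\<^bsub>H'\<^esub> p y \<longleftrightarrow> w x \<preceq>\<^bsub>H\<^esub> w y" if "x \<in> ?N" "y \<in> ?N" for x y
    using that rep by (simp add: H'_def)
  have one: "\<one>\<^bsub>H'\<^esub> = p \<one>\<^bsub>K\<^esub>" and car: "carrier H' = p ` ?N" by (auto simp: H'_def)
  have 1: "\<one>\<^bsub>K\<^esub> \<in> ?N" by simp
  have "ordered_abelian_group H'"
  proof (intro ordered_abelian_group.intro ordered_abelian_group_axioms.intro comm_groupI)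
    fix A assume "A \<in> carrier H'"
    then obtain x where x: "x \<in> ?N" "A = p x" by (auto simp: car)
    show "\<exists>B\<in>carrier H'. B \<otimes>\<^bsub>H'\<^esub> A = \<one>\<^bsub>H'\<^esub>"
      using W.val_inv[OF x(1)] x mult[of "inv\<^bsub>K\<^esub> x" x]
      by (auto simp: car one W.K.m_comm intro!: bexI[of _ "p (inv\<^bsub>K\<^esub> x)"])
    show "\<one>\<^bsub>H'\<^esub> \<otimes>\<^bsub>H'\<^esub> A = A" using x mult[OF 1 x(1)] by (simp add: one)
    show "A \<preceq>\<^bsub>H'\<^esub> A" using x ole W.G.ole_refl W.val_closed by simp
    fix B assume "B \<in> carrier H'"
    then obtain y where y: "y \<in> ?N" "B = p y" by (auto simp: car)
    show "A \<otimes>\<^bsub>H'\<^esub> B \<in> carrier H'" using mult x y mN by (auto simp: car)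
    show "A \<otimes>\<^bsub>H'\<^esub> B = B \<otimes>\<^bsub>H'\<^esub> A" using mult x y by (auto simp: W.K.m_comm)
    show "A \<preceq>\<^bsub>H'\<^esub> B \<Longrightarrow> B \<preceq>\<^bsub>H'\<^esub> A \<Longrightarrow> A = B"
      using x y ole pe W.G.ole_antisym W.val_closed by simp
    show "A \<preceq>\<^bsub>H'\<^esub> B \<or> B \<preceq>\<^bsub>H'\<^esub> A" using x y ole W.G.ole_total W.val_closed by simp
    fix C assume "C \<in> carrier H'"
    then obtain z where z: "z \<in> ?N" "C = p z" by (auto simp: car)
    show "A \<otimes>\<^bsub>H'\<^esub> B \<otimes>\<^bsub>H'\<^esub> C = A \<otimes>\<^bsub>H'\<^esub> (B \<otimes>\<^bsub>H'\<^esub> C)"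
      using x y z mult[OF mN[OF x(1) y(1)] z(1)] mult[OF x(1) mN[OF y(1) z(1)]] mult[OF x(1) y(1)]
        mult[OF y(1) z(1)] by (simp add: W.K.m_assoc)
    show "A \<preceq>\<^bsub>H'\<^esub> B \<Longrightarrow> B \<preceq>\<^bsub>H'\<^esub> C \<Longrightarrow> A \<preceq>\<^bsub>H'\<^esub> C"
      using x y z ole W.G.ole_trans[of "w x" "w y" "w z"] W.val_closed by simp
    show "A \<preceq>\<^bsub>H'\<^esub> B \<Longrightarrow> A \<otimes>\<^bsub>H'\<^esub> C \<preceq>\<^bsub>H'\<^esub> B \<otimes>\<^bsub>H'\<^esub> C"
      using ole[OF mN[OF x(1) z(1)] mN[OF y(1) z(1)]] ole[OF x(1) y(1)] x y z
        mult[OF x(1) z(1)] mult[OF y(1) z(1)] W.val_mult[OF x(1) z(1)] W.val_mult[OF y(1) z(1)]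
        W.G.ole_mult W.val_closed by simp
  qed (auto simp: car one)
  moreover have "valued_field_axioms K H' p"
  proof (intro valued_field_axioms.intro)
    fix x y assume "x \<in> ?N" "y \<in> ?N" "x \<oplus>\<^bsub>K\<^esub> y \<noteq> \<zero>\<^bsub>K\<^esub>"
    then show "p x \<preceq>\<^bsub>H'\<^esub> p (x \<oplus>\<^bsub>K\<^esub> y) \<or> p y \<preceq>\<^bsub>H'\<^esub> p (x \<oplus>\<^bsub>K\<^esub> y)"
      using W.val_add[of x y] ole by simp
  qed (auto simp: car mult)
  ultimately have V: "valued_field K H' p" by (simp add: valued_field_def W.K.field_axioms)
  have s: "val_set K H' p = val_set K H w"
    using ole[OF 1] by (auto simp: val_set_def one W.val_one)
  have i: "val_ideal K H' p = val_ideal K H w"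
    using ole[OF 1] pe[OF 1] by (auto simp: val_ideal_def oless_def one W.val_one)
  show ?thesis using V s i c by (intro exI[of _ H'] exI[of _ p]) (simp add: coarsening_def)
qed

end

theory Submission
 imports Defs "HOL-Decision_Procs.Commutative_Ring"
begin

text \<open>Hensel's lemma is equivalent to the following: every polynomial
\<open>f = X\<^sup>n\<^sup>+\<^sup>1 + X\<^sup>n + a\<^sub>n\<^sub>-\<^sub>1 X\<^sup>n\<^sup>-\<^sup>1 + \<dots> + a\<^sub>0\<close> with coefficients \<open>a\<^sub>i\<close> in the maximal ideal has a zero near \<open>-1\<close>.
Suppose that \<open>f\<close> has none. By Newton's method every value \<open>f(b)\<close> with \<open>b\<close> near \<open>-1\<close> has a square that divides
another such value, so the elements \<open>x\<close> for which some \<open>f(b) x\<close> is integral form the valuation ring of a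
coarsening. Over its residue field \<open>f\<close> has approximate zeros of arbitrary precision near \<open>-1\<close> but no zero. This is
impossible if the residue field is t-henselian. It is also impossible if images of neighbourhoods of regular
points have interior: consider the map \<open>z - z\<^sup>2\<close> on the algebra of \<open>f\<close>, written in coordinates.

Conversely let \<open>P\<close> be a polynomial map with non-zero Jacobian determinant. Every coordinate \<open>x\<^sub>i\<close> satisfies an
algebraic relation \<open>Q\<^sub>i(P(x), x\<^sub>i) = 0\<close> that is separable in the last variable. Indeed, take a relation of minimal
degree: if its last partial derivative vanished on the graph, so would the other ones; by minimality all exponents
would be divisible by the characteristic \<open>p\<close>, and the independence of \<open>p\<close>-th powers would give a relation of smaller
degree. Near a generic point \<open>x\<close> and for \<open>y\<close> near \<open>P(x)\<close>, Hensel's lemma gives zeros \<open>z\<^sub>i\<close> of \<open>Q\<^sub>i(y, -)\<close> near \<open>x\<^sub>i\<close>.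
If \<open>P(z)\<close> differed from \<open>y\<close>, one Newton step would move \<open>z\<close> to a point \<open>b\<close> with \<open>P(b) - y\<close> much smaller than
\<open>P(z) - y\<close>, while the uniqueness of the zeros bounds \<open>b - z\<close> by \<open>P(b) - y\<close>, a contradiction.\<close>

section \<open>Coefficient lists and valuation rings\<close>

text \<open>Henselian fields need not be complete and the value group has arbitrary rank, so
  Newton's method cannot be iterated to a limit. It enters through single steps only, and every zero
  comes from Hensel's lemma in one variable. This is why a system \<open>P(z) = y\<close> is split
  by elimination into separate equations for the coordinates. Their zeros, chosen independently of
  each other, might fail to solve the system; the final Newton step excludes that. In the other
  direction, interior of an image means a ball around some value, not around the image of the
  regular point itself. The map \<open>z - z^2\<close> makes up for this loss: the quantities
  \<open>1 - 4 (z - z^2)\<close> multiply under \<open>z + w - 2 z w\<close>, so a question about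
  small values can be translated to the place where the ball is. What is sought is an idempotent: a
  simple zero of \<open>f\<close> splits off a one-dimensional factor of its algebra, and an
  approximate zero gives an approximate idempotent, which the translated equation makes
  exact.\<close>

primrec (in ring) lpoly :: "'a list \<Rightarrow> 'a \<Rightarrow> 'a"
 where "lpoly [] x = \<zero>" | "lpoly (a # as) x = a \<oplus> x \<otimes> lpoly as x"

text \<open>Lists start with the constant term, and both recursions follow
  \<open>f = a + X g\<close>, \<open>f' = g + X g'\<close>. The same list can be evaluated in the
  field, in its valuation ring, in a residue field or in an algebra after mapping its entries, and
  all later estimates are inductions along the list.\<close>

primrec (in ring) lderiv :: "'a list \<Rightarrow> 'a \<Rightarrow> 'a"
 where "lderiv [] x = \<zero>" | "lderiv (a # as) x = lpoly as x \<oplus> x \<otimes> lderiv as x"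

fun (in ring) ladd :: "'a list \<Rightarrow> 'a list \<Rightarrow> 'a list"
 where "ladd [] bs = bs" | "ladd as [] = as" | "ladd (a # as) (b # bs) = (a \<oplus> b) # ladd as bs"

primrec (in ring) lmult :: "'a list \<Rightarrow> 'a list \<Rightarrow> 'a list"
 where "lmult [] bs = []" | "lmult (a # as) bs = ladd (map ((\<otimes>) a) bs) (\<zero> # lmult as bs)"

context cring
begin

lemma eqd: "a \<ominus> b = \<zero> ==> a \<in> carrier R ==> b \<in> carrier R ==> a = b"
 by (simp add: r_right_minus_eq)

text \<open>Ring identities are reduced to identities without subtraction: both sides are written as differences
of subtraction-free expressions, whose equality is decided by rewriting.\<close>

definition diff_of where "diff_of e p n = (e \<in> carrier R & p \<in> carrier R & n \<in> carrier R & e = p \<ominus> n)"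

lemma diff_of_atom: "x \<in> carrier R ==> diff_of x x \<zero>"
 unfolding diff_of_def by (simp add: a_minus_def)

lemma diff_of_uminus: "diff_of a p n ==> diff_of (\<ominus> a) n p"
 unfolding diff_of_def by (auto simp: a_minus_def minus_add a_comm)

lemma diff_of_add: "diff_of a p n ==> diff_of b q m ==> diff_of (a \<oplus> b) (p \<oplus> q) (n \<oplus> m)"
 unfolding diff_of_def by (auto simp: a_minus_def minus_add a_ac)

lemma diff_of_minus: "diff_of a p n ==> diff_of b q m ==> diff_of (a \<ominus> b) (p \<oplus> m) (n \<oplus> q)"
 unfolding a_minus_def[of R a b] by (rule diff_of_add[OF _ diff_of_uminus])

lemma diff_of_mult: "diff_of a p n ==> diff_of b q m ==> diff_of (a \<otimes> b) (p \<otimes> q \<oplus> n \<otimes> m) (p \<otimes> m \<oplus> n \<otimes> q)"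
 unfolding diff_of_def by (auto simp: a_minus_def minus_add l_distr r_distr l_minus r_minus a_ac)

lemmas ring_rep = diff_of_add diff_of_minus diff_of_uminus diff_of_mult diff_of_atom

lemma ring_identity:
 assumes "diff_of a p n" "diff_of b q m" and eq: "p \<oplus> m = q \<oplus> n"
 shows "a = b"
proof -
 have c: "p \<in> carrier R" "n \<in> carrier R" "q \<in> carrier R" "m \<in> carrier R" "a = p \<ominus> n" "b = q \<ominus> m"
  using assms unfolding diff_of_def by auto
 have "p = (q \<oplus> n) \<ominus> m" unfolding eq[symmetric] using c by (simp add: a_minus_def a_assoc r_neg)
 then have "p \<ominus> n = (q \<oplus> n) \<ominus> m \<ominus> n" by simp
 also have "\<dots> = ((q \<ominus> m) \<oplus> n) \<oplus> \<ominus> n" using c(1-4) by (simp add: a_minus_def a_ac)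
 also have "\<dots> = q \<ominus> m" using c(1-4) by (simp add: a_minus_def a_assoc r_neg)
 finally show ?thesis unfolding c(5,6) .
qed

lemmas ring_norm = a_minus_def l_distr r_distr a_ac m_ac l_minus r_minus r_neg r_neg1 r_neg2 minus_add

lemma lpoly_closed [simp]: "set f \<subseteq> carrier R ==> x \<in> carrier R ==> lpoly f x \<in> carrier R"
 by (induction f) auto

lemma lderiv_closed [simp]: "set f \<subseteq> carrier R ==> x \<in> carrier R ==> lderiv f x \<in> carrier R"
 by (induction f) auto

lemma subring_lpoly:
 "subring S R ==> set f \<subseteq> S ==> x \<in> S ==> lpoly f x \<in> S"
 by (induction f) (auto simp: subringE)

lemma subring_lderiv:
 "subring S R ==> set f \<subseteq> S ==> x \<in> S ==> lderiv f x \<in> S"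
 by (induction f) (auto simp: subringE subring_lpoly)

lemma ring_id_1: assumes "a \<in> carrier R" "b \<in> carrier R" "x \<in> carrier R" "p \<in> carrier R" "q \<in> carrier R"
 shows "(a \<oplus> b) \<oplus> x \<otimes> (p \<oplus> q) = (a \<oplus> x \<otimes> p) \<oplus> (b \<oplus> x \<otimes> q)"
 using assms by - (rule ring_identity, (rule ring_rep | assumption | (simp; fail))+, (simp_all add: l_distr r_distr a_ac m_ac)?)

lemma lpoly_ladd: "set f \<subseteq> carrier R ==> set g \<subseteq> carrier R ==> x \<in> carrier R ==>
  lpoly (ladd f g) x = lpoly f x \<oplus> lpoly g x"
 by (induction f g rule: ladd.induct) (auto simp: ring_id_1)

lemma lderiv_ladd: "set f \<subseteq> carrier R ==> set g \<subseteq> carrier R ==> x \<in> carrier R ==>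
  lderiv (ladd f g) x = lderiv f x \<oplus> lderiv g x"
 by (induction f g rule: ladd.induct) (auto simp: ring_id_1 lpoly_ladd)

lemma lpoly_scale: "set f \<subseteq> carrier R ==> c \<in> carrier R ==> x \<in> carrier R ==>
  lpoly (map ((\<otimes>) c) f) x = c \<otimes> lpoly f x"
proof (induction f)
 case (Cons a f)
 then have "lpoly f x \<in> carrier R" "a \<in> carrier R" "lpoly (map ((\<otimes>) c) f) x = c \<otimes> lpoly f x" by auto
 with Cons.prems show ?case by (simp add: r_distr m_lcomm)
qed auto

lemma lderiv_scale: "set f \<subseteq> carrier R ==> c \<in> carrier R ==> x \<in> carrier R ==>
  lderiv (map ((\<otimes>) c) f) x = c \<otimes> lderiv f x"
proof (induction f)
 case (Cons a f)
 then have "lpoly f x \<in> carrier R" "lderiv f x \<in> carrier R" "lderiv (map ((\<otimes>) c) f) x = c \<otimes> lderiv f x"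
  by auto
 with Cons.prems show ?case by (simp add: r_distr m_lcomm lpoly_scale)
qed auto

lemma length_ladd [simp]: "length (ladd f g) = max (length f) (length g)"
 by (induction f g rule: ladd.induct) auto

lemma ladd_set: "set f \<subseteq> S ==> set g \<subseteq> S ==> (\<And>x y. x \<in> S ==> y \<in> S ==> x \<oplus> y \<in> S) ==> set (ladd f g) \<subseteq> S"
 by (induction f g rule: ladd.induct) auto

lemma ladd_carr [simp]: "set f \<subseteq> carrier R ==> set g \<subseteq> carrier R ==> set (ladd f g) \<subseteq> carrier R"
 by (rule ladd_set) auto

lemma scale_carr [simp]: "set f \<subseteq> carrier R ==> c \<in> carrier R ==> set (map ((\<otimes>) c) f) \<subseteq> carrier R"
 by auto

lemma lmult_carr [simp]: "set f \<subseteq> carrier R ==> set g \<subseteq> carrier R ==> set (lmult f g) \<subseteq> carrier R"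
proof (induction f)
 case (Cons a f)
 have "set (map ((\<otimes>) a) g) \<subseteq> carrier R" "set (\<zero> # lmult f g) \<subseteq> carrier R" using Cons by auto
 then show ?case by (simp del: set_map list.set)
qed simp

lemma lpoly_lmult: "set f \<subseteq> carrier R ==> set g \<subseteq> carrier R ==> x \<in> carrier R ==>
  lpoly (lmult f g) x = lpoly f x \<otimes> lpoly g x"
proof (induction f)
 case (Cons a f)
 have c: "lpoly f x \<in> carrier R" "a \<in> carrier R" "lpoly g x \<in> carrier R"
  "set (map ((\<otimes>) a) g) \<subseteq> carrier R" "set (\<zero> # lmult f g) \<subseteq> carrier R" using Cons.prems by auto
 then have "lpoly (lmult (a # f) g) x = a \<otimes> lpoly g x \<oplus> (\<zero> \<oplus> x \<otimes> (lpoly f x \<otimes> lpoly g x))"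
  using Cons.IH Cons.prems by (simp add: lpoly_ladd lpoly_scale del: set_map)
 then show ?case using c Cons.prems(3) by (simp add: l_distr m_assoc)
qed auto

lemma lderiv_lmult: "set f \<subseteq> carrier R ==> set g \<subseteq> carrier R ==> x \<in> carrier R ==>
  lderiv (lmult f g) x = lderiv f x \<otimes> lpoly g x \<oplus> lpoly f x \<otimes> lderiv g x"
proof (induction f)
 case (Cons a f)
 have c: "lpoly f x \<in> carrier R" "a \<in> carrier R" "lpoly g x \<in> carrier R" "lderiv g x \<in> carrier R" "lderiv f x \<in> carrier R"
  "set (map ((\<otimes>) a) g) \<subseteq> carrier R" "set (\<zero> # lmult f g) \<subseteq> carrier R" using Cons.prems by auto
 then have e: "lderiv (lmult (a # f) g) x = a \<otimes> lderiv g x \<oplus> (lpoly f x \<otimes> lpoly g x \<oplus> x \<otimes> (lderiv f x \<otimes> lpoly g x \<oplus> lpoly f x \<otimes> lderiv g x))"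
  using Cons.IH Cons.prems by (simp add: lderiv_ladd lderiv_scale lpoly_lmult del: set_map)
 have id: "a \<otimes> g' \<oplus> (f \<otimes> g \<oplus> x \<otimes> (f' \<otimes> g \<oplus> f \<otimes> g')) = (f \<oplus> x \<otimes> f') \<otimes> g \<oplus> (a \<oplus> x \<otimes> f) \<otimes> g'"
  if "a \<in> carrier R" "f \<in> carrier R" "g \<in> carrier R" "f' \<in> carrier R" "g' \<in> carrier R" "x \<in> carrier R" for a f g f' g' x
  using that by - (rule ring_identity, (rule ring_rep | assumption | (simp; fail))+, (simp_all add: l_distr r_distr a_ac m_ac)?)
 show ?case unfolding e using id[of a "lpoly f x" "lpoly g x" "lderiv f x" "lderiv g x" x] c Cons.prems(3) by simp
qed auto

lemma lpoly_append: "set f \<subseteq> carrier R ==> set g \<subseteq> carrier R ==> x \<in> carrier R ==>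
  lpoly (f @ g) x = lpoly f x \<oplus> x [^] length f \<otimes> lpoly g x"
proof (induction f)
 case (Cons a f)
 have id: "a \<oplus> x \<otimes> (p \<oplus> q \<otimes> g) = a \<oplus> x \<otimes> p \<oplus> (q \<otimes> x) \<otimes> g"
  if "a \<in> carrier R" "p \<in> carrier R" "q \<in> carrier R" "g \<in> carrier R" "x \<in> carrier R" for a p q g x
  using that by - (rule ring_identity, (rule ring_rep | assumption | (simp; fail))+, (simp_all add: l_distr r_distr a_ac m_ac)?)
 show ?case using Cons id[of a "lpoly f x" "x [^] length f" "lpoly g x" x] by simp
qed auto

text \<open>Second-order Taylor expansion at \<open>b\<close>. The remainder keeps its coefficients
  in the subring, and its length does not depend on \<open>b\<close>; the latter fixes the degree in
  \<open>newton_substitution\<close> before an approximate zero is chosen.\<close>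

lemma lpoly_shift:
 assumes "subring S R" "b \<in> S"
 shows "set f \<subseteq> S ==> \<exists>h. set h \<subseteq> S \<and> length h = length f \<and> (\<forall>x \<in> carrier R.
  lpoly f (b \<oplus> x) = lpoly f b \<oplus> x \<otimes> (lderiv f b \<oplus> x \<otimes> lpoly h x))"
proof (induction f)
 case Nil
 then show ?case using assms subringE(1)[OF assms(1)] by (intro exI[of _ "[]"]) auto
next
 case (Cons a f)
 then obtain h where h: "set h \<subseteq> S" "length h = length f" "\<And>x. x \<in> carrier R ==>
   lpoly f (b \<oplus> x) = lpoly f b \<oplus> x \<otimes> (lderiv f b \<oplus> x \<otimes> lpoly h x)" by auto
 note sub = subringE(1)[OF assms(1)]
 let ?h = "ladd (map ((\<otimes>) b) h) (lderiv f b # h)"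
 have hc: "set h \<subseteq> carrier R" and bc: "b \<in> carrier R" and fc: "set f \<subseteq> carrier R" and ac: "a \<in> carrier R"
  using h Cons.prems assms sub by auto
 have "set ?h \<subseteq> S"
  using assms h Cons.prems subringE(6)[OF assms(1)] subringE(7)[OF assms(1)] subring_lderiv[OF assms(1), of f b]
  by (intro ladd_set) auto
 moreover have "lpoly (a # f) (b \<oplus> x) = lpoly (a # f) b \<oplus> x \<otimes> (lderiv (a # f) b \<oplus> x \<otimes> lpoly ?h x)"
  if x: "x \<in> carrier R" for x
 proof -
  have id: "a \<oplus> (b \<oplus> x) \<otimes> (p \<oplus> x \<otimes> (d \<oplus> x \<otimes> q)) = a \<oplus> b \<otimes> p \<oplus> x \<otimes> (p \<oplus> b \<otimes> d \<oplus> x \<otimes> (b \<otimes> q \<oplus> (d \<oplus> x \<otimes> q)))"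
   if "a \<in> carrier R" "p \<in> carrier R" "q \<in> carrier R" "d \<in> carrier R" "b \<in> carrier R" "x \<in> carrier R" for a p q d b x
   using that by - (rule ring_identity, (rule ring_rep | assumption | (simp; fail))+, (simp_all add: l_distr r_distr a_ac m_ac)?)
  have "lpoly ?h x = b \<otimes> lpoly h x \<oplus> (lderiv f b \<oplus> x \<otimes> lpoly h x)"
   using hc bc fc x by (subst lpoly_ladd) (auto simp: lpoly_scale)
  then show ?thesis using id[of a "lpoly f b" "lpoly h x" "lderiv f b" b x] h(3)[OF x] hc bc fc ac x by simp
 qed
 moreover have "length ?h = length (a # f)" using h(2) by simp
 ultimately show ?case by blast
qed

end

lemma (in ring_hom_cring) hom_lpoly:
 "set f \<subseteq> carrier R ==> x \<in> carrier R ==> h (R.lpoly f x) = S.lpoly (map h f) (h x)"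
 by (induction f) auto

section \<open>Divisibility in a valuation ring as a substitute for the value group\<close>

locale valuation_subring = field R for R (structure) +
 fixes V :: "'a set"
 assumes V_subring: "subring V R"
  and V_total: "x \<in> carrier R ==> x ~= \<zero> ==> x \<in> V \<or> inv x \<in> V"
begin

definition M where "M = {x \<in> carrier R. x = \<zero> \<or> inv x \<notin> V}"
text \<open>In terms of a valuation \<open>v\<close> with ring \<open>V\<close> and
  \<open>v \<zero>\<close> infinite, \<open>dv c x\<close> means \<open>v c \<le> v x\<close> and
  \<open>sdv c x\<close> means \<open>v c < v x\<close>, with the exception that
  \<open>sdv \<zero> \<zero>\<close> holds. A radius therefore has to be non-zero.\<close>

definition dv where "dv c x \<longleftrightarrow> (\<exists>a \<in> V. x = c \<otimes> a)"
definition sdv where "sdv c x \<longleftrightarrow> (\<exists>a \<in> M. x = c \<otimes> a)"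

lemma V_carr [simp]: "x \<in> V ==> x \<in> carrier R"
 using subringE(1)[OF V_subring] by auto
lemma V_sub: "V \<subseteq> carrier R" by auto
lemma V_zero [simp]: "\<zero> \<in> V" and V_one [simp]: "\<one> \<in> V"
 and V_minus [simp]: "x \<in> V ==> \<ominus> x \<in> V" and V_mult [simp]: "x \<in> V ==> y \<in> V ==> x \<otimes> y \<in> V"
 and V_add [simp]: "x \<in> V ==> y \<in> V ==> x \<oplus> y \<in> V"
 using subringE[OF V_subring] by auto
lemma V_diff [simp]: "x \<in> V ==> y \<in> V ==> x \<ominus> y \<in> V"
 by (simp add: a_minus_def)
lemma V_pow [simp]: "x \<in> V ==> x [^] (n :: nat) \<in> V"
 by (induction n) auto
lemma V_set_carr [simp]: "set f \<subseteq> V ==> set f \<subseteq> carrier R"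
 using V_sub by auto
lemma V_lpoly [simp]: "set f \<subseteq> V ==> x \<in> V ==> lpoly f x \<in> V"
 by (rule subring_lpoly[OF V_subring])
lemma V_lderiv [simp]: "set f \<subseteq> V ==> x \<in> V ==> lderiv f x \<in> V"
 by (rule subring_lderiv[OF V_subring])

lemma inv_carr: "x \<in> carrier R ==> x ~= \<zero> ==> inv x \<in> carrier R"
 and inv_nonzero: "x \<in> carrier R ==> x ~= \<zero> ==> inv x ~= \<zero>"
 and r_inv': "x \<in> carrier R ==> x ~= \<zero> ==> x \<otimes> inv x = \<one>"
 and l_inv': "x \<in> carrier R ==> x ~= \<zero> ==> inv x \<otimes> x = \<one>"
 and inv_inv': "x \<in> carrier R ==> x ~= \<zero> ==> inv (inv x) = x"
proof -
 assume x: "x \<in> carrier R" "x ~= \<zero>"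
 then have u: "x \<in> Units R" by (simp add: field_Units)
 then show c: "inv x \<in> carrier R" and r: "x \<otimes> inv x = \<one>" and "inv x \<otimes> x = \<one>" and "inv (inv x) = x" by auto
 show "inv x ~= \<zero>" using r x by force
qed

lemma M_zero [simp]: "\<zero> \<in> M" by (simp add: M_def)
lemma M_I: "x \<in> carrier R ==> inv x \<notin> V ==> x \<in> M"
 and M_D: "x \<in> M ==> x ~= \<zero> ==> inv x \<notin> V"
 and unitD: "x \<in> V ==> x \<notin> M ==> x ~= \<zero> \<and> inv x \<in> V"
 and M_carr: "x \<in> M ==> x \<in> carrier R"
 by (auto simp: M_def)
lemma one_notin_M [simp]: "\<one> \<notin> M"
 unfolding M_def using V_one one_not_zero by simp
lemma M_V [simp]: "x \<in> M ==> x \<in> V"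
 using V_total[of x] M_carr[of x] M_D[of x] by (cases "x = \<zero>") auto
lemma M_mult [simp]: assumes x: "x \<in> V" and y: "y \<in> M" shows "x \<otimes> y \<in> M" "y \<otimes> x \<in> M"
proof -
 show "x \<otimes> y \<in> M"
 proof (rule ccontr)
  assume n: "x \<otimes> y \<notin> M"
  then have u: "x \<otimes> y ~= \<zero>" "inv (x \<otimes> y) \<in> V" using unitD[of "x \<otimes> y"] x y by auto
  then have y0: "y ~= \<zero>" using x by auto
  have "(inv (x \<otimes> y) \<otimes> x) \<otimes> y = \<one>" using l_inv'[of "x \<otimes> y"] u x y by (simp add: m_assoc)
  moreover have c: "inv (x \<otimes> y) \<otimes> x \<in> carrier R" "y \<in> carrier R" using u x y by auto
  ultimately have "inv y = inv (x \<otimes> y) \<otimes> x" using comm_inv_char[OF c(2,1)] m_comm[OF c(2,1)] by simp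
  then have "inv y \<in> V" using u x by simp
  then show False using M_D[OF y y0] by simp
 qed
 then show "y \<otimes> x \<in> M" using x y by (simp add: m_comm)
qed
lemma M_minus [simp]: "x \<in> M ==> \<ominus> x \<in> M"
 using M_mult(1)[of "\<ominus> \<one>" x] by (simp add: l_minus)
lemma M_add [simp]: assumes "x \<in> M" "y \<in> M" shows "x \<oplus> y \<in> M"
proof -
 have c: "x \<in> carrier R" "y \<in> carrier R" "x \<in> V" "y \<in> V" using assms by auto
 have "inv x \<otimes> y \<in> V \<or> inv (inv x \<otimes> y) \<in> V" if "x ~= \<zero>" "y ~= \<zero>"
  using V_total[of "inv x \<otimes> y"] inv_carr[OF c(1)] inv_nonzero[OF c(1)] c that integral[of "inv x" y] by auto
 then consider "x = \<zero>" | "y = \<zero>" | "x ~= \<zero>" "y ~= \<zero>" "inv x \<otimes> y \<in> V" | "x ~= \<zero>" "y ~= \<zero>" "inv (inv x \<otimes> y) \<in> V"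
  by blast
 then show ?thesis
 proof cases
  case 3
  have i: "inv x \<in> carrier R" "inv x \<otimes> x = \<one>" using 3 inv_carr c l_inv' by auto
  have "(inv x \<otimes> y) \<otimes> x = (inv x \<otimes> x) \<otimes> y" using c i(1) by (simp add: m_ac)
  then have "x \<oplus> y = (\<one> \<oplus> inv x \<otimes> y) \<otimes> x" using c i by (simp add: l_distr)
  then show ?thesis using 3 assms by simp
 next
  case 4
  have i: "inv x \<in> carrier R" "inv y \<in> carrier R" "inv x \<otimes> x = \<one>" "y \<otimes> inv y = \<one>"
   using 4 inv_carr c l_inv' r_inv' by auto
  have e: "(inv x \<otimes> y) \<otimes> (x \<otimes> inv y) = (inv x \<otimes> x) \<otimes> (y \<otimes> inv y)"
   "(x \<otimes> inv y) \<otimes> y = x \<otimes> (y \<otimes> inv y)"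
   using c i(1,2) by (simp_all add: m_ac)
  have "inv (inv x \<otimes> y) = x \<otimes> inv y" using i c e(1) by (intro comm_inv_char) auto
  moreover have "x \<oplus> y = (x \<otimes> inv y \<oplus> \<one>) \<otimes> y"
   using c i e(2) by (simp add: l_distr)
  ultimately show ?thesis using 4 assms by simp
 qed (use assms in auto)
qed
lemma M_diff [simp]: "x \<in> M ==> y \<in> M ==> x \<ominus> y \<in> M"
 by (simp add: a_minus_def)
lemma M_prime: assumes "x \<in> V" "y \<in> V" "x \<otimes> y \<in> M" shows "x \<in> M \<or> y \<in> M"
proof (rule ccontr)
 assume n: "\<not> (x \<in> M \<or> y \<in> M)"
 then have i: "x ~= \<zero>" "inv x \<in> V" using unitD assms by auto
 then have "inv x \<otimes> (x \<otimes> y) = y" using assms l_inv'[of x] by (simp add: m_assoc[symmetric])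
 moreover have "inv x \<otimes> (x \<otimes> y) \<in> M" using i assms by simp
 ultimately show False using n by simp
qed
lemma M_lpoly [simp]: "set f \<subseteq> M ==> x \<in> V ==> lpoly f x \<in> M"
 by (induction f) auto
lemma M_set_V [simp]: "set f \<subseteq> M ==> set f \<subseteq> V" by auto
lemma dv_carr [intro]: "dv c x ==> c \<in> carrier R ==> x \<in> carrier R" by (auto simp: dv_def)
lemma sdv_carr [intro]: "sdv c x ==> c \<in> carrier R ==> x \<in> carrier R" by (auto simp: sdv_def)
lemma sdv_dv: "sdv c x ==> dv c x" by (auto simp: dv_def sdv_def)
lemma dv_refl [simp]: "c \<in> carrier R ==> dv c c" by (auto simp: dv_def intro!: bexI[of _ \<one>])
lemma dv_zero [simp]: "c \<in> carrier R ==> dv c \<zero>" by (auto simp: dv_def intro!: bexI[of _ \<zero>])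
lemma sdv_zero [simp]: "c \<in> carrier R ==> sdv c \<zero>" by (auto simp: sdv_def intro!: bexI[of _ \<zero>])
lemma dv_zeroD: "dv \<zero> x ==> x = \<zero>" by (auto simp: dv_def)
lemma dv_add: "dv c x ==> dv c y ==> c \<in> carrier R ==> dv c (x \<oplus> y)"
 by (auto simp: dv_def r_distr[symmetric] intro!: bexI)
lemma sdv_add: "sdv c x ==> sdv c y ==> c \<in> carrier R ==> sdv c (x \<oplus> y)"
 by (auto simp: sdv_def r_distr[symmetric] intro!: bexI)
lemma dv_minus: "dv c x ==> c \<in> carrier R ==> dv c (\<ominus> x)"
 by (auto simp: dv_def r_minus[symmetric] intro!: bexI)
lemma sdv_minus: "sdv c x ==> c \<in> carrier R ==> sdv c (\<ominus> x)"
 by (auto simp: sdv_def r_minus[symmetric] intro!: bexI)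
lemma dv_diff: "dv c x ==> dv c y ==> c \<in> carrier R ==> dv c (x \<ominus> y)"
 by (simp add: a_minus_def dv_add dv_minus)
lemma sdv_diff: "sdv c x ==> sdv c y ==> c \<in> carrier R ==> sdv c (x \<ominus> y)"
 by (simp add: a_minus_def sdv_add sdv_minus)
lemma mult_swap: "\<lbrakk>a \<in> carrier R; b \<in> carrier R; c \<in> carrier R; d \<in> carrier R\<rbrakk>
 \<Longrightarrow> (a \<otimes> b) \<otimes> (c \<otimes> d) = (a \<otimes> c) \<otimes> (b \<otimes> d)" by (simp add: m_ac)
lemma dv_mult: "dv a x ==> dv b y ==> a \<in> carrier R ==> b \<in> carrier R ==> dv (a \<otimes> b) (x \<otimes> y)"
 unfolding dv_def by (metis V_carr V_mult mult_swap)
lemma sdv_mult: "dv a x ==> sdv b y ==> a \<in> carrier R ==> b \<in> carrier R ==> sdv (a \<otimes> b) (x \<otimes> y)"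
 unfolding dv_def sdv_def by (metis V_carr M_V M_mult(1) mult_swap)
lemma dv_trans: "dv a b ==> dv b c ==> a \<in> carrier R ==> dv a c"
 by (auto simp: dv_def m_assoc intro!: bexI)
lemma sdv_dv_trans: "sdv a b ==> dv b c ==> a \<in> carrier R ==> sdv a c"
 by (auto simp: dv_def sdv_def m_assoc intro!: bexI)
lemma dv_sdv_trans: "dv a b ==> sdv b c ==> a \<in> carrier R ==> sdv a c"
 by (auto simp: dv_def sdv_def m_assoc intro!: bexI)
lemma dv_V: "dv c x ==> a \<in> V ==> c \<in> carrier R ==> dv c (a \<otimes> x)"
 unfolding dv_def by (metis V_carr V_mult m_lcomm)
lemma sdv_V: "sdv c x ==> a \<in> V ==> c \<in> carrier R ==> sdv c (a \<otimes> x)"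
 unfolding sdv_def by (metis V_carr M_V M_mult(1) m_lcomm)
lemma dv_one [simp]: "dv \<one> x \<longleftrightarrow> x \<in> V" by (auto simp: dv_def)
lemma sdv_one [simp]: "sdv \<one> x \<longleftrightarrow> x \<in> M" by (auto simp: sdv_def)
lemma dv_in_V: "dv c x ==> c \<in> V ==> x \<in> V" by (auto simp: dv_def)
lemma dv_in_M: "dv c x ==> c \<in> M ==> x \<in> M" by (auto simp: dv_def)
lemma sdv_in_M: "sdv c x ==> c \<in> V ==> x \<in> M" by (auto simp: sdv_def)
lemma dv_cancel: assumes "dv (a \<otimes> c) (a \<otimes> x)" "a \<in> carrier R" "a ~= \<zero>" "c \<in> carrier R" "x \<in> carrier R"
 shows "dv c x"
 using assms by (auto simp: dv_def m_assoc m_lcancel)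
lemma sdv_cancel: assumes "sdv (a \<otimes> c) (a \<otimes> x)" "a \<in> carrier R" "a ~= \<zero>" "c \<in> carrier R" "x \<in> carrier R"
 shows "sdv c x"
 using assms by (auto simp: sdv_def m_assoc m_lcancel)
lemma sdv_self: "sdv c c ==> c \<in> carrier R ==> c = \<zero>"
proof (rule ccontr)
 assume "sdv c c" and c: "c \<in> carrier R" "c ~= \<zero>"
 then obtain a where "a \<in> M" "c \<otimes> \<one> = c \<otimes> a" by (auto simp: sdv_def)
 then have "a = \<one>" using c m_lcancel[of c \<one> a] by simp
 then show False using \<open>a \<in> M\<close> by simp
qed
lemma dv_total: assumes "x \<in> carrier R" "c \<in> carrier R" shows "dv x c \<or> sdv c x"
proof (cases "x = \<zero> \<or> c = \<zero>")
 case True then show ?thesis using assms by auto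
next
 case False
 then have i: "inv x \<in> carrier R" "x \<otimes> inv x = \<one>" "inv c \<in> carrier R" "c \<otimes> inv c = \<one>"
  using inv_carr r_inv' assms by auto
 have "x = c \<otimes> (x \<otimes> inv c)" "c = x \<otimes> (c \<otimes> inv x)" using i assms m_lcomm[of c x "inv c"] m_lcomm[of x c "inv x"] by simp_all
 moreover have "c \<otimes> inv x \<in> V \<or> x \<otimes> inv c \<in> M"
 proof (rule disjCI)
  assume n: "x \<otimes> inv c \<notin> M"
  then have "inv (x \<otimes> inv c) \<in> V" using M_I[of "x \<otimes> inv c"] i assms by blast
  moreover have "inv (x \<otimes> inv c) = c \<otimes> inv x"
  proof (rule comm_inv_char)
   have "(x \<otimes> inv c) \<otimes> (c \<otimes> inv x) = (x \<otimes> inv x) \<otimes> (c \<otimes> inv c)"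
    using i(1,3) assms by (simp add: m_ac)
   then show "(x \<otimes> inv c) \<otimes> (c \<otimes> inv x) = \<one>" using i by simp
  qed (use i assms in auto)
  ultimately show "c \<otimes> inv x \<in> V" by simp
 qed
 ultimately show ?thesis by (metis dv_def sdv_def)
qed
lemma dv_finsum: "finite A ==> (\<And>i. i \<in> A ==> dv c (f i)) ==> c \<in> carrier R ==> dv c (\<Oplus>i\<in>A. f i)"
proof (induction A rule: finite_induct)
 case (insert a A)
 then have "f \<in> A \<rightarrow> carrier R" "f a \<in> carrier R" by auto
 then show ?case using insert by (simp add: dv_add)
qed simp
lemma dv_min:
 assumes "finite I" "I ~= {}" "\<And>i. i \<in> I ==> f i \<in> carrier R"
 shows "\<exists>i \<in> I. \<forall>j \<in> I. dv (f i) (f j)"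
 using assms
proof (induction I rule: finite_ne_induct)
 case (insert a I)
 then obtain i where i: "i \<in> I" "\<forall>j \<in> I. dv (f i) (f j)" by auto
 show ?case
 proof (cases "dv (f i) (f a)")
  case True then show ?thesis using i by auto
 next
  case False
  then have "dv (f a) (f i)" using dv_total[of "f i" "f a"] insert i sdv_dv by auto
  then show ?thesis using i insert dv_trans[of "f a" "f i"] by auto
 qed
qed auto

end

section \<open>Simple zeros of integral polynomials\<close>

context valuation_subring
begin

lemma pow_nonzero: "x \<in> carrier R ==> x ~= \<zero> ==> x [^] (n :: nat) ~= \<zero>"
 by (induction n) (auto simp: integral_iff)

lemma sdv_in_V: "sdv c x ==> c \<in> V ==> x \<in> V"
 using dv_in_V[OF sdv_dv] .

lemma add_diff_cancel_left: assumes "x \<in> carrier R" "y \<in> carrier R" shows "(x \<oplus> y) \<ominus> x = y"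
 using assms by - (rule ring_identity, (rule ring_rep | assumption | (simp; fail))+, (simp_all add: l_distr r_distr a_ac m_ac)?)

lemma add_diff_cancel_right: assumes "x \<in> carrier R" "y \<in> carrier R" shows "(x \<oplus> y) \<ominus> y = x"
 using assms by - (rule ring_identity, (rule ring_rep | assumption | (simp; fail))+, (simp_all add: l_distr r_distr a_ac m_ac)?)

lemma add_swap_one: "x \<in> carrier R ==> y \<in> carrier R ==> (x \<oplus> y) \<oplus> \<one> = (x \<oplus> \<one>) \<oplus> y"
 by (simp add: a_ac)

text \<open>The list \<open>l\<close> is the reversed polynomial \<open>Z^(n-1) k(t/Z)\<close>,
  where \<open>n\<close> is the length of \<open>k\<close> and \<open>w\<close> stands for
  \<open>1/Z\<close>. The additional factor \<open>Z\<close> avoids the exponent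
  \<open>n - 1\<close>.\<close>

lemma lpoly_flip:
 assumes t: "t \<in> V"
 shows "set k \<subseteq> V ==> \<exists>l. set l \<subseteq> V \<and> length l = length k \<and> (\<forall>Z w. Z \<in> carrier R --> w \<in> carrier R -->
  Z \<otimes> w = \<one> --> Z \<otimes> lpoly l Z = Z [^] length k \<otimes> lpoly k (t \<otimes> w))"
proof (induction k)
 case Nil
 then show ?case by auto
next
 case (Cons a k)
 then obtain l where l: "set l \<subseteq> V" "length l = length k" "\<And>Z w. Z \<in> carrier R ==> w \<in> carrier R ==>
  Z \<otimes> w = \<one> ==> Z \<otimes> lpoly l Z = Z [^] length k \<otimes> lpoly k (t \<otimes> w)" by auto
 have a: "a \<in> V" "set k \<subseteq> V" using Cons.prems by auto
 let ?l = "map ((\<otimes>) t) l @ [a]"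
 have "Z \<otimes> lpoly ?l Z = Z [^] length (a # k) \<otimes> lpoly (a # k) (t \<otimes> w)"
  if Z: "Z \<in> carrier R" "w \<in> carrier R" "Z \<otimes> w = \<one>" for Z w
 proof -
  have c: "a \<in> carrier R" "t \<in> carrier R" "set l \<subseteq> carrier R" "set k \<subseteq> carrier R"
   "set (map ((\<otimes>) t) l) \<subseteq> carrier R" using a t l by (auto simp: subset_eq)
  have id: "Z \<otimes> (t \<otimes> L \<oplus> p \<otimes> a) = t \<otimes> (Z \<otimes> L) \<oplus> (p \<otimes> Z) \<otimes> a"
   "(p \<otimes> Z) \<otimes> (a \<oplus> (t \<otimes> w) \<otimes> K) = (p \<otimes> (t \<otimes> K)) \<otimes> (Z \<otimes> w) \<oplus> (p \<otimes> Z) \<otimes> a"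
   if "Z \<in> carrier R" "t \<in> carrier R" "L \<in> carrier R" "p \<in> carrier R" "a \<in> carrier R" "w \<in> carrier R" "K \<in> carrier R"
   for Z t L p a w K using that by - (rule ring_identity, (rule ring_rep | assumption | (simp; fail))+, (simp_all add: l_distr r_distr a_ac m_ac)?)+
  have "Z \<otimes> lpoly ?l Z = t \<otimes> (Z \<otimes> lpoly l Z) \<oplus> (Z [^] length k \<otimes> Z) \<otimes> a"
   using id(1)[of Z t "lpoly l Z" "Z [^] length k" a w a] c Z l(2)
   by (simp add: lpoly_append lpoly_scale)
  also have "\<dots> = (Z [^] length k \<otimes> Z) \<otimes> (a \<oplus> (t \<otimes> w) \<otimes> lpoly k (t \<otimes> w))"
   using id(2)[of Z t a "Z [^] length k" a w "lpoly k (t \<otimes> w)"] c Z l(3)[OF Z] by (simp add: m_lcomm)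
  finally show ?thesis by simp
 qed
 moreover have "set ?l \<subseteq> V" using l a t by auto
 ultimately show ?case using l(2) by (intro exI[of _ ?l]) auto
qed

text \<open>Substituting \<open>x = b + f' b * e / Z\<close> and clearing denominators turns a polynomial with an approximate
 root \<open>b\<close> into one of the form \<open>Z^(m+1) + Z^m + \<dots>\<close> with small remaining coefficients.\<close>

lemma newton_substitution:
 assumes f: "set f \<subseteq> V" and b: "b \<in> V" and e: "e \<in> V"
  and fb: "lpoly f b = lderiv f b \<otimes> lderiv f b \<otimes> e"
 shows "\<exists>l. set l \<subseteq> V \<and> length l = length f \<and> (\<forall>Z w. Z \<in> carrier R --> w \<in> carrier R --> Z \<otimes> w = \<one> -->
  lpoly (map ((\<otimes>) e) l @ [\<one>, \<one>]) Z = \<zero> --> lpoly f (b \<oplus> lderiv f b \<otimes> e \<otimes> w) = \<zero>)"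
proof -
 let ?d = "lderiv f b"
 have d: "?d \<in> V" using f b by simp
 obtain h where h: "set h \<subseteq> V" "length h = length f" "\<And>x. x \<in> carrier R ==>
   lpoly f (b \<oplus> x) = lpoly f b \<oplus> x \<otimes> (?d \<oplus> x \<otimes> lpoly h x)"
  using lpoly_shift[OF V_subring b f] by auto
 obtain l where l: "set l \<subseteq> V" "length l = length f" "\<And>Z w. Z \<in> carrier R ==> w \<in> carrier R ==>
  Z \<otimes> w = \<one> ==> Z \<otimes> lpoly l Z = Z [^] length h \<otimes> lpoly h (?d \<otimes> e \<otimes> w)"
  using lpoly_flip[OF _ h(1), of "?d \<otimes> e"] d e h(2) by auto
 have "lpoly f (b \<oplus> ?d \<otimes> e \<otimes> w) = \<zero>" if Z: "Z \<in> carrier R" "w \<in> carrier R" "Z \<otimes> w = \<one>"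
  and r: "lpoly (map ((\<otimes>) e) l @ [\<one>, \<one>]) Z = \<zero>" for Z w
 proof -
  let ?n = "length f" and ?C = "lpoly h (?d \<otimes> e \<otimes> w)" and ?L = "lpoly l Z"
  have c: "?d \<in> carrier R" "e \<in> carrier R" "?C \<in> carrier R" "?L \<in> carrier R" "set l \<subseteq> carrier R"
   "set (map ((\<otimes>) e) l) \<subseteq> carrier R"
   using d e h l Z by (auto simp: subset_eq)
  have pw: "Z [^] ?n \<otimes> w [^] ?n = \<one>" using Z by (simp flip: nat_pow_distrib)
  have r': "e \<otimes> ?L \<oplus> Z [^] ?n \<otimes> (\<one> \<oplus> Z) = \<zero>"
   using r c Z l(2) by (simp add: lpoly_append lpoly_scale)
  have id: "(w \<otimes> w \<otimes> W) \<otimes> (Z \<otimes> (e \<otimes> L \<oplus> P \<otimes> (\<one> \<oplus> Z))) =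
    (w \<otimes> w \<otimes> W) \<otimes> (e \<otimes> (Z \<otimes> L)) \<oplus> (P \<otimes> W) \<otimes> (Z \<otimes> w) \<otimes> (w \<oplus> Z \<otimes> w)"
   "(w \<otimes> w \<otimes> W) \<otimes> (e \<otimes> (P \<otimes> C)) = (P \<otimes> W) \<otimes> (e \<otimes> w \<otimes> w \<otimes> C)"
   if "w \<in> carrier R" "W \<in> carrier R" "Z \<in> carrier R" "e \<in> carrier R" "L \<in> carrier R" "P \<in> carrier R" "C \<in> carrier R"
   for w W Z e L P C using that by - (rule ring_identity, (rule ring_rep | assumption | (simp; fail))+, (simp_all add: l_distr r_distr a_ac m_ac)?)+
  \<comment> \<open>By the expansion the value at \<open>b + d e w\<close> is
    \<open>d^2 e (e w^2 C + w + 1)\<close>. With \<open>w = 1/Z\<close> and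
    \<open>Z L = Z^n C\<close>, the bracket times \<open>Z^(n+1)\<close> is
    \<open>e L + Z^n + Z^(n+1)\<close>, the polynomial whose zero is \<open>Z\<close>.\<close>
  have z: "e \<otimes> w \<otimes> w \<otimes> ?C \<oplus> (w \<oplus> \<one>) = \<zero>"
   using id[of w "w [^] ?n" Z e ?L "Z [^] ?n" ?C] c Z r' pw l(3)[OF Z] h(2) by simp
  have id2: "d \<otimes> d \<otimes> e \<oplus> (d \<otimes> e \<otimes> w) \<otimes> (d \<oplus> (d \<otimes> e \<otimes> w) \<otimes> C) = d \<otimes> d \<otimes> e \<otimes> (e \<otimes> w \<otimes> w \<otimes> C \<oplus> (w \<oplus> \<one>))"
   if "d \<in> carrier R" "e \<in> carrier R" "w \<in> carrier R" "C \<in> carrier R"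
   for d e w C using that by - (rule ring_identity, (rule ring_rep | assumption | (simp; fail))+, (simp_all add: l_distr r_distr a_ac m_ac)?)
  show ?thesis using h(3)[of "?d \<otimes> e \<otimes> w"] fb id2[of ?d e w ?C] c Z z by simp
 qed
 then show ?thesis using l by blast
qed

definition SP where
 "SP \<longleftrightarrow> (\<forall>l. set l \<subseteq> M --> (\<exists>x \<in> V. x \<oplus> \<one> \<in> M \<and> lpoly (l @ [\<one>, \<one>]) x = \<zero>))"

text \<open>The common target of both ways back to henselianity: over the residue field of the
  coarsening constructed in \<open>SP_of_coarsenings\<close>, approximate zeros of every precision
  are available, so exact zeros are only needed in their presence.\<close>

definition approximate_SP where
 "approximate_SP \<longleftrightarrow> (\<forall>l. set l \<subseteq> M -->
  (\<forall>c \<in> carrier R - {\<zero>}. \<exists>b \<in> V. b \<oplus> \<one> \<in> M \<and> sdv c (lpoly (l @ [\<one>, \<one>]) b)) -->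
  (\<exists>x \<in> V. x \<oplus> \<one> \<in> M \<and> lpoly (l @ [\<one>, \<one>]) x = \<zero>))"

lemma unit_of_near:
 assumes "x \<in> V" "x \<oplus> \<one> \<in> M" shows "x \<notin> M"
proof
 assume "x \<in> M"
 then have "(x \<oplus> \<one>) \<ominus> x \<in> M" using assms by (intro M_diff) auto
 moreover have "(x \<oplus> \<one>) \<ominus> x = \<one>" using assms by (simp add: add_diff_cancel_left)
 ultimately show False by simp
qed

lemma special_val:
 assumes "set l \<subseteq> M" "b \<in> V" "b \<oplus> \<one> \<in> M"
 shows "lpoly (l @ [\<one>, \<one>]) b \<in> M"
proof -
 have "lpoly (l @ [\<one>, \<one>]) b = lpoly l b \<oplus> b [^] length l \<otimes> (b \<oplus> \<one>)"
  using assms by (subst lpoly_append) (auto simp: a_comm subset_eq)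
 then show ?thesis using assms by simp
qed

text \<open>Modulo \<open>M\<close> the polynomial is \<open>X^n (X + 1)\<close>, whose zero
  \<open>-1\<close> is simple. Along the list, \<open>f = a + X g\<close> gives
  \<open>f' = g + X g'\<close>, where \<open>g(b)\<close> lies in \<open>M\<close> and
  \<open>b\<close> is a unit.\<close>

lemma special_deriv:
 assumes "b \<in> V" "b \<oplus> \<one> \<in> M"
 shows "set l \<subseteq> M ==> lderiv (l @ [\<one>, \<one>]) b \<in> V \<and> lderiv (l @ [\<one>, \<one>]) b \<notin> M"
proof (induction l)
 case Nil
 then show ?case using assms by simp
next
 case (Cons a l)
 let ?p = "lpoly (l @ [\<one>, \<one>]) b" and ?d = "lderiv (l @ [\<one>, \<one>]) b"
 have d: "?d \<in> V" "?d \<notin> M" using Cons by auto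
 have p: "?p \<in> M" using special_val[OF _ assms, of l] Cons by auto
 have "?p \<oplus> b \<otimes> ?d \<notin> M"
 proof
  assume "?p \<oplus> b \<otimes> ?d \<in> M"
  then have "(?p \<oplus> b \<otimes> ?d) \<ominus> ?p \<in> M" using p by simp
  moreover have "(?p \<oplus> b \<otimes> ?d) \<ominus> ?p = b \<otimes> ?d" using p d assms by (simp add: add_diff_cancel_left)
  ultimately show False using M_prime[of b ?d] unit_of_near[OF assms] d assms by auto
 qed
 then show ?case using p d assms by simp
qed

lemma dv_lub: assumes "a \<in> carrier R - {\<zero>}" "b \<in> carrier R - {\<zero>}"
 shows "\<exists>c \<in> carrier R - {\<zero>}. dv a c \<and> dv b c"
 using dv_total[of a b] sdv_dv dv_refl assms by (metis DiffD1 dv_total sdv_dv)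

lemma dv_lub_V: assumes "a \<in> carrier R - {\<zero>}" "b \<in> carrier R - {\<zero>}"
 shows "\<exists>c \<in> V - {\<zero>}. dv a c \<and> dv b c"
proof -
 obtain c where c: "c \<in> carrier R - {\<zero>}" "dv a c" "dv b c" using dv_lub[OF assms] by auto
 obtain d where d: "d \<in> carrier R - {\<zero>}" "dv c d" "dv \<one> d" using dv_lub[OF c(1), of \<one>] by auto
 then show ?thesis using c assms dv_trans[of a c d] dv_trans[of b c d] by auto
qed

text \<open>The zero is \<open>b + d e / Z\<close> with \<open>d = f'(b)\<close>, where
  \<open>Z\<close> is the zero near \<open>-1\<close> of the substituted polynomial. Since
  \<open>Z\<close> is a unit, \<open>d (r - b)\<close> equals \<open>f(b)\<close> up to a unit. This
  quantitative bound is what \<open>slice_root\<close> needs, where the derivative is not a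
  unit.\<close>

lemma hensel_newton:
 assumes SP and f: "set f \<subseteq> V" and b: "b \<in> V" and d: "lderiv f b ~= \<zero>"
  and s: "sdv (lderiv f b \<otimes> lderiv f b) (lpoly f b)"
 shows "\<exists>r \<in> V. lpoly f r = \<zero> \<and> dv (lpoly f b) (lderiv f b \<otimes> (r \<ominus> b))"
proof -
 let ?d = "lderiv f b"
 have dV: "?d \<in> V" using f b by simp
 obtain e where e: "e \<in> M" "lpoly f b = ?d \<otimes> ?d \<otimes> e" using s by (auto simp: sdv_def)
 obtain l where l: "set l \<subseteq> V" "\<And>Z w. Z \<in> carrier R ==> w \<in> carrier R ==> Z \<otimes> w = \<one> ==>
  lpoly (map ((\<otimes>) e) l @ [\<one>, \<one>]) Z = \<zero> ==> lpoly f (b \<oplus> ?d \<otimes> e \<otimes> w) = \<zero>"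
  using newton_substitution[OF f b _ e(2)] e(1) by auto
 have "set (map ((\<otimes>) e) l) \<subseteq> M" using e l by auto
 then obtain Z where Z: "Z \<in> V" "Z \<oplus> \<one> \<in> M" "lpoly (map ((\<otimes>) e) l @ [\<one>, \<one>]) Z = \<zero>"
  using \<open>SP\<close> unfolding SP_def by blast
 note u = unitD[OF Z(1) unit_of_near[OF Z(1,2)]]
 let ?w = "inv Z"
 have Zw: "Z \<otimes> ?w = \<one>" using u Z r_inv' by auto
 have r: "lpoly f (b \<oplus> ?d \<otimes> e \<otimes> ?w) = \<zero>" using l(2)[of Z ?w] Zw Z u by auto
 have "?d \<otimes> ((b \<oplus> ?d \<otimes> e \<otimes> ?w) \<ominus> b) = lpoly f b \<otimes> ?w"
  using e b dV u by (simp add: ring_norm)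
 then have "dv (lpoly f b) (?d \<otimes> ((b \<oplus> ?d \<otimes> e \<otimes> ?w) \<ominus> b))" using u by (auto simp: dv_def)
 moreover have "b \<oplus> ?d \<otimes> e \<otimes> ?w \<in> V" using b dV e u by simp
 ultimately show ?thesis using r by blast
qed

lemma SP_hensel:
 assumes SP and f: "set f \<subseteq> V" and a: "a \<in> V" and m: "lpoly f a \<in> M" and n: "lderiv f a \<notin> M"
 shows "\<exists>b \<in> V. lpoly f b = \<zero> \<and> b \<ominus> a \<in> M"
proof -
 let ?d = "lderiv f a"
 have d: "?d \<in> V" using f a by simp
 then have u: "?d ~= \<zero>" "inv ?d \<in> V" using unitD n by auto
 have "lpoly f a = ?d \<otimes> ?d \<otimes> (inv ?d \<otimes> inv ?d \<otimes> lpoly f a)"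
 proof -
  have "?d \<otimes> ?d \<otimes> (inv ?d \<otimes> inv ?d \<otimes> lpoly f a) = (?d \<otimes> inv ?d) \<otimes> (?d \<otimes> inv ?d) \<otimes> lpoly f a"
   using d u m by (simp add: m_ac)
  then show ?thesis using r_inv'[of ?d] d u m by simp
 qed
 then have "sdv (?d \<otimes> ?d) (lpoly f a)" unfolding sdv_def using u m by (intro bexI[of _ "inv ?d \<otimes> inv ?d \<otimes> lpoly f a"]) auto
 from hensel_newton[OF \<open>SP\<close> f a u(1) this] obtain b where
  b: "b \<in> V" "lpoly f b = \<zero>" "dv (lpoly f a) (?d \<otimes> (b \<ominus> a))" by auto
 have "?d \<otimes> (b \<ominus> a) \<in> M" using dv_in_M[OF b(3) m] .
 then have "b \<ominus> a \<in> M" using M_prime[of ?d "b \<ominus> a"] n a b d by auto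
 then show ?thesis using b by blast
qed

lemma hensel_SP:
 assumes "\<And>f a. set f \<subseteq> V ==> a \<in> V ==> lpoly f a \<in> M ==> lderiv f a \<notin> M ==>
  \<exists>b \<in> V. lpoly f b = \<zero> \<and> b \<ominus> a \<in> M"
 shows SP
 unfolding SP_def
proof (intro allI impI)
 fix l assume l: "set l \<subseteq> M"
 have m: "\<ominus> \<one> \<in> V" "\<ominus> \<one> \<oplus> \<one> \<in> M" by (auto simp: l_neg)
 from assms[of "l @ [\<one>, \<one>]" "\<ominus> \<one>"] special_val[OF l m] special_deriv[OF m l] l m
 obtain b where "b \<in> V" "lpoly (l @ [\<one>, \<one>]) b = \<zero>" "b \<ominus> \<ominus> \<one> \<in> M" by auto
 then show "\<exists>x\<in>V. x \<oplus> \<one> \<in> M \<and> lpoly (l @ [\<one>, \<one>]) x = \<zero>" by (auto simp: a_minus_def)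
qed

section \<open>Zeros near -1 in t-henselian fields\<close>

definition t_SP where
 "t_SP \<longleftrightarrow> (\<forall>n \<ge> 1. \<exists>c \<in> carrier R - {\<zero>}. \<forall>l. length l = n --> (\<forall>a \<in> set l. sdv c a) -->
  (\<exists>x \<in> carrier R. lpoly (l @ [\<one>, \<one>]) x = \<zero>))"

lemma lpoly_reverse_V:
 assumes w: "w \<in> V" "x \<in> carrier R" "x \<otimes> w = \<one>"
 shows "set l \<subseteq> V ==> w [^] length l \<otimes> lpoly l x \<in> V"
proof (induction l)
 case (Cons a l)
 have id: "(W \<otimes> w) \<otimes> (a \<oplus> x \<otimes> L) = (W \<otimes> w) \<otimes> a \<oplus> (W \<otimes> L) \<otimes> (x \<otimes> w)"
  if "w \<in> carrier R" "W \<in> carrier R" "a \<in> carrier R" "x \<in> carrier R" "L \<in> carrier R" for w W a x L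
  using that by - (rule ring_identity, (rule ring_rep | assumption | (simp; fail))+, (simp_all add: l_distr r_distr a_ac m_ac)?)
 show ?case using Cons id[of w "w [^] length l" a x "lpoly l x"] w by simp
qed auto

text \<open>Valuation rings are integrally closed: if \<open>w = 1/x\<close> were in
  \<open>M\<close>, division of the equation by \<open>x^(n+1)\<close> would put \<open>-1\<close>
  into \<open>M\<close>.\<close>

lemma special_root_V:
 assumes l: "set l \<subseteq> V" and x: "x \<in> carrier R" and r: "lpoly (l @ [\<one>, \<one>]) x = \<zero>"
 shows "x \<in> V"
proof (rule ccontr)
 assume n: "x \<notin> V"
 then have x0: "x ~= \<zero>" by auto
 let ?w = "inv x"
 have w: "?w \<in> carrier R" "x \<otimes> ?w = \<one>" "?w ~= \<zero>" "inv ?w = x"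
  using inv_carr r_inv' inv_nonzero inv_inv' x x0 by auto
 then have wM: "?w \<in> M" using n M_I[of ?w] by simp
 let ?n = "length l"
 have q: "?w [^] ?n \<otimes> lpoly l x \<in> V" using lpoly_reverse_V[of ?w x l] w wM x l by auto
 have pw: "x [^] ?n \<otimes> ?w [^] ?n = \<one>" using w x by (simp flip: nat_pow_distrib)
 have r': "lpoly l x \<oplus> x [^] ?n \<otimes> (\<one> \<oplus> x) = \<zero>" using r l x by (simp add: lpoly_append)
 have id: "(w \<otimes> W) \<otimes> (L \<oplus> P \<otimes> (\<one> \<oplus> x)) = w \<otimes> (W \<otimes> L) \<oplus> (P \<otimes> W) \<otimes> (w \<oplus> x \<otimes> w)"
  if "w \<in> carrier R" "W \<in> carrier R" "P \<in> carrier R" "x \<in> carrier R" "L \<in> carrier R" for w W P x L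
  using that by - (rule ring_identity, (rule ring_rep | assumption | (simp; fail))+, (simp_all add: l_distr r_distr a_ac m_ac)?)
 have "?w \<otimes> (?w [^] ?n \<otimes> lpoly l x) \<oplus> (?w \<oplus> \<one>) = \<zero>"
  using id[of ?w "?w [^] ?n" "x [^] ?n" x "lpoly l x"] w x r' pw l by simp
 then have "\<ominus> \<one> = ?w \<otimes> (?w [^] ?n \<otimes> lpoly l x) \<oplus> ?w"
  using w(1) V_carr[OF q] by (intro minus_equality) (auto simp: a_assoc)
 moreover have "?w \<otimes> (?w [^] ?n \<otimes> lpoly l x) \<oplus> ?w \<in> M" using q wM by simp
 ultimately have "\<ominus> \<one> \<in> M" by (simp only:)
 then have "\<ominus> (\<ominus> \<one>) \<in> M" by (rule M_minus)
 then show False by simp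
qed

lemma sdv_lpoly: "(\<And>a. a \<in> set l ==> sdv c a) ==> c \<in> carrier R ==> x \<in> V ==> sdv c (lpoly l x)"
 by (induction l) (auto intro!: sdv_add sdv_V)

lemma dv_pow: "dv x y ==> x \<in> carrier R ==> dv (x [^] (n :: nat)) (y [^] n)"
 by (induction n) (auto intro!: dv_mult)

text \<open>If \<open>x\<close> is not smaller than \<open>c\<close>, then \<open>x^n\<close>
  divides \<open>c^n\<close>, so the lower part is smaller than \<open>x^n\<close>, and
  \<open>x^n (x + 1) = - l(x)\<close> forces \<open>x + 1\<close> into \<open>M\<close>. The
  exponent of \<open>c\<close> in the hypothesis serves this comparison.\<close>

lemma special_root_cases:
 assumes c: "c \<in> V - {\<zero>}" and l: "\<And>a. a \<in> set l ==> sdv (c [^] length l) a"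
  and x: "x \<in> carrier R" and r: "lpoly (l @ [\<one>, \<one>]) x = \<zero>"
 shows "x \<in> V \<and> (x \<oplus> \<one> \<in> M \<or> sdv c x)"
proof -
 have lV: "set l \<subseteq> V" using sdv_in_V[OF l] c by auto
 have xV: "x \<in> V" using special_root_V[OF lV x r] .
 moreover have "x \<oplus> \<one> \<in> M" if n: "\<not> sdv c x"
 proof -
  have d: "dv x c" using dv_total[of x c] x c n by auto
  then have x0: "x ~= \<zero>" using dv_zeroD c by auto
  have "sdv (x [^] length l) a" if "a \<in> set l" for a
   using dv_sdv_trans[OF dv_pow[OF d x] l[OF that]] x by simp
  then have s: "sdv (x [^] length l) (lpoly l x)" using sdv_lpoly xV by simp
  have r': "lpoly l x \<oplus> x [^] length l \<otimes> (x \<oplus> \<one>) = \<zero>" using r lV x by (simp add: lpoly_append a_comm)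
  then have "\<ominus> (x [^] length l \<otimes> (x \<oplus> \<one>)) = lpoly l x" using x lV by (intro minus_equality) auto
  then have "x [^] length l \<otimes> (x \<oplus> \<one>) = \<ominus> lpoly l x"
   using x by (metis a_closed m_closed minus_minus nat_pow_closed one_closed)
  then have "sdv (x [^] length l \<otimes> \<one>) (x [^] length l \<otimes> (x \<oplus> \<one>))" using sdv_minus[OF s] x by simp
  then have "sdv \<one> (x \<oplus> \<one>)" using sdv_cancel[of "x [^] length l" \<one> "x \<oplus> \<one>"] x x0 pow_nonzero[OF x x0] by simp
  then show ?thesis by simp
 qed
 ultimately show ?thesis by blast
qed

text \<open>Synthetic division by \<open>X - x\<close> at a small \<open>x\<close>. Small
  coefficients stay small and the polynomial stays monic, but the second leading coefficient becomes
  \<open>1 + x\<close>; \<open>special_rescale\<close> turns it back into \<open>1\<close>.\<close>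

lemma special_quotient:
 assumes c: "c \<in> V" and x: "sdv c x"
 shows "(\<And>a. a \<in> set l ==> sdv c a) ==> a \<in> V ==> \<exists>s. length s = length l \<and> (\<forall>a \<in> set s. sdv c a) \<and>
  (\<forall>y \<in> carrier R. lpoly (a # l @ [\<one>, \<one>]) y = lpoly (a # l @ [\<one>, \<one>]) x \<oplus> (y \<ominus> x) \<otimes> lpoly (s @ [\<one> \<oplus> x, \<one>]) y)"
proof (induction l arbitrary: a)
 have xM: "x \<in> M" using sdv_in_M[OF x c] .
 {
  case Nil
  have id: "a \<oplus> y \<otimes> (\<one> \<oplus> y) = a \<oplus> x \<otimes> (\<one> \<oplus> x) \<oplus> (y \<ominus> x) \<otimes> (\<one> \<oplus> x \<oplus> y)"
   if "a \<in> carrier R" "y \<in> carrier R" "x \<in> carrier R" for a y x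
   using that by - (rule ring_identity, (rule ring_rep | assumption | (simp; fail))+, (simp_all add: l_distr r_distr a_ac m_ac)?)
  have "lpoly (a # [] @ [\<one>, \<one>]) y = lpoly (a # [] @ [\<one>, \<one>]) x \<oplus> (y \<ominus> x) \<otimes> lpoly ([] @ [\<one> \<oplus> x, \<one>]) y"
   if "y \<in> carrier R" for y using id[of a y x] Nil(2) xM that by simp
  then show ?case by (intro exI[of _ "[]"]) auto
 next
  case (Cons a' l a)
  have "sdv c a'" using Cons.prems by simp
  then have "a' \<in> V" using c sdv_in_V by blast
  from Cons.IH[OF _ this] Cons.prems obtain s where s: "length s = length l" "\<And>a. a \<in> set s ==> sdv c a"
   "\<And>y. y \<in> carrier R ==> lpoly (a' # l @ [\<one>, \<one>]) y = lpoly (a' # l @ [\<one>, \<one>]) x \<oplus> (y \<ominus> x) \<otimes> lpoly (s @ [\<one> \<oplus> x, \<one>]) y"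
   by (metis list.set_intros(2))
  have lV: "set l \<subseteq> V" "a' \<in> V" "set s \<subseteq> V" using Cons.prems(1) s(2) c by (auto dest: sdv_in_V)
  let ?b = "lpoly (a' # l @ [\<one>, \<one>]) x"
  have bV: "lpoly (l @ [\<one>, \<one>]) x \<in> V" using lV xM by simp
  have "sdv c ?b" using Cons.prems(1)[of a'] sdv_V[OF x bV] c bV xM by (auto intro!: sdv_add simp: m_comm)
  moreover have "lpoly (a # (a' # l) @ [\<one>, \<one>]) y = lpoly (a # (a' # l) @ [\<one>, \<one>]) x \<oplus> (y \<ominus> x) \<otimes> lpoly ((?b # s) @ [\<one> \<oplus> x, \<one>]) y"
   if y: "y \<in> carrier R" for y
  proof -
   have id: "a \<oplus> y \<otimes> (b \<oplus> (y \<ominus> x) \<otimes> q) = a \<oplus> x \<otimes> b \<oplus> (y \<ominus> x) \<otimes> (b \<oplus> y \<otimes> q)"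
    if "a \<in> carrier R" "y \<in> carrier R" "x \<in> carrier R" "b \<in> carrier R" "q \<in> carrier R" for a y x b q
    using that by - (rule ring_identity, (rule ring_rep | assumption | (simp; fail))+, (simp_all add: l_distr r_distr a_ac m_ac)?)
   have b: "?b \<in> carrier R" using bV lV xM by simp
   have q: "lpoly (s @ [\<one> \<oplus> x, \<one>]) y \<in> carrier R" using lV xM y by (intro lpoly_closed) auto
   show ?thesis using id[of a y x ?b "lpoly (s @ [\<one> \<oplus> x, \<one>]) y"] s(3)[OF y] b q y xM Cons.prems(2) by simp
  qed
  ultimately show ?case using s by (intro exI[of _ "?b # s"]) auto
 }
qed

lemma special_rescale:
 assumes c: "c \<in> V" and u: "u \<in> V" "ui \<in> V" "u \<otimes> ui = \<one>"
 shows "(\<And>a. a \<in> set s ==> sdv c a) ==> \<exists>s'. length s' = length s \<and> (\<forall>a \<in> set s'. sdv c a) \<and>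
  (\<forall>Y \<in> carrier R. lpoly (s @ [u, \<one>]) (u \<otimes> Y) = u [^] Suc (length s) \<otimes> lpoly (s' @ [\<one>, \<one>]) Y)"
proof (induction s)
 case Nil
 then show ?case using u by (auto simp: r_distr)
next
 case (Cons a s)
 then obtain s' where s': "length s' = length s" "\<And>a. a \<in> set s' ==> sdv c a"
  "\<And>Y. Y \<in> carrier R ==> lpoly (s @ [u, \<one>]) (u \<otimes> Y) = u [^] Suc (length s) \<otimes> lpoly (s' @ [\<one>, \<one>]) Y"
  by auto
 let ?m = "Suc (Suc (length s))"
 let ?a = "ui [^] ?m \<otimes> a"
 have a: "sdv c a" using Cons.prems by simp
 then have aV: "a \<in> V" using dv_in_V[OF sdv_dv c] by auto
 have "sdv c ?a" using sdv_V[OF a] u c by simp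
 moreover have "lpoly ((a # s) @ [u, \<one>]) (u \<otimes> Y) = u [^] Suc (length (a # s)) \<otimes> lpoly ((?a # s') @ [\<one>, \<one>]) Y"
  if Y: "Y \<in> carrier R" for Y
 proof -
  have id: "(U \<otimes> u) \<otimes> (v \<otimes> a \<oplus> Y \<otimes> L) = ((U \<otimes> u) \<otimes> v) \<otimes> a \<oplus> (u \<otimes> Y) \<otimes> (U \<otimes> L)"
   if "U \<in> carrier R" "u \<in> carrier R" "v \<in> carrier R" "a \<in> carrier R" "Y \<in> carrier R" "L \<in> carrier R" for U u v a Y L
   using that by - (rule ring_identity, (rule ring_rep | assumption | (simp; fail))+, (simp_all add: l_distr r_distr a_ac m_ac)?)
  have s'V: "set s' \<subseteq> V" using s'(2) c by (auto dest: sdv_in_V)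
  have L: "lpoly (s' @ [\<one>, \<one>]) Y \<in> carrier R" using s'V Y by (intro lpoly_closed) auto
  have p: "(u [^] Suc (length s) \<otimes> u) \<otimes> ui [^] ?m = \<one>"
   using u nat_pow_distrib[of u ui ?m] by simp
  show ?thesis using id[of "u [^] Suc (length s)" u "ui [^] ?m" a Y "lpoly (s' @ [\<one>, \<one>]) Y"]
    s'(3)[OF Y] L p u aV Y by simp
 qed
 ultimately show ?case using s' by (intro exI[of _ "?a # s'"]) auto
qed

text \<open>The definition of t-henselian fields yields a zero somewhere. If it is not near
  \<open>-1\<close>, it is small by \<open>special_root_cases\<close> and can be divided out. The
  quotient has lower degree and, after rescaling, the same shape with small coefficients, so
  induction on the degree supplies the zero near \<open>-1\<close>.\<close>

lemma t_SP_near: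
 assumes t_SP
 shows "\<exists>c \<in> V - {\<zero>}. \<forall>l. length l = n --> (\<forall>a \<in> set l. sdv c a) -->
  (\<exists>x \<in> V. x \<oplus> \<one> \<in> M \<and> lpoly (l @ [\<one>, \<one>]) x = \<zero>)"
proof (induction n)
 case 0
 show ?case by (intro bexI[of _ \<one>]) (auto simp: l_neg r_neg intro!: bexI[of _ "\<ominus> \<one>"])
next
 case (Suc n)
 then obtain c2 where c2: "c2 \<in> V - {\<zero>}" "\<And>l. length l = n ==> (\<And>a. a \<in> set l ==> sdv c2 a) ==>
  (\<exists>x \<in> V. x \<oplus> \<one> \<in> M \<and> lpoly (l @ [\<one>, \<one>]) x = \<zero>)" by blast
 obtain c1 where c1: "c1 \<in> carrier R - {\<zero>}" "\<And>l. length l = Suc n ==> (\<And>a. a \<in> set l ==> sdv c1 a) ==>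
  (\<exists>x \<in> carrier R. lpoly (l @ [\<one>, \<one>]) x = \<zero>)"
  using assms unfolding t_SP_def by (metis le_add1 plus_1_eq_Suc)
 obtain c where c: "c \<in> V - {\<zero>}" "dv c1 c" "dv c2 c" using dv_lub_V[OF c1(1), of c2] c2 by auto
 \<comment> \<open>The power is the one demanded by \<open>special_root_cases\<close> for lists of
   length \<open>Suc n\<close>. Being divisible by \<open>c\<close>, and so by \<open>c2\<close>, it
   also leaves the quotient small enough for the induction hypothesis.\<close>
 have cp: "c [^] Suc n \<in> V - {\<zero>}" using c pow_nonzero[of c "Suc n"] by (simp del: nat_pow_Suc)
 have dcp: "dv c (c [^] Suc n)" using c by (auto simp: dv_def m_comm intro!: bexI[of _ "c [^] n"])
 have "\<exists>x \<in> V. x \<oplus> \<one> \<in> M \<and> lpoly (l @ [\<one>, \<one>]) x = \<zero>"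
  if l: "length l = Suc n" "\<And>a. a \<in> set l ==> sdv (c [^] Suc n) a" for l
 proof -
  have lc: "sdv c a" if "a \<in> set l" for a using dv_sdv_trans[OF dcp l(2)[OF that]] c by auto
  have lV: "set l \<subseteq> V" using lc c by (auto dest: sdv_in_V)
  have "sdv c1 a" if "a \<in> set l" for a using dv_sdv_trans[OF c(2) lc[OF that]] c1 by auto
  then obtain x where x: "x \<in> carrier R" "lpoly (l @ [\<one>, \<one>]) x = \<zero>" using c1(2)[OF l(1)] by auto
  from special_root_cases[OF c(1) _ x] l have xV: "x \<in> V" and cs: "x \<oplus> \<one> \<in> M \<or> sdv c x" by auto
  show ?thesis
  proof (cases "x \<oplus> \<one> \<in> M")
   case True then show ?thesis using x xV by blast
  next
   case False
   then have sx: "sdv c x" using cs by auto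
   have xM: "x \<in> M" using sdv_in_M[OF sx] c by auto
   obtain a l' where ll: "l = a # l'" using l(1) by (cases l) auto
   have "c \<in> V" "a \<in> V" using c lV ll by auto
   from special_quotient[OF this(1) sx _ this(2), of l'] lc ll
   obtain s where s: "length s = length l'" "\<And>a. a \<in> set s ==> sdv c a"
    "\<And>y. y \<in> carrier R ==> lpoly (l @ [\<one>, \<one>]) y = lpoly (l @ [\<one>, \<one>]) x \<oplus> (y \<ominus> x) \<otimes> lpoly (s @ [\<one> \<oplus> x, \<one>]) y"
    by auto
   let ?u = "\<one> \<oplus> x"
   have "?u \<notin> M"
   proof
    assume "?u \<in> M"
    then have "?u \<ominus> x \<in> M" using xM by simp
    then show False using xM by (simp add: add_diff_cancel_right)
   qed
   moreover have uV: "?u \<in> V" using xV by simp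
   ultimately have u: "?u ~= \<zero>" "inv ?u \<in> V" using unitD by auto
   then have ui: "?u \<otimes> inv ?u = \<one>" using r_inv'[of ?u] uV by auto
   have cV: "c \<in> V" using c by auto
   have "\<exists>s'. length s' = length s \<and> (\<forall>a \<in> set s'. sdv c a) \<and> (\<forall>Y \<in> carrier R.
    lpoly (s @ [?u, \<one>]) (?u \<otimes> Y) = ?u [^] Suc (length s) \<otimes> lpoly (s' @ [\<one>, \<one>]) Y)"
    by (rule special_rescale[OF cV uV u(2) ui]) (rule s(2))
   then obtain s' where s': "length s' = length s" "\<And>a. a \<in> set s' ==> sdv c a"
    "\<And>Y. Y \<in> carrier R ==> lpoly (s @ [?u, \<one>]) (?u \<otimes> Y) = ?u [^] Suc (length s) \<otimes> lpoly (s' @ [\<one>, \<one>]) Y"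
    by blast
   have "\<exists>x \<in> V. x \<oplus> \<one> \<in> M \<and> lpoly (s' @ [\<one>, \<one>]) x = \<zero>"
    using c2(2)[of s'] s s' ll l(1) dv_sdv_trans[OF c(3)] c2(1) by auto
   then obtain Y where Y: "Y \<in> V" "Y \<oplus> \<one> \<in> M" "lpoly (s' @ [\<one>, \<one>]) Y = \<zero>" by auto
   let ?y = "?u \<otimes> Y"
   have yV: "?y \<in> V" using uV Y by simp
   have "lpoly (s @ [?u, \<one>]) ?y = \<zero>" using s'(3)[of Y] Y uV by simp
   then have "lpoly (l @ [\<one>, \<one>]) ?y = \<zero>" using s(3)[of ?y] x yV xV by (simp del: m_closed V_mult)
   moreover have "?y \<oplus> \<one> = x \<otimes> Y \<oplus> (Y \<oplus> \<one>)" using xV Y by (simp add: ring_norm)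
   then have "?y \<oplus> \<one> \<in> M" using xM Y by simp
   ultimately show ?thesis using yV by blast
  qed
 qed
 then show ?case using cp by blast
qed

text \<open>Newton's substitution at an approximate zero gives a polynomial of the same shape whose
  lower coefficients are as small as \<open>f(b)\<close>. Its zero near \<open>-1\<close> yields an
  exact zero of \<open>f\<close>.\<close>

lemma t_SP_approximate:
 assumes t_SP shows approximate_SP
 unfolding approximate_SP_def
proof (intro allI impI)
 fix l assume l: "set l \<subseteq> M" and
  ap: "\<forall>c \<in> carrier R - {\<zero>}. \<exists>b \<in> V. b \<oplus> \<one> \<in> M \<and> sdv c (lpoly (l @ [\<one>, \<one>]) b)"
 let ?f = "l @ [\<one>, \<one>]"
 \<comment> \<open>The lower part of the substituted polynomial has this length for every
   \<open>b\<close>, so the radius \<open>c\<close> can be fixed before the approximate zero is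
   chosen.\<close>
 define n where "n = length ?f"
 obtain c where c: "c \<in> V - {\<zero>}" "\<forall>l. length l = n --> (\<forall>a \<in> set l. sdv c a) -->
  (\<exists>x \<in> V. x \<oplus> \<one> \<in> M \<and> lpoly (l @ [\<one>, \<one>]) x = \<zero>)" using t_SP_near[OF assms, of n] by (elim bexE) (rule that)
 obtain b where b: "b \<in> V" "b \<oplus> \<one> \<in> M" "sdv c (lpoly ?f b)"
  using ap[rule_format, of c] c(1) by auto
 have fV: "set ?f \<subseteq> V" using l by auto
 let ?d = "lderiv ?f b"
 have d: "?d \<in> V" "?d \<notin> M" using special_deriv[OF b(1,2) l] by auto
 then have u: "?d ~= \<zero>" "inv ?d \<in> V" using unitD by auto
 have fM: "lpoly ?f b \<in> M" using special_val[OF l b(1,2)] .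
 let ?e = "inv ?d \<otimes> inv ?d \<otimes> lpoly ?f b"
 have e: "?e \<in> M" "sdv c ?e" using u fM sdv_V[OF b(3), of "inv ?d \<otimes> inv ?d"] c by auto
 have "?d \<otimes> ?d \<otimes> ?e = (?d \<otimes> inv ?d) \<otimes> (?d \<otimes> inv ?d) \<otimes> lpoly ?f b"
  using d u fM by (simp add: m_ac)
 then have "lpoly ?f b = ?d \<otimes> ?d \<otimes> ?e" using r_inv'[of ?d] d u fM by simp
 from newton_substitution[OF fV b(1) _ this] e(1) obtain k where
  k: "set k \<subseteq> V" "length k = length ?f" "\<And>Z w. Z \<in> carrier R ==> w \<in> carrier R ==> Z \<otimes> w = \<one> ==>
  lpoly (map ((\<otimes>) ?e) k @ [\<one>, \<one>]) Z = \<zero> ==> lpoly ?f (b \<oplus> ?d \<otimes> ?e \<otimes> w) = \<zero>" by auto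
 have small: "sdv c a" if a: "a \<in> set (map ((\<otimes>) ?e) k)" for a
 proof -
  obtain z where z: "z \<in> set k" "a = ?e \<otimes> z" using a by auto
  then have "z \<in> V" using k(1) by auto
  then show ?thesis using sdv_V[OF e(2), of z] c e(1) z(2) m_comm[of z ?e] by simp
 qed
 have "length (map ((\<otimes>) ?e) k) = n" using k(2) by (simp add: n_def)
 then obtain Z where
  Z: "Z \<in> V" "Z \<oplus> \<one> \<in> M" "lpoly (map ((\<otimes>) ?e) k @ [\<one>, \<one>]) Z = \<zero>"
  using c(2)[rule_format, of "map ((\<otimes>) ?e) k"] small by auto
 note uZ = unitD[OF Z(1) unit_of_near[OF Z(1,2)]]
 then have w: "Z \<otimes> inv Z = \<one>" "inv Z \<in> V" using r_inv'[of Z] Z(1) by simp_all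
 let ?r = "b \<oplus> ?d \<otimes> ?e \<otimes> inv Z"
 have r0: "lpoly ?f ?r = \<zero>" by (rule k(3)[OF V_carr[OF Z(1)] V_carr[OF w(2)] w(1) Z(3)])
 have m: "?d \<otimes> ?e \<otimes> inv Z \<in> M" by (rule M_mult(2)[OF w(2) M_mult(1)[OF d(1) e(1)]])
 then have rV: "?r \<in> V" by (rule V_add[OF b(1) M_V])
 have "?r \<oplus> \<one> = (b \<oplus> \<one>) \<oplus> ?d \<otimes> ?e \<otimes> inv Z"
  by (rule add_swap_one[OF V_carr[OF b(1)] M_carr[OF m]])
 then have "?r \<oplus> \<one> \<in> M" using M_add[OF b(2) m] by simp
 then show "\<exists>x\<in>V. x \<oplus> \<one> \<in> M \<and> lpoly ?f x = \<zero>" using rV r0 by blast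
qed

end

section \<open>Valued fields\<close>

lemma carrier_UP: "carrier (UP R) = up R"
 by (simp add: UP_def)

lemma coeff_UP: "f \<in> up R ==> up_ring.coeff (UP R) f = f"
 by (simp add: UP_def)

lemma (in cring) lderiv_snoc:
 "set p \<subseteq> carrier R ==> a \<in> carrier R ==> x \<in> carrier R ==>
  lderiv (p @ [a]) x = lderiv p x \<oplus> [length p] \<cdot> (a \<otimes> x [^] (length p - 1))"
proof (induction p)
 case (Cons b p)
 have id: "P \<oplus> y \<otimes> a \<oplus> x \<otimes> (D \<oplus> e) = P \<oplus> x \<otimes> D \<oplus> (x \<otimes> e \<oplus> a \<otimes> y)"
  if "P \<in> carrier R" "y \<in> carrier R" "a \<in> carrier R" "x \<in> carrier R" "D \<in> carrier R" "e \<in> carrier R" for P y a x D e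
  using that by - (rule ring_identity, (rule ring_rep | assumption | (simp; fail))+, (simp_all add: l_distr r_distr a_ac m_ac)?)
 have e: "x \<otimes> ([length p] \<cdot> (a \<otimes> x [^] (length p - 1))) = [length p] \<cdot> (a \<otimes> x [^] length p)"
 proof (cases "length p")
  case (Suc k)
  have "x \<otimes> (a \<otimes> x [^] k) = a \<otimes> x [^] Suc k" using Cons.prems by (simp add: m_ac)
  then show ?thesis using Suc Cons.prems add_pow_rdistr[of x "a \<otimes> x [^] k" "Suc k"] by simp
 qed (use Cons.prems in auto)
 have p: "set p \<subseteq> carrier R" "b \<in> carrier R" using Cons.prems by auto
 show ?case
  using id[of "lpoly p x" "x [^] length p" a x "lderiv p x" "[length p] \<cdot> (a \<otimes> x [^] (length p - 1))"]
   Cons.IH p Cons.prems(2,3) e by (simp add: lpoly_append)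
qed auto

lemma (in cring) lpoly_upt:
 assumes "\<And>i. g i \<in> carrier R" "x \<in> carrier R"
 shows "lpoly (map g [0..<N]) x = (\<Oplus>i\<in>{..<N}. g i \<otimes> x [^] i)"
proof (induction N)
 case (Suc N)
 have "set (map g [0..<N]) \<subseteq> carrier R" "g N \<in> carrier R" using assms by auto
 then show ?case using Suc assms by (simp add: lpoly_append lessThan_Suc a_comm m_comm Pi_def)
qed simp

lemma (in cring) lderiv_upt:
 assumes "\<And>i. g i \<in> carrier R" "x \<in> carrier R"
 shows "lderiv (map g [0..<Suc N]) x = lpoly (map (\<lambda>i. [Suc i] \<cdot> g (Suc i)) [0..<N]) x"
proof (induction N)
 case (Suc N)
 let ?p = "map g [0..<Suc N]"
 have "set ?p \<subseteq> carrier R" "g (Suc N) \<in> carrier R" using assms by auto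
 then have "lderiv (?p @ [g (Suc N)]) x = lderiv ?p x \<oplus> [Suc N] \<cdot> (g (Suc N) \<otimes> x [^] N)"
  using assms lderiv_snoc[of ?p "g (Suc N)" x] by simp
 moreover have "set (map (\<lambda>i. [Suc i] \<cdot> g (Suc i)) [0..<N]) \<subseteq> carrier R" using assms by auto
 moreover have "map g [0..<Suc (Suc N)] = ?p @ [g (Suc N)]" by simp
 ultimately show ?case using Suc.IH assms add_pow_ldistr[of "g (Suc N)" "x [^] N" "Suc N"]
  by (simp add: lpoly_append m_comm[of "x [^] N"] del: upt_Suc add: upt_Suc_append)
qed (use assms in simp)

context cring
begin

interpretation U: UP_cring R "UP R" by unfold_locales auto

lemma up_eval_lpoly:
 assumes f: "f \<in> carrier (UP R)" and N: "deg R f < N" and x: "x \<in> carrier R"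
 shows "up_eval R f x = lpoly (map (up_ring.coeff (UP R) f) [0..<N]) x"
proof -
 have c: "up_ring.coeff (UP R) f i \<in> carrier R" for i using f by (rule U.coeff_closed)
 have z: "up_ring.coeff (UP R) f i = \<zero>" if "deg R f < i" for i using U.deg_aboveD[OF that f] .
 have "up_eval R f x = (\<Oplus>i\<in>{..deg R f}. up_ring.coeff (UP R) f i \<otimes> x [^] i)"
  using U.eval_on_carrier[OF f] by (simp add: up_eval_def)
 also have "\<dots> = (\<Oplus>i\<in>{..<N}. up_ring.coeff (UP R) f i \<otimes> x [^] i)"
  by (rule add.finprod_mono_neutral_cong_left) (use N z c x in auto)
 also have "\<dots> = lpoly (map (up_ring.coeff (UP R) f) [0..<N]) x" using lpoly_upt[of "up_ring.coeff (UP R) f" x N] c x by simp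
 finally show ?thesis .
qed

lemma up_deriv_lderiv:
 assumes f: "f \<in> carrier (UP R)" and N: "deg R f < N" and x: "x \<in> carrier R"
 shows "up_eval R (up_deriv R f) x = lderiv (map (up_ring.coeff (UP R) f) [0..<N]) x"
proof -
 have c: "up_ring.coeff (UP R) f i \<in> carrier R" for i using f by (rule U.coeff_closed)
 have z: "up_ring.coeff (UP R) f i = \<zero>" if "deg R f < i" for i using U.deg_aboveD[OF that f] .
 obtain N' where N': "N = Suc N'" using N by (cases N) auto
 have u: "up_deriv R f \<in> up R"
 proof (rule mem_upI)
  show "\<exists>n. bound \<zero> n (up_deriv R f)"
   using z by (intro exI[of _ "deg R f"] bound.intro) (simp add: up_deriv_def)
 qed (use c in \<open>simp add: up_deriv_def\<close>)
 then have d: "up_deriv R f \<in> carrier (UP R)" by (simp only: carrier_UP)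
 have cu: "up_ring.coeff (UP R) (up_deriv R f) = up_deriv R f" by (rule coeff_UP[OF u])
 have "deg R (up_deriv R f) \<le> N'"
 proof (rule U.deg_aboveI[OF _ d])
  fix m assume "N' < m"
  then show "up_ring.coeff (UP R) (up_deriv R f) m = \<zero>"
   unfolding cu using z[of "Suc m"] N N' by (simp add: up_deriv_def)
 qed
 then have "up_eval R (up_deriv R f) x = lpoly (map (up_deriv R f) [0..<Suc N']) x"
  using up_eval_lpoly[OF d _ x, of "Suc N'"] by (simp add: cu del: upt_Suc)
 also have "\<dots> = lpoly (map (\<lambda>i. [Suc i] \<cdot> up_ring.coeff (UP R) f (Suc i)) [0..<N']) x \<oplus> x [^] N' \<otimes> \<zero>"
  using c x z N N' by (simp add: up_deriv_def lpoly_append image_subset_iff)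
 also have "\<dots> = lderiv (map (up_ring.coeff (UP R) f) [0..<N]) x"
  using lderiv_upt[of "up_ring.coeff (UP R) f" x N'] c x N' by (simp add: image_subset_iff del: upt_Suc)
 finally show ?thesis .
qed

lemma list_to_UP:
 assumes "set l \<subseteq> carrier R"
 shows "\<exists>f \<in> carrier (UP R). (\<forall>i. up_ring.coeff (UP R) f i = (if i < length l then l ! i else \<zero>)) \<and>
  deg R f \<le> length l - 1 \<and> (l ~= [] --> last l ~= \<zero> --> deg R f = length l - 1) \<and>
  map (up_ring.coeff (UP R) f) [0..<length l] = l"
proof -
 define f where "f i = (if i < length l then l ! i else \<zero>)" for i
 have u: "f \<in> up R"
 proof (rule mem_upI)
  show "\<exists>n. bound \<zero> n f" by (intro exI[of _ "length l"] bound.intro) (simp add: f_def)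
 qed (use assms in \<open>auto simp: f_def subset_eq\<close>)
 then have c: "f \<in> carrier (UP R)" "up_ring.coeff (UP R) f = f" by (simp_all only: carrier_UP coeff_UP)
 have d: "deg R f \<le> length l - 1" by (intro U.deg_aboveI[OF _ c(1)]) (auto simp: c(2) f_def)
 moreover have "deg R f = length l - 1" if "l ~= []" "last l ~= \<zero>"
 proof (rule antisym[OF d])
  show "length l - 1 \<le> deg R f"
   using that by (intro U.deg_belowI[OF _ c(1)]) (simp add: c(2) f_def last_conv_nth)
 qed
 moreover have "map f [0..<length l] = l" by (rule nth_equalityI) (auto simp: f_def)
 ultimately show ?thesis using c by (intro bexI[of _ f]) (auto simp: f_def)
qed

end

text \<open>The valuation ring is the field with a smaller carrier, and Horner's rule involves only
  the operations.\<close>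

lemma lpoly_carrier_update: "ring.lpoly (K\<lparr>carrier := S\<rparr>) p x = ring.lpoly K p x"
 if "ring K" "ring (K\<lparr>carrier := S\<rparr>)"
 by (induction p) (auto simp: ring.lpoly.simps[OF that(1)] ring.lpoly.simps[OF that(2)])

lemma lderiv_carrier_update: "ring.lderiv (K\<lparr>carrier := S\<rparr>) p x = ring.lderiv K p x"
 if "ring K" "ring (K\<lparr>carrier := S\<rparr>)"
 by (induction p) (auto simp: ring.lderiv.simps[OF that(1)] ring.lderiv.simps[OF that(2)] lpoly_carrier_update[OF that])

context valued_field
begin

lemma valuation_subring_val_set: "valuation_subring K (val_set K G v)"
proof (intro valuation_subring.intro valuation_subring_axioms.intro K.field_axioms val_set_subring)
 fix x assume x: "x \<in> carrier K" "x ~= \<zero>\<^bsub>K\<^esub>"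
 then have x': "x \<in> carrier K - {\<zero>\<^bsub>K\<^esub>}" by simp
 note c = val_closed[OF x'] and i = val_inv[OF x']
 show "x \<in> val_set K G v \<or> inv\<^bsub>K\<^esub> x \<in> val_set K G v"
  using G.ole_total[OF c G.one_closed] ole_pos_iff[OF c] i x by (auto simp: val_set_def)
qed

lemma M_eq_val_ideal: "valuation_subring.M K (val_set K G v) = val_ideal K G v"
proof -
 have "inv\<^bsub>K\<^esub> x \<notin> val_set K G v \<longleftrightarrow> \<one>\<^bsub>G\<^esub> \<prec>\<^bsub>G\<^esub> v x" if x: "x \<in> carrier K - {\<zero>\<^bsub>K\<^esub>}" for x
 proof -
  note c = val_closed[OF x] and i = val_inv[OF x]
  have "inv\<^bsub>K\<^esub> x \<in> val_set K G v \<longleftrightarrow> v x \<preceq>\<^bsub>G\<^esub> \<one>\<^bsub>G\<^esub>" using i ole_pos_iff[OF c] by (auto simp: val_set_def)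
  then show ?thesis
   using G.ole_total[OF c G.one_closed] G.ole_antisym[OF c G.one_closed] G.ole_refl[OF c] by (auto simp: oless_def)
 qed
 then show ?thesis unfolding valuation_subring.M_def[OF valuation_subring_val_set] val_ideal_def by blast
qed

interpretation VS: valuation_subring K "val_set K G v" by (rule valuation_subring_val_set)

lemma sdv_iff_val:
 assumes c: "c \<in> carrier K - {\<zero>\<^bsub>K\<^esub>}" and y: "y \<in> carrier K"
 shows "VS.sdv c y \<longleftrightarrow> y = \<zero>\<^bsub>K\<^esub> \<or> v c \<prec>\<^bsub>G\<^esub> v y"
proof (cases "y = \<zero>\<^bsub>K\<^esub>")
 case True then show ?thesis using c VS.sdv_zero by auto
next
 case False
 then have y': "y \<in> carrier K - {\<zero>\<^bsub>K\<^esub>}" using y by simp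
 note i = val_inv[OF c] and cc = val_closed[OF c] and cy = val_closed[OF y']
 define m where "m = inv\<^bsub>K\<^esub> c \<otimes>\<^bsub>K\<^esub> y"
 have m: "m \<in> carrier K - {\<zero>\<^bsub>K\<^esub>}" using i(1) y' K.integral by (auto simp: m_def)
 have cm: "c \<otimes>\<^bsub>K\<^esub> m = y"
  using c y i by (simp add: m_def K.m_assoc[symmetric])
 have vm: "v y = v c \<otimes>\<^bsub>G\<^esub> v m" using val_mult[OF c m] cm by simp
 have gm: "v m \<in> carrier G" by (rule val_closed[OF m])
 have "VS.sdv c y \<longleftrightarrow> m \<in> VS.M"
 proof
  assume "VS.sdv c y"
  then obtain a where a: "a \<in> VS.M" "y = c \<otimes>\<^bsub>K\<^esub> a" by (auto simp: VS.sdv_def)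
  have "c \<otimes>\<^bsub>K\<^esub> a = c \<otimes>\<^bsub>K\<^esub> m" using a(2) cm by (simp only:)
  then have "a = m" using K.m_lcancel[OF _ _ VS.M_carr[OF a(1)], of c m] c m by blast
  then show "m \<in> VS.M" using a by simp
 next
  assume "m \<in> VS.M"
  then show "VS.sdv c y" unfolding VS.sdv_def using cm by blast
 qed
 also have "\<dots> \<longleftrightarrow> \<one>\<^bsub>G\<^esub> \<prec>\<^bsub>G\<^esub> v m" unfolding M_eq_val_ideal val_ideal_def using m by blast
 also have "\<dots> \<longleftrightarrow> v c \<prec>\<^bsub>G\<^esub> v y"
 proof
  assume l: "\<one>\<^bsub>G\<^esub> \<prec>\<^bsub>G\<^esub> v m"
  then have "v c \<preceq>\<^bsub>G\<^esub> v y" using ole_mult_pos[OF gm cc] cc gm vm by (simp add: oless_def G.m_comm)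
  moreover have "v c ~= v y"
   using l vm cc gm G.l_cancel_one[of "v c" "v m"] by (auto simp: oless_def)
  ultimately show "v c \<prec>\<^bsub>G\<^esub> v y" by (simp add: oless_def)
 next
  assume l: "v c \<prec>\<^bsub>G\<^esub> v y"
  have "v c \<otimes>\<^bsub>G\<^esub> inv\<^bsub>G\<^esub> v c \<preceq>\<^bsub>G\<^esub> v y \<otimes>\<^bsub>G\<^esub> inv\<^bsub>G\<^esub> v c"
   using G.ole_mult[OF cc cy G.inv_closed[OF cc]] l by (simp add: oless_def)
  moreover have "v y \<otimes>\<^bsub>G\<^esub> inv\<^bsub>G\<^esub> v c = v m"
   using vm cc gm by (metis G.inv_closed G.inv_solve_right G.m_closed G.m_comm)
  ultimately have "\<one>\<^bsub>G\<^esub> \<preceq>\<^bsub>G\<^esub> v m" using cc by simp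
  then show "\<one>\<^bsub>G\<^esub> \<prec>\<^bsub>G\<^esub> v m" using l vm G.r_one[OF cc] unfolding oless_def by metis
 qed
 finally show ?thesis using False by simp
qed

section \<open>The valuation topology in terms of divisibility\<close>

lemma val_ball_eq:
 assumes c: "c \<in> carrier K - {\<zero>\<^bsub>K\<^esub>}" and a: "a \<in> carrier K"
 shows "val_ball K G v a c = {x \<in> carrier K. VS.sdv c (x \<ominus>\<^bsub>K\<^esub> a)}"
 using sdv_iff_val[OF c] a by (auto simp: val_ball_def)

lemma ball_shift:
 assumes "VS.sdv c (x \<ominus>\<^bsub>K\<^esub> a)" "VS.sdv c (y \<ominus>\<^bsub>K\<^esub> x)" and C: "c \<in> carrier K" "x \<in> carrier K" "a \<in> carrier K" "y \<in> carrier K"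
 shows "VS.sdv c (y \<ominus>\<^bsub>K\<^esub> a)"
proof -
 have "(y \<ominus>\<^bsub>K\<^esub> x) \<oplus>\<^bsub>K\<^esub> (x \<ominus>\<^bsub>K\<^esub> a) = y \<ominus>\<^bsub>K\<^esub> a" using C by - (rule K.ring_identity, (rule K.ring_rep | assumption | (simp; fail))+, (simp_all add: K.l_distr K.r_distr K.a_ac K.m_ac)?)
 then show ?thesis using VS.sdv_add[OF assms(2,1)] C by simp
qed

text \<open>Every point of a ball is a centre of it, and of two radii one divides the other. Hence
  the generating balls already form a base.\<close>

lemma openin_val_topology:
 "openin (val_topology K G v) W \<longleftrightarrow> W \<subseteq> carrier K \<and>
  (\<forall>x \<in> W. \<exists>c \<in> carrier K - {\<zero>\<^bsub>K\<^esub>}. {y \<in> carrier K. VS.sdv c (y \<ominus>\<^bsub>K\<^esub> x)} \<subseteq> W)" (is "_ \<longleftrightarrow> ?R W")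
proof
 let ?S = "{val_ball K G v a c | a c. a \<in> carrier K \<and> c \<in> carrier K - {\<zero>\<^bsub>K\<^esub>}}"
 assume "openin (val_topology K G v) W"
 then have "generate_topology_on ?S W" by (simp add: val_topology_def openin_topology_generated_by_iff)
 then show "?R W"
 proof (induction rule: generate_topology_on.induct)
  case (Int A B)
  show ?case
  proof (intro conjI ballI)
   fix x assume x: "x \<in> A \<inter> B"
   obtain c d where c: "c \<in> carrier K - {\<zero>\<^bsub>K\<^esub>}" "{y \<in> carrier K. VS.sdv c (y \<ominus>\<^bsub>K\<^esub> x)} \<subseteq> A"
    and d: "d \<in> carrier K - {\<zero>\<^bsub>K\<^esub>}" "{y \<in> carrier K. VS.sdv d (y \<ominus>\<^bsub>K\<^esub> x)} \<subseteq> B" using Int x by (meson IntD1 IntD2)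
   obtain e where e: "e \<in> carrier K - {\<zero>\<^bsub>K\<^esub>}" "VS.dv c e" "VS.dv d e" using VS.dv_lub[OF c(1) d(1)] by auto
   show "\<exists>c\<in>carrier K - {\<zero>\<^bsub>K\<^esub>}. {y \<in> carrier K. VS.sdv c (y \<ominus>\<^bsub>K\<^esub> x)} \<subseteq> A \<inter> B"
    using e c d VS.dv_sdv_trans[OF e(2)] VS.dv_sdv_trans[OF e(3)] by (intro bexI[OF _ e(1)]) blast
  qed (use Int in auto)
 next
  case (UN \<K>)
  show ?case
  proof (intro conjI ballI)
   fix x assume "x \<in> \<Union>\<K>"
   then obtain A where A: "A \<in> \<K>" "x \<in> A" by auto
   then obtain c where "c \<in> carrier K - {\<zero>\<^bsub>K\<^esub>}" "{y \<in> carrier K. VS.sdv c (y \<ominus>\<^bsub>K\<^esub> x)} \<subseteq> A" using UN.IH[OF A(1)] A(2) by blast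
   then show "\<exists>c\<in>carrier K - {\<zero>\<^bsub>K\<^esub>}. {y \<in> carrier K. VS.sdv c (y \<ominus>\<^bsub>K\<^esub> x)} \<subseteq> \<Union>\<K>" using A by blast
  qed (use UN.IH in auto)
 next
  case (Basis s)
  then obtain a c where s: "s = val_ball K G v a c" "a \<in> carrier K" "c \<in> carrier K - {\<zero>\<^bsub>K\<^esub>}" by auto
  note e = val_ball_eq[OF s(3,2)]
  show ?case unfolding s(1) e
  proof (intro conjI ballI bexI[OF _ s(3)])
   fix x assume "x \<in> {x \<in> carrier K. VS.sdv c (x \<ominus>\<^bsub>K\<^esub> a)}"
   then show "{y \<in> carrier K. VS.sdv c (y \<ominus>\<^bsub>K\<^esub> x)} \<subseteq> {x \<in> carrier K. VS.sdv c (x \<ominus>\<^bsub>K\<^esub> a)}"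
    using ball_shift[of c x a] s by auto
  qed auto
 qed auto
next
 assume r: "?R W"
 show "openin (val_topology K G v) W"
 proof (subst openin_subopen, intro ballI)
  fix x assume x: "x \<in> W"
  then obtain c where c: "c \<in> carrier K - {\<zero>\<^bsub>K\<^esub>}" "{y \<in> carrier K. VS.sdv c (y \<ominus>\<^bsub>K\<^esub> x)} \<subseteq> W" and xK: "x \<in> carrier K"
   using r by blast
  have "openin (val_topology K G v) (val_ball K G v x c)"
   unfolding val_topology_def using c xK by (intro topology_generated_by_Basis) blast
  moreover have "x \<in> val_ball K G v x c" using xK by (simp add: val_ball_def)
  ultimately show "\<exists>T. openin (val_topology K G v) T \<and> x \<in> T \<and> T \<subseteq> W"
   using val_ball_eq[OF c(1) xK] c(2) by blast
 qed
qed

lemma openin_ball: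
 assumes c: "c \<in> carrier K - {\<zero>\<^bsub>K\<^esub>}" and x: "x \<in> carrier K"
 shows "openin (val_topology K G v) {y \<in> carrier K. VS.sdv c (y \<ominus>\<^bsub>K\<^esub> x)}"
proof -
 have "{y \<in> carrier K. VS.sdv c (y \<ominus>\<^bsub>K\<^esub> x)} = val_ball K G v x c" using val_ball_eq[OF c x] by simp
 then show ?thesis unfolding val_topology_def using c x by (auto intro!: topology_generated_by_Basis)
qed

lemma topspace_val_topology: "topspace (val_topology K G v) = carrier K"
proof
 show "topspace (val_topology K G v) \<subseteq> carrier K"
  using openin_val_topology[of "topspace (val_topology K G v)"] openin_topspace by blast
 have "openin (val_topology K G v) (carrier K)"
  unfolding openin_val_topology using K.one_closed K.one_not_zero by blast
 then show "carrier K \<subseteq> topspace (val_topology K G v)" by (rule openin_subset)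
qed

definition box :: "nat \<Rightarrow> (nat \<Rightarrow> 'a) \<Rightarrow> 'a \<Rightarrow> (nat \<Rightarrow> 'a) set" where
 "box n x c = {y \<in> {..<n} \<rightarrow>\<^sub>E carrier K. \<forall>i < n. VS.sdv c (y i \<ominus>\<^bsub>K\<^esub> x i)}"

lemma finite_dv_lub:
 assumes "finite I" "\<And>i. i \<in> I ==> f i \<in> carrier K - {\<zero>\<^bsub>K\<^esub>}"
 shows "\<exists>c \<in> carrier K - {\<zero>\<^bsub>K\<^esub>}. \<forall>i \<in> I. VS.dv (f i) c"
 using assms
proof (induction I rule: finite_induct)
 case empty
 show ?case by (intro bexI[of _ "\<one>\<^bsub>K\<^esub>"]) auto
next
 case (insert a I)
 then obtain c where c: "c \<in> carrier K - {\<zero>\<^bsub>K\<^esub>}" "\<forall>i \<in> I. VS.dv (f i) c" by auto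
 obtain d where d: "d \<in> carrier K - {\<zero>\<^bsub>K\<^esub>}" "VS.dv c d" "VS.dv (f a) d"
  using VS.dv_lub[OF c(1), of "f a"] insert.prems by auto
 have "\<forall>i \<in> insert a I. VS.dv (f i) d" using c d VS.dv_trans insert.prems by blast
 then show ?case using d(1) by blast
qed

text \<open>Finitely many coordinates admit a common radius, so boxes with a single radius
  suffice.\<close>

lemma openin_val_topology_pow:
 "openin (val_topology_pow K G v n) U \<longleftrightarrow> U \<subseteq> {..<n} \<rightarrow>\<^sub>E carrier K \<and>
  (\<forall>x \<in> U. \<exists>c \<in> carrier K - {\<zero>\<^bsub>K\<^esub>}. box n x c \<subseteq> U)"
proof
 assume o: "openin (val_topology_pow K G v n) U"
 show "U \<subseteq> {..<n} \<rightarrow>\<^sub>E carrier K \<and> (\<forall>x \<in> U. \<exists>c \<in> carrier K - {\<zero>\<^bsub>K\<^esub>}. box n x c \<subseteq> U)"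
 proof (intro conjI ballI)
  show "U \<subseteq> {..<n} \<rightarrow>\<^sub>E carrier K"
   using openin_subset[OF o] by (simp add: val_topology_pow_def topspace_val_topology)
  fix x assume x: "x \<in> U"
  have "\<exists>W. finite {i \<in> {..<n}. W i ~= topspace (val_topology K G v)} \<and>
    (\<forall>i \<in> {..<n}. openin (val_topology K G v) (W i)) \<and> x \<in> Pi\<^sub>E {..<n} W \<and> Pi\<^sub>E {..<n} W \<subseteq> U"
   by (rule bspec[OF o[unfolded val_topology_pow_def openin_product_topology_alt] x])
  then obtain W where W: "\<forall>i \<in> {..<n}. openin (val_topology K G v) (W i)" "x \<in> Pi\<^sub>E {..<n} W" "Pi\<^sub>E {..<n} W \<subseteq> U"
   by (elim exE conjE) (rule that)
  have "\<exists>c \<in> carrier K - {\<zero>\<^bsub>K\<^esub>}. {y \<in> carrier K. VS.sdv c (y \<ominus>\<^bsub>K\<^esub> x i)} \<subseteq> W i" if i: "i < n" for i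
  proof -
   have "openin (val_topology K G v) (W i)" "x i \<in> W i" using W(1,2) i PiE_mem[OF W(2), of i] by simp_all
   then show ?thesis unfolding openin_val_topology by blast
  qed
  then obtain c where c: "\<And>i. i < n ==> c i \<in> carrier K - {\<zero>\<^bsub>K\<^esub>} \<and> {y \<in> carrier K. VS.sdv (c i) (y \<ominus>\<^bsub>K\<^esub> x i)} \<subseteq> W i"
   by metis
  obtain d where d: "d \<in> carrier K - {\<zero>\<^bsub>K\<^esub>}" "\<forall>i \<in> {..<n}. VS.dv (c i) d" using finite_dv_lub[of "{..<n}" c] c by auto
  have "box n x d \<subseteq> U"
  proof
   fix y assume y: "y \<in> box n x d"
   have "y i \<in> W i" if "i < n" for i
    using c[OF that] y that d(2) VS.dv_sdv_trans[of "c i" d "y i \<ominus>\<^bsub>K\<^esub> x i"] by (auto simp: box_def PiE_iff)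
   then have "y \<in> Pi\<^sub>E {..<n} W" using y unfolding box_def PiE_iff by simp
   then show "y \<in> U" using W(3) by blast
  qed
  then show "\<exists>c \<in> carrier K - {\<zero>\<^bsub>K\<^esub>}. box n x c \<subseteq> U" using d by blast
 qed
next
 assume r: "U \<subseteq> {..<n} \<rightarrow>\<^sub>E carrier K \<and> (\<forall>x \<in> U. \<exists>c \<in> carrier K - {\<zero>\<^bsub>K\<^esub>}. box n x c \<subseteq> U)"
 show "openin (val_topology_pow K G v n) U"
  unfolding val_topology_pow_def openin_product_topology_alt
 proof
  fix x assume x: "x \<in> U"
  then obtain c where c: "c \<in> carrier K - {\<zero>\<^bsub>K\<^esub>}" "box n x c \<subseteq> U" using r by blast
  have xc: "x \<in> {..<n} \<rightarrow>\<^sub>E carrier K" using x r by blast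
  let ?W = "\<lambda>i. {y \<in> carrier K. VS.sdv c (y \<ominus>\<^bsub>K\<^esub> x i)}"
  have o: "\<forall>i \<in> {..<n}. openin (val_topology K G v) (?W i)" using openin_ball[OF c(1)] xc by (auto simp: PiE_iff)
  have "VS.sdv c (x i \<ominus>\<^bsub>K\<^esub> x i)" if "i < n" for i
  proof -
   have "x i \<ominus>\<^bsub>K\<^esub> x i = \<zero>\<^bsub>K\<^esub>" using xc that by (simp add: PiE_iff K.r_right_minus_eq)
   then show ?thesis using c(1) VS.sdv_zero by simp
  qed
  then have x': "x \<in> Pi\<^sub>E {..<n} ?W" using xc unfolding PiE_iff by simp
  have "Pi\<^sub>E {..<n} ?W \<subseteq> box n x c"
  proof
   fix y assume y: "y \<in> Pi\<^sub>E {..<n} ?W"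
   have "y \<in> {..<n} \<rightarrow>\<^sub>E carrier K" using y unfolding PiE_iff by blast
   moreover have "\<forall>i < n. VS.sdv c (y i \<ominus>\<^bsub>K\<^esub> x i)" using y unfolding PiE_iff by blast
   ultimately show "y \<in> box n x c" unfolding box_def by blast
  qed
  then have sU: "Pi\<^sub>E {..<n} ?W \<subseteq> U" using c(2) by (rule subset_trans)
  have fin: "finite {i \<in> {..<n}. ?W i ~= topspace (val_topology K G v)}"
   by (rule finite_subset[OF _ finite_lessThan[of n]]) blast
  show "\<exists>U'. finite {i \<in> {..<n}. U' i ~= topspace (val_topology K G v)} \<and>
    (\<forall>i\<in>{..<n}. openin (val_topology K G v) (U' i)) \<and> x \<in> Pi\<^sub>E {..<n} U' \<and> Pi\<^sub>E {..<n} U' \<subseteq> U"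
   by (rule exI[of _ ?W]) (rule conjI[OF fin conjI[OF o conjI[OF x' sU]]])
 qed
qed

lemma val_ring_minus: "x \<in> val_set K G v ==> \<ominus>\<^bsub>val_ring K G v\<^esub> x = \<ominus>\<^bsub>K\<^esub> x"
proof -
 interpret R: cring "val_ring K G v" by (rule val_ring_cring)
 assume x: "x \<in> val_set K G v"
 have "\<ominus>\<^bsub>K\<^esub> x \<oplus>\<^bsub>val_ring K G v\<^esub> x = \<zero>\<^bsub>val_ring K G v\<^esub>" using x by (simp add: val_ring_def K.l_neg)
 then show ?thesis using x by (intro R.minus_equality) (auto simp: val_ring_def)
qed

lemma henselian_iff_SP: "henselian K G v \<longleftrightarrow> VS.SP"
proof -
 let ?R = "val_ring K G v"
 interpret R: cring ?R by (rule val_ring_cring)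
 have R': "ring (K\<lparr>carrier := val_set K G v\<rparr>)" using R.ring_axioms by (simp add: val_ring_def)
 note lp = lpoly_carrier_update[OF K.ring_axioms R', folded val_ring_def]
 note ld = lderiv_carrier_update[OF K.ring_axioms R', folded val_ring_def]
 have cR: "carrier ?R = val_set K G v" "\<zero>\<^bsub>?R\<^esub> = \<zero>\<^bsub>K\<^esub>" by (auto simp: val_ring_def)
 have mn: "b \<ominus>\<^bsub>?R\<^esub> a = b \<ominus>\<^bsub>K\<^esub> a" if "a \<in> val_set K G v" for a b
  using val_ring_minus[OF that] by (simp add: a_minus_def val_ring_def)
 show ?thesis
 proof
  assume h: "henselian K G v"
  show "VS.SP"
  proof (rule VS.hensel_SP)
   fix f a assume f: "set f \<subseteq> val_set K G v" and a: "a \<in> val_set K G v" "K.lpoly f a \<in> VS.M" "K.lderiv f a \<notin> VS.M"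
   have "set f \<subseteq> carrier ?R" using f cR by simp
   then obtain F where F: "F \<in> carrier (UP ?R)" "deg ?R F \<le> length f - 1" "map (coeff (UP ?R) F) [0..<length f] = f"
    using R.list_to_UP by blast
   have "f ~= []" using a(3) VS.M_zero by auto
   then have d: "deg ?R F < length f" using F(2) by (cases f) auto
   have e: "up_eval ?R F x = K.lpoly f x" "up_eval ?R (up_deriv ?R F) x = K.lderiv f x" if "x \<in> val_set K G v" for x
    using R.up_eval_lpoly[OF F(1) d] R.up_deriv_lderiv[OF F(1) d] F(3) lp ld cR that by auto
   obtain b where "b \<in> carrier ?R" "up_eval ?R F b = \<zero>\<^bsub>?R\<^esub>" "b \<ominus>\<^bsub>?R\<^esub> a \<in> val_ideal K G v"
    using h F(1) a e[OF a(1)] cR unfolding henselian_def Let_def M_eq_val_ideal by metis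
   then show "\<exists>b\<in>val_set K G v. K.lpoly f b = \<zero>\<^bsub>K\<^esub> \<and> b \<ominus>\<^bsub>K\<^esub> a \<in> VS.M"
    using e cR mn[OF a(1)] M_eq_val_ideal by (intro bexI[of _ b]) auto
  qed
 next
  assume s: "VS.SP"
  show "henselian K G v"
   unfolding henselian_def Let_def
  proof (intro ballI impI)
   fix F a assume F: "F \<in> carrier (UP ?R)" and a: "a \<in> carrier ?R"
    and h: "up_eval ?R F a \<in> val_ideal K G v \<and> up_eval ?R (up_deriv ?R F) a \<notin> val_ideal K G v"
   interpret U: UP_cring ?R "UP ?R" by unfold_locales auto
   let ?f = "map (coeff (UP ?R) F) [0..<Suc (deg ?R F)]"
   have f: "set ?f \<subseteq> val_set K G v" using U.coeff_closed[OF F] cR by auto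
   have e: "up_eval ?R F x = K.lpoly ?f x" "up_eval ?R (up_deriv ?R F) x = K.lderiv ?f x" if "x \<in> val_set K G v" for x
    using R.up_eval_lpoly[OF F, of "Suc (deg ?R F)"] R.up_deriv_lderiv[OF F, of "Suc (deg ?R F)"] lp ld cR that by auto
   have aV: "a \<in> val_set K G v" using a cR by simp
   have "K.lpoly ?f a \<in> VS.M" "K.lderiv ?f a \<notin> VS.M" using h e[OF aV] M_eq_val_ideal by auto
   from VS.SP_hensel[OF s f aV this] obtain b where "b \<in> val_set K G v" "K.lpoly ?f b = \<zero>\<^bsub>K\<^esub>" "b \<ominus>\<^bsub>K\<^esub> a \<in> VS.M" by auto
   then show "\<exists>b\<in>carrier ?R. up_eval ?R F b = \<zero>\<^bsub>?R\<^esub> \<and> b \<ominus>\<^bsub>?R\<^esub> a \<in> val_ideal K G v"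
    using e cR mn[OF aV] M_eq_val_ideal by (intro bexI[of _ b]) auto
  qed
 qed
qed

lemma special_UP:
 assumes f: "f \<in> carrier (UP K)" "deg K f = n + 1" "coeff (UP K) f (n + 1) = \<one>\<^bsub>K\<^esub>" "coeff (UP K) f n = \<one>\<^bsub>K\<^esub>"
  and x: "x \<in> carrier K"
 shows "up_eval K f x = K.lpoly (map (coeff (UP K) f) [0..<n] @ [\<one>\<^bsub>K\<^esub>, \<one>\<^bsub>K\<^esub>]) x"
 using K.up_eval_lpoly[OF f(1) _ x, of "Suc (Suc n)"] f by simp

lemma SP_t_henselian: assumes "VS.SP" shows "t_henselian K G v"
 unfolding t_henselian_def
proof (intro allI impI exI conjI ballI)
 fix n :: nat
 \<comment> \<open>The ball of radius one is the maximal ideal; this neighbourhood serves for all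
   degrees.\<close>
 let ?U = "{y \<in> carrier K. VS.sdv \<one>\<^bsub>K\<^esub> (y \<ominus>\<^bsub>K\<^esub> \<zero>\<^bsub>K\<^esub>)}"
 show "openin (val_topology K G v) ?U" by (rule openin_ball) auto
 show "\<zero>\<^bsub>K\<^esub> \<in> ?U" by (simp add: K.minus_eq)
 fix f assume f: "f \<in> carrier (UP K)"
  and h: "deg K f = n + 1 \<and> coeff (UP K) f (n + 1) = \<one>\<^bsub>K\<^esub> \<and> coeff (UP K) f n = \<one>\<^bsub>K\<^esub> \<and> (\<forall>i<n. coeff (UP K) f i \<in> ?U)"
 have "set (map (coeff (UP K) f) [0..<n]) \<subseteq> VS.M" using h by (auto simp: K.minus_eq)
 then obtain x where "x \<in> val_set K G v" "K.lpoly (map (coeff (UP K) f) [0..<n] @ [\<one>\<^bsub>K\<^esub>, \<one>\<^bsub>K\<^esub>]) x = \<zero>\<^bsub>K\<^esub>"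
  using assms unfolding VS.SP_def by blast
 then show "\<exists>x\<in>carrier K. up_eval K f x = \<zero>\<^bsub>K\<^esub>"
  using special_UP[OF f, of n x] h by (intro bexI[of _ x]) auto
qed

lemma t_henselian_t_SP: assumes "t_henselian K G v" shows "VS.t_SP"
 unfolding VS.t_SP_def
proof (intro allI impI)
 fix n :: nat assume n: "1 \<le> n"
 then obtain U where U: "openin (val_topology K G v) U" "\<zero>\<^bsub>K\<^esub> \<in> U" "\<And>f. f \<in> carrier (UP K) ==>
    deg K f = n + 1 \<and> coeff (UP K) f (n + 1) = \<one>\<^bsub>K\<^esub> \<and> coeff (UP K) f n = \<one>\<^bsub>K\<^esub> \<and>
    (\<forall>i < n. coeff (UP K) f i \<in> U) ==> (\<exists>x \<in> carrier K. up_eval K f x = \<zero>\<^bsub>K\<^esub>)"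
  using assms unfolding t_henselian_def by meson
 obtain c where c: "c \<in> carrier K - {\<zero>\<^bsub>K\<^esub>}" "{y \<in> carrier K. VS.sdv c (y \<ominus>\<^bsub>K\<^esub> \<zero>\<^bsub>K\<^esub>)} \<subseteq> U"
  using U(1,2) unfolding openin_val_topology by blast
 have cU: "y \<in> U" if "VS.sdv c y" for y
 proof -
  have "y \<in> carrier K" using VS.sdv_carr[OF that] c by auto
  then show ?thesis using that c(2) by (auto simp: K.minus_eq)
 qed
 show "\<exists>c\<in>carrier K - {\<zero>\<^bsub>K\<^esub>}. \<forall>l. length l = n --> (\<forall>a\<in>set l. VS.sdv c a) -->
  (\<exists>x\<in>carrier K. K.lpoly (l @ [\<one>\<^bsub>K\<^esub>, \<one>\<^bsub>K\<^esub>]) x = \<zero>\<^bsub>K\<^esub>)"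
 proof (intro bexI[OF _ c(1)] allI impI)
  fix l assume l: "length l = n" "\<forall>a\<in>set l. VS.sdv c a"
  let ?l = "l @ [\<one>\<^bsub>K\<^esub>, \<one>\<^bsub>K\<^esub>]"
  have lc: "set ?l \<subseteq> carrier K" using l VS.sdv_carr c by auto
  obtain f where f: "f \<in> carrier (UP K)" "\<And>i. coeff (UP K) f i = (if i < length ?l then ?l ! i else \<zero>\<^bsub>K\<^esub>)"
   "deg K f = length ?l - 1" "map (coeff (UP K) f) [0..<length ?l] = ?l"
   using K.list_to_UP[OF lc] by auto
  have "deg K f = n + 1 \<and> coeff (UP K) f (n + 1) = \<one>\<^bsub>K\<^esub> \<and> coeff (UP K) f n = \<one>\<^bsub>K\<^esub> \<and> (\<forall>i < n. coeff (UP K) f i \<in> U)"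
   using f(2,3) l cU by (auto simp: nth_append)
  then obtain x where x: "x \<in> carrier K" "up_eval K f x = \<zero>\<^bsub>K\<^esub>" using U(3)[OF f(1)] by blast
  have "up_eval K f x = K.lpoly ?l x" using K.up_eval_lpoly[OF f(1) _ x(1), of "length ?l"] f(3,4) by simp
  then show "\<exists>x\<in>carrier K. K.lpoly ?l x = \<zero>\<^bsub>K\<^esub>" using x by auto
 qed
qed

end

section \<open>Residue fields of coarsenings\<close>

context valuation_subring
begin

declare M_V [simp del]

text \<open>The value group is the multiplicative group modulo the units of \<open>V\<close>,
  realised by the classes \<open>p x\<close> of elements of equal value. Its elements are sets of
  field elements, which is the type of value groups over which the theorem quantifies.\<close>

lemma exists_valuation: "\<exists>(H :: 'a set ogroup) w. valued_field R H w \<and> val_set R H w = V"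
proof -
 let ?N = "carrier R - {\<zero>}"
 define p where "p x = {y \<in> ?N. dv x y \<and> dv y x}" for x
 define rep where "rep A = (SOME y. y \<in> A)" for A :: "'a set"
 have rep_in: "rep (p x) \<in> p x" if "x \<in> ?N" for x
 proof -
  have "x \<in> p x" using that by (simp add: p_def)
  then show ?thesis unfolding rep_def by (rule someI)
 qed
 have rep: "rep (p x) \<in> ?N" "dv x (rep (p x))" "dv (rep (p x)) x" if "x \<in> ?N" for x
  using rep_in[OF that] unfolding p_def by blast+
 have pe: "p x = p y \<longleftrightarrow> dv x y \<and> dv y x" if "x \<in> ?N" "y \<in> ?N" for x y
 proof
  assume "p x = p y"
  moreover have "x \<in> p x" using that(1) by (simp add: p_def)
  ultimately show "dv x y \<and> dv y x" unfolding p_def by blast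
 next
  assume "dv x y \<and> dv y x"
  then show "p x = p y" unfolding p_def using that dv_trans by blast
 qed
 define H :: "'a set ogroup" where "H = \<lparr>carrier = p ` ?N,
  monoid.mult = (\<lambda>A B. p (rep A \<otimes> rep B)), one = p \<one>, ole = (\<lambda>A B. dv (rep A) (rep B))\<rparr>"
 have mN: "x \<otimes> y \<in> ?N" if "x \<in> ?N" "y \<in> ?N" for x y
  using that integral by auto
 have mult: "p x \<otimes>\<^bsub>H\<^esub> p y = p (x \<otimes> y)" if x: "x \<in> ?N" and y: "y \<in> ?N" for x y
 proof -
  have "p (rep (p x) \<otimes> rep (p y)) = p (x \<otimes> y)"
   using pe[OF mN[OF rep(1)[OF x] rep(1)[OF y]] mN[OF x y]] dv_mult rep[OF x] rep[OF y] x y by blast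
  then show ?thesis by (simp add: H_def)
 qed
 have ole: "p x \<preceq>\<^bsub>H\<^esub> p y \<longleftrightarrow> dv x y" if x: "x \<in> ?N" and y: "y \<in> ?N" for x y
 proof -
  have "dv (rep (p x)) (rep (p y)) \<longleftrightarrow> dv x y"
   using rep[OF x] rep[OF y] x y dv_trans by blast
  then show ?thesis by (simp add: H_def)
 qed
 have one: "\<one>\<^bsub>H\<^esub> = p \<one>" and car: "carrier H = p ` ?N" by (auto simp: H_def)
 have 1: "\<one> \<in> ?N" by simp
 have tot: "dv x y \<or> dv y x" if "x \<in> ?N" "y \<in> ?N" for x y
  using dv_total[of x y] sdv_dv that by blast
 have "ordered_abelian_group H"
 proof (intro ordered_abelian_group.intro ordered_abelian_group_axioms.intro comm_groupI)
  fix A assume "A \<in> carrier H"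
  then obtain x where x: "x \<in> ?N" "A = p x" by (auto simp: car)
  have ix: "inv x \<in> ?N" "inv x \<otimes> x = \<one>" using inv_carr inv_nonzero l_inv' x(1) by auto
  show "\<exists>B\<in>carrier H. B \<otimes>\<^bsub>H\<^esub> A = \<one>\<^bsub>H\<^esub>"
   using mult[OF ix(1) x(1)] ix x(2) unfolding car one by (intro bexI[of _ "p (inv x)"]) auto
  show "\<one>\<^bsub>H\<^esub> \<otimes>\<^bsub>H\<^esub> A = A" using x mult[OF 1 x(1)] by (simp add: one)
  show "A \<preceq>\<^bsub>H\<^esub> A" using x ole[OF x(1) x(1)] by simp
  fix B assume "B \<in> carrier H"
  then obtain y where y: "y \<in> ?N" "B = p y" by (auto simp: car)
  show "A \<otimes>\<^bsub>H\<^esub> B \<in> carrier H" unfolding x(2) y(2) mult[OF x(1) y(1)] car using mN[OF x(1) y(1)] by blast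
  show "A \<otimes>\<^bsub>H\<^esub> B = B \<otimes>\<^bsub>H\<^esub> A" unfolding x(2) y(2) mult[OF x(1) y(1)] mult[OF y(1) x(1)]
   using m_comm x(1) y(1) by auto
  show "A \<preceq>\<^bsub>H\<^esub> B ==> B \<preceq>\<^bsub>H\<^esub> A ==> A = B"
   unfolding x(2) y(2) ole[OF x(1) y(1)] ole[OF y(1) x(1)] pe[OF x(1) y(1)] by blast
  show "A \<preceq>\<^bsub>H\<^esub> B \<or> B \<preceq>\<^bsub>H\<^esub> A"
   unfolding x(2) y(2) ole[OF x(1) y(1)] ole[OF y(1) x(1)] by (rule tot[OF x(1) y(1)])
  fix C assume "C \<in> carrier H"
  then obtain z where z: "z \<in> ?N" "C = p z" by (auto simp: car)
  show "A \<otimes>\<^bsub>H\<^esub> B \<otimes>\<^bsub>H\<^esub> C = A \<otimes>\<^bsub>H\<^esub> (B \<otimes>\<^bsub>H\<^esub> C)"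
   unfolding x(2) y(2) z(2) mult[OF x(1) y(1)] mult[OF y(1) z(1)]
    mult[OF mN[OF x(1) y(1)] z(1)] mult[OF x(1) mN[OF y(1) z(1)]]
   using x(1) y(1) z(1) m_assoc by auto
  show "A \<preceq>\<^bsub>H\<^esub> B ==> B \<preceq>\<^bsub>H\<^esub> C ==> A \<preceq>\<^bsub>H\<^esub> C"
   unfolding x(2) y(2) z(2) ole[OF x(1) y(1)] ole[OF y(1) z(1)] ole[OF x(1) z(1)]
   using dv_trans x(1) by blast
  show "A \<preceq>\<^bsub>H\<^esub> B ==> A \<otimes>\<^bsub>H\<^esub> C \<preceq>\<^bsub>H\<^esub> B \<otimes>\<^bsub>H\<^esub> C"
   unfolding x(2) y(2) z(2) ole[OF x(1) y(1)] mult[OF x(1) z(1)] mult[OF y(1) z(1)]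
    ole[OF mN[OF x(1) z(1)] mN[OF y(1) z(1)]]
   using dv_mult[of x y z z] x(1) z(1) by simp
 qed (auto simp: car one)
 moreover have "valued_field_axioms R H p"
 proof (intro valued_field_axioms.intro)
  fix x y assume x: "x \<in> ?N" and y: "y \<in> ?N" and s: "x \<oplus> y ~= \<zero>"
  have s': "x \<oplus> y \<in> ?N" using x y s by auto
  show "p x \<preceq>\<^bsub>H\<^esub> p (x \<oplus> y) \<or> p y \<preceq>\<^bsub>H\<^esub> p (x \<oplus> y)"
   unfolding ole[OF x s'] ole[OF y s'] using tot[OF x y] dv_add[of x x y] dv_add[of y x y] x y by auto
 qed (auto simp: car mult)
 ultimately have "valued_field R H p" by (simp add: valued_field_def field_axioms)
 moreover have "val_set R H p = V"
 proof -
  have "\<one>\<^bsub>H\<^esub> \<preceq>\<^bsub>H\<^esub> p x \<longleftrightarrow> x \<in> V" if "x \<in> ?N" for x unfolding one using ole[OF 1 that] by simp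
  then have "val_set R H p = {x \<in> carrier R. x = \<zero> \<or> x \<in> V}" unfolding val_set_def by blast
  then show ?thesis using V_zero V_sub by auto
 qed
 ultimately show ?thesis by blast
qed

text \<open>For \<open>x = - f(b) / f'(b)\<close> the constant and the linear term of the expansion
  cancel and \<open>x^2 h(x)\<close> remains, a multiple of \<open>f(b)^2\<close> because
  \<open>f'(b)\<close> is a unit.\<close>

lemma newton_step:
 assumes l: "set l \<subseteq> M" and b: "b \<in> V" "b \<oplus> \<one> \<in> M"
 shows "\<exists>b' \<in> V. b' \<oplus> \<one> \<in> M \<and>
  dv (lpoly (l @ [\<one>, \<one>]) b \<otimes> lpoly (l @ [\<one>, \<one>]) b) (lpoly (l @ [\<one>, \<one>]) b')"
proof -
 let ?f = "l @ [\<one>, \<one>]"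
 define d c where "d = lderiv ?f b" and "c = lpoly ?f b"
 have fV: "set ?f \<subseteq> V" using l M_V by auto
 have d: "d \<in> V" "d \<notin> M" using special_deriv[OF b l] by (simp_all add: d_def)
 then have u: "d ~= \<zero>" "inv d \<in> V" using unitD by auto
 have cM: "c \<in> M" using special_val[OF l b] by (simp add: c_def)
 have cV: "c \<in> V" using cM M_V by blast
 obtain h where h: "set h \<subseteq> V" "\<And>x. x \<in> carrier R ==> lpoly ?f (b \<oplus> x) = c \<oplus> x \<otimes> (d \<oplus> x \<otimes> lpoly h x)"
  using lpoly_shift[OF V_subring b(1) fV] unfolding c_def d_def by blast
 define x where "x = \<ominus> (inv d \<otimes> c)"
 have x: "x \<in> M" unfolding x_def using M_minus[OF M_mult(1)[OF u(2) cM]] .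
 have xV: "x \<in> V" using x M_V by blast
 have hV: "lpoly h x \<in> V" using h(1) xV by simp
 have xd: "x \<otimes> d = \<ominus> c"
 proof -
  have "(inv d \<otimes> c) \<otimes> d = (d \<otimes> inv d) \<otimes> c"
   using V_carr[OF u(2)] V_carr[OF d(1)] V_carr[OF cV] by (simp add: m_ac)
  then show ?thesis unfolding x_def using r_inv'[of d] u d(1) cV by (simp add: l_minus)
 qed
 have id: "c \<oplus> x \<otimes> (d \<oplus> x \<otimes> h) = (c \<oplus> x \<otimes> d) \<oplus> x \<otimes> x \<otimes> h"
  if "c \<in> carrier R" "x \<in> carrier R" "d \<in> carrier R" "h \<in> carrier R" for c x d h
  using that by - (rule ring_identity, (rule ring_rep | assumption | (simp; fail))+, (simp_all add: l_distr r_distr a_ac m_ac)?)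
 have "lpoly ?f (b \<oplus> x) = x \<otimes> x \<otimes> lpoly h x"
  unfolding h(2)[OF V_carr[OF xV]] id[OF V_carr[OF cV] V_carr[OF xV] V_carr[OF d(1)] V_carr[OF hV]] xd
  using cV xV hV by (simp add: r_neg)
 moreover have "dv c x" unfolding x_def using dv_minus[OF dv_V[OF dv_refl[of c] u(2)]] cV by simp
 then have "dv (c \<otimes> c) (x \<otimes> x)" using dv_mult[of c x c x] cV by simp
 then have "dv (c \<otimes> c) (lpoly h x \<otimes> (x \<otimes> x))" using dv_V[OF _ hV] cV by simp
 then have "dv (c \<otimes> c) (x \<otimes> x \<otimes> lpoly h x)" using m_comm[of "x \<otimes> x" "lpoly h x"] xV hV by simp
 moreover have "(b \<oplus> x) \<oplus> \<one> \<in> M"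
  using add_swap_one[OF V_carr[OF b(1)] V_carr[OF xV]] M_add[OF b(2) x] by simp
 ultimately show ?thesis unfolding c_def using V_add[OF b(1) xV] by (intro bexI[of _ "b \<oplus> x"]) auto
qed

end

locale residue_setting = valued_field K G v for K :: "('a, 'k) ring_scheme" (structure)
  and G :: "('g, 'h) ogroup_scheme" (structure) and v +
 fixes H :: "('d, 'e) ogroup_scheme" and w :: "'a \<Rightarrow> 'd"
 assumes crs: "coarsening K G v H w"
begin

abbreviation "F \<equiv> residue_field K H w"
abbreviation "q x \<equiv> val_ideal K H w +>\<^bsub>val_ring K H w\<^esub> x"

lemma valued_w: "valued_field K H w" using crs by (simp add: coarsening_def)
lemma val_sub: "val_set K G v \<subseteq> val_set K H w" using crs by (simp add: coarsening_def)
lemma valued_F: "valued_field F G (induced_val v)"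
 by (rule valued_field_induced_val[OF valued_field_axioms crs])

lemma q_hom: "ring_hom_cring (val_ring K H w) F (\<lambda>x. q x)"
 unfolding residue_field_def
 by (rule ideal.rcos_ring_hom_cring[OF valued_field.val_ideal_ideal[OF valued_w] valued_field.val_ring_cring[OF valued_w]])

lemma q_zero_iff: assumes "x \<in> val_set K H w" shows "q x = \<zero>\<^bsub>F\<^esub> \<longleftrightarrow> x \<in> val_ideal K H w"
proof -
 interpret I: ideal "val_ideal K H w" "val_ring K H w" by (rule valued_field.val_ideal_ideal[OF valued_w])
 show ?thesis unfolding zero_residue_field
  using I.a_rcos_const[of x] I.rcos_const_imp_mem[of x] assms by (auto simp: val_ring_def)
qed

lemma carrier_F: "carrier F = (\<lambda>x. q x) ` val_set K H w" by (rule carrier_residue_field)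

text \<open>The maximal ideal of \<open>w\<close> is contained in that of \<open>v\<close>, so a
  class modulo the former lies either inside or outside the latter as a whole.\<close>

lemma q_ideal_iff: assumes x: "x \<in> val_set K H w"
 shows "q x \<in> val_ideal F G (induced_val v) \<longleftrightarrow> x \<in> val_ideal K G v"
proof (cases "x \<in> val_ideal K H w")
 case True
 then have "q x = \<zero>\<^bsub>F\<^esub>" using q_zero_iff[OF x] by simp
 moreover have "q x \<in> carrier F" using x carrier_F by blast
 moreover have "x \<in> val_ideal K G v" using coarsening_val_ideal[OF valued_field_axioms crs] True by blast
 ultimately show ?thesis by (simp add: val_ideal_def[of F])
next
 case False
 have xK: "x \<in> carrier K" using x by (simp add: val_set_def)
 have "q x ~= \<zero>\<^bsub>F\<^esub>" using q_zero_iff[OF x] False by simp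
 moreover have "q x \<in> carrier F" using x carrier_F by blast
 moreover have "x ~= \<zero>\<^bsub>K\<^esub>" using False xK by (auto simp: val_ideal_def)
 moreover note induced_val_coset[OF valued_field_axioms crs xK False]
 ultimately show ?thesis using xK by (simp add: val_ideal_def[of F] val_ideal_def[of K G v])
qed

lemma q_set_iff: assumes x: "x \<in> val_set K H w"
 shows "q x \<in> val_set F G (induced_val v) \<longleftrightarrow> x \<in> val_set K G v"
proof (cases "x \<in> val_ideal K H w")
 case True
 then have "q x = \<zero>\<^bsub>F\<^esub>" using q_zero_iff[OF x] by simp
 moreover have "q x \<in> carrier F" using x carrier_F by blast
 moreover have "x \<in> val_set K G v"
  using coarsening_val_ideal[OF valued_field_axioms crs] True val_ideal_subset by blast
 ultimately show ?thesis by (simp add: val_set_def[of F])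
next
 case False
 have xK: "x \<in> carrier K" using x by (simp add: val_set_def)
 have "q x ~= \<zero>\<^bsub>F\<^esub>" using q_zero_iff[OF x] False by simp
 moreover have "q x \<in> carrier F" using x carrier_F by blast
 moreover have "x ~= \<zero>\<^bsub>K\<^esub>" using False xK by (auto simp: val_ideal_def)
 moreover note induced_val_coset[OF valued_field_axioms crs xK False]
 ultimately show ?thesis using xK by (simp add: val_set_def[of F] val_set_def[of K G v])
qed

lemma q_lpoly:
 assumes "set l \<subseteq> val_set K H w" "x \<in> val_set K H w"
 shows "ring.lpoly F (map (\<lambda>x. q x) l) (q x) = q (K.lpoly l x)"
proof -
 interpret Q: ring_hom_cring "val_ring K H w" F "\<lambda>x. q x" by (rule q_hom)
 have R': "ring (K\<lparr>carrier := val_set K H w\<rparr>)" using Q.R.ring_axioms by (simp add: val_ring_def)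
 have "q (Q.R.lpoly l x) = ring.lpoly F (map (\<lambda>x. q x) l) (q x)"
  using Q.hom_lpoly[of l x] assms by (simp add: val_ring_def)
 then show ?thesis
  using lpoly_carrier_update[OF K.ring_axioms R', of l x] by (simp add: val_ring_def)
qed

lemma q_ops:
 assumes "x \<in> val_set K H w" "y \<in> val_set K H w"
 shows "q (x \<oplus>\<^bsub>K\<^esub> y) = q x \<oplus>\<^bsub>F\<^esub> q y" "q (x \<otimes>\<^bsub>K\<^esub> y) = q x \<otimes>\<^bsub>F\<^esub> q y" "q \<one>\<^bsub>K\<^esub> = \<one>\<^bsub>F\<^esub>"
proof -
 interpret Q: ring_hom_cring "val_ring K H w" F "\<lambda>x. q x" by (rule q_hom)
 show "q (x \<oplus>\<^bsub>K\<^esub> y) = q x \<oplus>\<^bsub>F\<^esub> q y" "q (x \<otimes>\<^bsub>K\<^esub> y) = q x \<otimes>\<^bsub>F\<^esub> q y" "q \<one>\<^bsub>K\<^esub> = \<one>\<^bsub>F\<^esub>"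
  using Q.hom_add[of x y] Q.hom_mult[of x y] Q.hom_one assms by (simp_all add: val_ring_def)
qed

lemma one_w: "\<one>\<^bsub>K\<^esub> \<in> val_set K H w"
 by (rule subringE(3)[OF valued_field.val_set_subring[OF valued_w]])

lemma q_special:
 assumes "set l \<subseteq> val_set K H w" "x \<in> val_set K H w"
 shows "ring.lpoly F (map (\<lambda>x. q x) l @ [\<one>\<^bsub>F\<^esub>, \<one>\<^bsub>F\<^esub>]) (q x) = q (K.lpoly (l @ [\<one>\<^bsub>K\<^esub>, \<one>\<^bsub>K\<^esub>]) x)"
 using q_lpoly[of "l @ [\<one>\<^bsub>K\<^esub>, \<one>\<^bsub>K\<^esub>]" x] assms one_w q_ops(3)[OF one_w one_w] by simp

lemma lift_list:
 assumes "set L \<subseteq> val_ideal F G (induced_val v)"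
 shows "\<exists>l. set l \<subseteq> val_ideal K G v \<and> set l \<subseteq> val_set K H w \<and> L = map (\<lambda>x. q x) l"
 using assms
proof (induction L)
 case (Cons C L)
 then obtain l where l: "set l \<subseteq> val_ideal K G v" "set l \<subseteq> val_set K H w" "L = map (\<lambda>x. q x) l" by auto
 have "C \<in> carrier F" using Cons.prems by (simp add: val_ideal_def)
 then obtain x where x: "x \<in> val_set K H w" "C = q x" using carrier_F by blast
 then have "x \<in> val_ideal K G v" using q_ideal_iff Cons.prems by simp
 then show ?case using l x by (intro exI[of _ "x # l"]) simp
qed simp

text \<open>Coefficients in the maximal ideal of the residue field lift to the maximal ideal of
  \<open>v\<close>. The polynomial therefore lifts to one of the same shape, and the zero of the
  lift is reduced again.\<close>

lemma SP_residue:
 assumes "valuation_subring.SP K (val_set K G v)"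
 shows "valuation_subring.SP F (val_set F G (induced_val v))"
proof -
 interpret W: valued_field F G "induced_val v" by (rule valued_F)
 note SPK = assms[unfolded valuation_subring.SP_def[OF valuation_subring_val_set] M_eq_val_ideal]
 show ?thesis
  unfolding valuation_subring.SP_def[OF W.valuation_subring_val_set] W.M_eq_val_ideal
 proof (intro allI impI)
  fix L assume "set L \<subseteq> val_ideal F G (induced_val v)"
  then obtain l where l: "set l \<subseteq> val_ideal K G v" "set l \<subseteq> val_set K H w" "L = map (\<lambda>x. q x) l"
   using lift_list by blast
  from SPK[rule_format, OF l(1)] obtain x where x: "x \<in> val_set K G v" "x \<oplus>\<^bsub>K\<^esub> \<one>\<^bsub>K\<^esub> \<in> val_ideal K G v"
   "K.lpoly (l @ [\<one>\<^bsub>K\<^esub>, \<one>\<^bsub>K\<^esub>]) x = \<zero>\<^bsub>K\<^esub>" by blast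
  have xw: "x \<in> val_set K H w" using x(1) val_sub by blast
  have x1: "x \<oplus>\<^bsub>K\<^esub> \<one>\<^bsub>K\<^esub> \<in> val_set K H w"
   using subringE(7)[OF valued_field.val_set_subring[OF valued_w] xw one_w] .
  have z: "\<zero>\<^bsub>K\<^esub> \<in> val_set K H w" "\<zero>\<^bsub>K\<^esub> \<in> val_ideal K H w" by (simp_all add: val_set_def val_ideal_def)
  show "\<exists>x\<in>val_set F G (induced_val v). x \<oplus>\<^bsub>F\<^esub> \<one>\<^bsub>F\<^esub> \<in> val_ideal F G (induced_val v) \<and>
   ring.lpoly F (L @ [\<one>\<^bsub>F\<^esub>, \<one>\<^bsub>F\<^esub>]) x = \<zero>\<^bsub>F\<^esub>"
  proof (intro bexI[of _ "q x"] conjI)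
   show "q x \<in> val_set F G (induced_val v)" using q_set_iff[OF xw] x(1) by simp
   show "q x \<oplus>\<^bsub>F\<^esub> \<one>\<^bsub>F\<^esub> \<in> val_ideal F G (induced_val v)"
    using q_ideal_iff[OF x1] x(2) q_ops(1)[OF xw one_w] q_ops(3)[OF one_w one_w] by simp
   show "ring.lpoly F (L @ [\<one>\<^bsub>F\<^esub>, \<one>\<^bsub>F\<^esub>]) (q x) = \<zero>\<^bsub>F\<^esub>"
    using q_special[OF l(2) xw] x(3) l(3) q_zero_iff[OF z(1)] z(2) by simp
  qed
 qed
qed

end

lemma (in valued_field) SP_of_coarsenings:
 assumes ap: "\<And>(H :: 'a set ogroup) w. coarsening K G v H w ==>
  valuation_subring.approximate_SP (residue_field K H w) (val_set (residue_field K H w) G (induced_val v))"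
 shows "valuation_subring.SP K (val_set K G v)"
proof -
 interpret VS: valuation_subring K "val_set K G v" by (rule valuation_subring_val_set)
 let ?V = "val_set K G v"
 show ?thesis unfolding VS.SP_def
 proof (intro allI impI)
  fix l assume l: "set l \<subseteq> VS.M"
  let ?f = "\<lambda>x. K.lpoly (l @ [\<one>\<^bsub>K\<^esub>, \<one>\<^bsub>K\<^esub>]) x"
  let ?B = "{b \<in> ?V. b \<oplus>\<^bsub>K\<^esub> \<one>\<^bsub>K\<^esub> \<in> VS.M}"
  show "\<exists>x\<in>?V. x \<oplus>\<^bsub>K\<^esub> \<one>\<^bsub>K\<^esub> \<in> VS.M \<and> ?f x = \<zero>\<^bsub>K\<^esub>"
  proof (rule ccontr)
   assume "\<not> ?thesis"
   then have nr: "?f b ~= \<zero>\<^bsub>K\<^esub>" if "b \<in> ?B" for b using that by blast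
   have fM: "?f b \<in> VS.M" if "b \<in> ?B" for b using VS.special_val[OF l] that by blast
   have fV: "?f b \<in> ?V" if "b \<in> ?B" for b using VS.M_V[OF fM[OF that]] .
   have fC: "?f b \<in> carrier K" if "b \<in> ?B" for b using VS.V_carr[OF fV[OF that]] .
   have new: "\<exists>b' \<in> ?B. VS.dv (?f b \<otimes>\<^bsub>K\<^esub> ?f b) (?f b')" if "b \<in> ?B" for b
    using VS.newton_step[OF l, of b] that by blast
   have m1: "\<ominus>\<^bsub>K\<^esub> \<one>\<^bsub>K\<^esub> \<in> ?B" using VS.V_minus[OF VS.V_one] by (simp add: K.l_neg)
   \<comment> \<open>The union of the fractional ideals \<open>f(b)^(-1) V\<close>. It is closed
     under sums because of two values one divides the other, and under products because
     \<open>f(c)^2\<close> divides some \<open>f(d)\<close>.\<close>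
   define Q where "Q = {x \<in> carrier K. \<exists>b \<in> ?B. ?f b \<otimes>\<^bsub>K\<^esub> x \<in> ?V}"
   have VQ: "?V \<subseteq> Q"
   proof
    fix x assume x: "x \<in> ?V"
    then show "x \<in> Q" unfolding Q_def using VS.V_mult[OF fV[OF m1] x] m1 VS.V_carr[OF x] by blast
   qed
   have up: "?f b' \<otimes>\<^bsub>K\<^esub> x \<in> ?V"
    if h: "?f b \<otimes>\<^bsub>K\<^esub> x \<in> ?V" "VS.dv (?f b) (?f b')" "b \<in> ?B" "x \<in> carrier K" for b b' x
   proof -
    obtain t where t: "t \<in> ?V" "?f b' = ?f b \<otimes>\<^bsub>K\<^esub> t" using h(2) unfolding VS.dv_def by blast
    have "?f b' \<otimes>\<^bsub>K\<^esub> x = t \<otimes>\<^bsub>K\<^esub> (?f b \<otimes>\<^bsub>K\<^esub> x)"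
     unfolding t(2) using fC[OF h(3)] VS.V_carr[OF t(1)] h(4) by (simp add: K.m_ac)
    then show ?thesis using VS.V_mult[OF t(1) h(1)] by simp
   qed
   have subQ: "subring Q K"
   proof (rule K.subringI)
    show "Q \<subseteq> carrier K" by (auto simp: Q_def)
    show "\<one>\<^bsub>K\<^esub> \<in> Q" using VQ VS.V_one by blast
    fix x assume x: "x \<in> Q"
    then obtain b where b: "b \<in> ?B" "?f b \<otimes>\<^bsub>K\<^esub> x \<in> ?V" and xC: "x \<in> carrier K" unfolding Q_def by blast
    have "?f b \<otimes>\<^bsub>K\<^esub> (\<ominus>\<^bsub>K\<^esub> x) \<in> ?V" using VS.V_minus[OF b(2)] fC[OF b(1)] xC by (simp add: K.r_minus)
    then show "\<ominus>\<^bsub>K\<^esub> x \<in> Q" unfolding Q_def using b(1) xC by blast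
    fix y assume y: "y \<in> Q"
    then obtain b' where b': "b' \<in> ?B" "?f b' \<otimes>\<^bsub>K\<^esub> y \<in> ?V" and yC: "y \<in> carrier K" unfolding Q_def by blast
    have "\<exists>c \<in> ?B. ?f c \<otimes>\<^bsub>K\<^esub> x \<in> ?V \<and> ?f c \<otimes>\<^bsub>K\<^esub> y \<in> ?V"
     using VS.dv_total[OF fC[OF b(1)] fC[OF b'(1)]] up[OF b(2) _ b(1) xC, of b'] up[OF b'(2) _ b'(1) yC, of b] VS.sdv_dv b b' by blast
    then obtain c where c: "c \<in> ?B" "?f c \<otimes>\<^bsub>K\<^esub> x \<in> ?V" "?f c \<otimes>\<^bsub>K\<^esub> y \<in> ?V" by blast
    obtain d where d: "d \<in> ?B" "VS.dv (?f c \<otimes>\<^bsub>K\<^esub> ?f c) (?f d)" using new[OF c(1)] by blast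
    obtain t where t: "t \<in> ?V" "?f d = (?f c \<otimes>\<^bsub>K\<^esub> ?f c) \<otimes>\<^bsub>K\<^esub> t" using d(2) unfolding VS.dv_def by blast
    have "?f d \<otimes>\<^bsub>K\<^esub> (x \<otimes>\<^bsub>K\<^esub> y) = t \<otimes>\<^bsub>K\<^esub> ((?f c \<otimes>\<^bsub>K\<^esub> x) \<otimes>\<^bsub>K\<^esub> (?f c \<otimes>\<^bsub>K\<^esub> y))"
     unfolding t(2) using fC[OF c(1)] VS.V_carr[OF t(1)] xC yC by (simp add: K.m_ac)
    also have "\<dots> \<in> ?V" using VS.V_mult[OF t(1) VS.V_mult[OF c(2,3)]] .
    finally show "x \<otimes>\<^bsub>K\<^esub> y \<in> Q" unfolding Q_def using d(1) xC yC by blast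
    have "?f c \<otimes>\<^bsub>K\<^esub> (x \<oplus>\<^bsub>K\<^esub> y) \<in> ?V" using VS.V_add[OF c(2,3)] fC[OF c(1)] xC yC by (simp add: K.r_distr)
    then show "x \<oplus>\<^bsub>K\<^esub> y \<in> Q" unfolding Q_def using c(1) xC yC by blast
   qed
   interpret QS: valuation_subring K Q
    using VS.V_total VQ by (intro valuation_subring.intro K.field_axioms valuation_subring_axioms.intro subQ) blast
   obtain H :: "'a set ogroup" and w where Hw: "valued_field K H w" "val_set K H w = Q"
    using QS.exists_valuation by blast
   have crs: "coarsening K G v H w" using Hw VQ by (simp add: coarsening_def)
   interpret RS: residue_setting K G v H w by unfold_locales (rule crs)
   interpret W: valued_field "residue_field K H w" G "induced_val v" by (rule RS.valued_F)
   interpret WS: valuation_subring "residue_field K H w" "val_set (residue_field K H w) G (induced_val v)"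
    by (rule W.valuation_subring_val_set)
   have MQ: "val_ideal K H w = QS.M" using valued_field.M_eq_val_ideal[OF Hw(1)] Hw(2) by simp
   \<comment> \<open>The inverse of \<open>x\<close> lies outside \<open>Q\<close>, so no
     \<open>f(b) / x\<close> is integral: elements of the maximal ideal of \<open>Q\<close> are
     smaller than every value of \<open>f\<close> near \<open>-1\<close>.\<close>
   have small: "VS.sdv (?f b) x" if x: "x \<in> QS.M" and b: "b \<in> ?B" for x b
   proof (cases "x = \<zero>\<^bsub>K\<^esub>")
    case True then show ?thesis using VS.sdv_zero[OF fC[OF b]] by simp
   next
    case False
    have xC: "x \<in> carrier K" using QS.M_carr[OF x] .
    have i: "inv\<^bsub>K\<^esub> x \<in> carrier K" "x \<otimes>\<^bsub>K\<^esub> inv\<^bsub>K\<^esub> x = \<one>\<^bsub>K\<^esub>" using VS.inv_carr[OF xC False] VS.r_inv'[OF xC False] by auto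
    have ni: "?f b \<otimes>\<^bsub>K\<^esub> inv\<^bsub>K\<^esub> x \<notin> ?V" using QS.M_D[OF x False] i(1) b unfolding Q_def by blast
    moreover have "?f b \<otimes>\<^bsub>K\<^esub> inv\<^bsub>K\<^esub> x \<in> ?V" if h: "VS.dv x (?f b)"
    proof -
     obtain t where t: "t \<in> ?V" "?f b = x \<otimes>\<^bsub>K\<^esub> t" using h unfolding VS.dv_def by blast
     have "x \<otimes>\<^bsub>K\<^esub> t \<otimes>\<^bsub>K\<^esub> inv\<^bsub>K\<^esub> x = (x \<otimes>\<^bsub>K\<^esub> inv\<^bsub>K\<^esub> x) \<otimes>\<^bsub>K\<^esub> t"
      using xC i(1) VS.V_carr[OF t(1)] by (simp add: K.m_ac)
     then show ?thesis unfolding t(2) using i(2) t(1) VS.V_carr[OF t(1)] by simp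
    qed
    ultimately show ?thesis using ni VS.dv_total[OF xC fC[OF b]] by blast
   qed
   let ?F = "residue_field K H w"
   let ?L = "map (\<lambda>x. RS.q x) l"
   have lV: "set l \<subseteq> ?V" using l VS.M_V by blast
   have lQ: "set l \<subseteq> val_set K H w" using lV VQ Hw(2) by blast
   have L: "set ?L \<subseteq> WS.M"
   proof -
    have "RS.q x \<in> val_ideal ?F G (induced_val v)" if "x \<in> set l" for x
     using RS.q_ideal_iff[of x] that l lQ M_eq_val_ideal by blast
    then show ?thesis unfolding W.M_eq_val_ideal by auto
   qed
   have BQ: "b \<in> val_set K H w" if "b \<in> ?B" for b using that VQ Hw(2) by blast
   have B1: "RS.q b \<in> val_set ?F G (induced_val v) \<and> RS.q b \<oplus>\<^bsub>?F\<^esub> \<one>\<^bsub>?F\<^esub> \<in> WS.M" if b: "b \<in> ?B" for b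
   proof
    show "RS.q b \<in> val_set ?F G (induced_val v)" using RS.q_set_iff[OF BQ[OF b]] b by blast
    have "b \<oplus>\<^bsub>K\<^esub> \<one>\<^bsub>K\<^esub> \<in> val_ideal K G v" using b unfolding M_eq_val_ideal by blast
    moreover have "b \<oplus>\<^bsub>K\<^esub> \<one>\<^bsub>K\<^esub> \<in> val_set K H w"
     using subringE(7)[OF valued_field.val_set_subring[OF Hw(1)] BQ[OF b] RS.one_w] .
    ultimately have "RS.q (b \<oplus>\<^bsub>K\<^esub> \<one>\<^bsub>K\<^esub>) \<in> val_ideal ?F G (induced_val v)" using RS.q_ideal_iff by blast
    then show "RS.q b \<oplus>\<^bsub>?F\<^esub> \<one>\<^bsub>?F\<^esub> \<in> WS.M"
     using RS.q_ops(1)[OF BQ[OF b] RS.one_w] RS.q_ops(3)[OF RS.one_w RS.one_w]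
     unfolding W.M_eq_val_ideal by simp
   qed
   \<comment> \<open>The inverse of the unit \<open>c\<close> of \<open>Q\<close> belongs to
     \<open>Q\<close>, so \<open>f(b) / c\<close> is integral for some \<open>b\<close>. A value
     divisible by \<open>f(b)^2 = c (f(b) / c) f(b)\<close> is then smaller than \<open>c\<close>,
     since \<open>f(b)\<close> lies in \<open>M\<close>.\<close>
   have apx: "\<exists>B \<in> val_set ?F G (induced_val v). B \<oplus>\<^bsub>?F\<^esub> \<one>\<^bsub>?F\<^esub> \<in> WS.M \<and> WS.sdv C (ring.lpoly ?F (?L @ [\<one>\<^bsub>?F\<^esub>, \<one>\<^bsub>?F\<^esub>]) B)"
    if C: "C \<in> carrier ?F - {\<zero>\<^bsub>?F\<^esub>}" for C
   proof -
    have "C \<in> (\<lambda>x. RS.q x) ` val_set K H w" using C unfolding RS.carrier_F by (rule DiffD1)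
    then obtain c where c: "c \<in> val_set K H w" "C = RS.q c" by (rule imageE)
    have "RS.q c ~= \<zero>\<^bsub>?F\<^esub>" using C c(2) by simp
    then have "c \<notin> QS.M" using RS.q_zero_iff[OF c(1)] MQ by simp
    then have c0: "c ~= \<zero>\<^bsub>K\<^esub>" "inv\<^bsub>K\<^esub> c \<in> Q" using QS.unitD[of c] c(1) Hw(2) by blast+
    then obtain b where b: "b \<in> ?B" "?f b \<otimes>\<^bsub>K\<^esub> inv\<^bsub>K\<^esub> c \<in> ?V" and iC: "inv\<^bsub>K\<^esub> c \<in> carrier K" unfolding Q_def by blast
    have cC: "c \<in> carrier K" by (rule QS.V_carr) (use c(1) Hw(2) in blast)
    obtain b' where b': "b' \<in> ?B" "VS.dv (?f b \<otimes>\<^bsub>K\<^esub> ?f b) (?f b')" using new[OF b(1)] by blast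
    obtain t where t: "t \<in> ?V" "?f b' = (?f b \<otimes>\<^bsub>K\<^esub> ?f b) \<otimes>\<^bsub>K\<^esub> t" using b'(2) unfolding VS.dv_def by blast
    define m where "m = (?f b \<otimes>\<^bsub>K\<^esub> inv\<^bsub>K\<^esub> c) \<otimes>\<^bsub>K\<^esub> t \<otimes>\<^bsub>K\<^esub> ?f b"
    have mM: "m \<in> VS.M" unfolding m_def by (rule VS.M_mult(1)[OF VS.V_mult[OF b(2) t(1)] fM[OF b(1)]])
    have mQ: "m \<in> val_set K H w" using VS.M_V[OF mM] VQ Hw(2) by blast
    have "c \<otimes>\<^bsub>K\<^esub> m = (c \<otimes>\<^bsub>K\<^esub> inv\<^bsub>K\<^esub> c) \<otimes>\<^bsub>K\<^esub> ((?f b \<otimes>\<^bsub>K\<^esub> ?f b) \<otimes>\<^bsub>K\<^esub> t)"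
     unfolding m_def using cC iC fC[OF b(1)] VS.V_carr[OF t(1)] by (simp add: K.m_ac)
    then have cm: "?f b' = c \<otimes>\<^bsub>K\<^esub> m"
     unfolding t(2) using VS.r_inv'[OF cC c0(1)] fC[OF b(1)] VS.V_carr[OF t(1)] by simp
    have "ring.lpoly ?F (?L @ [\<one>\<^bsub>?F\<^esub>, \<one>\<^bsub>?F\<^esub>]) (RS.q b') = C \<otimes>\<^bsub>?F\<^esub> RS.q m"
     unfolding RS.q_special[OF lQ BQ[OF b'(1)]] cm RS.q_ops(2)[OF c(1) mQ] c(2) ..
    moreover have "RS.q m \<in> WS.M" using RS.q_ideal_iff[OF mQ] mM unfolding W.M_eq_val_ideal M_eq_val_ideal by blast
    ultimately have "WS.sdv C (ring.lpoly ?F (?L @ [\<one>\<^bsub>?F\<^esub>, \<one>\<^bsub>?F\<^esub>]) (RS.q b'))" unfolding WS.sdv_def by blast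
    then show ?thesis using B1[OF b'(1)] by blast
   qed
   obtain Y where Y: "Y \<in> val_set ?F G (induced_val v)" "Y \<oplus>\<^bsub>?F\<^esub> \<one>\<^bsub>?F\<^esub> \<in> WS.M"
    "ring.lpoly ?F (?L @ [\<one>\<^bsub>?F\<^esub>, \<one>\<^bsub>?F\<^esub>]) Y = \<zero>\<^bsub>?F\<^esub>"
    using ap[OF crs, unfolded WS.approximate_SP_def, rule_format, OF L apx] by blast
   have "Y \<in> carrier ?F" by (rule WS.V_carr[OF Y(1)])
   then have "Y \<in> (\<lambda>x. RS.q x) ` val_set K H w" unfolding RS.carrier_F .
   then obtain x where x: "x \<in> val_set K H w" "Y = RS.q x" by (rule imageE)
   have xV: "x \<in> ?V" using RS.q_set_iff[OF x(1)] Y(1) x(2) by blast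
   have x1: "x \<oplus>\<^bsub>K\<^esub> \<one>\<^bsub>K\<^esub> \<in> val_set K H w"
    using subringE(7)[OF valued_field.val_set_subring[OF Hw(1)] x(1) RS.one_w] .
   have "RS.q (x \<oplus>\<^bsub>K\<^esub> \<one>\<^bsub>K\<^esub>) \<in> val_ideal ?F G (induced_val v)"
    using Y(2) RS.q_ops(1)[OF x(1) RS.one_w] RS.q_ops(3)[OF RS.one_w RS.one_w] x(2) unfolding W.M_eq_val_ideal by simp
   then have xB: "x \<in> ?B" using RS.q_ideal_iff[OF x1] xV unfolding M_eq_val_ideal by blast
   have "?f x \<in> val_set K H w" using fV[OF xB] VQ Hw(2) by blast
   moreover have "RS.q (?f x) = \<zero>\<^bsub>?F\<^esub>" using Y(3) RS.q_special[OF lQ x(1)] x(2) by simp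
   ultimately have "?f x \<in> QS.M" using RS.q_zero_iff MQ by blast
   \<comment> \<open>A lift \<open>x\<close> of the zero makes \<open>f(x)\<close> an element of the
     maximal ideal of \<open>Q\<close>, hence smaller than all values near \<open>-1\<close>, itself
     included.\<close>
   then have "VS.sdv (?f x) (?f x)" by (rule small[OF _ xB])
   then show False using VS.sdv_self[OF _ fC[OF xB]] nr[OF xB] by blast
  qed
 qed
qed

section \<open>Polynomial expressions\<close>

text \<open>Polynomials as expression trees; several trees may represent the same polynomial.
  Derivatives are formal, and the chain rule, restriction to lines, degree bounds and size estimates
  become structural inductions.\<close>

datatype 'a px = PC 'a | PV nat | PA "'a px" "'a px" | PM "'a px" "'a px"

primrec (in ring) peval :: "'a px \<Rightarrow> (nat \<Rightarrow> 'a) \<Rightarrow> 'a" where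
 "peval (PC a) x = a"
| "peval (PV i) x = x i"
| "peval (PA e f) x = peval e x \<oplus> peval f x"
| "peval (PM e f) x = peval e x \<otimes> peval f x"

primrec (in ring) pd :: "nat \<Rightarrow> 'a px \<Rightarrow> 'a px" where
 "pd j (PC a) = PC \<zero>"
| "pd j (PV i) = PC (if i = j then \<one> else \<zero>)"
| "pd j (PA e f) = PA (pd j e) (pd j f)"
| "pd j (PM e f) = PA (PM (pd j e) f) (PM e (pd j f))"

primrec (in ring) pwf :: "nat \<Rightarrow> 'a px \<Rightarrow> bool" where
 "pwf n (PC a) \<longleftrightarrow> a \<in> carrier R"
| "pwf n (PV i) \<longleftrightarrow> i < n"
| "pwf n (PA e f) \<longleftrightarrow> pwf n e \<and> pwf n f"
| "pwf n (PM e f) \<longleftrightarrow> pwf n e \<and> pwf n f"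

context cring
begin

text \<open>Unlike the points of the product topology these are not extensional. Lines and tuples of
  polynomial values are thus points without being restricted to the indices below
  \<open>n\<close>.\<close>

definition pts :: "nat \<Rightarrow> (nat \<Rightarrow> 'a) set" where "pts n = {x. \<forall>i < n. x i \<in> carrier R}"

lemma ptsD: "x \<in> pts n ==> i < n ==> x i \<in> carrier R" by (simp add: pts_def)

lemma peval_closed: "pwf n e ==> x \<in> pts n ==> peval e x \<in> carrier R"
 by (induction e) (auto simp: ptsD)

lemma pwf_pd: "pwf n e ==> pwf n (pd j e)"
 by (induction e) auto

definition mon :: "nat \<Rightarrow> nat multiset \<Rightarrow> (nat \<Rightarrow> 'a) \<Rightarrow> 'a" where
 "mon n m x = (\<Otimes>i \<in> {..<n}. x i [^] count m i)"

lemma mon_closed: "x \<in> pts n ==> mon n m x \<in> carrier R"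
 unfolding mon_def by (rule finprod_closed) (auto simp: pts_def)

lemma mon_add: assumes x: "x \<in> pts n" and k: "k < n" shows "mon n (add_mset k m) x = mon n m x \<otimes> x k"
proof -
 have f: "(\<lambda>i. x i [^] count m' i) \<in> {..<n} - {k} \<rightarrow> carrier R" for m' using x by (auto simp: pts_def)
 have s: "mon n m' x = x k [^] count m' k \<otimes> (\<Otimes>i \<in> {..<n} - {k}. x i [^] count m' i)" for m'
 proof -
  have "{..<n} = insert k ({..<n} - {k})" using k by auto
  then have "mon n m' x = (\<Otimes>i \<in> insert k ({..<n} - {k}). x i [^] count m' i)" unfolding mon_def by simp
  also have "\<dots> = x k [^] count m' k \<otimes> (\<Otimes>i \<in> {..<n} - {k}. x i [^] count m' i)"
   using f[of m'] x k by (intro finprod_insert) (auto simp: pts_def)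
  finally show ?thesis .
 qed
 have e: "(\<Otimes>i \<in> {..<n} - {k}. x i [^] count (add_mset k m) i) = (\<Otimes>i \<in> {..<n} - {k}. x i [^] count m i)"
  using f[of m] by (intro finprod_cong') auto
 have c: "x k \<in> carrier R" "(\<Otimes>i \<in> {..<n} - {k}. x i [^] count m i) \<in> carrier R"
  using ptsD[OF x k] finprod_closed[OF f[of m]] by auto
 show ?thesis unfolding s[of "add_mset k m"] s[of m] e using c by (simp add: m_ac)
qed

lemma mpoly_eval_support:
 assumes "finite S" "{m. p m ~= \<zero>} \<subseteq> S" "\<And>m. p m \<in> carrier R" "x \<in> pts n"
 shows "mpoly_eval R n p x = (\<Oplus>m \<in> S. p m \<otimes> mon n m x)"
 unfolding mpoly_eval_def mon_def[symmetric]
 by (rule add.finprod_mono_neutral_cong_left) (use assms mon_closed[OF assms(4)] in auto)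

text \<open>The clauses follow the generation of \<open>indexed_pset\<close>, so every polynomial
  has a tree. Both forms are kept side by side: values and derivatives are read off the tree,
  individual coefficients off the function.\<close>

inductive prep :: "nat \<Rightarrow> (nat multiset \<Rightarrow> 'a) \<Rightarrow> 'a px \<Rightarrow> bool" for n where
 prep_const: "k \<in> carrier R ==> prep n (indexed_const k) (PC k)"
| prep_add: "prep n p e ==> prep n q f ==> prep n (indexed_padd p q) (PA e f)"
| prep_mult: "prep n p e ==> i < n ==> prep n (indexed_pmult p i) (PM e (PV i))"

lemma prep_mpoly_set: "prep n p e ==> p \<in> mpoly_set R n"
 unfolding mpoly_set_def by (induction rule: prep.induct) (auto intro: indexed_pset.intros)

lemma mpoly_set_prep: "p \<in> mpoly_set R n ==> \<exists>e. prep n p e"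
 unfolding mpoly_set_def by (induction rule: indexed_pset.induct) (auto intro: prep.intros)

lemma prep_pwf: "prep n p e ==> pwf n e"
 by (induction rule: prep.induct) auto

lemma prep_carrier: "prep n p e ==> p m \<in> carrier R"
 by (induction arbitrary: m rule: prep.induct)
  (auto simp: indexed_const_def indexed_padd_def indexed_pmult_def)

lemma prep_finite: "prep n p e ==> finite {m. p m ~= \<zero>}"
proof (induction rule: prep.induct)
 case (prep_const k)
 show ?case by (rule finite_subset[of _ "{{#}}"]) (auto simp: indexed_const_def)
next
 case (prep_add p e q f)
 have "{m. indexed_padd p q m ~= \<zero>} \<subseteq> {m. p m ~= \<zero>} \<union> {m. q m ~= \<zero>}" by (auto simp: indexed_padd_def)
 then show ?case using prep_add.IH finite_subset by blast
next
 case (prep_mult p e i)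
 have "{m. indexed_pmult p i m ~= \<zero>} \<subseteq> add_mset i ` {m. p m ~= \<zero>}"
 proof
  fix m assume "m \<in> {m. indexed_pmult p i m ~= \<zero>}"
  then have "i \<in># m" "p (m - {#i#}) ~= \<zero>" by (auto simp: indexed_pmult_def split: if_splits)
  then show "m \<in> add_mset i ` {m. p m ~= \<zero>}" by (intro image_eqI[of _ _ "m - {#i#}"]) auto
 qed
 then show ?case using prep_mult.IH finite_subset by blast
qed

lemma eval_const: assumes "k \<in> carrier R" "x \<in> pts n" shows "mpoly_eval R n (indexed_const k) x = k"
proof -
 have "mpoly_eval R n (indexed_const k) x = (\<Oplus>m \<in> {{#}}. indexed_const k m \<otimes> mon n m x)"
  using assms by (intro mpoly_eval_support) (auto simp: indexed_const_def)
 also have "\<dots> = k"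
 proof -
  have "mon n {#} x = \<one>" unfolding mon_def by (simp add: finprod_one_eqI)
  then show ?thesis using assms(1) by (simp add: indexed_const_def)
 qed
 finally show ?thesis .
qed

lemma eval_padd:
 assumes p: "\<And>m. p m \<in> carrier R" "finite {m. p m ~= \<zero>}" and q: "\<And>m. q m \<in> carrier R" "finite {m. q m ~= \<zero>}"
  and x: "x \<in> pts n"
 shows "mpoly_eval R n (indexed_padd p q) x = mpoly_eval R n p x \<oplus> mpoly_eval R n q x"
proof -
 let ?S = "{m. p m ~= \<zero>} \<union> {m. q m ~= \<zero>}"
 have f: "finite ?S" using p q by simp
 have "mpoly_eval R n (indexed_padd p q) x = (\<Oplus>m \<in> ?S. indexed_padd p q m \<otimes> mon n m x)"
  using p q x f by (intro mpoly_eval_support) (auto simp: indexed_padd_def)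
 also have "\<dots> = (\<Oplus>m \<in> ?S. p m \<otimes> mon n m x \<oplus> q m \<otimes> mon n m x)"
  using p q mon_closed[OF x] by (intro add.finprod_cong') (auto simp: indexed_padd_def l_distr)
 also have "\<dots> = (\<Oplus>m \<in> ?S. p m \<otimes> mon n m x) \<oplus> (\<Oplus>m \<in> ?S. q m \<otimes> mon n m x)"
  using p q mon_closed[OF x] by (intro add.finprod_multf) auto
 also have "\<dots> = mpoly_eval R n p x \<oplus> mpoly_eval R n q x"
  using mpoly_eval_support[OF f _ p(1) x] mpoly_eval_support[OF f _ q(1) x] by simp
 finally show ?thesis .
qed

lemma eval_pmult:
 assumes p: "\<And>m. p m \<in> carrier R" "finite {m. p m ~= \<zero>}" and x: "x \<in> pts n" and i: "i < n"
 shows "mpoly_eval R n (indexed_pmult p i) x = mpoly_eval R n p x \<otimes> x i"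
proof -
 let ?S = "{m. p m ~= \<zero>}" and ?q = "indexed_pmult p i"
 have qc: "?q m \<in> carrier R" for m using p by (auto simp: indexed_pmult_def)
 have xi: "x i \<in> carrier R" using ptsD[OF x i] .
 have sub: "{m. ?q m ~= \<zero>} \<subseteq> add_mset i ` ?S"
 proof
  fix m assume "m \<in> {m. ?q m ~= \<zero>}"
  then have "i \<in># m" "p (m - {#i#}) ~= \<zero>" by (auto simp: indexed_pmult_def split: if_splits)
  then show "m \<in> add_mset i ` ?S" by (intro image_eqI[of _ _ "m - {#i#}"]) auto
 qed
 have "mpoly_eval R n ?q x = (\<Oplus>m \<in> add_mset i ` ?S. ?q m \<otimes> mon n m x)"
  using p(2) sub qc x by (intro mpoly_eval_support) auto
 also have "\<dots> = (\<Oplus>m \<in> ?S. ?q (add_mset i m) \<otimes> mon n (add_mset i m) x)"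
  using qc mon_closed[OF x] by (intro add.finprod_reindex) (auto simp: inj_on_def)
 also have "\<dots> = (\<Oplus>m \<in> ?S. (p m \<otimes> mon n m x) \<otimes> x i)"
  using p(1) mon_closed[OF x] xi
  by (intro add.finprod_cong') (auto simp: indexed_pmult_def mon_add[OF x i] m_assoc)
 also have "\<dots> = (\<Oplus>m \<in> ?S. p m \<otimes> mon n m x) \<otimes> x i"
  using p(1) mon_closed[OF x] xi p(2) by (intro finsum_ldistr[symmetric]) auto
 also have "\<dots> = mpoly_eval R n p x \<otimes> x i" using mpoly_eval_support[OF p(2) _ p(1) x] by simp
 finally show ?thesis .
qed

lemma deriv_const: "mpoly_deriv R j (indexed_const k) = indexed_const \<zero>"
 by (rule ext) (auto simp: mpoly_deriv_def indexed_const_def)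

lemma deriv_padd: assumes "\<And>m. p m \<in> carrier R" "\<And>m. q m \<in> carrier R"
 shows "mpoly_deriv R j (indexed_padd p q) = indexed_padd (mpoly_deriv R j p) (mpoly_deriv R j q)"
 using assms by (intro ext) (simp add: mpoly_deriv_def indexed_padd_def add.nat_pow_distrib del: add.nat_pow_Suc)

lemma deriv_pmult: assumes p: "\<And>m. p m \<in> carrier R"
 shows "mpoly_deriv R j (indexed_pmult p k) = indexed_padd (if k = j then p else indexed_const \<zero>) (indexed_pmult (mpoly_deriv R j p) k)"
proof
 fix m
 show "mpoly_deriv R j (indexed_pmult p k) m = indexed_padd (if k = j then p else indexed_const \<zero>) (indexed_pmult (mpoly_deriv R j p) k) m"
 proof (cases "k = j")
  case True
  have "[Suc (count m j)] \<cdot> p m = p m \<oplus> [count m j] \<cdot> p m" using p by (simp add: a_comm)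
  moreover have "indexed_pmult (mpoly_deriv R j p) j m = [count m j] \<cdot> p m"
  proof (cases "j \<in># m")
   case True
   then have "Suc (count (m - {#j#}) j) = count m j" "add_mset j (m - {#j#}) = m" by (simp_all add: Suc_diff_le)
   then show ?thesis using True by (simp add: indexed_pmult_def mpoly_deriv_def del: add.nat_pow_Suc)
  next
   case False
   then have "count m j = 0" by (simp add: count_eq_zero_iff)
   then show ?thesis using False by (simp add: indexed_pmult_def)
  qed
  ultimately show ?thesis using True by (simp add: indexed_padd_def mpoly_deriv_def indexed_pmult_def)
 next
  case False
  have z: "indexed_const \<zero> m = \<zero>" by (simp add: indexed_const_def)
  show ?thesis
  proof (cases "k \<in># m")
   case True
   then have "add_mset j m - {#k#} = add_mset j (m - {#k#})" using False by (simp add: diff_add_mset_swap)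
   then show ?thesis using False True p
    by (simp add: indexed_padd_def mpoly_deriv_def indexed_pmult_def z del: add.nat_pow_Suc)
  qed (use False z in \<open>simp add: indexed_padd_def mpoly_deriv_def indexed_pmult_def\<close>)
 qed
qed

lemma prep_eval: "prep n p e ==> x \<in> pts n ==> mpoly_eval R n p x = peval e x"
proof (induction rule: prep.induct)
 case (prep_const k)
 then show ?case using eval_const by simp
next
 case (prep_add p e q f)
 then show ?case using eval_padd[of p q x n] prep_carrier prep_finite by simp
next
 case (prep_mult p e i)
 then show ?case using eval_pmult[of p x n i] prep_carrier prep_finite by simp
qed

lemma prep_deriv:
 "prep n p e ==> \<exists>e'. prep n (mpoly_deriv R j p) e' \<and> (\<forall>x \<in> pts n. peval e' x = peval (pd j e) x)"
proof (induction rule: prep.induct)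
 case (prep_const k)
 then show ?case unfolding deriv_const by (intro exI[of _ "PC \<zero>"]) (auto intro: prep.intros)
next
 case (prep_add p e q f)
 then obtain e' f' where "prep n (mpoly_deriv R j p) e'" "\<forall>x \<in> pts n. peval e' x = peval (pd j e) x"
  "prep n (mpoly_deriv R j q) f'" "\<forall>x \<in> pts n. peval f' x = peval (pd j f) x" by auto
 then show ?case using deriv_padd[of p q j] prep_carrier prep_add.hyps
  by (intro exI[of _ "PA e' f'"]) (auto intro: prep.intros)
next
 case (prep_mult p e i)
 then obtain e' where e': "prep n (mpoly_deriv R j p) e'" "\<forall>x \<in> pts n. peval e' x = peval (pd j e) x" by auto
 have d: "mpoly_deriv R j (indexed_pmult p i) = indexed_padd (if i = j then p else indexed_const \<zero>) (indexed_pmult (mpoly_deriv R j p) i)"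
  using deriv_pmult[of p j i] prep_carrier prep_mult.hyps by blast
 let ?e = "PA (if i = j then e else PC \<zero>) (PM e' (PV i))"
 have "prep n (mpoly_deriv R j (indexed_pmult p i)) ?e"
  unfolding d using e'(1) prep_mult.hyps by (auto intro!: prep.intros)
 moreover have "peval ?e x = peval (pd j (PM e (PV i))) x" if x: "x \<in> pts n" for x
 proof -
  have "peval e x \<in> carrier R" "peval (pd j e) x \<in> carrier R" "x i \<in> carrier R"
   using peval_closed[OF _ x] pwf_pd prep_pwf[OF prep_mult.hyps(1)] ptsD[OF x prep_mult.hyps(2)] by auto
  then show ?thesis using e'(2) x by (simp add: a_comm)
 qed
 ultimately show ?case by blast
qed

lemma mpoly_expr:
 assumes "p \<in> mpoly_set R n"
 shows "\<exists>e. pwf n e \<and> (\<forall>x \<in> pts n. mpoly_eval R n p x = peval e x) \<and>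
  (\<forall>j. \<forall>x \<in> pts n. mpoly_eval R n (mpoly_deriv R j p) x = peval (pd j e) x)"
proof -
 obtain e where e: "prep n p e" using mpoly_set_prep[OF assms] by blast
 have "mpoly_eval R n (mpoly_deriv R j p) x = peval (pd j e) x" if x: "x \<in> pts n" for j x
 proof -
  obtain e' where e': "prep n (mpoly_deriv R j p) e'" "\<forall>x \<in> pts n. peval e' x = peval (pd j e) x"
   using prep_deriv[OF e] by blast
  show ?thesis using prep_eval[OF e'(1) x] e'(2) x by simp
 qed
 then show ?thesis using e prep_pwf prep_eval by blast
qed

end

section \<open>The algebra of a polynomial\<close>

text \<open>The algebra is \<open>R[X]/(f)\<close> with \<open>f\<close> monic, and \<open>x\<close>
  is the class of \<open>X\<close>. Over a domain a non-zero multiple of \<open>f\<close> has at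
  least the degree of \<open>f\<close>, so no non-zero polynomial of smaller degree vanishes at
  \<open>x\<close>.\<close>

lemma (in domain) root_algebra_exists:
 assumes l: "set l \<subseteq> carrier R"
 shows "\<exists>(A :: (nat \<Rightarrow> 'a) set ring) h x. ring_hom_cring R A h \<and> x \<in> carrier A \<and>
  ring.lpoly A (map h (l @ [\<one>])) x = \<zero>\<^bsub>A\<^esub> \<and>
  (\<forall>p. set p \<subseteq> carrier R --> length p \<le> length l --> ring.lpoly A (map h p) x = \<zero>\<^bsub>A\<^esub> --> set p \<subseteq> {\<zero>})"
proof -
 let ?P = "UP R"
 interpret U: UP_domain R ?P by unfold_locales auto
 define c where "c a = up_ring.monom ?P a 0" for a
 define t where "t = up_ring.monom ?P \<one> 1"
 have tc: "t \<in> carrier ?P" by (simp add: t_def)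
 have ch: "ring_hom_cring R ?P c"
  using U.const_ring_hom unfolding c_def by (intro ring_hom_cringI cring_axioms U.UP_cring) simp
 interpret C: ring_hom_cring R ?P c by (rule ch)
 have cf: "ring.lpoly ?P (map c p) t \<in> carrier ?P \<and>
  (\<forall>i. up_ring.coeff ?P (ring.lpoly ?P (map c p) t) i = (if i < length p then p ! i else \<zero>))"
  if "set p \<subseteq> carrier R" for p
  using that
 proof (induction p)
  case (Cons a p)
  let ?g = "ring.lpoly ?P (map c p) t"
  have g: "?g \<in> carrier ?P" "\<And>i. up_ring.coeff ?P ?g i = (if i < length p then p ! i else \<zero>)"
   using Cons by auto
  have a: "a \<in> carrier R" and pc: "\<And>k. k < length p ==> p ! k \<in> carrier R"
   using Cons.prems nth_mem by (simp, fastforce)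
  have m: "up_ring.coeff ?P (t \<otimes>\<^bsub>?P\<^esub> ?g) i = (case i of 0 \<Rightarrow> \<zero> | Suc k \<Rightarrow> up_ring.coeff ?P ?g k)" for i
  proof (cases i)
   case 0
   have "up_ring.coeff ?P (t \<otimes>\<^bsub>?P\<^esub> ?g) 0 = (\<Oplus>i\<in>{..0}. up_ring.coeff ?P t i \<otimes> up_ring.coeff ?P ?g (0 - i))"
    by (rule U.coeff_mult[OF tc g(1)])
   also have "\<dots> = (\<Oplus>i\<in>{..0 :: nat}. \<zero>)"
    using U.coeff_closed[OF g(1)] by (intro add.finprod_cong') (auto simp: t_def)
   finally have "up_ring.coeff ?P (t \<otimes>\<^bsub>?P\<^esub> ?g) 0 = \<zero>" by simp
   then show ?thesis using 0 by simp
  next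
   case (Suc k)
   have "up_ring.coeff ?P (t \<otimes>\<^bsub>?P\<^esub> ?g) (k + 1) = \<one> \<otimes> up_ring.coeff ?P ?g k"
    using U.coeff_monom_mult[OF one_closed g(1), of 1 k] unfolding t_def[symmetric] .
   then show ?thesis using Suc U.coeff_closed[OF g(1)] by simp
  qed
  have "up_ring.coeff ?P (c a \<oplus>\<^bsub>?P\<^esub> t \<otimes>\<^bsub>?P\<^esub> ?g) i = (if i < length (a # p) then (a # p) ! i else \<zero>)" for i
   using a g tc m[of i] pc by (cases i) (auto simp: c_def simp del: U.coeff_mult)
  then show ?case using a g tc by simp
 qed simp
 let ?f = "ring.lpoly ?P (map c (l @ [\<one>])) t"
 have lc: "set (l @ [\<one>]) \<subseteq> carrier R" using l by simp
 have f: "?f \<in> carrier ?P" "up_ring.coeff ?P ?f (length l) = \<one>" using cf[OF lc] by (auto simp: nth_append)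
 define I where "I = PIdl\<^bsub>?P\<^esub> ?f"
 have I: "ideal I ?P" unfolding I_def by (rule cring.cgenideal_ideal[OF U.UP_cring f(1)])
 interpret I: ideal I ?P by (rule I)
 define A where "A = ?P Quot I"
 have z: "\<zero>\<^bsub>A\<^esub> = I" by (simp add: A_def FactRing_def)
 interpret Q: ring_hom_cring ?P A "(+>\<^bsub>?P\<^esub>) I" unfolding A_def by (rule I.rcos_ring_hom_cring[OF U.UP_cring])
 define h where "h = (\<lambda>a. I +>\<^bsub>?P\<^esub> c a)"
 have hh: "ring_hom_cring R A h"
 proof (rule ring_hom_cringI[OF cring_axioms Q.S.cring_axioms])
  have "((+>\<^bsub>?P\<^esub>) I) \<circ> c \<in> ring_hom R A" using ring_hom_trans[OF C.homh Q.homh] .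
  then show "h \<in> ring_hom R A" by (simp add: h_def comp_def)
 qed
 let ?x = "I +>\<^bsub>?P\<^esub> t"
 have e: "ring.lpoly A (map h p) ?x = I +>\<^bsub>?P\<^esub> ring.lpoly ?P (map c p) t" if "set p \<subseteq> carrier R" for p
 proof -
  have "set (map c p) \<subseteq> carrier ?P" using that C.hom_closed by auto
  then have "I +>\<^bsub>?P\<^esub> ring.lpoly ?P (map c p) t = ring.lpoly A (map ((+>\<^bsub>?P\<^esub>) I) (map c p)) ?x"
   using Q.hom_lpoly tc by blast
  then show ?thesis by (simp add: h_def comp_def)
 qed
 have "?f \<in> I" unfolding I_def by (rule ring.cgenideal_self[OF U.UP_ring f(1)])
 then have root: "ring.lpoly A (map h (l @ [\<one>])) ?x = \<zero>\<^bsub>A\<^esub>" unfolding e[OF lc] z by (rule I.a_rcos_const)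
 have "set p \<subseteq> {\<zero>}" if p: "set p \<subseteq> carrier R" "length p \<le> length l" "ring.lpoly A (map h p) ?x = \<zero>\<^bsub>A\<^esub>" for p
 proof -
  let ?g = "ring.lpoly ?P (map c p) t"
  have g: "?g \<in> carrier ?P" "\<And>i. up_ring.coeff ?P ?g i = (if i < length p then p ! i else \<zero>)" using cf[OF p(1)] by auto
  have "I +>\<^bsub>?P\<^esub> ?g = I" using p(3) unfolding e[OF p(1)] z .
  then have "?g \<in> I" by (rule I.rcos_const_imp_mem[OF g(1)])
  then obtain k where k: "k \<in> carrier ?P" "?g = k \<otimes>\<^bsub>?P\<^esub> ?f" unfolding I_def cgenideal_def by blast
  have f0: "?f ~= \<zero>\<^bsub>?P\<^esub>" using f(2) by auto
  have df: "length l \<le> deg R ?f" using U.deg_belowI[OF _ f(1), of "length l"] f(2) by simp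
  have "k = \<zero>\<^bsub>?P\<^esub>"
  proof (rule ccontr)
   assume k0: "k ~= \<zero>\<^bsub>?P\<^esub>"
   have dg: "deg R ?g = deg R k + deg R ?f" unfolding k(2) by (rule U.deg_mult[OF k0 f0 k(1) f(1)])
   have "?g ~= \<zero>\<^bsub>?P\<^esub>" unfolding k(2) using U.integral[OF _ k(1) f(1)] k0 f0 by blast
   then have "up_ring.coeff ?P ?g (deg R ?g) ~= \<zero>" using U.lcoeff_nonzero[OF _ g(1)] by blast
   then show False using g(2)[of "deg R ?g"] dg df p(2) by (simp split: if_splits)
  qed
  then have gz: "?g = \<zero>\<^bsub>?P\<^esub>" using k(2) f(1) by simp
  have "p ! i = \<zero>" if "i < length p" for i using g(2)[of i] that unfolding gz by simp
  then show ?thesis by (auto simp: in_set_conv_nth)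
 qed
 then show ?thesis using hh root Q.hom_closed[OF tc] by blast
qed

context cring
begin

lemma nth_ladd: "length p = length q ==> i < length p ==> ladd p q ! i = p ! i \<oplus> q ! i"
proof (induction p q arbitrary: i rule: ladd.induct)
 case (3 a as b bs)
 then show ?case by (cases i) auto
qed auto

lemma set_lmult:
 assumes z: "\<zero> \<in> S" and a: "\<And>a b. a \<in> S ==> b \<in> S ==> a \<oplus> b \<in> S"
  and m: "\<And>a b. a \<in> S1 ==> b \<in> S2 ==> a \<otimes> b \<in> S"
 shows "set p \<subseteq> S1 ==> set q \<subseteq> S2 ==> set (lmult p q) \<subseteq> S"
proof (induction p)
 case (Cons b p)
 have "set (map ((\<otimes>) b) q) \<subseteq> S" using Cons.prems m by auto
 moreover have "set (\<zero> # lmult p q) \<subseteq> S" using Cons z by auto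
 ultimately show ?case using a by (simp add: ladd_set del: set_map)
qed simp

text \<open>Put \<open>q(z) = z - z^2\<close>. Then \<open>1 - 4 q(z) = (1 - 2z)^2\<close>, and
  \<open>s = e + u - 2eu\<close> satisfies \<open>1 - 2s = (1 - 2e)(1 - 2u)\<close>. This suggests
  \<open>q(s) - q(u) = q(e) (1 - 4 q(u))\<close>, an identity that holds in every
  characteristic.\<close>

lemma idem_identity_1:
 assumes "e \<in> carrier R" "u \<in> carrier R" and s: "s = e \<oplus> u \<ominus> (e \<otimes> u \<oplus> e \<otimes> u)"
 shows "s \<ominus> s \<otimes> s \<ominus> (u \<ominus> u \<otimes> u) =
  (e \<ominus> e \<otimes> e) \<ominus> ((e \<ominus> e \<otimes> e) \<otimes> ((u \<ominus> u \<otimes> u) \<oplus> (u \<ominus> u \<otimes> u) \<oplus> (u \<ominus> u \<otimes> u) \<oplus> (u \<ominus> u \<otimes> u)))"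
 unfolding s using assms(1,2) by - (rule ring_identity, (rule ring_rep | assumption | (simp; fail))+, (simp_all add: l_distr r_distr a_ac m_ac)?)

text \<open>If \<open>q(z) = z - z^2\<close> takes the same value at \<open>s\<close> and
  \<open>u\<close>, then \<open>w = s - u\<close> satisfies \<open>w^2 = (1 - 2u) w\<close>. For
  small \<open>u\<close> the difference of two solutions is thus idempotent up to a factor close to
  one.\<close>

lemma idem_identity_2:
 assumes "s \<in> carrier R" "u \<in> carrier R"
 shows "(s \<ominus> u) \<otimes> (s \<ominus> u) \<ominus> (\<one> \<ominus> (u \<oplus> u)) \<otimes> (s \<ominus> u) = (u \<ominus> u \<otimes> u) \<ominus> (s \<ominus> s \<otimes> s)"
 using assms by - (rule ring_identity, (rule ring_rep | assumption | (simp; fail))+, (simp_all add: l_distr r_distr a_ac m_ac)?)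

lemma idem_identity_3:
 assumes "e \<in> carrier R" "u \<in> carrier R" "w \<in> carrier R"
 shows "(e \<oplus> u \<ominus> (e \<otimes> u \<oplus> e \<otimes> u) \<ominus> w) \<ominus> e = u \<ominus> (e \<otimes> u \<oplus> e \<otimes> u) \<ominus> w"
 using assms by - (rule ring_identity, (rule ring_rep | assumption | (simp; fail))+, (simp_all add: l_distr r_distr a_ac m_ac)?)

lemma idem_identity_4:
 assumes "y \<in> carrier R" "u \<in> carrier R" "e \<in> carrier R" "q \<in> carrier R"
 shows "(u \<oplus> u) \<otimes> q \<oplus> ((y \<ominus> e) \<otimes> q \<oplus> e \<otimes> q) = (u \<oplus> u) \<otimes> q \<oplus> y \<otimes> q"
  "(u \<oplus> u) \<otimes> q \<oplus> (\<one> \<ominus> (u \<oplus> u)) \<otimes> q = q"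
 using assms by - (rule ring_identity, (rule ring_rep | assumption | (simp; fail))+, (simp_all add: l_distr r_distr a_ac m_ac)?)+

end

lemma (in ring_hom_cring) hom_ladd:
 "set p \<subseteq> carrier R ==> set q \<subseteq> carrier R ==> map h (R.ladd p q) = S.ladd (map h p) (map h q)"
 by (induction p q rule: R.ladd.induct) auto

lemma (in ring_hom_cring) hom_scale:
 "set p \<subseteq> carrier R ==> a \<in> carrier R ==> map h (map ((\<otimes>) a) p) = map ((\<otimes>\<^bsub>S\<^esub>) (h a)) (map h p)"
 by (induction p) auto

lemma (in ring_hom_cring) hom_lmult:
 "set p \<subseteq> carrier R ==> set q \<subseteq> carrier R ==> map h (R.lmult p q) = S.lmult (map h p) (map h q)"
proof (induction p)
 case (Cons a p)
 have "set (map ((\<otimes>) a) q) \<subseteq> carrier R" "set (\<zero> # R.lmult p q) \<subseteq> carrier R" using Cons.prems by auto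
 then show ?case using Cons hom_ladd[of "map ((\<otimes>) a) q" "\<zero> # R.lmult p q"] hom_scale[of q a]
  by (simp del: set_map map_map)
qed simp

text \<open>The element \<open>x\<close> is a zero of a monic polynomial of degree
  \<open>N = length l + 1\<close>, and by \<open>uniq\<close> the powers
  \<open>1, ..., x^(N-1)\<close> are linearly independent. Coordinates refer to these
  powers.\<close>

locale special_root_algebra = valuation_subring R V + h: ring_hom_cring R A h
 for R :: "('a, 'm) ring_scheme" (structure) and V and A :: "('b, 'n) ring_scheme" and h +
 fixes x :: 'b and l :: "'a list"
 assumes xA: "x \<in> carrier A" and l: "set l \<subseteq> M"
  and root: "ring.lpoly A (map h (l @ [\<one>, \<one>])) x = \<zero>\<^bsub>A\<^esub>"
  and uniq: "set p \<subseteq> carrier R ==> length p \<le> Suc (length l) ==> ring.lpoly A (map h p) x = \<zero>\<^bsub>A\<^esub> ==> set p \<subseteq> {\<zero>}"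
begin

abbreviation "N \<equiv> Suc (length l)"
abbreviation "f \<equiv> l @ [\<one>, \<one>]"
definition ev where "ev p = h.S.lpoly (map h p) x"
text \<open>The \<open>V\<close>-submodules of \<open>R\<close>. With \<open>md S\<close> the
  elements whose coordinates lie in \<open>S\<close>, integrality, membership in \<open>M\<close>
  and closeness to a given precision become instances of the same closure lemmas.\<close>

definition is_mod where "is_mod S \<longleftrightarrow> S \<subseteq> carrier R \<and> \<zero> \<in> S \<and> (\<forall>a \<in> S. \<forall>b \<in> S. a \<oplus> b \<in> S) \<and>
 (\<forall>a \<in> V. \<forall>b \<in> S. a \<otimes> b \<in> S)"
definition md where "md S = {ev p | p. set p \<subseteq> S \<and> length p = N}"

lemma is_mod_carrier: "is_mod (carrier R)" unfolding is_mod_def by auto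
lemma is_mod_V: "is_mod V" unfolding is_mod_def by auto
lemma is_mod_M: "is_mod M" unfolding is_mod_def using M_carr M_add M_mult by auto
lemma is_mod_dv: "c \<in> carrier R ==> is_mod {y. dv c y}"
 unfolding is_mod_def using dv_zero dv_add dv_V dv_carr by auto
lemma is_mod_sdv: "c \<in> carrier R ==> is_mod {y. sdv c y}"
 unfolding is_mod_def using sdv_zero sdv_add sdv_V sdv_carr by auto
lemma is_modD: assumes "is_mod S"
 shows "S \<subseteq> carrier R" "\<zero> \<in> S" "\<And>a b. a \<in> S ==> b \<in> S ==> a \<oplus> b \<in> S" "\<And>a b. a \<in> V ==> b \<in> S ==> a \<otimes> b \<in> S"
 using assms unfolding is_mod_def by blast+

lemma map_carr: "set p \<subseteq> carrier R ==> set (map h p) \<subseteq> carrier A"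
 using h.hom_closed by auto

lemma ev_closed: "set p \<subseteq> carrier R ==> ev p \<in> carrier A"
 unfolding ev_def using h.S.lpoly_closed[OF map_carr xA] .

lemma ev_Cons: "ev (a # p) = h a \<oplus>\<^bsub>A\<^esub> x \<otimes>\<^bsub>A\<^esub> ev p" by (simp add: ev_def)
lemma ev_Nil: "ev [] = \<zero>\<^bsub>A\<^esub>" by (simp add: ev_def)

lemma ev_append: "set p \<subseteq> carrier R ==> set q \<subseteq> carrier R ==> ev (p @ q) = ev p \<oplus>\<^bsub>A\<^esub> x [^]\<^bsub>A\<^esub> length p \<otimes>\<^bsub>A\<^esub> ev q"
 unfolding ev_def using h.S.lpoly_append[OF map_carr map_carr xA, of p q] by simp

lemma ev_ladd: "set p \<subseteq> carrier R ==> set q \<subseteq> carrier R ==> ev (ladd p q) = ev p \<oplus>\<^bsub>A\<^esub> ev q"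
 unfolding ev_def using h.S.lpoly_ladd[OF map_carr map_carr xA, of p q] h.hom_ladd[of p q] by simp

lemma ev_scale: "set p \<subseteq> carrier R ==> a \<in> carrier R ==> ev (map ((\<otimes>) a) p) = h a \<otimes>\<^bsub>A\<^esub> ev p"
 unfolding ev_def using h.S.lpoly_scale[OF map_carr _ xA, of p "h a"] h.hom_scale[of p a] h.hom_closed[of a] by (simp del: map_map)

lemma ev_lmult: "set p \<subseteq> carrier R ==> set q \<subseteq> carrier R ==> ev (lmult p q) = ev p \<otimes>\<^bsub>A\<^esub> ev q"
 unfolding ev_def using h.S.lpoly_lmult[OF map_carr map_carr xA, of p q] h.hom_lmult[of p q] by simp

lemma lc: "set l \<subseteq> V" using l M_V by blast
lemma fc: "set f \<subseteq> V" using lc by simp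

lemma ev_f: "ev f = \<zero>\<^bsub>A\<^esub>" using root by (simp add: ev_def)

lemma x_pow_N: "x [^]\<^bsub>A\<^esub> N = \<ominus>\<^bsub>A\<^esub> ev (l @ [\<one>])"
proof -
 have c: "set (l @ [\<one>]) \<subseteq> carrier R" using lc V_sub by auto
 have e: "ev [\<one>] = \<one>\<^bsub>A\<^esub>" using xA by (simp add: ev_Cons ev_Nil)
 have "ev f = ev (l @ [\<one>]) \<oplus>\<^bsub>A\<^esub> x [^]\<^bsub>A\<^esub> N"
  using ev_append[OF c, of "[\<one>]"] xA e by simp
 then have "x [^]\<^bsub>A\<^esub> N \<oplus>\<^bsub>A\<^esub> ev (l @ [\<one>]) = \<zero>\<^bsub>A\<^esub>" using ev_f ev_closed[OF c] xA by (simp add: h.S.a_comm)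
 then show ?thesis using h.S.minus_equality[of "x [^]\<^bsub>A\<^esub> N" "ev (l @ [\<one>])"] ev_closed[OF c] xA by simp
qed

text \<open>The relation \<open>x^N = - (l(x) + x^(N-1))\<close> has coefficients in
  \<open>V\<close>, so lowering the degree with it never leaves the \<open>V\<close>-module
  \<open>S\<close>.\<close>

lemma red: assumes S: "is_mod S" shows "set p \<subseteq> S ==> ev p \<in> md S"
proof (induction p)
 case Nil
 have "ev (replicate n \<zero>) = \<zero>\<^bsub>A\<^esub>" for n using xA by (induction n) (auto simp: ev_Nil ev_Cons)
 then show ?case unfolding md_def ev_Nil using is_modD(2)[OF S] by (intro CollectI exI[of _ "replicate N \<zero>"]) (auto simp del: replicate_Suc)
next
 case (Cons a p)
 note SC = is_modD(1)[OF S]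
 obtain p' where p': "ev p = ev p'" "set p' \<subseteq> S" "length p' = N" using Cons unfolding md_def by auto
 obtain p0 t where pt: "p' = p0 @ [t]" "length p0 = length l" using p'(3) by (cases p' rule: rev_cases) auto
 have a: "a \<in> S" "t \<in> S" "set p0 \<subseteq> S" using Cons.prems p' pt by auto
 have c: "a \<in> carrier R" "t \<in> carrier R" "set p0 \<subseteq> carrier R" "set (a # p0) \<subseteq> carrier R" "set [t] \<subseteq> carrier R" using a SC by auto
 let ?l = "l @ [\<one>]"
 have lcar: "set ?l \<subseteq> carrier R" using lc V_sub by auto
 let ?s = "map ((\<otimes>) (\<ominus> t)) ?l"
 have sc: "set ?s \<subseteq> carrier R" using lcar c by auto
 have "\<ominus> t \<otimes> y \<in> S" if "y \<in> set ?l" for y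
 proof -
  have y: "y \<in> V" using that lc by auto
  then have "\<ominus> t \<otimes> y = \<ominus> y \<otimes> t" using c(2) by (simp add: l_minus r_minus m_comm)
  then show ?thesis using is_modD(4)[OF S V_minus[OF y] a(2)] by simp
 qed
 then have "set ?s \<subseteq> S" by auto
 then have q: "set (ladd (a # p0) ?s) \<subseteq> S" using a is_modD(3)[OF S] by (intro ladd_set) auto
 have "ev (ladd (a # p0) ?s) = ev (a # p)"
 proof -
  have E: "ev p0 \<in> carrier A" "ev ?l \<in> carrier A" "h a \<in> carrier A" "h t \<in> carrier A" using ev_closed c lcar by auto
  have "ev [t] = h t" using xA E by (simp add: ev_Cons ev_Nil)
  then have "ev p' = ev p0 \<oplus>\<^bsub>A\<^esub> x [^]\<^bsub>A\<^esub> length l \<otimes>\<^bsub>A\<^esub> h t" using ev_append[OF c(3,5)] pt by simp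
  then have "x \<otimes>\<^bsub>A\<^esub> ev p' = x \<otimes>\<^bsub>A\<^esub> ev p0 \<oplus>\<^bsub>A\<^esub> x [^]\<^bsub>A\<^esub> N \<otimes>\<^bsub>A\<^esub> h t"
   using E xA by (simp add: h.S.r_distr h.S.m_ac)
  then have "x \<otimes>\<^bsub>A\<^esub> ev p' = x \<otimes>\<^bsub>A\<^esub> ev p0 \<oplus>\<^bsub>A\<^esub> (\<ominus>\<^bsub>A\<^esub> h t) \<otimes>\<^bsub>A\<^esub> ev ?l"
   unfolding x_pow_N using E xA by (simp add: h.S.l_minus h.S.r_minus h.S.m_comm)
  moreover have "ev ?s = (\<ominus>\<^bsub>A\<^esub> h t) \<otimes>\<^bsub>A\<^esub> ev ?l" using ev_scale[OF lcar, of "\<ominus> t"] c(2) by simp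
  ultimately show ?thesis
   using ev_ladd[OF c(4) sc] E xA p'(1) by (simp add: ev_Cons h.S.a_assoc)
 qed
 moreover have "length (ladd (a # p0) ?s) = N" using pt by simp
 ultimately show ?case using q unfolding md_def
  by (intro CollectI exI[of _ "ladd (a # p0) ?s"]) simp
qed

lemma md_sub: assumes "is_mod S" "a \<in> md S" shows "a \<in> carrier A"
 using assms ev_closed is_modD(1) unfolding md_def by blast

lemma md_mono: "S \<subseteq> T ==> md S \<subseteq> md T" unfolding md_def by blast

lemma md_add: assumes "is_mod S" "a \<in> md S" "b \<in> md S" shows "a \<oplus>\<^bsub>A\<^esub> b \<in> md S"
proof -
 obtain p q where pq: "a = ev p" "b = ev q" "set p \<subseteq> S" "set q \<subseteq> S" using assms unfolding md_def by blast
 have "set (ladd p q) \<subseteq> S" using pq is_modD(3)[OF assms(1)] by (intro ladd_set) auto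
 then have "ev (ladd p q) \<in> md S" by (rule red[OF assms(1)])
 moreover have "ev (ladd p q) = a \<oplus>\<^bsub>A\<^esub> b" using ev_ladd[of p q] pq is_modD(1)[OF assms(1)] by auto
 ultimately show ?thesis by simp
qed

lemma md_mult: assumes S: "is_mod S" "is_mod S1" "is_mod S2" and m: "\<And>a b. a \<in> S1 ==> b \<in> S2 ==> a \<otimes> b \<in> S"
  and a: "a \<in> md S1" and b: "b \<in> md S2"
 shows "a \<otimes>\<^bsub>A\<^esub> b \<in> md S"
proof -
 obtain p q where pq: "a = ev p" "b = ev q" "set p \<subseteq> S1" "set q \<subseteq> S2" using a b unfolding md_def by blast
 have "set (lmult p q) \<subseteq> S" using set_lmult[OF is_modD(2,3)[OF S(1)] m pq(3,4)] by blast
 then have "ev (lmult p q) \<in> md S" by (rule red[OF S(1)])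
 moreover have "ev (lmult p q) = a \<otimes>\<^bsub>A\<^esub> b"
  using ev_lmult[of p q] pq is_modD(1)[OF S(2)] is_modD(1)[OF S(3)] by auto
 ultimately show ?thesis by simp
qed

lemma md_V_mult: assumes "is_mod S" "a \<in> md V" "b \<in> md S" shows "a \<otimes>\<^bsub>A\<^esub> b \<in> md S"
 using md_mult[OF assms(1) is_mod_V assms(1) is_modD(4)[OF assms(1)] assms(2,3)] .

lemma md_h: assumes "is_mod S" "a \<in> S" shows "h a \<in> md S"
proof -
 have "ev [a] \<in> md S" using red[OF assms(1), of "[a]"] assms by simp
 moreover have "ev [a] = h a" using xA assms is_modD(1)[OF assms(1)] by (auto simp: ev_Cons ev_Nil)
 ultimately show ?thesis by simp
qed

lemma md_one: "\<one>\<^bsub>A\<^esub> \<in> md V" using md_h[OF is_mod_V V_one] by simp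

lemma md_x: "x \<in> md V"
proof -
 have "ev [\<zero>, \<one>] \<in> md V" using red[OF is_mod_V, of "[\<zero>, \<one>]"] by simp
 moreover have "ev [\<zero>, \<one>] = x" using xA by (simp add: ev_Cons ev_Nil)
 ultimately show ?thesis by simp
qed

lemma md_minus: assumes "is_mod S" "a \<in> md S" shows "\<ominus>\<^bsub>A\<^esub> a \<in> md S"
proof -
 have "h (\<ominus> \<one>) \<otimes>\<^bsub>A\<^esub> a \<in> md S" using md_V_mult[OF assms(1) md_h[OF is_mod_V V_minus[OF V_one]] assms(2)] .
 then show ?thesis using md_sub[OF assms] by (simp add: h.S.l_minus)
qed

lemma md_diff: assumes "is_mod S" "a \<in> md S" "b \<in> md S" shows "a \<ominus>\<^bsub>A\<^esub> b \<in> md S"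
 unfolding a_minus_def by (rule md_add[OF assms(1,2) md_minus[OF assms(1,3)]])

lemma coord_unique:
 assumes "set p \<subseteq> carrier R" "set q \<subseteq> carrier R" "length p = N" "length q = N" "ev p = ev q"
 shows "p = q"
proof -
 let ?s = "map ((\<otimes>) (\<ominus> \<one>)) q"
 have sc: "set ?s \<subseteq> carrier R" using assms(2) by auto
 have "ev (ladd p ?s) = ev p \<oplus>\<^bsub>A\<^esub> h (\<ominus> \<one>) \<otimes>\<^bsub>A\<^esub> ev q"
  using ev_ladd[OF assms(1) sc] ev_scale[OF assms(2), of "\<ominus> \<one>"] by simp
 also have "\<dots> = \<zero>\<^bsub>A\<^esub>" using assms(5) ev_closed[OF assms(2)] by (simp add: h.S.l_minus h.S.r_neg)
 finally have "set (ladd p ?s) \<subseteq> {\<zero>}"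
  using uniq[of "ladd p ?s"] assms sc ladd_carr[OF assms(1) sc] by (simp add: ev_def)
 then have z: "ladd p ?s ! i = \<zero>" if i: "i < N" for i
 proof -
  have "ladd p ?s ! i \<in> set (ladd p ?s)" by (rule nth_mem) (use i assms(3,4) in simp)
  then show ?thesis using \<open>set (ladd p ?s) \<subseteq> {\<zero>}\<close> by blast
 qed
 show ?thesis
 proof (rule nth_equalityI)
  fix i assume i: "i < length p"
  have "p ! i \<in> set p" "q ! i \<in> set q" using i assms(3,4) by simp_all
  then have c: "p ! i \<in> carrier R" "q ! i \<in> carrier R" using assms(1,2) by blast+
  have "p ! i \<oplus> \<ominus> \<one> \<otimes> q ! i = \<zero>" using z[of i] nth_ladd[of p ?s i] i assms(3,4) by simp
  then have "p ! i \<ominus> q ! i = \<zero>" using c by (simp add: l_minus a_minus_def)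
  then show "p ! i = q ! i" using c by simp
 qed (use assms in simp)
qed

lemma md_coord:
 assumes "is_mod S" "ev p \<in> md S" "set p \<subseteq> carrier R" "length p = N" shows "set p \<subseteq> S"
proof -
 obtain q where q: "ev p = ev q" "set q \<subseteq> S" "length q = N" using assms(2) unfolding md_def by blast
 then have "p = q" using coord_unique[OF assms(3) _ assms(4)] is_modD(1)[OF assms(1)] by blast
 then show ?thesis using q by simp
qed

text \<open>Synthetic division by \<open>X - b\<close>; the quotient keeps its coefficients in
  \<open>S\<close> because \<open>b\<close> is integral.\<close>

lemma ev_divide:
 assumes S: "is_mod S" and b: "b \<in> V"
 shows "set p \<subseteq> S ==> \<exists>k. set k \<subseteq> S \<and> ev p = h (lpoly p b) \<oplus>\<^bsub>A\<^esub> (x \<ominus>\<^bsub>A\<^esub> h b) \<otimes>\<^bsub>A\<^esub> ev k"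
proof (induction p)
 case Nil
 then show ?case using xA b by (intro exI[of _ "[]"]) (simp add: ev_Nil)
next
 case (Cons a p)
 then obtain k where k: "set k \<subseteq> S" "ev p = h (lpoly p b) \<oplus>\<^bsub>A\<^esub> (x \<ominus>\<^bsub>A\<^esub> h b) \<otimes>\<^bsub>A\<^esub> ev k" by auto
 note SC = is_modD(1)[OF S]
 have pS: "lpoly q b \<in> S" if "set q \<subseteq> S" for q
  using that by (induction q) (auto intro!: is_modD(2,3,4)[OF S] b)
 let ?k = "lpoly p b # k"
 have "set ?k \<subseteq> S" using pS k(1) Cons.prems by auto
 moreover have "ev (a # p) = h (lpoly (a # p) b) \<oplus>\<^bsub>A\<^esub> (x \<ominus>\<^bsub>A\<^esub> h b) \<otimes>\<^bsub>A\<^esub> ev ?k"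
 proof -
  have c: "a \<in> carrier R" "set p \<subseteq> carrier R" "lpoly p b \<in> carrier R" "set k \<subseteq> carrier R" "b \<in> carrier R"
   using Cons.prems SC pS[of p] k b by auto
  have id: "a \<oplus>\<^bsub>A\<^esub> x \<otimes>\<^bsub>A\<^esub> (p \<oplus>\<^bsub>A\<^esub> (x \<ominus>\<^bsub>A\<^esub> b) \<otimes>\<^bsub>A\<^esub> k) = (a \<oplus>\<^bsub>A\<^esub> b \<otimes>\<^bsub>A\<^esub> p) \<oplus>\<^bsub>A\<^esub> (x \<ominus>\<^bsub>A\<^esub> b) \<otimes>\<^bsub>A\<^esub> (p \<oplus>\<^bsub>A\<^esub> x \<otimes>\<^bsub>A\<^esub> k)"
   if "a \<in> carrier A" "x \<in> carrier A" "p \<in> carrier A" "b \<in> carrier A" "k \<in> carrier A" for a x p b k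
   using that by - (rule h.S.ring_identity, (rule h.S.ring_rep | assumption | (simp; fail))+, (simp_all add: h.S.l_distr h.S.r_distr h.S.a_ac h.S.m_ac)?)
  show ?thesis using id[of "h a" x "h (lpoly p b)" "h b" "ev k"] k(2) c xA ev_closed[OF c(4)]
   by (simp add: ev_Cons)
 qed
 ultimately show ?case by blast
qed

text \<open>Two further facts about the quotient are needed: its value at \<open>b\<close> is the
  derivative, which normalises it, and it is monic, which keeps it out of
  \<open>md M\<close>.\<close>

lemma ev_divide_monic:
 assumes b: "b \<in> V"
 shows "set p \<subseteq> V ==> \<exists>g. set g \<subseteq> V \<and> length g = length p \<and> (p ~= [] --> last g = \<one>) \<and> lpoly g b = lderiv (p @ [\<one>]) b \<and>
  ev (p @ [\<one>]) = h (lpoly (p @ [\<one>]) b) \<oplus>\<^bsub>A\<^esub> (x \<ominus>\<^bsub>A\<^esub> h b) \<otimes>\<^bsub>A\<^esub> ev g"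
proof (induction p)
 case Nil
 then show ?case using xA b by (intro exI[of _ "[]"]) (simp add: ev_Nil ev_Cons)
next
 case (Cons a p)
 then obtain g where g: "set g \<subseteq> V" "length g = length p" "p ~= [] --> last g = \<one>" "lpoly g b = lderiv (p @ [\<one>]) b"
  "ev (p @ [\<one>]) = h (lpoly (p @ [\<one>]) b) \<oplus>\<^bsub>A\<^esub> (x \<ominus>\<^bsub>A\<^esub> h b) \<otimes>\<^bsub>A\<^esub> ev g" by auto
 let ?q = "lpoly (p @ [\<one>]) b"
 have qV: "?q \<in> V" using Cons.prems b by (intro V_lpoly) auto
 let ?g = "?q # g"
 have "set ?g \<subseteq> V" using qV g(1) by simp
 moreover have "last ?g = \<one>" using g(2,3) b by (cases p) auto
 moreover have "ev ((a # p) @ [\<one>]) = h (lpoly ((a # p) @ [\<one>]) b) \<oplus>\<^bsub>A\<^esub> (x \<ominus>\<^bsub>A\<^esub> h b) \<otimes>\<^bsub>A\<^esub> ev ?g"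
 proof -
  have c: "a \<in> carrier R" "?q \<in> carrier R" "set g \<subseteq> carrier R" "b \<in> carrier R"
   using Cons.prems qV g b by auto
  have id: "a \<oplus>\<^bsub>A\<^esub> x \<otimes>\<^bsub>A\<^esub> (p \<oplus>\<^bsub>A\<^esub> (x \<ominus>\<^bsub>A\<^esub> b) \<otimes>\<^bsub>A\<^esub> k) = (a \<oplus>\<^bsub>A\<^esub> b \<otimes>\<^bsub>A\<^esub> p) \<oplus>\<^bsub>A\<^esub> (x \<ominus>\<^bsub>A\<^esub> b) \<otimes>\<^bsub>A\<^esub> (p \<oplus>\<^bsub>A\<^esub> x \<otimes>\<^bsub>A\<^esub> k)"
   if "a \<in> carrier A" "x \<in> carrier A" "p \<in> carrier A" "b \<in> carrier A" "k \<in> carrier A" for a x p b k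
   using that by - (rule h.S.ring_identity, (rule h.S.ring_rep | assumption | (simp; fail))+, (simp_all add: h.S.l_distr h.S.r_distr h.S.a_ac h.S.m_ac)?)
  show ?thesis using id[of "h a" x "h ?q" "h b" "ev g"] g(5) c xA ev_closed[OF c(3)]
   by (simp add: ev_Cons)
 qed
 ultimately show ?case using g(2,4) by (intro exI[of _ ?g]) simp
qed

text \<open>An argument of Nakayama type, relative to a coordinate \<open>d\<close> of minimal
  value. As \<open>p(b) = 0\<close>, \<open>ev p\<close> is a multiple of \<open>x - b\<close>;
  since \<open>(x - b) e\<close> lies in \<open>md M\<close>, the product \<open>e ev p\<close> is
  smaller than \<open>d\<close>. Because \<open>w\<close> is congruent to \<open>e\<close>, so is
  \<open>w ev p = (1 - 2u) ev p\<close>, and because \<open>u\<close> lies in \<open>md M\<close>,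
  so is \<open>ev p\<close>. Hence \<open>d\<close> is smaller than itself, that is, zero.\<close>

lemma coord_zero:
 assumes y: "set p \<subseteq> carrier R" "length p = N" and b: "b \<in> V" and z: "lpoly p b = \<zero>"
  and e: "e \<in> md V" "(x \<ominus>\<^bsub>A\<^esub> h b) \<otimes>\<^bsub>A\<^esub> e \<in> md M"
  and u: "u \<in> md M" and w: "w \<in> md V" "w \<ominus>\<^bsub>A\<^esub> e \<in> md M"
  and q: "(\<one>\<^bsub>A\<^esub> \<ominus>\<^bsub>A\<^esub> (u \<oplus>\<^bsub>A\<^esub> u)) \<otimes>\<^bsub>A\<^esub> ev p = w \<otimes>\<^bsub>A\<^esub> ev p"
 shows "set p \<subseteq> {\<zero>}"
proof -
 obtain i0 where i0: "i0 < N" "\<And>j. j < N ==> dv (p ! i0) (p ! j)"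
  using dv_min[of "{..<N}" "\<lambda>i. p ! i"] y nth_mem[of _ p] by (auto simp: subset_eq)
 define d where "d = p ! i0"
 have dc: "d \<in> carrier R" unfolding d_def using y i0(1) nth_mem[of i0 p] by auto
 have pd: "set p \<subseteq> {y. dv d y}" using i0(2) y(2) by (auto simp: in_set_conv_nth d_def)
 note Sd = is_mod_dv[OF dc] and Ss = is_mod_sdv[OF dc]
 have qd: "ev p \<in> md {y. dv d y}" using red[OF Sd pd] .
 have mm: "a \<otimes>\<^bsub>A\<^esub> c \<in> md {y. sdv d y}" if a: "a \<in> md M" and c: "c \<in> md {y. dv d y}" for a c
 proof (rule md_mult[OF Ss is_mod_M Sd _ a c])
  fix r t assume r: "r \<in> M" and t: "t \<in> {y. dv d y}"
  have tc: "t \<in> carrier R" using t dv_carr dc by blast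
  have "sdv (d \<otimes> \<one>) (t \<otimes> r)" using sdv_mult[of d t \<one> r] t r dc by simp
  then show "r \<otimes> t \<in> {y. sdv d y}" using dc tc M_carr[OF r] by (simp add: m_comm)
 qed
 obtain k where k: "set k \<subseteq> {y. dv d y}" "ev p = h (lpoly p b) \<oplus>\<^bsub>A\<^esub> (x \<ominus>\<^bsub>A\<^esub> h b) \<otimes>\<^bsub>A\<^esub> ev k"
  using ev_divide[OF Sd b pd] by blast
 have c: "u \<in> carrier A" "w \<in> carrier A" "e \<in> carrier A" "ev p \<in> carrier A" "ev k \<in> carrier A" "h b \<in> carrier A"
  using md_sub[OF is_mod_M u] md_sub[OF is_mod_V w(1)] md_sub[OF is_mod_V e(1)] ev_closed[OF y(1)]
   md_sub[OF Sd red[OF Sd k(1)]] b by auto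
 have pk: "ev p = (x \<ominus>\<^bsub>A\<^esub> h b) \<otimes>\<^bsub>A\<^esub> ev k" using k(2) z c xA by simp
 have "e \<otimes>\<^bsub>A\<^esub> ev p = ((x \<ominus>\<^bsub>A\<^esub> h b) \<otimes>\<^bsub>A\<^esub> e) \<otimes>\<^bsub>A\<^esub> ev k" unfolding pk using c xA by (simp add: h.S.m_ac)
 then have t1: "e \<otimes>\<^bsub>A\<^esub> ev p \<in> md {y. sdv d y}" using mm[OF e(2) red[OF Sd k(1)]] by simp
 have t2: "(u \<oplus>\<^bsub>A\<^esub> u) \<otimes>\<^bsub>A\<^esub> ev p \<in> md {y. sdv d y}" by (rule mm[OF md_add[OF is_mod_M u u] qd])
 have t3: "(w \<ominus>\<^bsub>A\<^esub> e) \<otimes>\<^bsub>A\<^esub> ev p \<in> md {y. sdv d y}" by (rule mm[OF w(2) qd])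
 have "ev p = (u \<oplus>\<^bsub>A\<^esub> u) \<otimes>\<^bsub>A\<^esub> ev p \<oplus>\<^bsub>A\<^esub> ((w \<ominus>\<^bsub>A\<^esub> e) \<otimes>\<^bsub>A\<^esub> ev p \<oplus>\<^bsub>A\<^esub> e \<otimes>\<^bsub>A\<^esub> ev p)"
  unfolding h.S.idem_identity_4(1)[OF c(2,1,3,4)] q[symmetric] h.S.idem_identity_4(2)[OF c(2,1,3,4)] ..
 moreover have "\<dots> \<in> md {y. sdv d y}" by (rule md_add[OF Ss t2 md_add[OF Ss t3 t1]])
 ultimately have "ev p \<in> md {y. sdv d y}" by metis
 then have "set p \<subseteq> {y. sdv d y}" by (rule md_coord[OF Ss _ y])
 moreover have "d \<in> set p" unfolding d_def by (rule nth_mem) (use y(2) i0(1) in simp)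
 ultimately have "sdv d d" by blast
 then have "d = \<zero>" by (rule sdv_self[OF _ dc])
 then show ?thesis using pd dv_zeroD by auto
qed

text \<open>An approximate zero \<open>b\<close> gives an approximate idempotent \<open>e\<close>.
  Adding \<open>u1\<close> by the group law moves its value from near zero to near the value of
  \<open>u1\<close>, where \<open>img\<close> provides a solution \<open>u2\<close>. The difference
  \<open>w\<close> of the two elements with equal value satisfies \<open>w^2 = (1 - 2 u2) w\<close>.
  On \<open>w\<close> the element \<open>x\<close> acts as a scalar \<open>r\<close>, and this
  scalar is the zero.\<close>

lemma root_of_interior:
 assumes c: "c \<in> carrier R - {\<zero>}"
  and u1: "u1 \<in> md M"
  and img: "\<And>y. y \<in> carrier A ==> y \<ominus>\<^bsub>A\<^esub> (u1 \<ominus>\<^bsub>A\<^esub> u1 \<otimes>\<^bsub>A\<^esub> u1) \<in> md {y. sdv c y} ==> \<exists>u \<in> md M. u \<ominus>\<^bsub>A\<^esub> u \<otimes>\<^bsub>A\<^esub> u = y"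
  and b: "b \<in> V" "b \<oplus> \<one> \<in> M" "sdv c (lpoly f b)"
 shows "\<exists>r \<in> V. r \<oplus> \<one> \<in> M \<and> lpoly f r = \<zero>"
proof -
 let ?f = "lpoly f b"
 have cC: "c \<in> carrier R" using c by simp
 note Sc = is_mod_sdv[OF cC]
 have fM: "?f \<in> M" by (rule special_val[OF l b(1,2)])
 have d: "lderiv f b \<in> V" "lderiv f b \<notin> M" using special_deriv[OF b(1,2) l] by auto
 define d where "d = lderiv f b"
 have d: "d \<in> V" "d \<notin> M" "inv d \<in> V" "d \<otimes> inv d = \<one>"
  using d unitD[OF d] r_inv'[of d] V_carr[OF d(1)] unfolding d_def by auto
 have "set (l @ [\<one>]) \<subseteq> V" using lc by simp
 from ev_divide_monic[OF b(1) this] obtain g where g: "set g \<subseteq> V" "length g = N" "last g = \<one>" "lpoly g b = d"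
  "ev f = h ?f \<oplus>\<^bsub>A\<^esub> (x \<ominus>\<^bsub>A\<^esub> h b) \<otimes>\<^bsub>A\<^esub> ev g" unfolding d_def by auto
 have gc: "set g \<subseteq> carrier R" using g(1) V_sub by blast
 define xb where "xb = x \<ominus>\<^bsub>A\<^esub> h b"
 have hb: "h b \<in> md V" using md_h[OF is_mod_V b(1)] .
 have xb: "xb \<in> md V" unfolding xb_def by (rule md_diff[OF is_mod_V md_x hb])
 have xbC: "xb \<in> carrier A" by (rule md_sub[OF is_mod_V xb])
 have egV: "ev g \<in> md V" by (rule red[OF is_mod_V g(1)])
 have egC: "ev g \<in> carrier A" by (rule ev_closed[OF gc])
 have fC: "h ?f \<in> carrier A" using M_carr[OF fM] by simp
 have "xb \<otimes>\<^bsub>A\<^esub> ev g \<oplus>\<^bsub>A\<^esub> h ?f = \<zero>\<^bsub>A\<^esub>"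
  using g(5) xbC egC fC unfolding ev_f xb_def by (simp add: h.S.a_comm)
 then have xg: "xb \<otimes>\<^bsub>A\<^esub> ev g = \<ominus>\<^bsub>A\<^esub> h ?f" using h.S.minus_equality[OF _ fC] xbC egC by simp
 \<comment> \<open>\<open>ev g\<close> is the cofactor of \<open>x - b\<close> up to the error
   \<open>f(b)\<close>, and dividing by \<open>d = g(b)\<close> makes it congruent to one modulo
   \<open>x - b\<close>. If \<open>b\<close> were an exact zero, this would be the idempotent of the
   factor belonging to \<open>b\<close>.\<close>
 define e where "e = h (inv d) \<otimes>\<^bsub>A\<^esub> ev g"
 have hd: "h (inv d) \<in> md V" "h (inv d) \<in> carrier A" "h d \<in> carrier A"
  using md_h[OF is_mod_V d(3)] V_carr[OF d(3)] V_carr[OF d(1)] by auto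
 have eV: "e \<in> md V" unfolding e_def by (rule md_V_mult[OF is_mod_V hd(1) egV])
 have eC: "e \<in> carrier A" by (rule md_sub[OF is_mod_V eV])
 have xbe: "xb \<otimes>\<^bsub>A\<^esub> e = h (inv d) \<otimes>\<^bsub>A\<^esub> (\<ominus>\<^bsub>A\<^esub> h ?f)"
  unfolding e_def xg[symmetric] using xbC egC hd by (simp add: h.S.m_ac)
 have small: "xb \<otimes>\<^bsub>A\<^esub> e \<in> md S" if S: "is_mod S" "?f \<in> S" for S
  unfolding xbe by (rule md_V_mult[OF S(1) hd(1) md_minus[OF S(1) md_h[OF S]]])
 have xbeM: "xb \<otimes>\<^bsub>A\<^esub> e \<in> md M" by (rule small[OF is_mod_M fM])
 have xbec: "xb \<otimes>\<^bsub>A\<^esub> e \<in> md {y. sdv c y}" by (rule small[OF Sc]) (simp add: b(3))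
 obtain k where k: "set k \<subseteq> V" "ev g = h d \<oplus>\<^bsub>A\<^esub> xb \<otimes>\<^bsub>A\<^esub> ev k"
  using ev_divide[OF is_mod_V b(1) g(1)] unfolding g(4) xb_def by blast
 have kV: "ev k \<in> md V" by (rule red[OF is_mod_V k(1)])
 have kC: "ev k \<in> carrier A" by (rule md_sub[OF is_mod_V kV])
 have hdd: "h (inv d) \<otimes>\<^bsub>A\<^esub> h d = \<one>\<^bsub>A\<^esub>"
  unfolding h.hom_mult[OF V_carr[OF d(3)] V_carr[OF d(1)], symmetric]
  using d(4) m_comm[OF V_carr[OF d(3)] V_carr[OF d(1)]] by simp
 have e1: "e = \<one>\<^bsub>A\<^esub> \<oplus>\<^bsub>A\<^esub> h (inv d) \<otimes>\<^bsub>A\<^esub> (xb \<otimes>\<^bsub>A\<^esub> ev k)"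
  unfolding e_def k(2) using hd xbC kC hdd by (simp add: h.S.r_distr)
 define \<epsilon> where "\<epsilon> = e \<ominus>\<^bsub>A\<^esub> e \<otimes>\<^bsub>A\<^esub> e"
 have eps: "\<epsilon> = \<ominus>\<^bsub>A\<^esub> ((h (inv d) \<otimes>\<^bsub>A\<^esub> ev k) \<otimes>\<^bsub>A\<^esub> (xb \<otimes>\<^bsub>A\<^esub> e))"
 proof -
  have id: "e \<ominus>\<^bsub>A\<^esub> e \<otimes>\<^bsub>A\<^esub> (\<one>\<^bsub>A\<^esub> \<oplus>\<^bsub>A\<^esub> i \<otimes>\<^bsub>A\<^esub> (z \<otimes>\<^bsub>A\<^esub> k)) = \<ominus>\<^bsub>A\<^esub> ((i \<otimes>\<^bsub>A\<^esub> k) \<otimes>\<^bsub>A\<^esub> (z \<otimes>\<^bsub>A\<^esub> e))"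
   if "e \<in> carrier A" "i \<in> carrier A" "z \<in> carrier A" "k \<in> carrier A" for e i z k
   using that by - (rule h.S.ring_identity, (rule h.S.ring_rep | assumption | (simp; fail))+, (simp_all add: h.S.l_distr h.S.r_distr h.S.a_ac h.S.m_ac)?)
  have "\<epsilon> = e \<ominus>\<^bsub>A\<^esub> e \<otimes>\<^bsub>A\<^esub> (\<one>\<^bsub>A\<^esub> \<oplus>\<^bsub>A\<^esub> h (inv d) \<otimes>\<^bsub>A\<^esub> (xb \<otimes>\<^bsub>A\<^esub> ev k))"
   unfolding \<epsilon>_def e1[symmetric] ..
  then show ?thesis using id[OF eC hd(2) xbC kC] by simp
 qed
 have epsm: "\<epsilon> \<in> md S" if "is_mod S" "xb \<otimes>\<^bsub>A\<^esub> e \<in> md S" for S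
  unfolding eps by (rule md_minus[OF that(1) md_V_mult[OF that(1) md_V_mult[OF is_mod_V hd(1) kV] that(2)]])
 have u1V: "u1 \<in> md V" using u1 md_mono[of M V] M_V by blast
 have u1C: "u1 \<in> carrier A" by (rule md_sub[OF is_mod_V u1V])
 define y1 where "y1 = u1 \<ominus>\<^bsub>A\<^esub> u1 \<otimes>\<^bsub>A\<^esub> u1"
 have y1V: "y1 \<in> md V" unfolding y1_def by (rule md_diff[OF is_mod_V u1V md_V_mult[OF is_mod_V u1V u1V]])
 \<comment> \<open>The group law applied to \<open>e\<close> and \<open>u1\<close>. By
   \<open>idem_identity_1\<close> the value of \<open>s\<close> differs from \<open>y1\<close> by an
   integral multiple of \<open>\<epsilon>\<close>, hence by less than \<open>c\<close>.\<close>
 define s where "s = e \<oplus>\<^bsub>A\<^esub> u1 \<ominus>\<^bsub>A\<^esub> (e \<otimes>\<^bsub>A\<^esub> u1 \<oplus>\<^bsub>A\<^esub> e \<otimes>\<^bsub>A\<^esub> u1)"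
 have eu: "e \<otimes>\<^bsub>A\<^esub> u1 \<in> md M" by (rule md_V_mult[OF is_mod_M eV u1])
 have sV: "s \<in> md V" unfolding s_def
  using md_diff[OF is_mod_V md_add[OF is_mod_V eV u1V] md_add[OF is_mod_V]] md_V_mult[OF is_mod_V eV u1V] by blast
 have sC: "s \<in> carrier A" by (rule md_sub[OF is_mod_V sV])
 have "s \<ominus>\<^bsub>A\<^esub> s \<otimes>\<^bsub>A\<^esub> s \<ominus>\<^bsub>A\<^esub> y1 = \<epsilon> \<ominus>\<^bsub>A\<^esub> \<epsilon> \<otimes>\<^bsub>A\<^esub> (y1 \<oplus>\<^bsub>A\<^esub> y1 \<oplus>\<^bsub>A\<^esub> y1 \<oplus>\<^bsub>A\<^esub> y1)"
  unfolding y1_def \<epsilon>_def by (rule h.S.idem_identity_1[OF eC u1C s_def])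
 also have "\<dots> = \<epsilon> \<ominus>\<^bsub>A\<^esub> (y1 \<oplus>\<^bsub>A\<^esub> y1 \<oplus>\<^bsub>A\<^esub> y1 \<oplus>\<^bsub>A\<^esub> y1) \<otimes>\<^bsub>A\<^esub> \<epsilon>"
  using md_sub[OF Sc epsm[OF Sc xbec]] md_sub[OF is_mod_V y1V] by (simp add: h.S.m_comm)
 also have "\<dots> \<in> md {y. sdv c y}"
  by (intro md_diff[OF Sc] md_V_mult[OF Sc] md_add[OF is_mod_V] y1V epsm[OF Sc xbec])
 finally have "s \<ominus>\<^bsub>A\<^esub> s \<otimes>\<^bsub>A\<^esub> s \<ominus>\<^bsub>A\<^esub> y1 \<in> md {y. sdv c y}" .
 then obtain u2 where u2: "u2 \<in> md M" "u2 \<ominus>\<^bsub>A\<^esub> u2 \<otimes>\<^bsub>A\<^esub> u2 = s \<ominus>\<^bsub>A\<^esub> s \<otimes>\<^bsub>A\<^esub> s"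
  using img[of "s \<ominus>\<^bsub>A\<^esub> s \<otimes>\<^bsub>A\<^esub> s"] sC unfolding y1_def by auto
 have u2V: "u2 \<in> md V" using u2(1) md_mono[of M V] M_V by blast
 have u2C: "u2 \<in> carrier A" by (rule md_sub[OF is_mod_V u2V])
 define w where "w = s \<ominus>\<^bsub>A\<^esub> u2"
 have wV: "w \<in> md V" unfolding w_def by (rule md_diff[OF is_mod_V sV u2V])
 have wC: "w \<in> carrier A" by (rule md_sub[OF is_mod_V wV])
 let ?t = "\<one>\<^bsub>A\<^esub> \<ominus>\<^bsub>A\<^esub> (u2 \<oplus>\<^bsub>A\<^esub> u2)"
 have tC: "?t \<in> carrier A" using u2C by simp
 have "w \<otimes>\<^bsub>A\<^esub> w \<ominus>\<^bsub>A\<^esub> ?t \<otimes>\<^bsub>A\<^esub> w = \<zero>\<^bsub>A\<^esub>"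
  unfolding w_def h.S.idem_identity_2[OF sC u2C] u2(2) using sC by (simp add: h.S.r_right_minus_eq)
 then have ww: "?t \<otimes>\<^bsub>A\<^esub> w = w \<otimes>\<^bsub>A\<^esub> w" using wC tC by (simp add: h.S.r_right_minus_eq)
 have we: "w \<ominus>\<^bsub>A\<^esub> e \<in> md M"
  unfolding w_def s_def h.S.idem_identity_3[OF eC u1C u2C]
  by (rule md_diff[OF is_mod_M md_diff[OF is_mod_M u1 md_add[OF is_mod_M eu eu]] u2(1)])
 \<comment> \<open>Evaluation of coordinates at \<open>b\<close> is injective on multiples of
   \<open>w\<close>. This replaces the statement that \<open>w\<close> generates a one-dimensional
   factor.\<close>
 have key: "set p \<subseteq> {\<zero>}" if p: "set p \<subseteq> carrier R" "length p = N" "lpoly p b = \<zero>" "ev p = w \<otimes>\<^bsub>A\<^esub> a" "a \<in> carrier A" for p a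
 proof (rule coord_zero[OF p(1,2) b(1) p(3) eV xbeM[unfolded xb_def] u2(1) wV we])
  show "?t \<otimes>\<^bsub>A\<^esub> ev p = w \<otimes>\<^bsub>A\<^esub> ev p"
   unfolding p(4) using ww wC tC p(5) by (metis h.S.m_assoc)
 qed
 obtain py where py: "w = ev py" "set py \<subseteq> V" "length py = N" using wV unfolding md_def by blast
 have pyc: "set py \<subseteq> carrier R" using py(2) V_sub by blast
 define \<beta> where "\<beta> = lpoly py b"
 have \<beta>V: "\<beta> \<in> V" unfolding \<beta>_def by (rule V_lpoly[OF py(2) b(1)])
 \<comment> \<open>If \<open>w(b)\<close> were in \<open>M\<close>, then \<open>e w\<close> would
   lie in \<open>md M\<close>, and with it \<open>e^2\<close> and \<open>e\<close>, since
   \<open>w\<close> is congruent to \<open>e\<close> and \<open>e - e^2\<close> is small. But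
   \<open>d e\<close> is the monic element \<open>ev g\<close>.\<close>
 have \<beta>M: "\<beta> \<notin> M"
 proof
  assume \<beta>: "\<beta> \<in> M"
  obtain k' where k': "set k' \<subseteq> V" "w = h \<beta> \<oplus>\<^bsub>A\<^esub> xb \<otimes>\<^bsub>A\<^esub> ev k'"
   using ev_divide[OF is_mod_V b(1) py(2)] unfolding py(1) \<beta>_def xb_def by blast
  have k'V: "ev k' \<in> md V" by (rule red[OF is_mod_V k'(1)])
  have k'C: "ev k' \<in> carrier A" by (rule md_sub[OF is_mod_V k'V])
  have h\<beta>: "h \<beta> \<in> md M" "h \<beta> \<in> carrier A" using md_h[OF is_mod_M \<beta>] V_carr[OF \<beta>V] by auto
  have "e \<otimes>\<^bsub>A\<^esub> w = e \<otimes>\<^bsub>A\<^esub> h \<beta> \<oplus>\<^bsub>A\<^esub> ev k' \<otimes>\<^bsub>A\<^esub> (xb \<otimes>\<^bsub>A\<^esub> e)"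
   unfolding k'(2) using eC h\<beta>(2) xbC k'C by (simp add: h.S.r_distr h.S.m_ac)
  also have "\<dots> \<in> md M"
   by (rule md_add[OF is_mod_M md_V_mult[OF is_mod_M eV h\<beta>(1)] md_V_mult[OF is_mod_M k'V xbeM]])
  finally have ew: "e \<otimes>\<^bsub>A\<^esub> w \<in> md M" .
  have id: "e = (e \<ominus>\<^bsub>A\<^esub> e \<otimes>\<^bsub>A\<^esub> e) \<oplus>\<^bsub>A\<^esub> (e \<otimes>\<^bsub>A\<^esub> w \<ominus>\<^bsub>A\<^esub> e \<otimes>\<^bsub>A\<^esub> (w \<ominus>\<^bsub>A\<^esub> e))"
   if "e \<in> carrier A" "w \<in> carrier A" for e w
   using that by - (rule h.S.ring_identity, (rule h.S.ring_rep | assumption | (simp; fail))+, (simp_all add: h.S.l_distr h.S.r_distr h.S.a_ac h.S.m_ac)?)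
  have "(e \<ominus>\<^bsub>A\<^esub> e \<otimes>\<^bsub>A\<^esub> e) \<oplus>\<^bsub>A\<^esub> (e \<otimes>\<^bsub>A\<^esub> w \<ominus>\<^bsub>A\<^esub> e \<otimes>\<^bsub>A\<^esub> (w \<ominus>\<^bsub>A\<^esub> e)) \<in> md M"
   by (rule md_add[OF is_mod_M epsm[OF is_mod_M xbeM, unfolded \<epsilon>_def] md_diff[OF is_mod_M ew md_V_mult[OF is_mod_M eV we]]])
  then have eM: "e \<in> md M" using id[OF eC wC] by simp
  have "ev g = h d \<otimes>\<^bsub>A\<^esub> e" unfolding e_def using hd egC hdd by (metis h.S.m_assoc h.S.m_comm h.S.l_one)
  then have "ev g \<in> md M" using md_V_mult[OF is_mod_M md_h[OF is_mod_V d(1)] eM] by simp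
  then have "set g \<subseteq> M" by (rule md_coord[OF is_mod_M _ gc g(2)])
  moreover have "\<one> \<in> set g" using g(2,3) last_in_set[of g] by force
  ultimately show False using one_notin_M by blast
 qed
 have \<beta>0: "\<beta> ~= \<zero>" "inv \<beta> \<in> V" using unitD[OF \<beta>V \<beta>M] by auto
 have \<beta>C: "\<beta> \<in> carrier R" "inv \<beta> \<in> carrier R" using V_carr[OF \<beta>V] V_carr[OF \<beta>0(2)] .
 obtain px where px: "x \<otimes>\<^bsub>A\<^esub> w = ev px" "set px \<subseteq> V" "length px = N"
  using md_V_mult[OF is_mod_V md_x wV] unfolding md_def by blast
 have pxc: "set px \<subseteq> carrier R" using px(2) V_sub by blast
 define \<gamma> where "\<gamma> = lpoly px b"
 have \<gamma>V: "\<gamma> \<in> V" unfolding \<gamma>_def by (rule V_lpoly[OF px(2) b(1)])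
 have \<gamma>C: "\<gamma> \<in> carrier R" by (rule V_carr[OF \<gamma>V])
 have hC: "h \<beta> \<in> carrier A" "h \<gamma> \<in> carrier A" "h (inv \<beta>) \<in> carrier A" using \<beta>C \<gamma>C by auto
 let ?q1 = "map ((\<otimes>) \<beta>) px" and ?q2 = "map ((\<otimes>) (\<ominus> \<gamma>)) py"
 have q12: "set ?q1 \<subseteq> carrier R" "set ?q2 \<subseteq> carrier R" by (rule scale_carr; use pxc pyc \<beta>C \<gamma>C in simp)+
 \<comment> \<open>The multiple \<open>\<beta> x w - \<gamma> w\<close> of \<open>w\<close> takes
   the value \<open>\<beta> \<gamma> - \<gamma> \<beta>\<close> at \<open>b\<close>. By
   \<open>key\<close> it vanishes, so \<open>x\<close> acts on \<open>w\<close> as the scalar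
   \<open>\<gamma> / \<beta>\<close>.\<close>
 let ?q = "ladd ?q1 ?q2"
 have qc: "set ?q \<subseteq> carrier R" "length ?q = N" using ladd_carr[OF q12] px(3) py(3) by auto
 have evq: "ev ?q = h \<beta> \<otimes>\<^bsub>A\<^esub> (x \<otimes>\<^bsub>A\<^esub> w) \<ominus>\<^bsub>A\<^esub> h \<gamma> \<otimes>\<^bsub>A\<^esub> w"
  unfolding ev_ladd[OF q12] ev_scale[OF pxc \<beta>C(1)] ev_scale[OF pyc a_inv_closed[OF \<gamma>C]] px(1)[symmetric] py(1)[symmetric]
  using \<gamma>C hC wC xA by (simp add: a_minus_def h.S.l_minus)
 have "lpoly ?q b = \<beta> \<otimes> \<gamma> \<oplus> \<ominus> \<gamma> \<otimes> \<beta>"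
  unfolding lpoly_ladd[OF q12 V_carr[OF b(1)]] lpoly_scale[OF pxc \<beta>C(1) V_carr[OF b(1)]]
   lpoly_scale[OF pyc a_inv_closed[OF \<gamma>C] V_carr[OF b(1)]]
  unfolding \<beta>_def \<gamma>_def ..
 also have "\<dots> = \<zero>" using \<beta>C \<gamma>C by (simp add: l_minus r_minus m_comm r_neg)
 finally have lq: "lpoly ?q b = \<zero>" .
 have "h \<beta> \<otimes>\<^bsub>A\<^esub> (x \<otimes>\<^bsub>A\<^esub> w) \<ominus>\<^bsub>A\<^esub> h \<gamma> \<otimes>\<^bsub>A\<^esub> w = w \<otimes>\<^bsub>A\<^esub> (h \<beta> \<otimes>\<^bsub>A\<^esub> x \<ominus>\<^bsub>A\<^esub> h \<gamma>)"
  using hC wC xA by - (rule h.S.eqd, simp_all add: h.S.ring_norm)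
 then have "set ?q \<subseteq> {\<zero>}" using key[OF qc lq] evq hC xA by simp
 then have "ev ?q = \<zero>\<^bsub>A\<^esub>"
 proof -
  have "ev q = \<zero>\<^bsub>A\<^esub>" if "set q \<subseteq> {\<zero>}" for q using that xA by (induction q) (auto simp: ev_Nil ev_Cons)
  then show ?thesis using \<open>set ?q \<subseteq> {\<zero>}\<close> .
 qed
 then have bx: "h \<beta> \<otimes>\<^bsub>A\<^esub> (x \<otimes>\<^bsub>A\<^esub> w) = h \<gamma> \<otimes>\<^bsub>A\<^esub> w"
  using evq hC wC xA by (simp add: h.S.r_right_minus_eq)
 define r where "r = inv \<beta> \<otimes> \<gamma>"
 have rV: "r \<in> V" unfolding r_def by (rule V_mult[OF \<beta>0(2) \<gamma>V])
 have rC: "r \<in> carrier R" by (rule V_carr[OF rV])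
 have hrC: "h r \<in> carrier A" using rC by simp
 have hbb: "h (inv \<beta>) \<otimes>\<^bsub>A\<^esub> h \<beta> = \<one>\<^bsub>A\<^esub>"
  unfolding h.hom_mult[OF \<beta>C(2,1), symmetric] l_inv'[OF \<beta>C(1) \<beta>0(1)] by simp
 have xw: "x \<otimes>\<^bsub>A\<^esub> w = h r \<otimes>\<^bsub>A\<^esub> w"
 proof -
  have "x \<otimes>\<^bsub>A\<^esub> w = (h (inv \<beta>) \<otimes>\<^bsub>A\<^esub> h \<beta>) \<otimes>\<^bsub>A\<^esub> (x \<otimes>\<^bsub>A\<^esub> w)" unfolding hbb using xA wC by simp
  also have "\<dots> = h (inv \<beta>) \<otimes>\<^bsub>A\<^esub> (h \<beta> \<otimes>\<^bsub>A\<^esub> (x \<otimes>\<^bsub>A\<^esub> w))" using hC xA wC by (simp add: h.S.m_assoc)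
  also have "\<dots> = h r \<otimes>\<^bsub>A\<^esub> w" unfolding bx r_def using hC wC \<beta>C \<gamma>C by (simp add: h.S.m_assoc)
  finally show ?thesis .
 qed
 have evw: "ev p \<otimes>\<^bsub>A\<^esub> w = h (lpoly p r) \<otimes>\<^bsub>A\<^esub> w" if "set p \<subseteq> carrier R" for p
  using that
 proof (induction p)
  case Nil then show ?case using wC by (simp add: ev_Nil)
 next
  case (Cons a p)
  have c: "h a \<in> carrier A" "ev p \<in> carrier A" "h (lpoly p r) \<in> carrier A" "a \<in> carrier R" "lpoly p r \<in> carrier R"
   using Cons.prems ev_closed[of p] lpoly_closed[OF _ rC, of p] by auto
  have "ev (a # p) \<otimes>\<^bsub>A\<^esub> w = h a \<otimes>\<^bsub>A\<^esub> w \<oplus>\<^bsub>A\<^esub> x \<otimes>\<^bsub>A\<^esub> (ev p \<otimes>\<^bsub>A\<^esub> w)"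
   using c wC xA by (simp add: ev_Cons h.S.l_distr h.S.m_assoc)
  also have "\<dots> = h a \<otimes>\<^bsub>A\<^esub> w \<oplus>\<^bsub>A\<^esub> h (lpoly p r) \<otimes>\<^bsub>A\<^esub> (x \<otimes>\<^bsub>A\<^esub> w)"
   using Cons c wC xA by (simp add: h.S.m_lcomm)
  also have "\<dots> = h (lpoly (a # p) r) \<otimes>\<^bsub>A\<^esub> w"
   unfolding xw using c wC hrC rC by (simp add: h.S.l_distr h.S.r_distr h.S.m_ac)
  finally show ?case .
 qed
 \<comment> \<open>A coordinate of \<open>w\<close> outside \<open>M\<close> carries statements
   about \<open>h a\<close> times \<open>w\<close> over to the scalar \<open>a\<close>; it is used
   for \<open>f(r) = 0\<close> and for the congruence of \<open>r\<close> and
   \<open>b\<close>.\<close>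
 have py0: "\<exists>y \<in> set py. y \<notin> M"
  using \<beta>M M_lpoly[OF _ b(1), of py] unfolding \<beta>_def by blast
 then obtain y where y: "y \<in> set py" "y \<notin> M" by blast
 have yV: "y \<in> V" using y(1) py(2) by blast
 have scale0: "h a \<otimes>\<^bsub>A\<^esub> w \<in> md S ==> a \<otimes> y \<in> S" if S: "is_mod S" and a: "a \<in> carrier R" for a S
 proof -
  assume m: "h a \<otimes>\<^bsub>A\<^esub> w \<in> md S"
  have "ev (map ((\<otimes>) a) py) \<in> md S" using m unfolding py(1) ev_scale[OF pyc a] .
  then have "set (map ((\<otimes>) a) py) \<subseteq> S" by (rule md_coord[OF S _ scale_carr[OF pyc a]]) (simp add: py(3))
  then show "a \<otimes> y \<in> S" using y(1) by auto
 qed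
 have frC: "lpoly f r \<in> carrier R" by (rule V_carr[OF V_lpoly[OF fc rV]])
 have is0: "is_mod {\<zero>}" unfolding is_mod_def by auto
 have "h (lpoly f r) \<otimes>\<^bsub>A\<^esub> w = \<zero>\<^bsub>A\<^esub>" using evw[of f] fc V_sub wC unfolding ev_f by auto
 moreover have "\<zero>\<^bsub>A\<^esub> \<in> md {\<zero>}" using md_h[OF is0, of \<zero>] by simp
 ultimately have "lpoly f r \<otimes> y = \<zero>" using scale0[OF is0 frC] by simp
 moreover have "y ~= \<zero>" using y(2) by auto
 ultimately have f0: "lpoly f r = \<zero>" using integral[OF _ frC V_carr[OF yV]] by blast
 have rb: "r \<ominus> b \<in> carrier R" using rC b(1) by simp
 have wC': "w \<ominus>\<^bsub>A\<^esub> e \<in> carrier A" using wC eC by simp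
 have "h (r \<ominus> b) \<otimes>\<^bsub>A\<^esub> w = xb \<otimes>\<^bsub>A\<^esub> w"
  unfolding xb_def using xw rC V_carr[OF b(1)] wC xA hrC by (simp add: a_minus_def h.S.l_distr h.S.l_minus)
 also have "\<dots> = xb \<otimes>\<^bsub>A\<^esub> e \<oplus>\<^bsub>A\<^esub> xb \<otimes>\<^bsub>A\<^esub> (w \<ominus>\<^bsub>A\<^esub> e)"
 proof -
  have id: "z \<otimes>\<^bsub>A\<^esub> w = z \<otimes>\<^bsub>A\<^esub> e \<oplus>\<^bsub>A\<^esub> z \<otimes>\<^bsub>A\<^esub> (w \<ominus>\<^bsub>A\<^esub> e)" if "z \<in> carrier A" "w \<in> carrier A" "e \<in> carrier A" for z w e
   using that by - (rule h.S.ring_identity, (rule h.S.ring_rep | assumption | (simp; fail))+, (simp_all add: h.S.l_distr h.S.r_distr h.S.a_ac h.S.m_ac)?)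
  show ?thesis by (rule id[OF xbC wC eC])
 qed
 also have "\<dots> \<in> md M" by (rule md_add[OF is_mod_M xbeM md_V_mult[OF is_mod_M xb we]])
 finally have "(r \<ominus> b) \<otimes> y \<in> M" by (rule scale0[OF is_mod_M rb])
 then have "r \<ominus> b \<in> M" using M_prime[OF V_diff[OF rV b(1)] yV] y(2) by blast
 then have "(r \<ominus> b) \<oplus> (b \<oplus> \<one>) \<in> M" using b(2) M_add by blast
 moreover have "(r \<ominus> b) \<oplus> (b \<oplus> \<one>) = r \<oplus> \<one>"
 proof -
  have id: "(r \<ominus> b) \<oplus> (b \<oplus> \<one>) = r \<oplus> \<one>" if "r \<in> carrier R" "b \<in> carrier R" for r b
   using that by - (rule ring_identity, (rule ring_rep | assumption | (simp; fail))+, (simp_all add: l_distr r_distr a_ac m_ac)?)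
  show ?thesis by (rule id[OF rC V_carr[OF b(1)]])
 qed
 ultimately show ?thesis using rV f0 by auto
qed

end

section \<open>Images of neighbourhoods of regular points\<close>

context cring
begin

text \<open>These record coefficients of a representing polynomial, because its derivatives at the
  origin are its linear coefficients. Multiplying a function without constant term by a variable
  gives one without linear terms, which is how the quadratic part of \<open>z - z^2\<close> drops
  out of the Jacobian matrix.\<close>

definition px_no_const where
 "px_no_const n g \<longleftrightarrow> (\<exists>p e. prep n p e \<and> p {#} = \<zero> \<and> (\<forall>z \<in> pts n. peval e z = g z))"
definition px_no_linear where
 "px_no_linear n g \<longleftrightarrow> (\<exists>p e. prep n p e \<and> (\<forall>j. p {#j#} = \<zero>) \<and> (\<forall>z \<in> pts n. peval e z = g z))"

lemma px_no_const_cong: "px_no_const n g ==> (\<And>z. z \<in> pts n ==> g' z = g z) ==> px_no_const n g'"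
 unfolding px_no_const_def by metis
lemma px_no_linear_cong: "px_no_linear n g ==> (\<And>z. z \<in> pts n ==> g' z = g z) ==> px_no_linear n g'"
 unfolding px_no_linear_def by metis

lemma px_no_const_zero: "px_no_const n (\<lambda>_. \<zero>)"
 unfolding px_no_const_def
 by (intro exI[of _ "indexed_const \<zero>"] exI[of _ "PC \<zero>"] conjI prep.intros) (auto simp: indexed_const_def)
lemma px_no_linear_zero: "px_no_linear n (\<lambda>_. \<zero>)"
 unfolding px_no_linear_def
 by (intro exI[of _ "indexed_const \<zero>"] exI[of _ "PC \<zero>"] conjI prep.intros) (auto simp: indexed_const_def)

lemma px_no_const_add: assumes "px_no_const n g" "px_no_const n g'" shows "px_no_const n (\<lambda>z. g z \<oplus> g' z)"
proof -
 obtain p e p' e' where "prep n p e" "p {#} = \<zero>" "\<forall>z \<in> pts n. peval e z = g z"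
  "prep n p' e'" "p' {#} = \<zero>" "\<forall>z \<in> pts n. peval e' z = g' z" using assms unfolding px_no_const_def by blast
 then show ?thesis unfolding px_no_const_def
  by (intro exI[of _ "indexed_padd p p'"] exI[of _ "PA e e'"] conjI prep.intros) (auto simp: indexed_padd_def)
qed
lemma px_no_linear_add: assumes "px_no_linear n g" "px_no_linear n g'" shows "px_no_linear n (\<lambda>z. g z \<oplus> g' z)"
proof -
 obtain p e p' e' where "prep n p e" "\<forall>j. p {#j#} = \<zero>" "\<forall>z \<in> pts n. peval e z = g z"
  "prep n p' e'" "\<forall>j. p' {#j#} = \<zero>" "\<forall>z \<in> pts n. peval e' z = g' z" using assms unfolding px_no_linear_def by blast
 then show ?thesis unfolding px_no_linear_def
  by (intro exI[of _ "indexed_padd p p'"] exI[of _ "PA e e'"] conjI prep.intros) (auto simp: indexed_padd_def)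
qed
lemma px_no_const_var: "c \<in> carrier R ==> j < n ==> px_no_const n (\<lambda>z. c \<otimes> z j)"
 unfolding px_no_const_def
 by (intro exI[of _ "indexed_pmult (indexed_const c) j"] exI[of _ "PM (PC c) (PV j)"] conjI prep.intros) (auto simp: indexed_pmult_def)
lemma px_no_linear_mult: assumes "px_no_const n g" "j < n" shows "px_no_linear n (\<lambda>z. g z \<otimes> z j)"
proof -
 obtain p e where "prep n p e" "p {#} = \<zero>" "\<forall>z \<in> pts n. peval e z = g z" using assms unfolding px_no_const_def by blast
 then show ?thesis unfolding px_no_linear_def using assms(2)
  by (intro exI[of _ "indexed_pmult p j"] exI[of _ "PM e (PV j)"] conjI prep.intros) (auto simp: indexed_pmult_def)
qed

lemma prep_at_zero: "prep n p e ==> \<forall>i < n. z i = \<zero> ==> peval e z = p {#}"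
proof (induction rule: prep.induct)
 case (prep_mult p e i)
 have "z \<in> pts n" using prep_mult.prems by (simp add: pts_def)
 then have "peval e z \<in> carrier R" using peval_closed prep_pwf[OF prep_mult.hyps(1)] by blast
 then show ?case using prep_mult by (simp add: indexed_pmult_def)
qed (auto simp: indexed_const_def indexed_padd_def)

lemma finprod_zero_factor:
 assumes "finite A" "i \<in> A" "f i = \<zero>" "\<And>j. j \<in> A ==> f j \<in> carrier R"
 shows "(\<Otimes>j\<in>A. f j) = \<zero>"
proof -
 have "(\<Otimes>j\<in>insert i (A - {i}). f j) = f i \<otimes> (\<Otimes>j\<in>A - {i}. f j)"
  using assms by (intro finprod_insert) auto
 moreover have "insert i (A - {i}) = A" using assms by auto
 moreover have "(\<Otimes>j\<in>A - {i}. f j) \<in> carrier R" using assms by (intro finprod_closed) auto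
 ultimately show ?thesis using assms(3) by simp
qed

lemma det_identity:
 "(\<Oplus>\<sigma> \<in> {\<sigma>. \<sigma> permutes {..<n}}. [sign \<sigma>] \<cdot> (\<Otimes>i \<in> {..<n :: nat}. if i = \<sigma> i then \<one> else \<zero>)) = \<one>"
proof -
 let ?S = "{\<sigma>. \<sigma> permutes {..<n}}"
 let ?f = "\<lambda>\<sigma>. [sign \<sigma>] \<cdot> (\<Otimes>i \<in> {..<n}. if i = \<sigma> i then \<one> else \<zero>)"
 have fin: "finite ?S" by (rule finite_permutations) simp
 have z: "?f \<sigma> = \<zero>" if \<sigma>: "\<sigma> \<in> ?S" "\<sigma> ~= id" for \<sigma>
 proof -
  obtain i where i: "\<sigma> i ~= i" using \<sigma>(2) by (auto simp: fun_eq_iff)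
  then have "i < n" using permutes_not_in[of \<sigma> "{..<n}" i] \<sigma>(1) by auto
  then have "(\<Otimes>i \<in> {..<n}. if i = \<sigma> i then \<one> else \<zero>) = \<zero>"
   using i by (intro finprod_zero_factor[of _ i]) auto
  then show ?thesis by simp
 qed
 have o: "?f id = \<one>"
 proof -
  have "(\<Otimes>i \<in> {..<n}. if i = id i then \<one> else \<zero>) = \<one>" by (rule finprod_one_eqI) auto
  then show ?thesis by (simp add: add.int_pow_1)
 qed
 have "id \<in> ?S" by (simp add: permutes_id)
 then have "(\<Oplus>\<sigma> \<in> ?S. ?f \<sigma>) = (\<Oplus>\<sigma> \<in> insert id (?S - {id}). ?f \<sigma>)" by (simp add: insert_absorb)
 also have "\<dots> = ?f id \<oplus> (\<Oplus>\<sigma> \<in> ?S - {id}. ?f \<sigma>)"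
  using fin z o by (intro add.finprod_insert) auto
 also have "(\<Oplus>\<sigma> \<in> ?S - {id}. ?f \<sigma>) = \<zero>" using z by (intro add.finprod_one_eqI) auto
 finally show ?thesis using o by simp
qed

end

section \<open>The map \<open>z - z^2\<close> in coordinates\<close>

context special_root_algebra
begin

definition co where "co a = (SOME p. set p \<subseteq> carrier R \<and> length p = N \<and> ev p = a)"
abbreviation "mdc \<equiv> md (carrier R)"

lemma co: assumes "a \<in> mdc" shows "set (co a) \<subseteq> carrier R" "length (co a) = N" "ev (co a) = a"
proof -
 have "\<exists>p. set p \<subseteq> carrier R \<and> length p = N \<and> ev p = a" using assms unfolding md_def by blast
 from someI_ex[OF this] show "set (co a) \<subseteq> carrier R" "length (co a) = N" "ev (co a) = a" unfolding co_def by blast+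
qed

lemma co_eq: assumes "set p \<subseteq> carrier R" "length p = N" "ev p = a" shows "co a = p"
proof -
 have "a \<in> mdc" using assms unfolding md_def by blast
 from coord_unique[OF co(1)[OF this] assms(1) co(2)[OF this] assms(2)] co(3)[OF this] assms(3) show ?thesis by simp
qed

lemma co_add: assumes "a \<in> mdc" "b \<in> mdc" "i < N" shows "co (a \<oplus>\<^bsub>A\<^esub> b) ! i = co a ! i \<oplus> co b ! i"
proof -
 have "co (a \<oplus>\<^bsub>A\<^esub> b) = ladd (co a) (co b)"
  using ev_ladd[OF co(1)[OF assms(1)] co(1)[OF assms(2)]] co[OF assms(1)] co[OF assms(2)] by (intro co_eq ladd_carr) simp_all
 then show ?thesis using nth_ladd[of "co a" "co b" i] co(2)[OF assms(1)] co(2)[OF assms(2)] assms(3) by simp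
qed

lemma co_h: assumes "a \<in> mdc" "c \<in> carrier R" "i < N" shows "co (h c \<otimes>\<^bsub>A\<^esub> a) ! i = c \<otimes> co a ! i"
proof -
 have "co (h c \<otimes>\<^bsub>A\<^esub> a) = map ((\<otimes>) c) (co a)"
  using ev_scale[OF co(1)[OF assms(1)] assms(2)] co[OF assms(1)] assms(2) by (intro co_eq scale_carr) simp_all
 then show ?thesis using co(2)[OF assms(1)] assms(3) by simp
qed

lemma co_zero: "i < N ==> co \<zero>\<^bsub>A\<^esub> ! i = \<zero>"
proof -
 assume i: "i < N"
 have "ev (replicate n \<zero>) = \<zero>\<^bsub>A\<^esub>" for n using xA by (induction n) (auto simp: ev_Nil ev_Cons)
 then have "co \<zero>\<^bsub>A\<^esub> = replicate N \<zero>" by (intro co_eq) (auto simp del: replicate_Suc)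
 then show ?thesis using i by (simp del: replicate_Suc)
qed

lemma mdc_closed: "a \<in> mdc ==> a \<in> carrier A" by (rule md_sub[OF is_mod_carrier])
lemma mdc_V: "a \<in> md V ==> a \<in> mdc" using md_mono[OF V_sub] by blast
lemma is_mod_cc: "a \<in> carrier R ==> b \<in> carrier R ==> a \<otimes> b \<in> carrier R" by simp
lemma mdc_mult: "a \<in> mdc ==> b \<in> mdc ==> a \<otimes>\<^bsub>A\<^esub> b \<in> mdc"
 by (rule md_mult[OF is_mod_carrier is_mod_carrier is_mod_carrier is_mod_cc])
lemma mdc_add: "a \<in> mdc ==> b \<in> mdc ==> a \<oplus>\<^bsub>A\<^esub> b \<in> mdc" by (rule md_add[OF is_mod_carrier])
lemma mdc_h: "c \<in> carrier R ==> h c \<in> mdc" by (rule md_h[OF is_mod_carrier])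
lemma co_carr: "a \<in> mdc ==> i < N ==> co a ! i \<in> carrier R"
proof -
 assume a: "a \<in> mdc" and i: "i < N"
 have "co a ! i \<in> set (co a)" by (rule nth_mem) (use co(2)[OF a] i in simp)
 then show ?thesis using co(1)[OF a] by blast
qed

lemma map_pts: assumes "z \<in> pts n" "set js \<subseteq> {..<n}" shows "set (map z js) \<subseteq> carrier R"
 using assms by (auto simp: pts_def)

lemma ev_mdc: "set p \<subseteq> carrier R ==> ev p \<in> mdc" by (rule red[OF is_mod_carrier])

text \<open>The factor \<open>a\<close> is there for the induction: the power of \<open>x\<close> in
  front of the tail of the list is moved into it.\<close>

lemma linear_coord:
 assumes i: "i < N"
 shows "set js \<subseteq> {..<n} ==> a \<in> mdc ==> px_no_const n (\<lambda>z. co (ev (map z js) \<otimes>\<^bsub>A\<^esub> a) ! i)"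
proof (induction js arbitrary: a)
 case Nil
 then show ?case using co_zero[OF i] mdc_closed[OF Nil(2)] px_no_const_zero by (simp add: ev_Nil)
next
 case (Cons j js)
 have j: "j < n" "set js \<subseteq> {..<n}" using Cons.prems by auto
 have xa: "x \<otimes>\<^bsub>A\<^esub> a \<in> mdc" by (rule mdc_mult[OF mdc_V[OF md_x] Cons.prems(2)])
 have "px_no_const n (\<lambda>z. co a ! i \<otimes> z j \<oplus> co (ev (map z js) \<otimes>\<^bsub>A\<^esub> (x \<otimes>\<^bsub>A\<^esub> a)) ! i)"
  by (intro px_no_const_add px_no_const_var co_carr Cons.prems(2) i j Cons.IH xa)
 then show ?case
 proof (rule px_no_const_cong)
  fix z assume z: "z \<in> pts n"
  have zj: "z j \<in> carrier R" by (rule ptsD[OF z j(1)])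
  have m: "ev (map z js) \<in> mdc" by (rule ev_mdc[OF map_pts[OF z j(2)]])
  have "ev (map z (j # js)) \<otimes>\<^bsub>A\<^esub> a = h (z j) \<otimes>\<^bsub>A\<^esub> a \<oplus>\<^bsub>A\<^esub> ev (map z js) \<otimes>\<^bsub>A\<^esub> (x \<otimes>\<^bsub>A\<^esub> a)"
   using zj mdc_closed[OF m] mdc_closed[OF Cons.prems(2)] xA by (simp add: ev_Cons h.S.l_distr h.S.r_distr h.S.m_ac)
  then show "co (ev (map z (j # js)) \<otimes>\<^bsub>A\<^esub> a) ! i = co a ! i \<otimes> z j \<oplus> co (ev (map z js) \<otimes>\<^bsub>A\<^esub> (x \<otimes>\<^bsub>A\<^esub> a)) ! i"
   using co_add[OF mdc_mult[OF mdc_h[OF zj] Cons.prems(2)] mdc_mult[OF m xa] i] co_h[OF Cons.prems(2) zj i]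
    m_comm[OF zj co_carr[OF Cons.prems(2) i]] by simp
 qed
qed

lemma quadratic_coord:
 assumes i: "i < N" and ks: "set ks \<subseteq> {..<n}"
 shows "set js \<subseteq> {..<n} ==> a \<in> mdc ==> px_no_linear n (\<lambda>z. co (ev (map z js) \<otimes>\<^bsub>A\<^esub> (ev (map z ks) \<otimes>\<^bsub>A\<^esub> a)) ! i)"
proof (induction js arbitrary: a)
 case Nil
 have "px_no_linear n (\<lambda>_. \<zero>)" by (rule px_no_linear_zero)
 then show ?case
 proof (rule px_no_linear_cong)
  fix z assume z: "z \<in> pts n"
  show "co (ev (map z []) \<otimes>\<^bsub>A\<^esub> (ev (map z ks) \<otimes>\<^bsub>A\<^esub> a)) ! i = \<zero>"
   using co_zero[OF i] mdc_closed[OF mdc_mult[OF ev_mdc[OF map_pts[OF z ks]] Nil(2)]] by (simp add: ev_Nil)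
 qed
next
 case (Cons j js)
 have j: "j < n" "set js \<subseteq> {..<n}" using Cons.prems by auto
 have xa: "x \<otimes>\<^bsub>A\<^esub> a \<in> mdc" by (rule mdc_mult[OF mdc_V[OF md_x] Cons.prems(2)])
 have "px_no_linear n (\<lambda>z. co (ev (map z ks) \<otimes>\<^bsub>A\<^esub> a) ! i \<otimes> z j \<oplus> co (ev (map z js) \<otimes>\<^bsub>A\<^esub> (ev (map z ks) \<otimes>\<^bsub>A\<^esub> (x \<otimes>\<^bsub>A\<^esub> a))) ! i)"
  by (intro px_no_linear_add px_no_linear_mult linear_coord Cons.prems(2) i j ks Cons.IH xa)
 then show ?case
 proof (rule px_no_linear_cong)
  fix z assume z: "z \<in> pts n"
  have zj: "z j \<in> carrier R" by (rule ptsD[OF z j(1)])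
  have m: "ev (map z js) \<in> mdc" by (rule ev_mdc[OF map_pts[OF z j(2)]])
  have k: "ev (map z ks) \<in> mdc" by (rule ev_mdc[OF map_pts[OF z ks]])
  have ka: "ev (map z ks) \<otimes>\<^bsub>A\<^esub> a \<in> mdc" by (rule mdc_mult[OF k Cons.prems(2)])
  have kxa: "ev (map z ks) \<otimes>\<^bsub>A\<^esub> (x \<otimes>\<^bsub>A\<^esub> a) \<in> mdc" by (rule mdc_mult[OF k xa])
  have "ev (map z (j # js)) \<otimes>\<^bsub>A\<^esub> (ev (map z ks) \<otimes>\<^bsub>A\<^esub> a) = h (z j) \<otimes>\<^bsub>A\<^esub> (ev (map z ks) \<otimes>\<^bsub>A\<^esub> a) \<oplus>\<^bsub>A\<^esub> ev (map z js) \<otimes>\<^bsub>A\<^esub> (ev (map z ks) \<otimes>\<^bsub>A\<^esub> (x \<otimes>\<^bsub>A\<^esub> a))"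
   using zj mdc_closed[OF m] mdc_closed[OF k] mdc_closed[OF Cons.prems(2)] xA by (simp add: ev_Cons h.S.l_distr h.S.r_distr h.S.m_ac)
  then show "co (ev (map z (j # js)) \<otimes>\<^bsub>A\<^esub> (ev (map z ks) \<otimes>\<^bsub>A\<^esub> a)) ! i =
   co (ev (map z ks) \<otimes>\<^bsub>A\<^esub> a) ! i \<otimes> z j \<oplus> co (ev (map z js) \<otimes>\<^bsub>A\<^esub> (ev (map z ks) \<otimes>\<^bsub>A\<^esub> (x \<otimes>\<^bsub>A\<^esub> a))) ! i"
   using co_add[OF mdc_mult[OF mdc_h[OF zj] ka] mdc_mult[OF m kxa] i] co_h[OF ka zj i]
    m_comm[OF zj co_carr[OF ka i]] by simp
 qed
qed

abbreviation "pt z \<equiv> ev (map z [0..<N])"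

text \<open>The coordinates of \<open>z - z\<^sup>2\<close> on \<open>A\<close> are polynomials whose linear part is the identity. This map is
 multiplicative up to the group law \<open>z + w - 2 z w\<close>, in every characteristic.\<close>

lemma idempotent_map:
 "\<exists>P. \<forall>i < N. P i \<in> mpoly_set R N \<and>
  (\<forall>z \<in> pts N. mpoly_eval R N (P i) z = co (pt z \<ominus>\<^bsub>A\<^esub> pt z \<otimes>\<^bsub>A\<^esub> pt z) ! i) \<and>
  (\<forall>z j. (\<forall>k < N. z k = \<zero>) --> mpoly_eval R N (mpoly_deriv R j (P i)) z = (if i = j then \<one> else \<zero>))"
proof -
 have m1: "\<ominus>\<^bsub>A\<^esub> \<one>\<^bsub>A\<^esub> \<in> mdc" by (rule mdc_V[OF md_minus[OF is_mod_V md_one]])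
 have s: "set [0..<N] \<subseteq> {..<N}" by auto
 have "\<exists>P. P \<in> mpoly_set R N \<and>
  (\<forall>z \<in> pts N. mpoly_eval R N P z = co (pt z \<ominus>\<^bsub>A\<^esub> pt z \<otimes>\<^bsub>A\<^esub> pt z) ! i) \<and>
  (\<forall>z j. (\<forall>k < N. z k = \<zero>) --> mpoly_eval R N (mpoly_deriv R j P) z = (if i = j then \<one> else \<zero>))" if i: "i < N" for i
 proof -
  obtain p e where pe: "prep N p e" "\<forall>j. p {#j#} = \<zero>"
   "\<forall>z \<in> pts N. peval e z = co (pt z \<otimes>\<^bsub>A\<^esub> (pt z \<otimes>\<^bsub>A\<^esub> (\<ominus>\<^bsub>A\<^esub> \<one>\<^bsub>A\<^esub>))) ! i"
   using quadratic_coord[OF i s s m1] unfolding px_no_linear_def by blast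
  let ?v = "indexed_pmult (indexed_const \<one>) i"
  let ?P = "indexed_padd ?v p" and ?e = "PA (PM (PC \<one>) (PV i)) e"
  have P: "prep N ?P ?e" using pe(1) i by (auto intro!: prep.intros)
  have "mpoly_eval R N ?P z = co (pt z \<ominus>\<^bsub>A\<^esub> pt z \<otimes>\<^bsub>A\<^esub> pt z) ! i" if z: "z \<in> pts N" for z
  proof -
   have zc: "set (map z [0..<N]) \<subseteq> carrier R" by (rule map_pts[OF z s])
   have pm: "pt z \<in> mdc" by (rule ev_mdc[OF zc])
   have pC: "pt z \<in> carrier A" by (rule mdc_closed[OF pm])
   have "co (pt z) = map z [0..<N]" by (rule co_eq[OF zc]) simp_all
   then have cz: "co (pt z) ! i = z i" using i by (simp del: upt_Suc)
   have e: "pt z \<ominus>\<^bsub>A\<^esub> pt z \<otimes>\<^bsub>A\<^esub> pt z = pt z \<oplus>\<^bsub>A\<^esub> pt z \<otimes>\<^bsub>A\<^esub> (pt z \<otimes>\<^bsub>A\<^esub> (\<ominus>\<^bsub>A\<^esub> \<one>\<^bsub>A\<^esub>))"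
    using pC by (simp add: a_minus_def h.S.r_minus del: upt_Suc)
   have "co (pt z \<ominus>\<^bsub>A\<^esub> pt z \<otimes>\<^bsub>A\<^esub> pt z) ! i = z i \<oplus> peval e z"
    unfolding e co_add[OF pm mdc_mult[OF pm mdc_mult[OF pm m1]] i] cz using pe(3) z by simp
   then show ?thesis using prep_eval[OF P z] ptsD[OF z i] by simp
  qed
  moreover have "mpoly_eval R N (mpoly_deriv R j ?P) z = (if i = j then \<one> else \<zero>)" if z: "\<forall>k < N. z k = \<zero>" for z j
  proof -
   have zp: "z \<in> pts N" using z by (simp add: pts_def)
   obtain e' where e': "prep N (mpoly_deriv R j ?P) e'" using prep_deriv[OF P] by blast
   have "mpoly_eval R N (mpoly_deriv R j ?P) z = mpoly_deriv R j ?P {#}"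
    using prep_eval[OF e' zp] prep_at_zero[OF e' z] by simp
   also have "\<dots> = ?P {#j#}" using prep_carrier[OF P, of "{#j#}"] by (simp add: mpoly_deriv_def)
   also have "\<dots> = (if i = j then \<one> else \<zero>)" using pe(2) by (simp add: indexed_padd_def indexed_pmult_def indexed_const_def)
   finally show ?thesis .
  qed
  ultimately show ?thesis using prep_mpoly_set[OF P] by blast
 qed
 then show ?thesis by metis
qed

end

lemma (in valued_field) regular_approximate_SP:
 assumes reg: "interior_image_at_regular_points K G v"
 shows "valuation_subring.approximate_SP K (val_set K G v)"
proof -
 interpret VS: valuation_subring K "val_set K G v" by (rule valuation_subring_val_set)
 show ?thesis unfolding VS.approximate_SP_def
 proof (intro allI impI)
  fix l assume l: "set l \<subseteq> VS.M"
   and ap: "\<forall>c\<in>carrier K - {\<zero>\<^bsub>K\<^esub>}. \<exists>b\<in>val_set K G v. b \<oplus>\<^bsub>K\<^esub> \<one>\<^bsub>K\<^esub> \<in> VS.M \<and> VS.sdv c (K.lpoly (l @ [\<one>\<^bsub>K\<^esub>, \<one>\<^bsub>K\<^esub>]) b)"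
  have lc: "set (l @ [\<one>\<^bsub>K\<^esub>]) \<subseteq> carrier K" using l VS.M_carr by auto
  obtain A :: "(nat \<Rightarrow> 'a) set ring" and h x where A: "ring_hom_cring K A h" "x \<in> carrier A"
   "ring.lpoly A (map h ((l @ [\<one>\<^bsub>K\<^esub>]) @ [\<one>\<^bsub>K\<^esub>])) x = \<zero>\<^bsub>A\<^esub>"
   "\<forall>p. set p \<subseteq> carrier K --> length p \<le> length (l @ [\<one>\<^bsub>K\<^esub>]) --> ring.lpoly A (map h p) x = \<zero>\<^bsub>A\<^esub> --> set p \<subseteq> {\<zero>\<^bsub>K\<^esub>}"
   using K.root_algebra_exists[OF lc] by blast
  interpret H: ring_hom_cring K A h by (rule A(1))
  interpret S: special_root_algebra K "val_set K G v" A h x l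
  proof (intro special_root_algebra.intro VS.valuation_subring_axioms A(1) special_root_algebra_axioms.intro A(2) l)
   show "ring.lpoly A (map h (l @ [\<one>\<^bsub>K\<^esub>, \<one>\<^bsub>K\<^esub>])) x = \<zero>\<^bsub>A\<^esub>" using A(3) by simp
   show "set p \<subseteq> {\<zero>\<^bsub>K\<^esub>}" if "set p \<subseteq> carrier K" "length p \<le> Suc (length l)" "ring.lpoly A (map h p) x = \<zero>\<^bsub>A\<^esub>" for p
    using A(4)[rule_format, OF that(1) _ that(3)] that(2) by simp
  qed
  define n where "n = Suc (length l)"
  obtain P where P: "\<And>i. i < n ==> P i \<in> mpoly_set K n"
   "\<And>i z. i < n ==> z \<in> K.pts n ==> mpoly_eval K n (P i) z = S.co (S.pt z \<ominus>\<^bsub>A\<^esub> S.pt z \<otimes>\<^bsub>A\<^esub> S.pt z) ! i"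
   "\<And>i z j. i < n ==> (\<forall>k < n. z k = \<zero>\<^bsub>K\<^esub>) ==> mpoly_eval K n (mpoly_deriv K j (P i)) z = (if i = j then \<one>\<^bsub>K\<^esub> else \<zero>\<^bsub>K\<^esub>)"
   using S.idempotent_map unfolding n_def[symmetric] by blast
  define z0 where "z0 = (\<lambda>i \<in> {..<n}. \<zero>\<^bsub>K\<^esub>)"
  have z0: "z0 \<in> {..<n} \<rightarrow>\<^sub>E carrier K" "\<forall>k < n. z0 k = \<zero>\<^bsub>K\<^esub>" by (auto simp: z0_def)
  have "jacobian_det K n P z0 = (\<Oplus>\<^bsub>K\<^esub>\<sigma> \<in> {\<sigma>. \<sigma> permutes {..<n}}. [sign \<sigma>] \<cdot>\<^bsub>K\<^esub> (\<Otimes>\<^bsub>K\<^esub>i \<in> {..<n}. if i = \<sigma> i then \<one>\<^bsub>K\<^esub> else \<zero>\<^bsub>K\<^esub>))"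
   unfolding jacobian_det_def
  proof (rule K.add.finprod_cong')
   fix \<sigma>
   have "(\<Otimes>\<^bsub>K\<^esub>i \<in> {..<n}. mpoly_eval K n (mpoly_deriv K (\<sigma> i) (P i)) z0) = (\<Otimes>\<^bsub>K\<^esub>i \<in> {..<n}. if i = \<sigma> i then \<one>\<^bsub>K\<^esub> else \<zero>\<^bsub>K\<^esub>)"
    by (rule K.finprod_cong') (use P(3)[OF _ z0(2)] in auto)
   then show "[sign \<sigma>] \<cdot>\<^bsub>K\<^esub> (\<Otimes>\<^bsub>K\<^esub>i \<in> {..<n}. mpoly_eval K n (mpoly_deriv K (\<sigma> i) (P i)) z0) =
    [sign \<sigma>] \<cdot>\<^bsub>K\<^esub> (\<Otimes>\<^bsub>K\<^esub>i \<in> {..<n}. if i = \<sigma> i then \<one>\<^bsub>K\<^esub> else \<zero>\<^bsub>K\<^esub>)" by simp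
  next
   have "(\<Otimes>\<^bsub>K\<^esub>i \<in> {..<n}. if i = \<sigma> i then \<one>\<^bsub>K\<^esub> else \<zero>\<^bsub>K\<^esub>) \<in> carrier K" for \<sigma> by (rule K.finprod_closed) auto
   then show "(\<lambda>\<sigma>. [sign \<sigma>] \<cdot>\<^bsub>K\<^esub> (\<Otimes>\<^bsub>K\<^esub>i \<in> {..<n}. if i = \<sigma> i then \<one>\<^bsub>K\<^esub> else \<zero>\<^bsub>K\<^esub>)) \<in> {\<sigma>. \<sigma> permutes {..<n}} \<rightarrow> carrier K"
    by (intro funcsetI K.add.int_pow_closed)
  qed simp
  then have jac: "jacobian_det K n P z0 ~= \<zero>\<^bsub>K\<^esub>" unfolding K.det_identity by simp
  \<comment> \<open>On this neighbourhood of the origin the corresponding elements of the algebra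
    lie in \<open>md M\<close>, so the preimages found below have the form required by
    \<open>root_of_interior\<close>.\<close>
  define U where "U = {z \<in> {..<n} \<rightarrow>\<^sub>E carrier K. \<forall>i < n. z i \<in> VS.M}"
  have one: "\<one>\<^bsub>K\<^esub> \<in> carrier K - {\<zero>\<^bsub>K\<^esub>}" by simp
  have openU: "openin (val_topology_pow K G v n) U"
   unfolding openin_val_topology_pow
  proof (intro conjI ballI bexI[OF _ one] subsetI)
   fix z y assume z: "z \<in> U" and y: "y \<in> box n z \<one>\<^bsub>K\<^esub>"
   have "y i \<in> VS.M" if i: "i < n" for i
   proof -
    have zi: "z i \<in> VS.M" using z i unfolding U_def by blast
    have yi: "y i \<in> carrier K" "y i \<ominus>\<^bsub>K\<^esub> z i \<in> VS.M" using y i unfolding box_def VS.sdv_one by (auto simp: PiE_iff)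
    have "(y i \<ominus>\<^bsub>K\<^esub> z i) \<oplus>\<^bsub>K\<^esub> z i = y i" using yi(1) VS.M_carr[OF zi] by (simp add: K.minus_eq K.a_assoc K.l_neg)
    then show ?thesis using VS.M_add[OF yi(2) zi] by simp
   qed
   then show "y \<in> U" using y unfolding U_def box_def by blast
  qed (auto simp: U_def)
  have z0U: "z0 \<in> U" using z0 VS.M_zero unfolding U_def by auto
  have "val_topology_pow K G v n interior_of (poly_map K n P ` U) ~= {}"
   using reg[unfolded interior_image_at_regular_points_def, rule_format, of n P z0 U] P(1) z0(1) jac openU z0U by blast
  then obtain y0 W where W: "openin (val_topology_pow K G v n) W" "y0 \<in> W" "W \<subseteq> poly_map K n P ` U"
   unfolding interior_of_def by blast
  obtain c where c: "c \<in> carrier K - {\<zero>\<^bsub>K\<^esub>}" "box n y0 c \<subseteq> W"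
   using W(1,2) unfolding openin_val_topology_pow by blast
  \<comment> \<open>The ball lies around the value at some \<open>u\<close>, which need not be the
    origin. This \<open>u\<close> is the element \<open>u1\<close> of
    \<open>root_of_interior\<close>.\<close>
  obtain u where u: "u \<in> U" "y0 = poly_map K n P u" using W(2,3) by blast
  have Upts: "z \<in> K.pts n" if "z \<in> U" for z using that unfolding U_def K.pts_def by (auto simp: PiE_iff)
  have UM: "S.pt z \<in> S.md VS.M" if "z \<in> U" for z
   using that unfolding U_def n_def by (intro S.red[OF S.is_mod_M]) auto
  have Umdc: "S.pt z \<in> S.mdc" if "z \<in> U" for z using S.md_mono[of VS.M "carrier K"] UM[OF that] VS.M_carr by blast
  have pm: "poly_map K n P z i = S.co (S.pt z \<ominus>\<^bsub>A\<^esub> S.pt z \<otimes>\<^bsub>A\<^esub> S.pt z) ! i" if "z \<in> U" "i < n" for z i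
   using P(2)[OF that(2) Upts[OF that(1)]] that(2) unfolding poly_map_def by simp
  have qmdc: "a \<ominus>\<^bsub>A\<^esub> a \<otimes>\<^bsub>A\<^esub> a \<in> S.mdc" if "a \<in> S.mdc" for a
   by (rule S.md_diff[OF S.is_mod_carrier that S.mdc_mult[OF that that]])
  let ?u = "S.pt u"
  have cC: "c \<in> carrier K" using c(1) by simp
  note Sc = S.is_mod_sdv[OF cC]
  have img: "\<exists>t \<in> S.md VS.M. t \<ominus>\<^bsub>A\<^esub> t \<otimes>\<^bsub>A\<^esub> t = y"
   if y: "y \<in> carrier A" "y \<ominus>\<^bsub>A\<^esub> (?u \<ominus>\<^bsub>A\<^esub> ?u \<otimes>\<^bsub>A\<^esub> ?u) \<in> S.md {y. VS.sdv c y}" for y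
  proof -
   define q where "q = ?u \<ominus>\<^bsub>A\<^esub> ?u \<otimes>\<^bsub>A\<^esub> ?u"
   have q: "q \<in> S.mdc" unfolding q_def by (rule qmdc[OF Umdc[OF u(1)]])
   have d: "y \<ominus>\<^bsub>A\<^esub> q \<in> S.md {y. VS.sdv c y}" using y(2) unfolding q_def .
   have dm: "y \<ominus>\<^bsub>A\<^esub> q \<in> S.mdc" using d S.md_mono[OF S.is_modD(1)[OF Sc]] by blast
   have yq: "y = (y \<ominus>\<^bsub>A\<^esub> q) \<oplus>\<^bsub>A\<^esub> q" using y(1) S.mdc_closed[OF q] by (simp add: H.S.minus_eq H.S.a_assoc H.S.l_neg)
   then have ym: "y \<in> S.mdc" using S.mdc_add[OF dm q] by simp
   define yv where "yv = (\<lambda>i \<in> {..<n}. S.co y ! i)"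
   have "yv \<in> box n y0 c" unfolding box_def
   proof (intro CollectI conjI allI impI)
    show "yv \<in> {..<n} \<rightarrow>\<^sub>E carrier K" unfolding yv_def using S.co_carr[OF ym] n_def by auto
    fix i assume i: "i < n"
    then have i': "i < Suc (length l)" by (simp add: n_def)
    have "S.co y ! i = S.co (y \<ominus>\<^bsub>A\<^esub> q) ! i \<oplus>\<^bsub>K\<^esub> S.co q ! i" using S.co_add[OF dm q i'] yq by simp
    then have e: "yv i \<ominus>\<^bsub>K\<^esub> y0 i = S.co (y \<ominus>\<^bsub>A\<^esub> q) ! i"
     unfolding u(2) pm[OF u(1) i] q_def[symmetric] yv_def
     using i VS.add_diff_cancel_right[OF S.co_carr[OF dm i'] S.co_carr[OF q i']] by simp
    have "S.ev (S.co (y \<ominus>\<^bsub>A\<^esub> q)) \<in> S.md {y. VS.sdv c y}" using S.co(3)[OF dm] d by simp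
    from S.md_coord[OF Sc this S.co(1)[OF dm] S.co(2)[OF dm]]
    have "S.co (y \<ominus>\<^bsub>A\<^esub> q) ! i \<in> {y. VS.sdv c y}" using nth_mem[of i "S.co (y \<ominus>\<^bsub>A\<^esub> q)"] S.co(2)[OF dm] i' by (metis subsetD)
    then show "VS.sdv c (yv i \<ominus>\<^bsub>K\<^esub> y0 i)" unfolding e by blast
   qed
   then obtain t where t: "t \<in> U" "yv = poly_map K n P t" using c(2) W(3) by blast
   define w where "w = S.pt t \<ominus>\<^bsub>A\<^esub> S.pt t \<otimes>\<^bsub>A\<^esub> S.pt t"
   have w: "w \<in> S.mdc" unfolding w_def by (rule qmdc[OF Umdc[OF t(1)]])
   have "S.co w = S.co y"
   proof (rule nth_equalityI)
    show "length (S.co w) = length (S.co y)" using S.co(2)[OF w] S.co(2)[OF ym] by simp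
    fix i assume "i < length (S.co w)"
    then have i: "i < n" using S.co(2)[OF w] by (simp add: n_def)
    have "S.co w ! i = yv i" unfolding t(2) pm[OF t(1) i] w_def ..
    then show "S.co w ! i = S.co y ! i" using i by (simp add: yv_def)
   qed
   then have "S.ev (S.co w) = S.ev (S.co y)" by (rule arg_cong)
   then have "w = y" unfolding S.co(3)[OF w] S.co(3)[OF ym] .
   then show ?thesis unfolding w_def by (rule bexI[OF _ UM[OF t(1)]])
  qed
  \<comment> \<open>The precision \<open>c\<close> is dictated by the ball inside the image; the
    approximate zero is chosen only after it.\<close>
  obtain b where b: "b \<in> val_set K G v" "b \<oplus>\<^bsub>K\<^esub> \<one>\<^bsub>K\<^esub> \<in> VS.M" "VS.sdv c (K.lpoly (l @ [\<one>\<^bsub>K\<^esub>, \<one>\<^bsub>K\<^esub>]) b)"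
   using ap[rule_format, OF c(1)] by (elim bexE conjE) (rule that)
  show "\<exists>x\<in>val_set K G v. x \<oplus>\<^bsub>K\<^esub> \<one>\<^bsub>K\<^esub> \<in> VS.M \<and> K.lpoly (l @ [\<one>\<^bsub>K\<^esub>, \<one>\<^bsub>K\<^esub>]) x = \<zero>\<^bsub>K\<^esub>"
   by (rule S.root_of_interior[OF c(1) UM[OF u(1)] img b])
 qed
qed

section \<open>Linear algebra\<close>

context cring
begin

lemma fsum_closed: "(\<And>i. i \<in> A ==> f i \<in> carrier R) ==> (\<Oplus>i\<in>A. f i) \<in> carrier R"
 by (rule add.finprod_closed) auto

lemma fsum_insert: "finite A ==> a \<notin> A ==> (\<And>i. i \<in> insert a A ==> f i \<in> carrier R) ==>
  (\<Oplus>i\<in>insert a A. f i) = f a \<oplus> (\<Oplus>i\<in>A. f i)"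
 by (rule add.finprod_insert) auto

lemma fsum_cong: "A = B ==> (\<And>i. i \<in> B ==> f i = g i) ==> (\<And>i. i \<in> B ==> g i \<in> carrier R) ==>
  (\<Oplus>i\<in>A. f i) = (\<Oplus>i\<in>B. g i)"
 by (rule add.finprod_cong') auto

lemma fsum_add: "(\<And>i. i \<in> A ==> f i \<in> carrier R) ==> (\<And>i. i \<in> A ==> g i \<in> carrier R) ==>
  (\<Oplus>i\<in>A. f i \<oplus> g i) = (\<Oplus>i\<in>A. f i) \<oplus> (\<Oplus>i\<in>A. g i)"
 by (rule add.finprod_multf) auto

lemma fsum_mult: "finite A ==> c \<in> carrier R ==> (\<And>i. i \<in> A ==> f i \<in> carrier R) ==>
  (\<Oplus>i\<in>A. c \<otimes> f i) = c \<otimes> (\<Oplus>i\<in>A. f i)"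
 by (rule finsum_rdistr[symmetric]) auto

lemma fsum_mult_right: "finite A ==> c \<in> carrier R ==> (\<And>i. i \<in> A ==> f i \<in> carrier R) ==>
  (\<Oplus>i\<in>A. f i \<otimes> c) = (\<Oplus>i\<in>A. f i) \<otimes> c"
 by (rule finsum_ldistr[symmetric]) auto

lemma fsum_zero: "(\<And>i. i \<in> A ==> f i = \<zero>) ==> (\<Oplus>i\<in>A. f i) = \<zero>"
 by (rule add.finprod_one_eqI)

lemma fsum_remove: "finite A ==> a \<in> A ==> (\<And>i. i \<in> A ==> f i \<in> carrier R) ==>
  (\<Oplus>i\<in>A. f i) = f a \<oplus> (\<Oplus>i\<in>A - {a}. f i)"
 using fsum_insert[of "A - {a}" a f] by (simp add: insert_absorb)

lemma fsum_single: "finite A ==> a \<in> A ==> f a \<in> carrier R ==> (\<And>i. i \<in> A ==> i ~= a ==> f i = \<zero>) ==>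
  (\<Oplus>i\<in>A. f i) = f a"
proof -
 assume a: "finite A" "a \<in> A" "f a \<in> carrier R" and z: "\<And>i. i \<in> A ==> i ~= a ==> f i = \<zero>"
 have c: "f i \<in> carrier R" if "i \<in> A" for i using a z[OF that] by (cases "i = a") auto
 have "(\<Oplus>i\<in>A - {a}. f i) = \<zero>" by (rule fsum_zero) (use z in blast)
 then show ?thesis using fsum_remove[OF a(1,2) c] a(3) by simp
qed

lemma fsum_minus: "finite A ==> (\<And>i. i \<in> A ==> f i \<in> carrier R) ==> (\<Oplus>i\<in>A. \<ominus> f i) = \<ominus> (\<Oplus>i\<in>A. f i)"
proof -
 assume a: "finite A" "\<And>i. i \<in> A ==> f i \<in> carrier R"
 have "(\<Oplus>i\<in>A. \<ominus> f i) = (\<Oplus>i\<in>A. (\<ominus> \<one>) \<otimes> f i)" by (rule fsum_cong) (auto simp: l_minus a)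
 also have "\<dots> = \<ominus> (\<Oplus>i\<in>A. f i)" using fsum_mult[OF a(1) _ a(2), of "\<ominus> \<one>"] fsum_closed[of A f] a by (simp add: l_minus)
 finally show ?thesis .
qed

lemma fsum_swap:
 assumes "finite A" "finite B" "\<And>a b. a \<in> A ==> b \<in> B ==> f a b \<in> carrier R"
 shows "(\<Oplus>a\<in>A. \<Oplus>b\<in>B. f a b) = (\<Oplus>b\<in>B. \<Oplus>a\<in>A. f a b)"
 using assms(1,3)
proof (induction A rule: finite_induct)
 case (insert x A)
 have "(\<Oplus>a\<in>insert x A. \<Oplus>b\<in>B. f a b) = (\<Oplus>b\<in>B. f x b) \<oplus> (\<Oplus>a\<in>A. \<Oplus>b\<in>B. f a b)"
  using insert by (intro fsum_insert fsum_closed) auto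
 also have "\<dots> = (\<Oplus>b\<in>B. f x b) \<oplus> (\<Oplus>b\<in>B. \<Oplus>a\<in>A. f a b)" using insert by simp
 also have "\<dots> = (\<Oplus>b\<in>B. f x b \<oplus> (\<Oplus>a\<in>A. f a b))" using insert by (intro fsum_add[symmetric] fsum_closed) auto
 also have "\<dots> = (\<Oplus>b\<in>B. \<Oplus>a\<in>insert x A. f a b)"
  using insert fsum_insert[of A x "\<lambda>a. f a _"] by (intro fsum_cong) (auto intro!: a_closed fsum_closed)
 finally show ?case .
qed (simp add: fsum_zero)

definition det where
 "det n A = (\<Oplus>\<sigma> \<in> {\<sigma>. \<sigma> permutes {..<n}}. [sign \<sigma>] \<cdot> (\<Otimes>i \<in> {..<n :: nat}. A i (\<sigma> i)))"

text \<open>Composition with the transposition of the equal rows pairs even permutations with odd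
  ones, and paired terms cancel. Deducing only that the determinant equals its negative would say
  nothing in characteristic 2.\<close>

lemma det_equal_rows:
 assumes A: "\<And>i j. i < n ==> j < n ==> A i j \<in> carrier R"
  and i: "p < n" "q < n" "p ~= q" and eq: "\<And>j. j < n ==> A p j = A q j"
 shows "det n A = \<zero>"
proof -
 let ?S = "{\<sigma>. \<sigma> permutes {..<n}}" and ?t = "transpose p q"
 let ?g = "\<lambda>\<sigma>. (\<Otimes>i \<in> {..<n}. A i (\<sigma> i))"
 let ?f = "\<lambda>\<sigma>. [sign \<sigma>] \<cdot> ?g \<sigma>"
 have tp: "?t permutes {..<n}" using i by (simp add: permutes_swap_id)
 have fin: "finite ?S" by (rule finite_permutations) simp
 have \<sigma>c: "A i (\<sigma> i) \<in> carrier R" if "\<sigma> permutes {..<n}" "i < n" for \<sigma> i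
  using A[OF that(2)] permutes_in_image[OF that(1), of i] that(2) by simp
 have gc: "?g \<sigma> \<in> carrier R" if "\<sigma> permutes {..<n}" for \<sigma> by (rule finprod_closed) (use \<sigma>c[OF that] in auto)
 have fc: "?f \<sigma> \<in> carrier R" if "\<sigma> \<in> ?S" for \<sigma> using gc that by (auto intro!: add.int_pow_closed)
 let ?E = "{\<sigma> \<in> ?S. evenperm \<sigma>}" and ?O = "{\<sigma> \<in> ?S. \<not> evenperm \<sigma>}"
 have gt: "?g (\<sigma> \<circ> ?t) = ?g \<sigma>" if \<sigma>: "\<sigma> permutes {..<n}" for \<sigma>
 proof -
  have "?g (\<sigma> \<circ> ?t) = (\<Otimes>i \<in> ?t ` {..<n}. A i ((\<sigma> \<circ> ?t) i))" by (simp add: permutes_image[OF tp])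
  also have "\<dots> = (\<Otimes>i \<in> {..<n}. A (?t i) ((\<sigma> \<circ> ?t) (?t i)))"
  proof (rule finprod_reindex)
   show "inj_on ?t {..<n}" by (rule inj_on_subset[OF permutes_inj[OF tp]]) simp
   have "\<sigma> \<circ> ?t permutes {..<n}" by (rule permutes_compose[OF tp \<sigma>])
   then show "(\<lambda>i. A i ((\<sigma> \<circ> ?t) i)) \<in> ?t ` {..<n} \<rightarrow> carrier R" using \<sigma>c[of "\<sigma> \<circ> ?t"] by (auto simp: permutes_image[OF tp])
  qed
  also have "\<dots> = ?g \<sigma>"
  proof (rule finprod_cong')
   fix i assume "i \<in> {..<n}"
   then have si: "\<sigma> i < n" using permutes_in_image[OF \<sigma>, of i] by simp
   show "A (?t i) ((\<sigma> \<circ> ?t) (?t i)) = A i (\<sigma> i)"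
    using eq[OF si] by (auto simp: transpose_def)
  qed (use \<sigma>c[OF \<sigma>] in auto)
  finally show ?thesis .
 qed
 have sg: "sign (\<sigma> \<circ> ?t) = - sign \<sigma>" if \<sigma>: "\<sigma> permutes {..<n}" for \<sigma>
  using sign_compose[of \<sigma> ?t] permutation_permutes[of \<sigma>] permutation_permutes[of ?t] \<sigma> tp i(3)
  by (auto simp: sign_swap_id)
 have ev: "evenperm (\<sigma> \<circ> ?t) \<longleftrightarrow> \<not> evenperm \<sigma>" if "\<sigma> permutes {..<n}" for \<sigma>
  using sg[OF that] by (simp add: sign_def split: if_splits)
 have bij: "(\<lambda>\<sigma>. \<sigma> \<circ> ?t) ` ?E = ?O"
 proof
  show "(\<lambda>\<sigma>. \<sigma> \<circ> ?t) ` ?E \<subseteq> ?O"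
   using ev permutes_compose[OF tp] by auto
  show "?O \<subseteq> (\<lambda>\<sigma>. \<sigma> \<circ> ?t) ` ?E"
  proof
   fix \<sigma> assume \<sigma>: "\<sigma> \<in> ?O"
   then have "\<sigma> \<circ> ?t \<in> ?E" using ev[of \<sigma>] permutes_compose[OF tp, of \<sigma>] by auto
   moreover have "\<sigma> = (\<sigma> \<circ> ?t) \<circ> ?t" by (simp add: comp_assoc)
   ultimately show "\<sigma> \<in> (\<lambda>\<sigma>. \<sigma> \<circ> ?t) ` ?E" by (intro image_eqI)
  qed
 qed
 have inj: "inj_on (\<lambda>\<sigma>. \<sigma> \<circ> ?t) ?E"
 proof (rule inj_onI)
  fix a b assume "a \<circ> ?t = b \<circ> ?t"
  then have "(a \<circ> ?t) \<circ> ?t = (b \<circ> ?t) \<circ> ?t" by simp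
  then show "a = b" by (simp add: comp_assoc)
 qed
 have "det n A = (\<Oplus>\<sigma>\<in>?E \<union> ?O. ?f \<sigma>)" unfolding det_def by (rule arg_cong2[where f = "finsum R"]) auto
 also have "\<dots> = (\<Oplus>\<sigma>\<in>?E. ?f \<sigma>) \<oplus> (\<Oplus>\<sigma>\<in>?O. ?f \<sigma>)"
  using fin fc by (intro add.finprod_Un_disjoint) auto
 also have "(\<Oplus>\<sigma>\<in>?O. ?f \<sigma>) = (\<Oplus>\<sigma>\<in>(\<lambda>\<sigma>. \<sigma> \<circ> ?t) ` ?E. ?f \<sigma>)" unfolding bij ..
 also have "\<dots> = (\<Oplus>\<sigma>\<in>?E. ?f (\<sigma> \<circ> ?t))"
  by (rule add.finprod_reindex[OF _ inj]) (use fc bij in auto)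
 also have "\<dots> = (\<Oplus>\<sigma>\<in>?E. \<ominus> ?f \<sigma>)"
 proof (rule fsum_cong)
  fix \<sigma> assume \<sigma>: "\<sigma> \<in> ?E"
  then have p: "\<sigma> permutes {..<n}" by simp
  show "?f (\<sigma> \<circ> ?t) = \<ominus> ?f \<sigma>" unfolding gt[OF p] sg[OF p] using gc[OF p] by (simp add: add.int_pow_neg)
  show "\<ominus> ?f \<sigma> \<in> carrier R" using fc[of \<sigma>] p by simp
 qed simp
 also have "\<dots> = \<ominus> (\<Oplus>\<sigma>\<in>?E. ?f \<sigma>)" using fin fc by (intro fsum_minus) auto
 finally show ?thesis using fsum_closed[of ?E ?f] fc by (simp add: r_neg)
qed

text \<open>Let \<open>B k\<close> be \<open>A\<close> with row \<open>p\<close> replaced by row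
  \<open>k\<close>. By linearity in that row the sum of the \<open>c k det (B k)\<close> is zero.
  All terms with \<open>k \<noteq> p\<close> vanish because of two equal rows, and
  \<open>B p = A\<close>.\<close>

lemma det_row_dependent:
 assumes A: "\<And>i j. i < n ==> j < n ==> A i j \<in> carrier R"
  and c: "\<And>i. i < n ==> c i \<in> carrier R" and p: "p < n"
  and dep: "\<And>j. j < n ==> (\<Oplus>i\<in>{..<n}. c i \<otimes> A i j) = \<zero>"
 shows "c p \<otimes> det n A = \<zero>"
proof -
 let ?S = "{\<sigma>. \<sigma> permutes {..<n}}"
 have fin: "finite ?S" by (rule finite_permutations) simp
 have \<sigma>n: "\<sigma> i < n" if "\<sigma> \<in> ?S" "i < n" for \<sigma> i
  using permutes_in_image[of \<sigma> "{..<n}" i] that by simp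
 let ?r = "\<lambda>\<sigma>. \<Otimes>i \<in> {..<n} - {p}. A i (\<sigma> i)"
 have rc: "?r \<sigma> \<in> carrier R" if "\<sigma> \<in> ?S" for \<sigma> by (rule finprod_closed) (use A \<sigma>n[OF that] in auto)
 have split: "(\<Otimes>i \<in> {..<n}. B i (\<sigma> i)) = B p (\<sigma> p) \<otimes> (\<Otimes>i \<in> {..<n} - {p}. B i (\<sigma> i))"
  if "\<sigma> \<in> ?S" "\<And>i j. i < n ==> j < n ==> B i j \<in> carrier R" for B \<sigma>
 proof -
  have "{..<n} = insert p ({..<n} - {p})" using p by auto
  then have "(\<Otimes>i \<in> {..<n}. B i (\<sigma> i)) = (\<Otimes>i \<in> insert p ({..<n} - {p}). B i (\<sigma> i))" by simp
  also have "\<dots> = B p (\<sigma> p) \<otimes> (\<Otimes>i \<in> {..<n} - {p}. B i (\<sigma> i))"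
   using that(2) \<sigma>n[OF that(1)] p by (intro finprod_insert) auto
  finally show ?thesis .
 qed
 define B where "B k = A(p := A k)" for k
 have Bc: "B k i j \<in> carrier R" if "k < n" "i < n" "j < n" for k i j using A that by (simp add: B_def)
 have pB: "(\<Otimes>i \<in> {..<n}. B k i (\<sigma> i)) = A k (\<sigma> p) \<otimes> ?r \<sigma>" if k: "k < n" and \<sigma>: "\<sigma> \<in> ?S" for k \<sigma>
 proof -
  have "(\<Otimes>i \<in> {..<n} - {p}. B k i (\<sigma> i)) = ?r \<sigma>" by (rule finprod_cong') (use A \<sigma>n[OF \<sigma>] in \<open>auto simp: B_def\<close>)
  then show ?thesis using split[OF \<sigma>, of "B k"] Bc[OF k] by (simp add: B_def)
 qed
 have z: "(\<Oplus>k\<in>{..<n}. c k \<otimes> (\<Otimes>i \<in> {..<n}. B k i (\<sigma> i))) = \<zero>" if \<sigma>: "\<sigma> \<in> ?S" for \<sigma>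
 proof -
  have "(\<Oplus>k\<in>{..<n}. c k \<otimes> (\<Otimes>i \<in> {..<n}. B k i (\<sigma> i))) = (\<Oplus>k\<in>{..<n}. (c k \<otimes> A k (\<sigma> p)) \<otimes> ?r \<sigma>)"
   using c A \<sigma>n[OF \<sigma> p] rc[OF \<sigma>] by (intro fsum_cong) (auto simp: pB[OF _ \<sigma>] m_assoc)
  also have "\<dots> = (\<Oplus>k\<in>{..<n}. c k \<otimes> A k (\<sigma> p)) \<otimes> ?r \<sigma>"
   using c A \<sigma>n[OF \<sigma> p] rc[OF \<sigma>] by (intro fsum_mult_right) auto
  finally show ?thesis using dep[OF \<sigma>n[OF \<sigma> p]] rc[OF \<sigma>] by simp
 qed
 have Bp: "(\<Otimes>i \<in> {..<n}. B k i (\<sigma> i)) \<in> carrier R" if "k < n" "\<sigma> \<in> ?S" for k \<sigma>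
  by (rule finprod_closed) (use Bc that \<sigma>n in auto)
 have dB: "c k \<otimes> det n (B k) = (\<Oplus>\<sigma>\<in>?S. [sign \<sigma>] \<cdot> (c k \<otimes> (\<Otimes>i \<in> {..<n}. B k i (\<sigma> i))))" if k: "k < n" for k
 proof -
  have "c k \<otimes> det n (B k) = (\<Oplus>\<sigma>\<in>?S. c k \<otimes> ([sign \<sigma>] \<cdot> (\<Otimes>i \<in> {..<n}. B k i (\<sigma> i))))"
   unfolding det_def using fin c[OF k] Bp[OF k] by (intro fsum_mult[symmetric] add.int_pow_closed) auto
  also have "\<dots> = (\<Oplus>\<sigma>\<in>?S. [sign \<sigma>] \<cdot> (c k \<otimes> (\<Otimes>i \<in> {..<n}. B k i (\<sigma> i))))"
   using c[OF k] Bp[OF k] by (intro fsum_cong) (auto simp: add_pow_rdistr_int intro!: add.int_pow_closed)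
  finally show ?thesis .
 qed
 have "(\<Oplus>k\<in>{..<n}. c k \<otimes> det n (B k)) = (\<Oplus>k\<in>{..<n}. \<Oplus>\<sigma>\<in>?S. [sign \<sigma>] \<cdot> (c k \<otimes> (\<Otimes>i \<in> {..<n}. B k i (\<sigma> i))))"
  using dB c Bp by (intro fsum_cong) (auto intro!: fsum_closed add.int_pow_closed)
 also have "\<dots> = (\<Oplus>\<sigma>\<in>?S. \<Oplus>k\<in>{..<n}. [sign \<sigma>] \<cdot> (c k \<otimes> (\<Otimes>i \<in> {..<n}. B k i (\<sigma> i))))"
  using fin c Bp by (intro fsum_swap) (auto intro!: add.int_pow_closed)
 also have "\<dots> = \<zero>"
 proof (rule fsum_zero)
  fix \<sigma> assume \<sigma>: "\<sigma> \<in> ?S"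
  let ?s = "[sign \<sigma>] \<cdot> \<one>"
  have sc: "?s \<in> carrier R" by (intro add.int_pow_closed) simp
  have "(\<Oplus>k\<in>{..<n}. [sign \<sigma>] \<cdot> (c k \<otimes> (\<Otimes>i \<in> {..<n}. B k i (\<sigma> i)))) = (\<Oplus>k\<in>{..<n}. ?s \<otimes> (c k \<otimes> (\<Otimes>i \<in> {..<n}. B k i (\<sigma> i))))"
   using c Bp[OF _ \<sigma>] sc by (intro fsum_cong) (auto simp: add_pow_ldistr_int)
  also have "\<dots> = ?s \<otimes> (\<Oplus>k\<in>{..<n}. c k \<otimes> (\<Otimes>i \<in> {..<n}. B k i (\<sigma> i)))"
   using c Bp[OF _ \<sigma>] sc by (intro fsum_mult) auto
  finally show "(\<Oplus>k\<in>{..<n}. [sign \<sigma>] \<cdot> (c k \<otimes> (\<Otimes>i \<in> {..<n}. B k i (\<sigma> i)))) = \<zero>" using z[OF \<sigma>] sc by simp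
 qed
 finally have "(\<Oplus>k\<in>{..<n}. c k \<otimes> det n (B k)) = \<zero>" .
 moreover have "(\<Oplus>k\<in>{..<n}. c k \<otimes> det n (B k)) = c p \<otimes> det n (B p)"
 proof (rule fsum_single)
  have d: "det n (B k) = \<zero>" if "k < n" "k ~= p" for k
   using Bc[OF that(1)] p that by (intro det_equal_rows[of n "B k" p k]) (auto simp: B_def)
  show "c k \<otimes> det n (B k) = \<zero>" if "k \<in> {..<n}" "k ~= p" for k using d[of k] c[of k] that by simp
  show "c p \<otimes> det n (B p) \<in> carrier R"
   unfolding det_def using c[OF p] Bp[OF p] by (intro m_closed fsum_closed add.int_pow_closed) auto
 qed (use p in auto)
 moreover have "B p = A" by (simp add: B_def)
 ultimately show ?thesis by simp
qed

lemma binomial: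
 assumes a: "a \<in> carrier R" and b: "b \<in> carrier R"
 shows "(a \<oplus> b) [^] n = (\<Oplus>k\<in>{..n}. [(n choose k)] \<cdot> (a [^] k \<otimes> b [^] (n - k)))"
proof (induction n)
 case 0
 show ?case using a b by simp
next
 case (Suc n)
 let ?F = "\<lambda>n k. [(n choose k)] \<cdot> (a [^] k \<otimes> b [^] (n - k))"
 have F: "?F n k \<in> carrier R" for n k using a b by simp
 have bF: "b \<otimes> ?F n k = [(n choose k)] \<cdot> (a [^] k \<otimes> b [^] (Suc n - k))" if "k \<le> n" for k
 proof -
  have "b \<otimes> (a [^] k \<otimes> b [^] (n - k)) = a [^] k \<otimes> b [^] (Suc n - k)"
   using a b that by (simp add: Suc_diff_le m_ac)
  then show ?thesis using a b add_pow_rdistr[of b "a [^] k \<otimes> b [^] (n - k)" "n choose k"] by simp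
 qed
 have aF: "a \<otimes> ?F n k = [(n choose k)] \<cdot> (a [^] Suc k \<otimes> b [^] (n - k))" for k
 proof -
  have "a \<otimes> (a [^] k \<otimes> b [^] (n - k)) = a [^] Suc k \<otimes> b [^] (n - k)" using a b by (simp add: m_ac)
  then show ?thesis using a b add_pow_rdistr[of a "a [^] k \<otimes> b [^] (n - k)" "n choose k"] by simp
 qed
 let ?G = "\<lambda>k. [(n choose k)] \<cdot> (a [^] k \<otimes> b [^] (Suc n - k))"
 have G: "?G k \<in> carrier R" for k using a b by simp
 have "(\<Oplus>k\<in>{..Suc n}. ?F (Suc n) k) = (\<Oplus>k\<in>{..n}. ?F (Suc n) (Suc k)) \<oplus> ?F (Suc n) 0"
  by (rule finsum_Suc2) (use F in auto)
 also have "(\<Oplus>k\<in>{..n}. ?F (Suc n) (Suc k)) = (\<Oplus>k\<in>{..n}. a \<otimes> ?F n k \<oplus> ?G (Suc k))"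
 proof (rule fsum_cong)
  fix k
  have "?F (Suc n) (Suc k) = [((n choose k) + (n choose Suc k))] \<cdot> (a [^] Suc k \<otimes> b [^] (n - k))" by simp
  also have "\<dots> = a \<otimes> ?F n k \<oplus> ?G (Suc k)"
   unfolding aF using a b by (simp add: add.nat_pow_mult[symmetric] del: nat_pow_Suc)
  finally show "?F (Suc n) (Suc k) = a \<otimes> ?F n k \<oplus> ?G (Suc k)" .
  show "a \<otimes> ?F n k \<oplus> ?G (Suc k) \<in> carrier R" using a F G by blast
 qed simp
 also have "\<dots> = (\<Oplus>k\<in>{..n}. a \<otimes> ?F n k) \<oplus> (\<Oplus>k\<in>{..n}. ?G (Suc k))"
  by (rule fsum_add) (use a F G in blast)+
 also have "\<dots> \<oplus> ?F (Suc n) 0 = (\<Oplus>k\<in>{..n}. a \<otimes> ?F n k) \<oplus> ((\<Oplus>k\<in>{..n}. ?G (Suc k)) \<oplus> ?G 0)"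
  using a b F G by (subst a_assoc) (auto intro!: fsum_closed simp del: nat_pow_Suc)
 also have "(\<Oplus>k\<in>{..n}. ?G (Suc k)) \<oplus> ?G 0 = (\<Oplus>k\<in>{..Suc n}. ?G k)"
  by (rule finsum_Suc2[symmetric]) (use G in auto)
 also have "\<dots> = ?G (Suc n) \<oplus> (\<Oplus>k\<in>{..n}. ?G k)"
  by (rule finsum_Suc) (use G in auto)
 also have "\<dots> = (\<Oplus>k\<in>{..n}. b \<otimes> ?F n k)"
 proof -
  have "(\<Oplus>k\<in>{..n}. ?G k) = (\<Oplus>k\<in>{..n}. b \<otimes> ?F n k)"
   by (rule fsum_cong) (use a b F bF in auto)
  moreover have "?G (Suc n) = \<zero>" using a b by (simp add: binomial_eq_0)
  moreover have "(\<Oplus>k\<in>{..n}. b \<otimes> ?F n k) \<in> carrier R" by (rule fsum_closed) (use b F in blast)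
  ultimately show ?thesis by simp
 qed
 also have "(\<Oplus>k\<in>{..n}. a \<otimes> ?F n k) \<oplus> (\<Oplus>k\<in>{..n}. b \<otimes> ?F n k) = (a \<oplus> b) \<otimes> (\<Oplus>k\<in>{..n}. ?F n k)"
  using a b F fsum_mult[of "{..n}" a "?F n"] fsum_mult[of "{..n}" b "?F n"] fsum_closed[of "{..n}" "?F n"]
  by (simp add: l_distr)
 also have "\<dots> = (a \<oplus> b) [^] Suc n" using Suc.IH a b by (simp add: m_comm)
 finally show ?case ..
qed

lemma add_pow_one: "a \<in> carrier R ==> [(m :: nat)] \<cdot> a = ([m] \<cdot> \<one>) \<otimes> a"
 by (simp add: add_pow_ldistr)

lemma frobenius_add:
 assumes p: "Factorial_Ring.prime (p :: nat)" and c: "[p] \<cdot> \<one> = \<zero>" and a: "a \<in> carrier R" and b: "b \<in> carrier R"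
 shows "(a \<oplus> b) [^] p = a [^] p \<oplus> b [^] p"
proof -
 let ?F = "\<lambda>k. [(p choose k)] \<cdot> (a [^] k \<otimes> b [^] (p - k))"
 have p0: "p > 0" using p by (simp add: prime_gt_0_nat)
 have F: "?F k \<in> carrier R" for k using a b by simp
 have z: "?F k = \<zero>" if k: "0 < k" "k < p" for k
 proof -
  obtain m where m: "p choose k = p * m" using dvd_choose_prime[OF k(2) _ _ p] k p0 by (auto elim: dvdE)
  have "[(p * m)] \<cdot> \<one> = [m] \<cdot> ([p] \<cdot> \<one>)" by (simp add: add.nat_pow_pow)
  then have "[(p choose k)] \<cdot> \<one> = \<zero>" unfolding m c by simp
  moreover have "a [^] k \<otimes> b [^] (p - k) \<in> carrier R" using a b by simp
  ultimately show ?thesis using add_pow_one[of "a [^] k \<otimes> b [^] (p - k)" "p choose k"] by simp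
 qed
 have "(\<Oplus>k\<in>{..p}. ?F k) = ?F 0 \<oplus> (\<Oplus>k\<in>{..p} - {0}. ?F k)" by (rule fsum_remove) (use F in auto)
 also have "(\<Oplus>k\<in>{..p} - {0}. ?F k) = ?F p" by (rule fsum_single) (use F z p0 a b in auto)
 finally show ?thesis using binomial[OF a b, of p] a b by (simp add: a_comm)
qed

end

context field
begin

text \<open>Gaussian elimination: unless every \<open>a i j\<close> is zero for the new equation
  \<open>j\<close>, a pivot \<open>i0\<close> removes this equation together with one
  unknown.\<close>

lemma elimination:
 assumes "finite J"
 shows "finite I ==> card J < card I ==> (\<And>i j. i \<in> I ==> j \<in> J ==> a i j \<in> carrier R) ==>
  \<exists>c. (\<forall>i \<in> I. c i \<in> carrier R) \<and> (\<exists>i \<in> I. c i ~= \<zero>) \<and> (\<forall>j \<in> J. (\<Oplus>i\<in>I. c i \<otimes> a i j) = \<zero>)"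
 using assms
proof (induction J arbitrary: I a rule: finite_induct)
 case empty
 then have "I ~= {}" by auto
 then show ?case by (intro exI[of _ "\<lambda>_. \<one>"]) auto
next
 case (insert j J)
 show ?case
 proof (cases "\<forall>i \<in> I. a i j = \<zero>")
  case True
  have "card J < card I" using insert by simp
  then obtain c where c: "\<forall>i \<in> I. c i \<in> carrier R" "\<exists>i \<in> I. c i ~= \<zero>" "\<forall>j \<in> J. (\<Oplus>i\<in>I. c i \<otimes> a i j) = \<zero>"
   using insert.IH[of I a] insert.prems by auto
  have "(\<Oplus>i\<in>I. c i \<otimes> a i j) = \<zero>" by (rule fsum_zero) (use c True in auto)
  then show ?thesis using c by auto
 next
  case False
  then obtain i0 where i0: "i0 \<in> I" "a i0 j ~= \<zero>" by auto
  have ac: "a i k \<in> carrier R" if "i \<in> I" "k \<in> insert j J" for i k using insert.prems(3) that by blast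
  define v where "v = inv (a i0 j)"
  have u: "a i0 j \<in> Units R" using i0 ac[OF i0(1)] field_Units by auto
  then have v: "v \<in> carrier R" "a i0 j \<otimes> v = \<one>" "v \<otimes> a i0 j = \<one>" unfolding v_def by auto
  let ?I = "I - {i0}"
  define b where "b i k = a i k \<ominus> (a i j \<otimes> v) \<otimes> a i0 k" for i k
  have fin: "finite ?I" "finite I" using insert.prems by auto
  have "card J < card ?I" using insert i0 by (simp add: card_Diff_singleton)
  then obtain c where c: "\<forall>i \<in> ?I. c i \<in> carrier R" "\<exists>i \<in> ?I. c i ~= \<zero>" "\<forall>k \<in> J. (\<Oplus>i\<in>?I. c i \<otimes> b i k) = \<zero>"
   using insert.IH[of ?I b] fin ac i0 v(1) unfolding b_def by auto
  have cc: "c i \<in> carrier R" if "i \<in> ?I" for i using c that by blast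
  define s where "s = (\<Oplus>i\<in>?I. c i \<otimes> (a i j \<otimes> v))"
  have sc: "s \<in> carrier R" unfolding s_def using cc ac v by (intro fsum_closed) auto
  define d where "d = c(i0 := \<ominus> s)"
  have dc: "d i \<in> carrier R" if "i \<in> I" for i using cc sc that by (simp add: d_def)
  have tot: "(\<Oplus>i\<in>I. d i \<otimes> a i k) = \<ominus> s \<otimes> a i0 k \<oplus> (\<Oplus>i\<in>?I. c i \<otimes> a i k)" if k: "k \<in> insert j J" for k
  proof -
   have "(\<Oplus>i\<in>I. d i \<otimes> a i k) = d i0 \<otimes> a i0 k \<oplus> (\<Oplus>i\<in>?I. d i \<otimes> a i k)"
    by (rule fsum_remove) (use fin i0 dc ac k in auto)
   also have "(\<Oplus>i\<in>?I. d i \<otimes> a i k) = (\<Oplus>i\<in>?I. c i \<otimes> a i k)"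
    by (rule fsum_cong) (use cc ac k in \<open>auto simp: d_def\<close>)
   finally show ?thesis by (simp add: d_def)
  qed
  have "(\<Oplus>i\<in>I. d i \<otimes> a i k) = \<zero>" if k: "k \<in> insert j J" for k
  proof -
   have S: "(\<Oplus>i\<in>?I. c i \<otimes> a i k) \<in> carrier R" using cc ac k by (intro fsum_closed) auto
   have sk: "s \<otimes> a i0 k = (\<Oplus>i\<in>?I. (c i \<otimes> (a i j \<otimes> v)) \<otimes> a i0 k)"
    unfolding s_def using fin cc ac i0 v k by (intro fsum_mult_right[symmetric]) auto
   have kz: "(\<Oplus>i\<in>?I. c i \<otimes> b i k) = \<zero>"
   proof (cases "k = j")
    case True
    show ?thesis
    proof (rule fsum_zero)
     fix i assume i: "i \<in> ?I"
     have "b i k = \<zero>" unfolding b_def True using ac[of i j] i ac[OF i0(1), of j] v by (simp add: m_assoc r_right_minus_eq)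
     then show "c i \<otimes> b i k = \<zero>" using cc[OF i] by simp
    qed
   next
    case False then show ?thesis using c(3) k by auto
   qed
   have "(\<Oplus>i\<in>?I. c i \<otimes> a i k) = (\<Oplus>i\<in>?I. c i \<otimes> b i k \<oplus> (c i \<otimes> (a i j \<otimes> v)) \<otimes> a i0 k)"
   proof (rule fsum_cong)
    fix i assume i: "i \<in> ?I"
    have id: "c \<otimes> a = c \<otimes> (a \<ominus> e \<otimes> f) \<oplus> (c \<otimes> e) \<otimes> f"
     if "c \<in> carrier R" "a \<in> carrier R" "e \<in> carrier R" "f \<in> carrier R" for c a e f
     using that by - (rule ring_identity, (rule ring_rep | assumption | (simp; fail))+, (simp_all add: l_distr r_distr a_ac m_ac)?)
    have C: "a i k \<in> carrier R" "a i j \<otimes> v \<in> carrier R" "a i0 k \<in> carrier R" using ac i i0 k v by auto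
    show "c i \<otimes> a i k = c i \<otimes> b i k \<oplus> (c i \<otimes> (a i j \<otimes> v)) \<otimes> a i0 k" unfolding b_def by (rule id[OF cc[OF i] C])
    show "c i \<otimes> b i k \<oplus> (c i \<otimes> (a i j \<otimes> v)) \<otimes> a i0 k \<in> carrier R" unfolding b_def using cc[OF i] C by simp
   qed simp
   also have "\<dots> = (\<Oplus>i\<in>?I. c i \<otimes> b i k) \<oplus> s \<otimes> a i0 k"
    unfolding sk by (rule fsum_add) (use cc ac i0 k v in \<open>auto simp: b_def\<close>)
   finally have "(\<Oplus>i\<in>?I. c i \<otimes> a i k) = s \<otimes> a i0 k" using kz sc ac[OF i0(1) k] by simp
   then show ?thesis unfolding tot[OF k] using sc ac[OF i0(1) k] by (simp add: l_minus l_neg)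
  qed
  moreover have "\<exists>i \<in> I. d i ~= \<zero>" using c(2) by (auto simp: d_def)
  ultimately show ?thesis using dc by (intro exI[of _ d]) blast
 qed
qed

section \<open>Linear independence of functions and of their p-th powers\<close>

definition indep where
 "indep Xs I u \<longleftrightarrow> (\<forall>c. (\<forall>i \<in> I. c i \<in> carrier R) --> (\<forall>x \<in> Xs. (\<Oplus>i\<in>I. c i \<otimes> u i x) = \<zero>) --> (\<forall>i \<in> I. c i = \<zero>))"

text \<open>Finite linear combinations of evaluations at points. They are generated inductively so
  that the twist by Frobenius, which acts on the coefficients, can be constructed by
  induction.\<close>

inductive fnl :: "'x set \<Rightarrow> (('x \<Rightarrow> 'a) \<Rightarrow> 'a) \<Rightarrow> bool" for Xs where
 fnl_zero: "fnl Xs (\<lambda>_. \<zero>)"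
| fnl_ev: "x \<in> Xs ==> fnl Xs (\<lambda>f. f x)"
| fnl_add: "fnl Xs L ==> fnl Xs L' ==> fnl Xs (\<lambda>f. L f \<oplus> L' f)"
| fnl_scale: "fnl Xs L ==> a \<in> carrier R ==> fnl Xs (\<lambda>f. a \<otimes> L f)"

lemma fnl_closed: "fnl Xs L ==> (\<And>x. x \<in> Xs ==> f x \<in> carrier R) ==> L f \<in> carrier R"
 by (induction rule: fnl.induct) auto

lemma fnl_cong: "fnl Xs L ==> (\<And>x. x \<in> Xs ==> f x = g x) ==> L f = L g"
 by (induction rule: fnl.induct) auto

lemma fnl_sum: "finite I ==> (\<And>i. i \<in> I ==> fnl Xs (L i)) ==> (\<And>i. i \<in> I ==> a i \<in> carrier R) ==>
 \<exists>L'. fnl Xs L' \<and> (\<forall>f. (\<forall>x \<in> Xs. f x \<in> carrier R) --> L' f = (\<Oplus>i\<in>I. a i \<otimes> L i f))"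
proof (induction I rule: finite_induct)
 case empty
 show ?case by (intro exI[of _ "\<lambda>_. \<zero>"]) (auto intro: fnl.intros)
next
 case (insert j I)
 then obtain L' where L': "fnl Xs L'" "\<forall>f. (\<forall>x \<in> Xs. f x \<in> carrier R) --> L' f = (\<Oplus>i\<in>I. a i \<otimes> L i f)" by auto
 have "fnl Xs (\<lambda>f. a j \<otimes> L j f \<oplus> L' f)" using insert.prems L' by (auto intro!: fnl_add fnl_scale)
 moreover have "a j \<otimes> L j f \<oplus> L' f = (\<Oplus>i\<in>insert j I. a i \<otimes> L i f)" if "\<forall>x \<in> Xs. f x \<in> carrier R" for f
  using fsum_insert[of I j "\<lambda>i. a i \<otimes> L i f"] insert L'(2) that fnl_closed[OF insert.prems(1)] by auto
 ultimately show ?case by (intro exI[of _ "\<lambda>f. a j \<otimes> L j f \<oplus> L' f"]) blast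
qed

lemma fnl_linear:
 assumes "finite I" "\<And>i. i \<in> I ==> c i \<in> carrier R" "\<And>i x. i \<in> I ==> x \<in> Xs ==> u i x \<in> carrier R"
 shows "fnl Xs L ==> L (\<lambda>x. \<Oplus>i\<in>I. c i \<otimes> u i x) = (\<Oplus>i\<in>I. c i \<otimes> L (u i))"
proof (induction rule: fnl.induct)
 case fnl_zero
 show ?case by (rule fsum_zero[symmetric]) (use assms in auto)
next
 case (fnl_add L L')
 have C: "L (u i) \<in> carrier R" "L' (u i) \<in> carrier R" if "i \<in> I" for i
  using fnl_closed fnl_add.hyps assms(3) that by blast+
 have "(\<Oplus>i\<in>I. c i \<otimes> L (u i)) \<oplus> (\<Oplus>i\<in>I. c i \<otimes> L' (u i)) = (\<Oplus>i\<in>I. c i \<otimes> L (u i) \<oplus> c i \<otimes> L' (u i))"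
  by (rule fsum_add[symmetric]) (use assms C in auto)
 also have "\<dots> = (\<Oplus>i\<in>I. c i \<otimes> (L (u i) \<oplus> L' (u i)))" by (rule fsum_cong) (use assms C in \<open>auto simp: r_distr\<close>)
 finally show ?case using fnl_add.IH by simp
next
 case (fnl_scale L a)
 have C: "L (u i) \<in> carrier R" if "i \<in> I" for i using fnl_closed fnl_scale.hyps assms(3) that by blast
 have "a \<otimes> (\<Oplus>i\<in>I. c i \<otimes> L (u i)) = (\<Oplus>i\<in>I. a \<otimes> (c i \<otimes> L (u i)))"
  by (rule fsum_mult[symmetric]) (use assms C fnl_scale.hyps in auto)
 also have "\<dots> = (\<Oplus>i\<in>I. c i \<otimes> (a \<otimes> L (u i)))" by (rule fsum_cong) (use assms C fnl_scale.hyps in \<open>auto simp: m_lcomm\<close>)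
 finally show ?case using fnl_scale.IH by simp
qed simp

lemma indep_subset:
 assumes "finite I" "J \<subseteq> I" "indep Xs I u" "\<And>i x. i \<in> I ==> x \<in> Xs ==> u i x \<in> carrier R"
 shows "indep Xs J u"
 unfolding indep_def
proof (intro allI impI)
 fix c assume c: "\<forall>i \<in> J. c i \<in> carrier R" and z: "\<forall>x \<in> Xs. (\<Oplus>i\<in>J. c i \<otimes> u i x) = \<zero>"
 define d where "d i = (if i \<in> J then c i else \<zero>)" for i
 have dc: "d i \<in> carrier R" for i using c by (simp add: d_def)
 have "(\<Oplus>i\<in>I. d i \<otimes> u i x) = \<zero>" if x: "x \<in> Xs" for x
 proof -
  have "(\<Oplus>i\<in>J. c i \<otimes> u i x) = (\<Oplus>i\<in>I. d i \<otimes> u i x)"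
   by (rule add.finprod_mono_neutral_cong_left) (use assms c x in \<open>auto simp: d_def\<close>)
  then show ?thesis using z x by simp
 qed
 then have "\<forall>i \<in> I. d i = \<zero>" using assms(3) dc unfolding indep_def by blast
 then show "\<forall>i \<in> J. c i = \<zero>" using assms(2) d_def by (metis subsetD)
qed

text \<open>By independence the difference \<open>g\<close> of \<open>u a\<close> and its projection
  to the earlier functions is non-zero at some \<open>x\<close>. Evaluation at \<open>x\<close>,
  corrected on the earlier functions and divided by \<open>g x\<close>, is dual to
  \<open>u a\<close>; multiples of it then adjust the earlier functionals.\<close>

lemma dual_functionals:
 assumes "finite I"
 shows "(\<And>i x. i \<in> I ==> x \<in> Xs ==> u i x \<in> carrier R) ==> indep Xs I u ==>
  \<forall>i \<in> I. \<exists>L. fnl Xs L \<and> (\<forall>j \<in> I. L (u j) = (if i = j then \<one> else \<zero>))"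
 using assms
proof (induction I rule: finite_induct)
 case (insert a I)
 have uc: "u i x \<in> carrier R" if "i \<in> insert a I" "x \<in> Xs" for i x using insert.prems that by blast
 have "indep Xs I u" using indep_subset[of "insert a I" I Xs u] insert by blast
 then have "\<forall>i \<in> I. \<exists>L. fnl Xs L \<and> (\<forall>j \<in> I. L (u j) = (if i = j then \<one> else \<zero>))" using insert by blast
 then obtain L where L: "\<And>i. i \<in> I ==> fnl Xs (L i)" "\<And>i j. i \<in> I ==> j \<in> I ==> L i (u j) = (if i = j then \<one> else \<zero>)"
  by metis
 have Lc: "L i (u j) \<in> carrier R" if "i \<in> I" "j \<in> insert a I" for i j using fnl_closed[OF L(1)] uc that by blast
 define g where "g x = u a x \<ominus> (\<Oplus>i\<in>I. u i x \<otimes> L i (u a))" for x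
 have sumc: "(\<Oplus>i\<in>I. u i x \<otimes> L i (u a)) \<in> carrier R" if "x \<in> Xs" for x using uc Lc that by (intro fsum_closed) auto
 have "\<exists>x \<in> Xs. g x ~= \<zero>"
 proof (rule ccontr)
  assume "\<not> (\<exists>x \<in> Xs. g x ~= \<zero>)"
  then have z: "g x = \<zero>" if "x \<in> Xs" for x using that by blast
  define c where "c i = (if i = a then \<one> else \<ominus> L i (u a))" for i
  have cc: "\<forall>i \<in> insert a I. c i \<in> carrier R" using Lc by (auto simp: c_def)
  have "(\<Oplus>i\<in>insert a I. c i \<otimes> u i x) = \<zero>" if x: "x \<in> Xs" for x
  proof -
   have "(\<Oplus>i\<in>insert a I. c i \<otimes> u i x) = c a \<otimes> u a x \<oplus> (\<Oplus>i\<in>I. c i \<otimes> u i x)"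
    by (rule fsum_insert) (use insert.hyps cc uc x in auto)
   also have "(\<Oplus>i\<in>I. c i \<otimes> u i x) = (\<Oplus>i\<in>I. \<ominus> (u i x \<otimes> L i (u a)))"
    by (rule fsum_cong) (use insert.hyps Lc uc x in \<open>auto simp: c_def l_minus r_minus m_comm\<close>)
   also have "\<dots> = \<ominus> (\<Oplus>i\<in>I. u i x \<otimes> L i (u a))" by (rule fsum_minus) (use insert.hyps Lc uc x in auto)
   finally show ?thesis using z[OF x] uc x by (simp add: g_def c_def a_minus_def)
  qed
  then have "c a = \<zero>" using insert.prems(2) cc unfolding indep_def by blast
  then show False by (simp add: c_def)
 qed
 then obtain x where x: "x \<in> Xs" "g x ~= \<zero>" by blast
 define v where "v = inv (g x)"
 have gc: "g x \<in> carrier R" unfolding g_def using uc sumc x by simp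
 have v: "v \<in> carrier R" "v \<otimes> g x = \<one>" using gc x(2) field_Units unfolding v_def by auto
 have "\<exists>K. fnl Xs K \<and> (\<forall>f. (\<forall>x \<in> Xs. f x \<in> carrier R) --> K f = (\<Oplus>i\<in>I. u i x \<otimes> L i f))"
  by (rule fnl_sum[OF insert.hyps(1)]) (use L(1) uc x in auto)
 then obtain K where K: "fnl Xs K" "\<And>f. (\<forall>x \<in> Xs. f x \<in> carrier R) ==> K f = (\<Oplus>i\<in>I. u i x \<otimes> L i f)"
  by blast
 define D where "D = (\<lambda>f. v \<otimes> (f x \<oplus> \<ominus> \<one> \<otimes> K f))"
 have D: "fnl Xs D" unfolding D_def by (intro fnl_scale fnl_add fnl_ev x(1) K(1) v(1)) simp
 have Kc: "K (u j) \<in> carrier R" if "j \<in> insert a I" for j using fnl_closed[OF K(1)] uc that by blast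
 have Da: "D (u a) = \<one>"
 proof -
  have "K (u a) = (\<Oplus>i\<in>I. u i x \<otimes> L i (u a))" using K(2)[of "u a"] uc by auto
  then have "u a x \<oplus> \<ominus> \<one> \<otimes> K (u a) = g x" unfolding g_def using sumc[OF x(1)] by (simp add: a_minus_def l_minus)
  then show ?thesis unfolding D_def using v by simp
 qed
 have Dj: "D (u j) = \<zero>" if j: "j \<in> I" for j
 proof -
  have ux: "u i x \<in> carrier R" if "i \<in> insert a I" for i using uc x that by blast
  have "K (u j) = (\<Oplus>i\<in>I. u i x \<otimes> L i (u j))" using K(2)[of "u j"] uc j by auto
  also have "\<dots> = u j x \<otimes> L j (u j)" by (rule fsum_single) (use insert.hyps j ux L(2) in auto)
  also have "\<dots> = u j x" using L(2)[OF j j] ux j by simp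
  finally show ?thesis unfolding D_def using ux j v by (simp add: l_minus r_neg)
 qed
 show ?case
 proof
  fix i assume i: "i \<in> insert a I"
  show "\<exists>L. fnl Xs L \<and> (\<forall>j \<in> insert a I. L (u j) = (if i = j then \<one> else \<zero>))"
  proof (cases "i = a")
   case True
   then show ?thesis using D Da Dj insert.hyps(2) by (intro exI[of _ D]) auto
  next
   case False
   then have iI: "i \<in> I" using i by blast
   let ?L = "\<lambda>f. L i f \<oplus> \<ominus> L i (u a) \<otimes> D f"
   have lc: "L i (u a) \<in> carrier R" using Lc iI by blast
   have "fnl Xs ?L" by (intro fnl_add fnl_scale L(1) iI D) (use lc in simp)
   moreover have "?L (u j) = (if i = j then \<one> else \<zero>)" if j: "j \<in> insert a I" for j
   proof (cases "j = a")
    case True then show ?thesis using Da lc False by (simp add: r_neg)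
   next
    case F: False
    then have "j \<in> I" using j by blast
    then show ?thesis using Dj L(2)[OF iI] lc by simp
   qed
   ultimately show ?thesis by (intro exI[of _ ?L]) blast
  qed
 qed
qed simp

text \<open>A non-zero determinant makes the rows independent as functions of the column index.
  Functionals on such functions are column vectors, so the functionals dual to the rows are the
  columns of the inverse.\<close>

lemma right_inverse:
 assumes A: "\<And>i j. i < n ==> j < n ==> A i j \<in> carrier R" and d: "det n A ~= \<zero>"
 shows "\<exists>B. (\<forall>i<n. \<forall>j<n. B i j \<in> carrier R) \<and> (\<forall>i<n. \<forall>j<n. (\<Oplus>k\<in>{..<n}. A i k \<otimes> B k j) = (if i = j then \<one> else \<zero>))"
proof -
 have "indep {..<n} {..<n} A" unfolding indep_def
 proof (intro allI impI ballI)
  fix c i assume c: "\<forall>i\<in>{..<n}. c i \<in> carrier R" and z: "\<forall>x\<in>{..<n}. (\<Oplus>i\<in>{..<n}. c i \<otimes> A i x) = \<zero>" and i: "i \<in> {..<n}"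
  have "c i \<otimes> det n A = \<zero>" by (rule det_row_dependent) (use A c z i in auto)
  moreover have "det n A \<in> carrier R" unfolding det_def
  proof (rule fsum_closed)
   fix \<sigma> assume "\<sigma> \<in> {\<sigma>. \<sigma> permutes {..<n}}"
   then have "\<sigma> i < n" if "i < n" for i using permutes_in_image[of \<sigma> "{..<n}" i] that by simp
   then have "(\<Otimes>i\<in>{..<n}. A i (\<sigma> i)) \<in> carrier R" using A by (intro finprod_closed) auto
   then show "[sign \<sigma>] \<cdot> (\<Otimes>i\<in>{..<n}. A i (\<sigma> i)) \<in> carrier R" by (rule add.int_pow_closed)
  qed
  ultimately show "c i = \<zero>" using integral c i d by blast
 qed
 then have "\<forall>i \<in> {..<n}. \<exists>L. fnl {..<n} L \<and> (\<forall>j \<in> {..<n}. L (A j) = (if i = j then \<one> else \<zero>))"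
  using A by (intro dual_functionals) auto
 then obtain L where L: "\<And>i. i < n ==> fnl {..<n} (L i)" "\<And>i j. i < n ==> j < n ==> L i (A j) = (if i = j then \<one> else \<zero>)"
  by (metis lessThan_iff)
 have "\<exists>b. (\<forall>k<n. b k \<in> carrier R) \<and> (\<forall>f. (\<forall>k<n. f k \<in> carrier R) --> F f = (\<Oplus>k\<in>{..<n}. f k \<otimes> b k))" if "fnl {..<n} F" for F
  using that
 proof (induction rule: fnl.induct)
  case fnl_zero
  show ?case by (intro exI[of _ "\<lambda>_. \<zero>"]) (auto intro!: fsum_zero[symmetric])
 next
  case (fnl_ev x)
  have "f x = (\<Oplus>k\<in>{..<n}. f k \<otimes> (if k = x then \<one> else \<zero>))" if f: "\<forall>k<n. f k \<in> carrier R" for f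
   using fsum_single[of "{..<n}" x "\<lambda>k. f k \<otimes> (if k = x then \<one> else \<zero>)"] f fnl_ev by auto
  then show ?case by (intro exI[of _ "\<lambda>k. if k = x then \<one> else \<zero>"]) auto
 next
  case (fnl_add F F')
  then obtain b b' where b: "\<forall>k<n. b k \<in> carrier R" "\<forall>f. (\<forall>k<n. f k \<in> carrier R) --> F f = (\<Oplus>k\<in>{..<n}. f k \<otimes> b k)"
   "\<forall>k<n. b' k \<in> carrier R" "\<forall>f. (\<forall>k<n. f k \<in> carrier R) --> F' f = (\<Oplus>k\<in>{..<n}. f k \<otimes> b' k)" by blast
  have "(\<Oplus>k\<in>{..<n}. f k \<otimes> b k) \<oplus> (\<Oplus>k\<in>{..<n}. f k \<otimes> b' k) = (\<Oplus>k\<in>{..<n}. f k \<otimes> (b k \<oplus> b' k))" if f: "\<forall>k<n. f k \<in> carrier R" for f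
  proof -
   have "(\<Oplus>k\<in>{..<n}. f k \<otimes> (b k \<oplus> b' k)) = (\<Oplus>k\<in>{..<n}. f k \<otimes> b k \<oplus> f k \<otimes> b' k)"
    by (rule fsum_cong) (use f b in \<open>auto simp: r_distr\<close>)
   then show ?thesis using fsum_add[of "{..<n}" "\<lambda>k. f k \<otimes> b k" "\<lambda>k. f k \<otimes> b' k"] f b by auto
  qed
  then show ?case using b by (intro exI[of _ "\<lambda>k. b k \<oplus> b' k"]) auto
 next
  case (fnl_scale F a)
  then obtain b where b: "\<forall>k<n. b k \<in> carrier R" "\<forall>f. (\<forall>k<n. f k \<in> carrier R) --> F f = (\<Oplus>k\<in>{..<n}. f k \<otimes> b k)" by blast
  have "a \<otimes> (\<Oplus>k\<in>{..<n}. f k \<otimes> b k) = (\<Oplus>k\<in>{..<n}. f k \<otimes> (a \<otimes> b k))" if f: "\<forall>k<n. f k \<in> carrier R" for f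
  proof -
   have "(\<Oplus>k\<in>{..<n}. f k \<otimes> (a \<otimes> b k)) = (\<Oplus>k\<in>{..<n}. a \<otimes> (f k \<otimes> b k))"
    by (rule fsum_cong) (use f b fnl_scale.hyps in \<open>auto simp: m_lcomm\<close>)
   then show ?thesis using fsum_mult[of "{..<n}" a "\<lambda>k. f k \<otimes> b k"] f b fnl_scale.hyps by auto
  qed
  then show ?case using b fnl_scale.hyps by (intro exI[of _ "\<lambda>k. a \<otimes> b k"]) auto
 qed
 then have "\<forall>i. \<exists>b. i < n --> (\<forall>k<n. b k \<in> carrier R) \<and> (\<forall>f. (\<forall>k<n. f k \<in> carrier R) --> L i f = (\<Oplus>k\<in>{..<n}. f k \<otimes> b k))"
  using L(1) by blast
 then obtain B where B: "\<And>i. i < n ==> (\<forall>k<n. B i k \<in> carrier R) \<and> (\<forall>f. (\<forall>k<n. f k \<in> carrier R) --> L i f = (\<Oplus>k\<in>{..<n}. f k \<otimes> B i k))"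
  by metis
 have "(\<Oplus>k\<in>{..<n}. A i k \<otimes> B j k) = (if i = j then \<one> else \<zero>)" if "i < n" "j < n" for i j
 proof -
  have "L j (A i) = (\<Oplus>k\<in>{..<n}. A i k \<otimes> B j k)" using conjunct2[OF B[OF that(2)]] A[OF that(1)] by blast
  then have "(\<Oplus>k\<in>{..<n}. A i k \<otimes> B j k) = (if j = i then \<one> else \<zero>)" unfolding L(2)[OF that(2,1)] by (rule sym)
  then show ?thesis by (simp add: eq_commute[of j i])
 qed
 moreover have "B j k \<in> carrier R" if "j < n" "k < n" for j k using conjunct1[OF B[OF that(1)]] that(2) by blast
 ultimately show ?thesis by (intro exI[of _ "\<lambda>k j. B j k"] conjI allI impI) simp_all
qed

text \<open>The coefficients of the functional are raised to the power \<open>p\<close>.\<close>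

lemma fnl_frobenius:
 assumes p: "Factorial_Ring.prime (p :: nat)" and c: "[p] \<cdot> \<one> = \<zero>"
 shows "fnl Xs L ==> \<exists>L'. fnl Xs L' \<and> (\<forall>f. (\<forall>x \<in> Xs. f x \<in> carrier R) --> L' (\<lambda>x. f x [^] p) = L f [^] p)"
proof (induction rule: fnl.induct)
 case fnl_zero
 have "\<zero> [^] p = \<zero>" using p by (simp add: prime_gt_0_nat nat_pow_zero)
 then show ?case by (intro exI[of _ "\<lambda>_. \<zero>"] conjI fnl.fnl_zero allI impI) (rule sym)
next
 case (fnl_ev x)
 then show ?case by (intro exI[of _ "\<lambda>f. f x"]) (auto intro: fnl.intros)
next
 case (fnl_add L K)
 then obtain L' K' where L': "fnl Xs L'" "\<forall>f. (\<forall>x \<in> Xs. f x \<in> carrier R) --> L' (\<lambda>x. f x [^] p) = L f [^] p"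
  "fnl Xs K'" "\<forall>f. (\<forall>x \<in> Xs. f x \<in> carrier R) --> K' (\<lambda>x. f x [^] p) = K f [^] p" by blast
 have "L f [^] p \<oplus> K f [^] p = (L f \<oplus> K f) [^] p" if "\<forall>x \<in> Xs. f x \<in> carrier R" for f
  using frobenius_add[OF p c] fnl_closed fnl_add.hyps that by metis
 then show ?case using L' by (intro exI[of _ "\<lambda>f. L' f \<oplus> K' f"]) (auto intro: fnl.intros)
next
 case (fnl_scale L a)
 then obtain L' where L': "fnl Xs L'" "\<forall>f. (\<forall>x \<in> Xs. f x \<in> carrier R) --> L' (\<lambda>x. f x [^] p) = L f [^] p" by blast
 have "a [^] p \<otimes> L f [^] p = (a \<otimes> L f) [^] p" if "\<forall>x \<in> Xs. f x \<in> carrier R" for f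
  using nat_pow_distrib[OF fnl_scale.hyps(2)] fnl_closed[OF fnl_scale.hyps(1)] that by metis
 then show ?case using L' fnl_scale.hyps by (intro exI[of _ "\<lambda>f. a [^] p \<otimes> L' f"]) (auto intro: fnl.intros)
qed

text \<open>The coefficients of a relation between the powers need not be \<open>p\<close>-th
  powers, as the field may be imperfect, so a root of the relation cannot be extracted. Instead the
  Frobenius twist of the functional dual to \<open>u i\<close> isolates the coefficient
  \<open>d i\<close>.\<close>

lemma indep_powers:
 assumes p: "Factorial_Ring.prime (p :: nat)" and c: "[p] \<cdot> \<one> = \<zero>"
  and I: "finite I" "indep Xs I u" "\<And>i x. i \<in> I ==> x \<in> Xs ==> u i x \<in> carrier R"
 shows "indep Xs I (\<lambda>i x. u i x [^] p)"
 unfolding indep_def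
proof (intro allI impI ballI)
 fix d i assume d: "\<forall>i\<in>I. d i \<in> carrier R" and z: "\<forall>x\<in>Xs. (\<Oplus>i\<in>I. d i \<otimes> u i x [^] p) = \<zero>" and i: "i \<in> I"
 obtain L where L: "fnl Xs L" "\<forall>j \<in> I. L (u j) = (if i = j then \<one> else \<zero>)"
  using dual_functionals[OF I(1) I(3) I(2)] i by blast
 obtain L' where L': "fnl Xs L'" "\<forall>f. (\<forall>x \<in> Xs. f x \<in> carrier R) --> L' (\<lambda>x. f x [^] p) = L f [^] p"
  using fnl_frobenius[OF p c L(1)] by blast
 have Lj: "L' (\<lambda>x. u j x [^] p) = (if i = j then \<one> else \<zero>)" if "j \<in> I" for j
  using L'(2) L(2) that I(3) prime_gt_0_nat[OF p] by (auto simp: nat_pow_zero)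
 have "L' (\<lambda>x. \<Oplus>i\<in>I. d i \<otimes> u i x [^] p) = (\<Oplus>j\<in>I. d j \<otimes> L' (\<lambda>x. u j x [^] p))"
  by (rule fnl_linear[OF I(1) _ _ L'(1)]) (use d I(3) in auto)
 also have "\<dots> = d i \<otimes> L' (\<lambda>x. u i x [^] p)"
  by (rule fsum_single) (use I(1) i d Lj in auto)
 also have "\<dots> = d i" using Lj[OF i] d i by simp
 finally have "d i = L' (\<lambda>x. \<Oplus>i\<in>I. d i \<otimes> u i x [^] p)" ..
 also have "\<dots> = L' (\<lambda>_. \<zero>)" by (rule fnl_cong[OF L'(1)]) (use z in blast)
 also have "\<dots> = \<zero>"
 proof -
  have "L' (\<lambda>x. \<Oplus>i\<in>{}. d i \<otimes> u i x) = (\<Oplus>i\<in>{}. d i \<otimes> L' (u i))" by (rule fnl_linear[OF _ _ _ L'(1)]) auto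
  then show ?thesis by simp
 qed
 finally show "d i = \<zero>" .
qed

lemma characteristic:
 assumes "m > 0" "[(m :: nat)] \<cdot> \<one> = \<zero>"
 shows "\<exists>p :: nat. Factorial_Ring.prime p \<and> [p] \<cdot> \<one> = \<zero> \<and> (\<forall>k :: nat. [k] \<cdot> \<one> = \<zero> --> p dvd k)"
proof -
 define p where "p = (LEAST m :: nat. m > 0 \<and> [m] \<cdot> \<one> = \<zero>)"
 have p: "p > 0" "[p] \<cdot> \<one> = \<zero>" using LeastI[of "\<lambda>m :: nat. m > 0 \<and> [m] \<cdot> \<one> = \<zero>" m] assms unfolding p_def by auto
 have least: "p \<le> k" if "k > 0" "[k] \<cdot> \<one> = \<zero>" for k :: nat unfolding p_def by (rule Least_le) (use that in simp)
 have dv: "p dvd k" if k: "[k] \<cdot> \<one> = \<zero>" for k :: nat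
 proof -
  have "[k] \<cdot> \<one> = [(p * (k div p) + k mod p)] \<cdot> \<one>" by simp
  also have "\<dots> = [(p * (k div p))] \<cdot> \<one> \<oplus> [(k mod p)] \<cdot> \<one>" by (rule add.nat_pow_mult[symmetric]) simp
  also have "[(p * (k div p))] \<cdot> \<one> = [(k div p)] \<cdot> ([p] \<cdot> \<one>)" by (simp add: add.nat_pow_pow)
  finally have "[(k mod p)] \<cdot> \<one> = \<zero>" using k p(2) by simp
  then have "k mod p = 0" using least[of "k mod p"] p(1) by (meson mod_less_divisor not_gr_zero not_le)
  then show ?thesis by blast
 qed
 have "Factorial_Ring.prime p"
 proof (rule prime_natI)
  show "2 \<le> p" using p by (cases "p = 1") auto
  fix a b assume ab: "p dvd a * b"
  then obtain k where k: "a * b = p * k" by (auto elim: dvdE)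
  have "[(a * b)] \<cdot> \<one> = [k] \<cdot> ([p] \<cdot> \<one>)" unfolding k by (simp add: add.nat_pow_pow)
  then have "[(a * b)] \<cdot> \<one> = \<zero>" using p(2) by simp
  moreover have "[(a * b)] \<cdot> \<one> = ([a] \<cdot> \<one>) \<otimes> ([b] \<cdot> \<one>)"
   using add_pow_one[of "[a] \<cdot> \<one>" b] add.nat_pow_pow[of \<one> b a] by (simp add: m_comm)
  ultimately have "[a] \<cdot> \<one> = \<zero> \<or> [b] \<cdot> \<one> = \<zero>" using integral by simp
  then show "p dvd a \<or> p dvd b" using dv by blast
 qed
 then show ?thesis using p dv by blast
qed

end

section \<open>Estimates for polynomials and generic points\<close>

text \<open>The coefficients in \<open>t\<close> of the polynomial restricted to the line
  \<open>u + t w\<close>. They reduce estimates and non-vanishing in several variables to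
  coefficient lists.\<close>

primrec (in ring) linel :: "(nat \<Rightarrow> 'a) \<Rightarrow> (nat \<Rightarrow> 'a) \<Rightarrow> 'a px \<Rightarrow> 'a list" where
 "linel u w (PC a) = [a]"
| "linel u w (PV i) = [u i, w i]"
| "linel u w (PA e f) = ladd (linel u w e) (linel u w f)"
| "linel u w (PM e f) = lmult (linel u w e) (linel u w f)"

primrec psub :: "'a px \<Rightarrow> (nat \<Rightarrow> 'a px) \<Rightarrow> 'a px" where
 "psub (PC a) \<sigma> = PC a"
| "psub (PV i) \<sigma> = \<sigma> i"
| "psub (PA e f) \<sigma> = PA (psub e \<sigma>) (psub f \<sigma>)"
| "psub (PM e f) \<sigma> = PM (psub e \<sigma>) (psub f \<sigma>)"

context cring
begin

lemma ptsI: "(\<And>i. i < n ==> x i \<in> carrier R) ==> x \<in> pts n" by (simp add: pts_def)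

lemma peval_cong: "pwf n e ==> (\<And>i. i < n ==> x i = y i) ==> peval e x = peval e y"
 by (induction e) auto

lemma linel_carr: "pwf n e ==> u \<in> pts n ==> w \<in> pts n ==> set (linel u w e) \<subseteq> carrier R"
 by (induction e) (auto simp: ptsD simp del: ladd_carr lmult_carr dest: subsetD[OF ladd_carr] subsetD[OF lmult_carr])

lemma line_pts: "u \<in> pts n ==> w \<in> pts n ==> t \<in> carrier R ==> (\<lambda>i. u i \<oplus> t \<otimes> w i) \<in> pts n"
 by (simp add: pts_def)

lemma lpoly_linel: "pwf n e ==> u \<in> pts n ==> w \<in> pts n ==> t \<in> carrier R ==>
  lpoly (linel u w e) t = peval e (\<lambda>i. u i \<oplus> t \<otimes> w i)"
 by (induction e) (auto simp: ptsD lpoly_ladd lpoly_lmult linel_carr)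

lemma lderiv_linel:
 assumes u: "u \<in> pts n" and w: "w \<in> pts n" and t: "t \<in> carrier R"
 shows "pwf n e ==> lderiv (linel u w e) t = (\<Oplus>j\<in>{..<n}. peval (pd j e) (\<lambda>i. u i \<oplus> t \<otimes> w i) \<otimes> w j)"
proof (induction e)
 let ?x = "\<lambda>i. u i \<oplus> t \<otimes> w i"
 have C: "peval (pd j e) ?x \<otimes> w j \<in> carrier R" if "pwf n e" "j < n" for e j
  using peval_closed[OF pwf_pd[OF that(1)] line_pts[OF u w t]] ptsD[OF w that(2)] by simp
 have E: "peval e ?x \<in> carrier R" if "pwf n e" for e
  using peval_closed[OF that line_pts[OF u w t]] .
 {
  case (PC a)
  have "(\<Oplus>j\<in>{..<n}. peval (pd j (PC a)) ?x \<otimes> w j) = \<zero>" by (rule fsum_zero) (use ptsD[OF w] in auto)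
  then show ?case using t by simp
 next
  case (PV i)
  have "(\<Oplus>j\<in>{..<n}. peval (pd j (PV i)) ?x \<otimes> w j) = peval (pd i (PV i)) ?x \<otimes> w i"
   by (rule fsum_single) (use PV ptsD[OF w] in auto)
  then show ?case using t PV ptsD[OF w] by simp
 next
  case (PA e f)
  have "(\<Oplus>j\<in>{..<n}. peval (pd j (PA e f)) ?x \<otimes> w j) = (\<Oplus>j\<in>{..<n}. peval (pd j e) ?x \<otimes> w j \<oplus> peval (pd j f) ?x \<otimes> w j)"
   by (rule fsum_cong) (use PA.prems C ptsD[OF w] peval_closed[OF pwf_pd line_pts[OF u w t]] in \<open>auto simp: l_distr\<close>)
  also have "\<dots> = (\<Oplus>j\<in>{..<n}. peval (pd j e) ?x \<otimes> w j) \<oplus> (\<Oplus>j\<in>{..<n}. peval (pd j f) ?x \<otimes> w j)"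
   by (rule fsum_add) (use PA.prems C in auto)
  finally show ?case using PA linel_carr[OF _ u w] t by (simp add: lderiv_ladd)
 next
  case (PM e f)
  have id: "(a \<otimes> F \<oplus> E \<otimes> b) \<otimes> c = (a \<otimes> c) \<otimes> F \<oplus> E \<otimes> (b \<otimes> c)"
   if "a \<in> carrier R" "F \<in> carrier R" "E \<in> carrier R" "b \<in> carrier R" "c \<in> carrier R" for a F E b c
   using that by - (rule ring_identity, (rule ring_rep | assumption | (simp; fail))+, (simp_all add: l_distr r_distr a_ac m_ac)?)
  have wf: "pwf n e" "pwf n f" using PM.prems by auto
  have "(\<Oplus>j\<in>{..<n}. peval (pd j (PM e f)) ?x \<otimes> w j)
    = (\<Oplus>j\<in>{..<n}. (peval (pd j e) ?x \<otimes> w j) \<otimes> peval f ?x \<oplus> peval e ?x \<otimes> (peval (pd j f) ?x \<otimes> w j))"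
  proof (rule fsum_cong)
   fix j assume "j \<in> {..<n}"
   then have j: "j < n" by simp
   show "peval (pd j (PM e f)) ?x \<otimes> w j = (peval (pd j e) ?x \<otimes> w j) \<otimes> peval f ?x \<oplus> peval e ?x \<otimes> (peval (pd j f) ?x \<otimes> w j)"
    unfolding pd.simps peval.simps
    by (rule id) (use E[OF wf(1)] E[OF wf(2)] E[OF pwf_pd[OF wf(1)]] E[OF pwf_pd[OF wf(2)]] ptsD[OF w j] in auto)
   show "(peval (pd j e) ?x \<otimes> w j) \<otimes> peval f ?x \<oplus> peval e ?x \<otimes> (peval (pd j f) ?x \<otimes> w j) \<in> carrier R"
    using C[OF wf(1) j] C[OF wf(2) j] E[OF wf(1)] E[OF wf(2)] by blast
  qed simp
  also have "\<dots> = (\<Oplus>j\<in>{..<n}. (peval (pd j e) ?x \<otimes> w j) \<otimes> peval f ?x) \<oplus> (\<Oplus>j\<in>{..<n}. peval e ?x \<otimes> (peval (pd j f) ?x \<otimes> w j))"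
   by (rule fsum_add) (use C[OF wf(1)] C[OF wf(2)] E[OF wf(1)] E[OF wf(2)] in auto)
  also have "(\<Oplus>j\<in>{..<n}. (peval (pd j e) ?x \<otimes> w j) \<otimes> peval f ?x) = (\<Oplus>j\<in>{..<n}. peval (pd j e) ?x \<otimes> w j) \<otimes> peval f ?x"
   by (rule fsum_mult_right) (use C[OF wf(1)] E[OF wf(2)] in auto)
  also have "(\<Oplus>j\<in>{..<n}. peval e ?x \<otimes> (peval (pd j f) ?x \<otimes> w j)) = peval e ?x \<otimes> (\<Oplus>j\<in>{..<n}. peval (pd j f) ?x \<otimes> w j)"
   by (rule fsum_mult) (use C[OF wf(2)] E[OF wf(1)] in auto)
  finally show ?case using PM.IH wf linel_carr[OF _ u w] t by (simp add: lderiv_lmult lpoly_linel[OF _ u w])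
 }
qed

lemma pwf_psub: "pwf m e ==> (\<And>i. i < m ==> pwf n (sb i)) ==> pwf n (psub e sb)"
 by (induction e) auto

lemma peval_psub: "peval (psub e sb) x = peval e (\<lambda>i. peval (sb i) x)"
 by (induction e) auto

lemma peval_pd_psub:
 assumes s: "\<And>i. i < m ==> pwf n (sb i)" and x: "x \<in> pts n"
 shows "pwf m e ==> peval (pd k (psub e sb)) x = (\<Oplus>j\<in>{..<m}. peval (pd j e) (\<lambda>i. peval (sb i) x) \<otimes> peval (pd k (sb j)) x)"
proof (induction e)
 let ?x = "\<lambda>i. peval (sb i) x" and ?w = "\<lambda>j. peval (pd k (sb j)) x"
 have w: "?w \<in> pts m" by (rule ptsI) (use peval_closed[OF pwf_pd[OF s] x] in auto)
 have xx: "?x \<in> pts m" by (rule ptsI) (use peval_closed[OF s x] in auto)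
 have E: "peval e ?x \<in> carrier R" if "pwf m e" for e
  using peval_closed[OF that xx] .
 have C: "peval (pd j e) ?x \<otimes> ?w j \<in> carrier R" if "pwf m e" "j < m" for e j
  using E[OF pwf_pd[OF that(1)]] ptsD[OF w that(2)] by simp
 {
  case (PC a)
  have "(\<Oplus>j\<in>{..<m}. peval (pd j (PC a)) ?x \<otimes> ?w j) = \<zero>" by (rule fsum_zero) (use ptsD[OF w] in auto)
  then show ?case by simp
 next
  case (PV i)
  have "(\<Oplus>j\<in>{..<m}. peval (pd j (PV i)) ?x \<otimes> ?w j) = peval (pd i (PV i)) ?x \<otimes> ?w i"
   by (rule fsum_single) (use PV ptsD[OF w] in auto)
  then show ?case using PV ptsD[OF w] by simp
 next
  case (PA e f)
  have "(\<Oplus>j\<in>{..<m}. peval (pd j (PA e f)) ?x \<otimes> ?w j) = (\<Oplus>j\<in>{..<m}. peval (pd j e) ?x \<otimes> ?w j \<oplus> peval (pd j f) ?x \<otimes> ?w j)"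
   by (rule fsum_cong) (use PA.prems C ptsD[OF w] E[OF pwf_pd] in \<open>auto simp: l_distr\<close>)
  also have "\<dots> = (\<Oplus>j\<in>{..<m}. peval (pd j e) ?x \<otimes> ?w j) \<oplus> (\<Oplus>j\<in>{..<m}. peval (pd j f) ?x \<otimes> ?w j)"
   by (rule fsum_add) (use PA.prems C in auto)
  finally show ?case using PA by simp
 next
  case (PM e f)
  have id: "(a \<otimes> F \<oplus> E \<otimes> b) \<otimes> c = (a \<otimes> c) \<otimes> F \<oplus> E \<otimes> (b \<otimes> c)"
   if "a \<in> carrier R" "F \<in> carrier R" "E \<in> carrier R" "b \<in> carrier R" "c \<in> carrier R" for a F E b c
   using that by - (rule ring_identity, (rule ring_rep | assumption | (simp; fail))+, (simp_all add: l_distr r_distr a_ac m_ac)?)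
  have wf: "pwf m e" "pwf m f" using PM.prems by auto
  have "(\<Oplus>j\<in>{..<m}. peval (pd j (PM e f)) ?x \<otimes> ?w j)
    = (\<Oplus>j\<in>{..<m}. (peval (pd j e) ?x \<otimes> ?w j) \<otimes> peval f ?x \<oplus> peval e ?x \<otimes> (peval (pd j f) ?x \<otimes> ?w j))"
  proof (rule fsum_cong)
   fix j assume "j \<in> {..<m}"
   then have j: "j < m" by simp
   show "peval (pd j (PM e f)) ?x \<otimes> ?w j = (peval (pd j e) ?x \<otimes> ?w j) \<otimes> peval f ?x \<oplus> peval e ?x \<otimes> (peval (pd j f) ?x \<otimes> ?w j)"
    unfolding pd.simps peval.simps
    by (rule id) (use E[OF wf(1)] E[OF wf(2)] E[OF pwf_pd[OF wf(1)]] E[OF pwf_pd[OF wf(2)]] ptsD[OF w j] in auto)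
   show "(peval (pd j e) ?x \<otimes> ?w j) \<otimes> peval f ?x \<oplus> peval e ?x \<otimes> (peval (pd j f) ?x \<otimes> ?w j) \<in> carrier R"
    using C[OF wf(1) j] C[OF wf(2) j] E[OF wf(1)] E[OF wf(2)] by blast
  qed simp
  also have "\<dots> = (\<Oplus>j\<in>{..<m}. (peval (pd j e) ?x \<otimes> ?w j) \<otimes> peval f ?x) \<oplus> (\<Oplus>j\<in>{..<m}. peval e ?x \<otimes> (peval (pd j f) ?x \<otimes> ?w j))"
   by (rule fsum_add) (use C[OF wf(1)] C[OF wf(2)] E[OF wf(1)] E[OF wf(2)] in auto)
  also have "(\<Oplus>j\<in>{..<m}. (peval (pd j e) ?x \<otimes> ?w j) \<otimes> peval f ?x) = (\<Oplus>j\<in>{..<m}. peval (pd j e) ?x \<otimes> ?w j) \<otimes> peval f ?x"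
   by (rule fsum_mult_right) (use C[OF wf(1)] E[OF wf(2)] in auto)
  also have "(\<Oplus>j\<in>{..<m}. peval e ?x \<otimes> (peval (pd j f) ?x \<otimes> ?w j)) = peval e ?x \<otimes> (\<Oplus>j\<in>{..<m}. peval (pd j f) ?x \<otimes> ?w j)"
   by (rule fsum_mult) (use C[OF wf(2)] E[OF wf(1)] in auto)
  finally show ?case using PM.IH wf by (simp add: peval_psub)
 }
qed

definition polyf where "polyf n f \<longleftrightarrow> (\<exists>e. pwf n e \<and> (\<forall>x \<in> pts n. f x = peval e x))"

lemma polyf_peval: "pwf n e ==> polyf n (peval e)" unfolding polyf_def by auto

lemma polyf_const: "a \<in> carrier R ==> polyf n (\<lambda>_. a)" unfolding polyf_def by (intro exI[of _ "PC a"]) auto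

lemma polyf_closed: "polyf n f ==> x \<in> pts n ==> f x \<in> carrier R" unfolding polyf_def using peval_closed by auto

lemma polyf_add: "polyf n f ==> polyf n g ==> polyf n (\<lambda>x. f x \<oplus> g x)"
 unfolding polyf_def by (elim exE) (rule_tac x = "PA e ea" in exI, auto)

lemma polyf_mult: "polyf n f ==> polyf n g ==> polyf n (\<lambda>x. f x \<otimes> g x)"
 unfolding polyf_def by (elim exE) (rule_tac x = "PM e ea" in exI, auto)

lemma polyf_cong: "polyf n f ==> (\<And>x. x \<in> pts n ==> g x = f x) ==> polyf n g"
 unfolding polyf_def by auto

lemma polyf_finsum: "finite A ==> (\<And>a. a \<in> A ==> polyf n (f a)) ==> polyf n (\<lambda>x. \<Oplus>a\<in>A. f a x)"
proof (induction A rule: finite_induct)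
 case empty
 show ?case using polyf_const[of \<zero> n] by simp
next
 case (insert b A)
 have "polyf n (\<lambda>x. f b x \<oplus> (\<Oplus>a\<in>A. f a x))" by (rule polyf_add) (use insert in auto)
 then show ?case by (rule polyf_cong) (rule fsum_insert, use insert polyf_closed in auto)
qed

lemma polyf_finprod: "finite A ==> (\<And>a. a \<in> A ==> polyf n (f a)) ==> polyf n (\<lambda>x. \<Otimes>a\<in>A. f a x)"
proof (induction A rule: finite_induct)
 case empty
 show ?case using polyf_const[of \<one> n] by simp
next
 case (insert b A)
 have "polyf n (\<lambda>x. f b x \<otimes> (\<Otimes>a\<in>A. f a x))" by (rule polyf_mult) (use insert in auto)
 then show ?case by (rule polyf_cong) (rule finprod_insert, use insert polyf_closed in auto)
qed

lemma polyf_det: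
 assumes A: "\<And>i j. i < n ==> j < n ==> polyf m (A i j)"
 shows "polyf m (\<lambda>x. det n (\<lambda>i j. A i j x))"
 unfolding det_def
proof (rule polyf_finsum)
 fix \<sigma> assume "\<sigma> \<in> {\<sigma>. \<sigma> permutes {..<n}}"
 then have s: "\<sigma> i < n" if "i < n" for i using permutes_in_image[of \<sigma> "{..<n}" i] that by simp
 have p: "polyf m (\<lambda>x. \<Otimes>i\<in>{..<n}. A i (\<sigma> i) x)" by (rule polyf_finprod) (use A s in auto)
 have "polyf m (\<lambda>x. [sign \<sigma>] \<cdot> \<one> \<otimes> (\<Otimes>i\<in>{..<n}. A i (\<sigma> i) x))"
  by (rule polyf_mult[OF polyf_const p]) (intro add.int_pow_closed one_closed)
 then show "polyf m (\<lambda>x. [sign \<sigma>] \<cdot> (\<Otimes>i\<in>{..<n}. A i (\<sigma> i) x))"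
  by (rule polyf_cong) (use polyf_closed[OF p] in \<open>simp add: add_pow_ldistr_int\<close>)
qed (simp add: finite_permutations)

end

section \<open>Taylor estimates with a uniform constant\<close>

context valuation_subring
begin

lemma lpoly_dv: "(\<forall>a \<in> set f. dv c a) ==> c \<in> carrier R ==> t \<in> V ==> dv c (lpoly f t)"
 by (induction f) (auto intro!: dv_add dv_V)

lemma ladd_dv: "(\<forall>a \<in> set f. dv c a) ==> (\<forall>a \<in> set g. dv c a) ==> c \<in> carrier R ==> \<forall>a \<in> set (ladd f g). dv c a"
 using ladd_set[of f "{a. dv c a}" g] dv_add by (auto simp: subset_iff)

lemma lmult_dv: "(\<forall>a \<in> set f. dv c a) ==> (\<forall>a \<in> set g. dv d a) ==> c \<in> carrier R ==> d \<in> carrier R ==>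
  \<forall>a \<in> set (lmult f g). dv (c \<otimes> d) a"
proof (induction f)
 case (Cons a f)
 have "\<forall>x \<in> set (map ((\<otimes>) a) g). dv (c \<otimes> d) x" using Cons.prems by (auto intro: dv_mult)
 moreover have "\<forall>x \<in> set (\<zero> # lmult f g). dv (c \<otimes> d) x" using Cons by simp
 ultimately show ?case using ladd_dv[of "map ((\<otimes>) a) g" "c \<otimes> d" "\<zero> # lmult f g"] Cons.prems by (simp del: set_map list.set)
qed simp

lemma lpoly_split:
 assumes f: "\<forall>a \<in> set f. dv c a" and c: "c \<in> carrier R" and t: "t \<in> V"
 shows "dv (c \<otimes> t) (lpoly f t \<ominus> lpoly f \<zero>)" "dv (c \<otimes> (t \<otimes> t)) (lpoly f t \<ominus> lpoly f \<zero> \<ominus> t \<otimes> lderiv f \<zero>)"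
proof -
 have tc: "t \<in> carrier R" using t by simp
 have C: "a \<in> carrier R" if "dv c a" for a using dv_carr[OF that c] .
 show "dv (c \<otimes> t) (lpoly f t \<ominus> lpoly f \<zero>)"
 proof (cases f)
  case (Cons a g)
  have g: "dv c (lpoly g t)" and ac: "a \<in> carrier R" using f Cons lpoly_dv[OF _ c t, of g] C by auto
  have gc: "set g \<subseteq> carrier R" using f Cons C by auto
  have "lpoly f t \<ominus> lpoly f \<zero> = lpoly g t \<otimes> t"
   using ac gc tc lpoly_closed[OF gc tc] lpoly_closed[OF gc zero_closed] Cons by (simp add: add_diff_cancel_left m_comm)
  then show ?thesis using dv_mult[OF g dv_refl[OF tc] c tc] by simp
 qed (use c tc in \<open>simp add: a_minus_def\<close>)
 show "dv (c \<otimes> (t \<otimes> t)) (lpoly f t \<ominus> lpoly f \<zero> \<ominus> t \<otimes> lderiv f \<zero>)"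
 proof (cases f)
  case (Cons a g)
  note fa = Cons
  have ac: "a \<in> carrier R" using f Cons C by auto
  show ?thesis
  proof (cases g)
   case (Cons b h)
   have h: "dv c (lpoly h t)" and bc: "b \<in> carrier R" using f Cons fa lpoly_dv[OF _ c t, of h] C by auto
   have hc: "set h \<subseteq> carrier R" using f Cons fa C by auto
   have id: "(a \<oplus> t \<otimes> (b \<oplus> t \<otimes> q)) \<ominus> a \<ominus> t \<otimes> b = q \<otimes> (t \<otimes> t)"
    if "a \<in> carrier R" "b \<in> carrier R" "t \<in> carrier R" "q \<in> carrier R" for a b t q
    using that by - (rule ring_identity, (rule ring_rep | assumption | (simp; fail))+, (simp_all add: l_distr r_distr a_ac m_ac)?)
   have "lpoly f t \<ominus> lpoly f \<zero> \<ominus> t \<otimes> lderiv f \<zero> = lpoly h t \<otimes> (t \<otimes> t)"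
    using id[OF ac bc tc lpoly_closed[OF hc tc]] ac bc hc tc lpoly_closed[OF hc tc] lpoly_closed[OF hc zero_closed] lderiv_closed[OF hc zero_closed]
    unfolding fa Cons by simp
   then show ?thesis using dv_mult[OF h dv_refl[of "t \<otimes> t"] c] tc by simp
  qed (use c tc ac fa in \<open>simp add: a_minus_def r_neg\<close>)
 qed (use c tc in \<open>simp add: a_minus_def\<close>)
qed

text \<open>A single constant bounds the coefficients on all lines with integral direction that
  start at integral distance from \<open>x0\<close>. The base point of an estimate can therefore
  vary without changing the constant.\<close>

definition lb where "lb n e x0 \<rho> \<longleftrightarrow> (\<forall>u \<in> pts n. \<forall>w \<in> pts n. (\<forall>i<n. u i \<ominus> x0 i \<in> V \<and> w i \<in> V) --> (\<forall>a \<in> set (linel u w e). dv \<rho> a))"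

text \<open>Constants of value at most zero. The product of two of them bounds whatever either
  factor bounds, so finitely many constants can be merged into one.\<close>

definition big where "big \<rho> \<longleftrightarrow> \<rho> \<in> carrier R \<and> \<rho> ~= \<zero> \<and> dv \<rho> \<one>"

lemma bigD: "big \<rho> ==> \<rho> \<in> carrier R" "big \<rho> ==> \<rho> ~= \<zero>" "big \<rho> ==> x \<in> V ==> dv \<rho> x"
 unfolding big_def using dv_trans[of \<rho> \<one> x] by auto

lemma big_mult: "big \<rho> ==> big \<rho>' ==> big (\<rho> \<otimes> \<rho>') \<and> dv (\<rho> \<otimes> \<rho>') \<rho> \<and> dv (\<rho> \<otimes> \<rho>') \<rho>'"
 unfolding big_def using dv_mult[of \<rho> \<one> \<rho>' \<one>] dv_mult[of \<rho> \<rho> \<rho>' \<one>] dv_mult[of \<rho> \<one> \<rho>' \<rho>'] by (auto simp: integral_iff)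

lemma big_one: "big \<one>" unfolding big_def by simp

lemma big_elt: assumes "a \<in> carrier R" shows "\<exists>\<rho>. big \<rho> \<and> dv \<rho> a"
proof (cases "a \<in> V")
 case True then show ?thesis using big_one by (intro exI[of _ \<one>]) simp
next
 case False
 then have "dv a \<one>" using dv_total[of a \<one>] dv_total[of \<one> a] sdv_dv[of \<one> a] assms sdv_dv[of a \<one>] by auto
 moreover have "a ~= \<zero>" using False by auto
 ultimately show ?thesis using assms by (intro exI[of _ a]) (auto simp: big_def)
qed

lemma big_family:
 assumes "finite A" "\<And>a. a \<in> A ==> \<exists>\<rho>. big \<rho> \<and> P a \<rho>"
  and mono: "\<And>a \<rho> \<sigma>. a \<in> A ==> P a \<rho> ==> big \<rho> ==> big \<sigma> ==> dv \<sigma> \<rho> ==> P a \<sigma>"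
 shows "\<exists>\<rho>. big \<rho> \<and> (\<forall>a \<in> A. P a \<rho>)"
 using assms
proof (induction A rule: finite_induct)
 case empty
 show ?case using big_one by blast
next
 case (insert b A)
 obtain \<rho> where r: "big \<rho>" "\<forall>a \<in> A. P a \<rho>" using insert.IH insert.prems by blast
 obtain \<sigma> where s: "big \<sigma>" "P b \<sigma>" using insert.prems(1) by blast
 have m: "big (\<rho> \<otimes> \<sigma>)" "dv (\<rho> \<otimes> \<sigma>) \<rho>" "dv (\<rho> \<otimes> \<sigma>) \<sigma>" using big_mult[OF r(1) s(1)] by auto
 have "P b (\<rho> \<otimes> \<sigma>)" by (rule insert.prems(2)[OF _ s(2,1) m(1,3)]) simp
 moreover have "P a (\<rho> \<otimes> \<sigma>)" if "a \<in> A" for a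
  by (rule insert.prems(2)[OF _ _ r(1) m(1,2)]) (use r(2) that in auto)
 ultimately show ?case using m(1) by (intro exI[of _ "\<rho> \<otimes> \<sigma>"]) blast
qed

lemma lb_mono: "lb n e x0 \<rho> ==> dv \<rho>' \<rho> ==> \<rho>' \<in> carrier R ==> lb n e x0 \<rho>'"
 unfolding lb_def using dv_trans by meson

lemma lb_exists: "pwf n e ==> x0 \<in> pts n ==> \<exists>\<rho>. big \<rho> \<and> lb n e x0 \<rho>"
proof (induction e)
 case (PC a)
 then obtain \<rho> where "big \<rho>" "dv \<rho> a" using big_elt[of a] by auto
 then show ?case unfolding lb_def by (intro exI[of _ \<rho>]) simp
next
 case (PV i)
 then have xi: "x0 i \<in> carrier R" using ptsD by simp
 then obtain \<rho> where r: "big \<rho>" "dv \<rho> (x0 i)" using big_elt by auto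
 have "dv \<rho> (u i)" if "u i \<ominus> x0 i \<in> V" "u i \<in> carrier R" for u
 proof -
  have "u i = (u i \<ominus> x0 i) \<oplus> x0 i" using that(2) xi by (simp add: a_minus_def a_assoc l_neg)
  then show ?thesis using dv_add[OF bigD(3)[OF r(1) that(1)] r(2) bigD(1)[OF r(1)]] by simp
 qed
 then show ?case using PV r bigD(3)[OF r(1)] unfolding lb_def by (intro exI[of _ \<rho>]) (auto simp: ptsD)
next
 case (PA e f)
 then obtain \<rho> \<sigma> where r: "big \<rho>" "lb n e x0 \<rho>" "big \<sigma>" "lb n f x0 \<sigma>" by auto
 have m: "big (\<rho> \<otimes> \<sigma>)" "dv (\<rho> \<otimes> \<sigma>) \<rho>" "dv (\<rho> \<otimes> \<sigma>) \<sigma>" using big_mult[OF r(1,3)] by auto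
 have "lb n e x0 (\<rho> \<otimes> \<sigma>)" "lb n f x0 (\<rho> \<otimes> \<sigma>)" using lb_mono r m bigD(1)[OF m(1)] by blast+
 note L = this
 have "lb n (PA e f) x0 (\<rho> \<otimes> \<sigma>)" unfolding lb_def linel.simps
 proof (rule ballI, rule ballI, rule impI)
  fix u w assume uw: "u \<in> pts n" "w \<in> pts n" "\<forall>i<n. u i \<ominus> x0 i \<in> V \<and> w i \<in> V"
  show "\<forall>a\<in>set (ladd (linel u w e) (linel u w f)). dv (\<rho> \<otimes> \<sigma>) a"
   by (rule ladd_dv[OF _ _ bigD(1)[OF m(1)]]) (use L uw in \<open>simp_all add: lb_def\<close>)
 qed
 then show ?case using m(1) by blast
next
 case (PM e f)
 then obtain \<rho> \<sigma> where r: "big \<rho>" "lb n e x0 \<rho>" "big \<sigma>" "lb n f x0 \<sigma>" by auto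
 have "lb n (PM e f) x0 (\<rho> \<otimes> \<sigma>)" unfolding lb_def linel.simps
 proof (rule ballI, rule ballI, rule impI)
  fix u w assume uw: "u \<in> pts n" "w \<in> pts n" "\<forall>i<n. u i \<ominus> x0 i \<in> V \<and> w i \<in> V"
  have "\<forall>a \<in> set (linel u w e). dv \<rho> a" "\<forall>a \<in> set (linel u w f). dv \<sigma> a"
   using r(2,4) uw unfolding lb_def by simp_all
  then show "\<forall>a\<in>set (lmult (linel u w e) (linel u w f)). dv (\<rho> \<otimes> \<sigma>) a"
   by (rule lmult_dv[OF _ _ bigD(1)[OF r(1)] bigD(1)[OF r(3)]])
 qed
 then show ?case using big_mult[OF r(1,3)] by blast
qed

text \<open>Write \<open>x' - x = \<delta> w\<close> with integral \<open>w\<close> and cut the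
  coefficient list of the line at \<open>t = \<delta>\<close> after the constant or after the linear
  term. By the chain rule the linear term is the differential.\<close>

lemma lb_estimates:
 assumes e: "pwf n e" and lb: "lb n e x0 \<rho>" and \<rho>: "\<rho> \<in> carrier R"
  and x: "x \<in> pts n" "\<And>i. i < n ==> x i \<ominus> x0 i \<in> V"
  and x': "x' \<in> pts n" "\<And>i. i < n ==> dv \<delta> (x' i \<ominus> x i)" and \<delta>: "\<delta> \<in> V"
 shows "dv (\<rho> \<otimes> \<delta>) (peval e x' \<ominus> peval e x)"
  "dv (\<rho> \<otimes> (\<delta> \<otimes> \<delta>)) (peval e x' \<ominus> peval e x \<ominus> (\<Oplus>j\<in>{..<n}. peval (pd j e) x \<otimes> (x' j \<ominus> x j)))"
proof -
 have "\<forall>i. \<exists>w. i < n --> w \<in> V \<and> x' i \<ominus> x i = \<delta> \<otimes> w" using x'(2) unfolding dv_def by blast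
 then obtain w where w: "\<And>i. i < n ==> w i \<in> V" "\<And>i. i < n ==> x' i \<ominus> x i = \<delta> \<otimes> w i" by metis
 have wp: "w \<in> pts n" using w(1) by (simp add: pts_def)
 have dc: "\<delta> \<in> carrier R" using \<delta> by simp
 let ?l = "linel x w e"
 have l: "\<forall>a \<in> set ?l. dv \<rho> a" using lb x wp w(1) unfolding lb_def by blast
 have xi: "x' i = x i \<oplus> \<delta> \<otimes> w i" if "i < n" for i
 proof -
  have "x i \<oplus> \<delta> \<otimes> w i = x i \<oplus> (x' i \<ominus> x i)" using w(2)[OF that] by simp
  moreover have "a \<oplus> (b \<ominus> a) = b" if "a \<in> carrier R" "b \<in> carrier R" for a b
   using that by - (rule ring_identity, (rule ring_rep | assumption | (simp; fail))+, (simp_all add: l_distr r_distr a_ac m_ac)?)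
  ultimately show ?thesis using ptsD[OF x(1) that] ptsD[OF x'(1) that] by simp
 qed
 have 1: "lpoly ?l \<delta> = peval e x'"
  unfolding lpoly_linel[OF e x(1) wp dc] by (rule peval_cong[OF e]) (simp add: xi)
 have 2: "lpoly ?l \<zero> = peval e x"
  unfolding lpoly_linel[OF e x(1) wp zero_closed] by (rule peval_cong[OF e]) (use x(1) wp in \<open>simp add: pts_def\<close>)
 have C: "peval (pd j e) x \<in> carrier R" for j using peval_closed[OF pwf_pd[OF e] x(1)] .
 have "\<delta> \<otimes> lderiv ?l \<zero> = \<delta> \<otimes> (\<Oplus>j\<in>{..<n}. peval (pd j e) x \<otimes> w j)"
 proof -
  have "lderiv ?l \<zero> = (\<Oplus>j\<in>{..<n}. peval (pd j e) x \<otimes> w j)"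
   unfolding lderiv_linel[OF x(1) wp zero_closed e]
  proof (rule fsum_cong)
   fix j
   have "peval (pd j e) (\<lambda>i. x i \<oplus> \<zero> \<otimes> w i) = peval (pd j e) x"
    by (rule peval_cong[OF pwf_pd[OF e]]) (use x(1) wp in \<open>simp add: pts_def\<close>)
   then show "peval (pd j e) (\<lambda>i. x i \<oplus> \<zero> \<otimes> w i) \<otimes> w j = peval (pd j e) x \<otimes> w j" by simp
  qed (use C wp in \<open>auto simp: pts_def\<close>)
  then show ?thesis by simp
 qed
 also have "\<dots> = (\<Oplus>j\<in>{..<n}. \<delta> \<otimes> (peval (pd j e) x \<otimes> w j))"
  by (rule fsum_mult[symmetric]) (use C wp dc in \<open>auto simp: pts_def\<close>)
 also have "\<dots> = (\<Oplus>j\<in>{..<n}. peval (pd j e) x \<otimes> (x' j \<ominus> x j))"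
  by (rule fsum_cong) (use C wp dc w(2) in \<open>auto simp: pts_def m_lcomm\<close>)
 finally have 3: "\<delta> \<otimes> lderiv ?l \<zero> = (\<Oplus>j\<in>{..<n}. peval (pd j e) x \<otimes> (x' j \<ominus> x j))" .
 show "dv (\<rho> \<otimes> \<delta>) (peval e x' \<ominus> peval e x)" using lpoly_split(1)[OF l \<rho> \<delta>] 1 2 by simp
 show "dv (\<rho> \<otimes> (\<delta> \<otimes> \<delta>)) (peval e x' \<ominus> peval e x \<ominus> (\<Oplus>j\<in>{..<n}. peval (pd j e) x \<otimes> (x' j \<ominus> x j)))"
  using lpoly_split(2)[OF l \<rho> \<delta>] 1 2 3 by simp
qed

section \<open>Non-vanishing of polynomials near a point\<close>

lemma cancel_inv:
 assumes a: "a \<in> carrier R" and b: "b \<in> carrier R" "b ~= \<zero>"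
 shows "(a \<otimes> inv b) \<otimes> b = a" "b \<otimes> (a \<otimes> inv b) = a"
proof -
 note i = inv_carr[OF b]
 have "(a \<otimes> inv b) \<otimes> b = a \<otimes> (b \<otimes> inv b)" using m_assoc[OF a i b(1)] m_comm[OF i b(1)] by metis
 also have "\<dots> = a" unfolding r_inv'[OF b] using a by (rule r_one)
 finally show 1: "(a \<otimes> inv b) \<otimes> b = a" .
 show "b \<otimes> (a \<otimes> inv b) = a" using m_comm[OF b(1) m_closed[OF a i]] 1 by metis
qed

text \<open>Once factors \<open>t\<close> are removed the constant term is non-zero and dominates
  the rest for small \<open>t\<close>. These factors are the reason for excluding
  \<open>t = \<zero>\<close>.\<close>

lemma lpoly_nonzero_near_zero:
 "set l \<subseteq> carrier R ==> \<exists>a \<in> set l. a ~= \<zero> ==> \<exists>c \<in> carrier R - {\<zero>}. \<forall>t. t ~= \<zero> --> sdv c t --> lpoly l t ~= \<zero>"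
proof (induction l)
 case (Cons a l)
 show ?case
 proof (cases "a = \<zero>")
  case True
  then obtain c where c: "c \<in> carrier R - {\<zero>}" "\<forall>t. t ~= \<zero> --> sdv c t --> lpoly l t ~= \<zero>" using Cons by auto
  have "lpoly (a # l) t ~= \<zero>" if t: "t ~= \<zero>" "sdv c t" for t
  proof -
   have tc: "t \<in> carrier R" using sdv_carr[OF t(2)] c(1) by simp
   have lc: "lpoly l t \<in> carrier R" using Cons.prems(1) tc by simp
   show ?thesis using integral[of t "lpoly l t"] c(2) t tc lc True by auto
  qed
  then show ?thesis using c(1) by blast
 next
  case False
  have ac: "a \<in> carrier R" and lc: "set l \<subseteq> carrier R" using Cons.prems by auto
  have "\<exists>\<rho>. big \<rho> \<and> (\<forall>b \<in> set l. dv \<rho> b)"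
  proof (rule big_family)
   show "\<exists>\<rho>. big \<rho> \<and> dv \<rho> b" if "b \<in> set l" for b using big_elt lc that by blast
   show "dv \<sigma> b" if "dv \<rho> b" "big \<sigma>" "dv \<sigma> \<rho>" for b \<rho> \<sigma>
    using dv_trans[OF that(3,1) bigD(1)[OF that(2)]] .
  qed simp
  then obtain \<rho> where r: "big \<rho>" "\<forall>b \<in> set l. dv \<rho> b" by (elim exE conjE) (rule that)
  have rc: "\<rho> \<in> carrier R" "\<rho> ~= \<zero>" using bigD[OF r(1)] by auto
  have ri': "inv \<rho> \<in> carrier R" "\<rho> \<otimes> inv \<rho> = \<one>" using inv_carr[OF rc] r_inv'[OF rc] by auto
  note ri = ri'(1) inv_nonzero[OF rc] ri'(2)
  have "a \<otimes> inv \<rho> \<in> carrier R - {\<zero>}" using ac ri False integral[of a "inv \<rho>"] by auto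
  then obtain c where c: "c \<in> V - {\<zero>}" "dv (a \<otimes> inv \<rho>) c" using dv_lub_V[of "a \<otimes> inv \<rho>" \<one>] by auto
  have cc: "c \<in> carrier R" using c by simp
  have "dv ((a \<otimes> inv \<rho>) \<otimes> \<rho>) (c \<otimes> \<rho>)" by (rule dv_mult[OF c(2) dv_refl]) (use ac ri rc in auto)
  then have ac': "dv a (c \<otimes> \<rho>)" unfolding cancel_inv(1)[OF ac rc] .
  have "lpoly (a # l) t ~= \<zero>" if t: "sdv c t" for t
  proof
   assume z: "lpoly (a # l) t = \<zero>"
   have tc: "t \<in> carrier R" using sdv_carr[OF t cc] .
   have tV: "t \<in> V" using sdv_in_V[OF t] c by simp
   have q: "dv \<rho> (lpoly l t)" using lpoly_dv[OF r(2) rc(1) tV] .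
   have qc: "lpoly l t \<in> carrier R" using lc tc by simp
   have "sdv (\<rho> \<otimes> c) (lpoly l t \<otimes> t)" by (rule sdv_mult[OF q t rc(1) cc])
   then have "sdv (c \<otimes> \<rho>) (t \<otimes> lpoly l t)" using cc rc qc tc by (simp add: m_comm)
   then have s: "sdv a (t \<otimes> lpoly l t)" using dv_sdv_trans[OF ac'] ac by blast
   have "a = \<ominus> (t \<otimes> lpoly l t)" using z ac tc qc minus_equality[of a "t \<otimes> lpoly l t"] by simp
   then have "sdv a a" using sdv_minus[OF s ac] by simp
   then show False using sdv_self ac False by blast
  qed
  then show ?thesis using c(1) cc by blast
 qed
qed simp

lemma lpoly_zero_list: "\<forall>a \<in> set l. a = \<zero> ==> t \<in> carrier R ==> lpoly l t = \<zero>"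
 by (induction l) auto

lemma lderiv_zero_list: "\<forall>a \<in> set l. a = \<zero> ==> t \<in> carrier R ==> lderiv l t = \<zero>"
 by (induction l) (auto simp: lpoly_zero_list)

lemma lpoly_nonzero_near:
 assumes l: "set l \<subseteq> carrier R" and s: "s \<in> carrier R" "lpoly l s ~= \<zero>"
 shows "\<exists>c \<in> carrier R - {\<zero>}. \<forall>t. t ~= \<zero> --> sdv c t --> lpoly l t ~= \<zero>"
 by (rule lpoly_nonzero_near_zero[OF l]) (use lpoly_zero_list[OF _ s(1)] s(2) in blast)

lemma small_exists:
 assumes p: "\<pi> \<in> M" "\<pi> ~= \<zero>" and c: "c \<in> carrier R - {\<zero>}" "d \<in> carrier R - {\<zero>}"
 shows "\<exists>t \<in> carrier R - {\<zero>}. sdv c t \<and> sdv d t"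
proof -
 obtain b where b: "b \<in> carrier R - {\<zero>}" "dv c b" "dv d b" using dv_lub[OF c] by auto
 have pc: "\<pi> \<in> carrier R" using M_V[OF p(1)] by simp
 have s: "sdv b (b \<otimes> \<pi>)" unfolding sdv_def using p(1) by blast
 have "b \<otimes> \<pi> ~= \<zero>" using integral[of b \<pi>] b(1) p(2) pc by auto
 then show ?thesis using dv_sdv_trans[OF b(2) s] dv_sdv_trans[OF b(3) s] c b(1) pc by (intro bexI[of _ "b \<otimes> \<pi>"]) auto
qed

definition seg where "seg u w i = w i \<ominus> (u :: nat \<Rightarrow> 'a) i"

lemma seg_pts: "u \<in> pts n ==> w \<in> pts n ==> seg u w \<in> pts n" by (simp add: pts_def seg_def)

lemma seg_list:
 assumes e: "pwf n e" and u: "u \<in> pts n" and w: "w \<in> pts n"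
 shows "set (linel u (seg u w) e) \<subseteq> carrier R" "lpoly (linel u (seg u w) e) \<zero> = peval e u" "lpoly (linel u (seg u w) e) \<one> = peval e w"
proof -
 note s = seg_pts[OF u w]
 show "set (linel u (seg u w) e) \<subseteq> carrier R" by (rule linel_carr[OF e u s])
 show "lpoly (linel u (seg u w) e) \<zero> = peval e u" unfolding lpoly_linel[OF e u s zero_closed]
  by (rule peval_cong[OF e]) (use u s in \<open>simp add: pts_def\<close>)
 have id: "a \<oplus> \<one> \<otimes> (b \<ominus> a) = b" if "a \<in> carrier R" "b \<in> carrier R" for a b
  using that by - (rule ring_identity, (rule ring_rep | assumption | (simp; fail))+, (simp_all add: l_distr r_distr a_ac m_ac)?)
 show "lpoly (linel u (seg u w) e) \<one> = peval e w" unfolding lpoly_linel[OF e u s one_closed]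
  by (rule peval_cong[OF e]) (use id u w in \<open>simp add: pts_def seg_def\<close>)
qed

text \<open>On the line through \<open>u\<close> and \<open>w\<close> both restrictions are non-zero
  polynomials, one by its value at \<open>0\<close>, the other by its value at \<open>1\<close>.
  Both are therefore non-zero for all small \<open>t \<noteq> 0\<close>, and \<open>\<pi>\<close>
  guarantees that there is such a \<open>t\<close>.\<close>

lemma polyf_common_nonzero:
 assumes p: "\<pi> \<in> M" "\<pi> ~= \<zero>" and f: "polyf n f" "u \<in> pts n" "f u ~= \<zero>" and g: "polyf n g" "w \<in> pts n" "g w ~= \<zero>"
 shows "\<exists>x \<in> pts n. f x ~= \<zero> \<and> g x ~= \<zero>"
proof -
 obtain e where e: "pwf n e" "\<And>x. x \<in> pts n ==> f x = peval e x" using f(1) unfolding polyf_def by blast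
 obtain e' where e': "pwf n e'" "\<And>x. x \<in> pts n ==> g x = peval e' x" using g(1) unfolding polyf_def by blast
 note s = seg_list[OF e(1) f(2) g(2)] and s' = seg_list[OF e'(1) f(2) g(2)]
 obtain c where c: "c \<in> carrier R - {\<zero>}" "\<And>t. t ~= \<zero> ==> sdv c t ==> lpoly (linel u (seg u w) e) t ~= \<zero>"
  using lpoly_nonzero_near[OF s(1) zero_closed] s(2) e(2)[OF f(2)] f(3) by auto
 obtain d where d: "d \<in> carrier R - {\<zero>}" "\<And>t. t ~= \<zero> ==> sdv d t ==> lpoly (linel u (seg u w) e') t ~= \<zero>"
  using lpoly_nonzero_near[OF s'(1) one_closed] s'(3) e'(2)[OF g(2)] g(3) by auto
 obtain t where t: "t \<in> carrier R - {\<zero>}" "sdv c t" "sdv d t" using small_exists[OF p c(1) d(1)] by blast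
 let ?x = "\<lambda>i. u i \<oplus> t \<otimes> seg u w i"
 have x: "?x \<in> pts n" using line_pts[OF f(2) seg_pts[OF f(2) g(2)]] t(1) by simp
 have "f ?x ~= \<zero>" using c(2)[OF _ t(2)] t(1) lpoly_linel[OF e(1) f(2) seg_pts[OF f(2) g(2)], of t] e(2)[OF x] by simp
 moreover have "g ?x ~= \<zero>" using d(2)[OF _ t(3)] t(1) lpoly_linel[OF e'(1) f(2) seg_pts[OF f(2) g(2)], of t] e'(2)[OF x] by simp
 ultimately show ?thesis using x by blast
qed

lemma polyf_nonzero_near:
 assumes p: "\<pi> \<in> M" "\<pi> ~= \<zero>" and f: "polyf n f" "w \<in> pts n" "f w ~= \<zero>" and u: "u \<in> pts n" and c: "c \<in> carrier R - {\<zero>}"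
 shows "\<exists>x \<in> pts n. (\<forall>i<n. sdv c (x i \<ominus> u i)) \<and> f x ~= \<zero>"
proof -
 obtain e where e: "pwf n e" "\<And>x. x \<in> pts n ==> f x = peval e x" using f(1) unfolding polyf_def by blast
 note s = seg_list[OF e(1) u f(2)] and sp = seg_pts[OF u f(2)]
 obtain d where d: "d \<in> carrier R - {\<zero>}" "\<And>t. t ~= \<zero> ==> sdv d t ==> lpoly (linel u (seg u w) e) t ~= \<zero>"
  using lpoly_nonzero_near[OF s(1) one_closed] s(3) e(2)[OF f(2)] f(3) by auto
 have "\<exists>\<rho>. big \<rho> \<and> (\<forall>i \<in> {..<n}. dv \<rho> (seg u w i))"
 proof (rule big_family)
  show "\<exists>\<rho>. big \<rho> \<and> dv \<rho> (seg u w i)" if "i \<in> {..<n}" for i using big_elt ptsD[OF sp] that by simp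
  show "dv \<sigma> (seg u w i)" if "dv \<rho> (seg u w i)" "big \<sigma>" "dv \<sigma> \<rho>" for i \<rho> \<sigma>
   using dv_trans[OF that(3,1) bigD(1)[OF that(2)]] .
 qed simp
 then obtain \<rho> where r: "big \<rho>" "\<And>i. i < n ==> dv \<rho> (seg u w i)" by auto
 have rc: "\<rho> \<in> carrier R" "\<rho> ~= \<zero>" using bigD[OF r(1)] by auto
 have ri: "inv \<rho> \<in> carrier R" "\<rho> \<otimes> inv \<rho> = \<one>" using inv_carr[OF rc] r_inv'[OF rc] by auto
 note inz = inv_nonzero[OF rc]
 have "c \<otimes> inv \<rho> \<in> carrier R - {\<zero>}" using integral[of c "inv \<rho>"] c ri inz by auto
 then obtain t where t: "t \<in> carrier R - {\<zero>}" "sdv (c \<otimes> inv \<rho>) t" "sdv d t" using small_exists[OF p _ d(1)] by blast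
 let ?x = "\<lambda>i. u i \<oplus> t \<otimes> seg u w i"
 have x: "?x \<in> pts n" using line_pts[OF u sp] t(1) by simp
 have "f ?x ~= \<zero>" using d(2)[OF _ t(3)] t(1) lpoly_linel[OF e(1) u sp, of t] e(2)[OF x] by simp
 moreover have "sdv c (?x i \<ominus> u i)" if i: "i < n" for i
 proof -
  have C: "u i \<in> carrier R" "seg u w i \<in> carrier R" "t \<in> carrier R" using ptsD[OF u i] ptsD[OF sp i] t by auto
  have "sdv (\<rho> \<otimes> (c \<otimes> inv \<rho>)) (seg u w i \<otimes> t)" by (rule sdv_mult[OF r(2)[OF i] t(2)]) (use rc c ri in auto)
  moreover have "\<rho> \<otimes> (c \<otimes> inv \<rho>) = c" by (rule cancel_inv(2)) (use rc c in auto)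
  ultimately have "sdv c (t \<otimes> seg u w i)" using m_comm[OF C(2,3)] by metis
  then show ?thesis unfolding add_diff_cancel_left[OF C(1) m_closed[OF C(3,2)]] .
 qed
 ultimately show ?thesis by (intro bexI[OF _ x] conjI allI impI)
qed

lemma polyf_family_nonzero_near:
 assumes p: "\<pi> \<in> M" "\<pi> ~= \<zero>" and K: "finite K" "\<And>k. k \<in> K ==> polyf n (f k)" "\<And>k. k \<in> K ==> \<exists>w \<in> pts n. f k w ~= \<zero>"
  and u: "u \<in> pts n" and c: "c \<in> carrier R - {\<zero>}"
 shows "\<exists>x \<in> pts n. (\<forall>i<n. sdv c (x i \<ominus> u i)) \<and> (\<forall>k \<in> K. f k x ~= \<zero>)"
proof -
 have "\<exists>g. polyf n g \<and> (\<exists>w \<in> pts n. g w ~= \<zero>) \<and> (\<forall>x \<in> pts n. g x ~= \<zero> --> (\<forall>k \<in> K. f k x ~= \<zero>))"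
  using K
 proof (induction K rule: finite_induct)
  case empty
  show ?case using polyf_const[of \<one> n] u by (intro exI[of _ "\<lambda>_. \<one>"]) auto
 next
  case (insert b K)
  have "\<exists>g. polyf n g \<and> (\<exists>w \<in> pts n. g w ~= \<zero>) \<and> (\<forall>x \<in> pts n. g x ~= \<zero> --> (\<forall>k \<in> K. f k x ~= \<zero>))"
   by (rule insert.IH) (use insert.prems in auto)
  then obtain g where g: "polyf n g" "\<exists>w \<in> pts n. g w ~= \<zero>" "\<And>x k. x \<in> pts n ==> g x ~= \<zero> ==> k \<in> K ==> f k x ~= \<zero>" by blast
  have fb: "polyf n (f b)" "\<exists>w \<in> pts n. f b w ~= \<zero>" using insert.prems by auto
  obtain x where x: "x \<in> pts n" "f b x ~= \<zero>" "g x ~= \<zero>" using polyf_common_nonzero[OF p fb(1) _ _ g(1)] fb(2) g(2) by blast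
  have "f b x \<otimes> g x ~= \<zero>" using integral[OF _ polyf_closed[OF fb(1) x(1)] polyf_closed[OF g(1) x(1)]] x(2,3) by blast
  moreover have "f b y ~= \<zero> \<and> g y ~= \<zero>" if "y \<in> pts n" "f b y \<otimes> g y ~= \<zero>" for y
   using that polyf_closed[OF fb(1) that(1)] polyf_closed[OF g(1) that(1)] by auto
  ultimately show ?case using polyf_mult[OF fb(1) g(1)] x(1) g(3) by (intro exI[of _ "\<lambda>x. f b x \<otimes> g x"]) blast
 qed
 then obtain g w where g: "polyf n g" "w \<in> pts n" "g w ~= \<zero>" "\<And>x k. x \<in> pts n ==> g x ~= \<zero> ==> k \<in> K ==> f k x ~= \<zero>" by blast
 obtain x where x: "x \<in> pts n" "\<forall>i<n. sdv c (x i \<ominus> u i)" "g x ~= \<zero>"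
  using polyf_nonzero_near[OF p g(1,2,3) u c] by (elim bexE conjE) (rule that)
 show ?thesis
 proof (rule bexI[OF _ x(1)], rule conjI[OF x(2)], rule ballI)
  show "f k x ~= \<zero>" if "k \<in> K" for k by (rule g(4)[OF x(1,3) that])
 qed
qed

text \<open>Over a finite field a polynomial may vanish everywhere while its formal derivative does
  not. Here \<open>\<pi>\<close> provides non-zero \<open>t\<close> arbitrarily close to zero, so
  the restriction to every line in direction \<open>k\<close> has only zero coefficients.\<close>

lemma pd_zero:
 assumes p: "\<pi> \<in> M" "\<pi> ~= \<zero>" and e: "pwf n e" and z: "\<And>x. x \<in> pts n ==> peval e x = \<zero>"
  and k: "k < n" and x: "x \<in> pts n"
 shows "peval (pd k e) x = \<zero>"
proof -
 let ?w = "\<lambda>i. if i = k then \<one> else \<zero>"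
 have w: "?w \<in> pts n" by (simp add: pts_def)
 let ?l = "linel x ?w e"
 have l: "\<forall>a \<in> set ?l. a = \<zero>"
 proof (rule ccontr)
  assume "\<not> (\<forall>a \<in> set ?l. a = \<zero>)"
  then have "\<exists>a \<in> set ?l. a ~= \<zero>" by blast
  then obtain c where c: "c \<in> carrier R - {\<zero>}" "\<And>t. t ~= \<zero> ==> sdv c t ==> lpoly ?l t ~= \<zero>"
   using lpoly_nonzero_near_zero[OF linel_carr[OF e x w]] by blast
  obtain t where t: "t \<in> carrier R - {\<zero>}" "sdv c t" using small_exists[OF p c(1,1)] by blast
  then show False using c(2)[OF _ t(2)] lpoly_linel[OF e x w] z[OF line_pts[OF x w]] by auto
 qed
 have pc: "peval (pd j e) x \<in> carrier R" for j using peval_closed[OF pwf_pd[OF e] x] .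
 have "\<zero> = lderiv ?l \<zero>" using lderiv_zero_list[OF l zero_closed] ..
 also have "\<dots> = (\<Oplus>j\<in>{..<n}. peval (pd j e) (\<lambda>i. x i \<oplus> \<zero> \<otimes> ?w i) \<otimes> ?w j)" by (rule lderiv_linel[OF x w zero_closed e])
 also have "\<dots> = (\<Oplus>j\<in>{..<n}. peval (pd j e) x \<otimes> ?w j)"
 proof (rule fsum_cong)
  fix j
  have "peval (pd j e) (\<lambda>i. x i \<oplus> \<zero> \<otimes> ?w i) = peval (pd j e) x"
   by (rule peval_cong[OF pwf_pd[OF e]]) (use ptsD[OF x] in simp)
  then show "peval (pd j e) (\<lambda>i. x i \<oplus> \<zero> \<otimes> ?w i) \<otimes> ?w j = peval (pd j e) x \<otimes> ?w j" by simp
 qed (use pc in auto)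
 also have "\<dots> = peval (pd k e) x \<otimes> ?w k" by (rule fsum_single) (use k pc in auto)
 finally show ?thesis using pc by simp
qed

end

section \<open>Algebraic relations\<close>

primrec (in ring) mo :: "nat \<Rightarrow> (nat \<Rightarrow> nat) \<Rightarrow> (nat \<Rightarrow> 'a) \<Rightarrow> 'a" where
 "mo 0 \<alpha> x = \<one>"
| "mo (Suc m) \<alpha> x = mo m \<alpha> x \<otimes> x m [^] \<alpha> m"

primrec (in ring) ppow :: "nat \<Rightarrow> nat \<Rightarrow> 'a px" where
 "ppow i 0 = PC \<one>"
| "ppow i (Suc k) = PM (ppow i k) (PV i)"

primrec (in ring) mexp :: "nat \<Rightarrow> (nat \<Rightarrow> nat) \<Rightarrow> 'a px" where
 "mexp 0 \<alpha> = PC \<one>"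
| "mexp (Suc m) \<alpha> = PM (mexp m \<alpha>) (ppow m (\<alpha> m))"

context cring
begin

lemma mo_closed: "(\<And>i. i < n ==> x i \<in> carrier R) ==> mo n \<alpha> x \<in> carrier R"
 by (induction n) auto

lemma mo_cong: "(\<And>i. i < n ==> \<alpha> i = \<beta> i) ==> (\<And>i. i < n ==> x i = y i) ==> mo n \<alpha> x = mo n \<beta> y"
 by (induction n) auto

lemma mo_Suc: "(\<And>i. i < n ==> x i \<in> carrier R) ==> k < n ==> mo n (\<alpha>(k := Suc (\<alpha> k))) x = mo n \<alpha> x \<otimes> x k"
proof (induction n)
 case (Suc n)
 have C: "mo n \<alpha> x \<in> carrier R" "x n \<in> carrier R" "x k \<in> carrier R" using Suc.prems mo_closed[of n x] by auto
 show ?case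
 proof (cases "k = n")
  case True
  have "mo n (\<alpha>(k := Suc (\<alpha> k))) x = mo n \<alpha> x" by (rule mo_cong) (use True in auto)
  then show ?thesis using C unfolding True mo.simps by (simp add: m_assoc)
 next
  case False
  have "mo n (\<alpha>(k := Suc (\<alpha> k))) x = mo n \<alpha> x \<otimes> x k" by (rule Suc.IH) (use Suc.prems False in auto)
  moreover have "(\<alpha>(k := Suc (\<alpha> k))) n = \<alpha> n" using False by simp
  ultimately show ?thesis using C unfolding mo.simps by (simp add: m_ac)
 qed
qed simp

lemma mo_power: "(\<And>i. i < n ==> x i \<in> carrier R) ==> mo n (\<lambda>i. p * \<alpha> i) x = mo n \<alpha> x [^] p"
proof (induction n)
 case (Suc n)
 have C: "mo n \<alpha> x \<in> carrier R" "x n \<in> carrier R" using Suc.prems mo_closed[of n x] by auto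
 have "x n [^] (p * \<alpha> n) = (x n [^] \<alpha> n) [^] p" using C by (simp add: nat_pow_pow mult.commute)
 then show ?case using Suc C by (simp add: nat_pow_distrib)
qed simp

lemma pwf_ppow: "i < n ==> pwf n (ppow i k)" by (induction k) auto

lemma pwf_mexp: "m \<le> n ==> pwf n (mexp m \<alpha>)" by (induction m) (auto simp: pwf_ppow)

lemma peval_ppow: "peval (ppow i k) x = x i [^] k" by (induction k) auto

lemma peval_mexp: "peval (mexp m \<alpha>) x = mo m \<alpha> x" by (induction m) (auto simp: peval_ppow)

lemma peval_pd_ppow:
 "x i \<in> carrier R ==> peval (pd j (ppow i k)) x = (if i = j then [k] \<cdot> (x i [^] (k - 1)) else \<zero>)"
proof (induction k)
 case (Suc k)
 show ?case
 proof (cases "i = j")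
  case True
  have "[k] \<cdot> (x i [^] (k - 1)) \<otimes> x i = [k] \<cdot> (x i [^] k)"
   using Suc.prems add_pow_ldistr[of "x i [^] (k - 1)" "x i" k] by (cases k) (simp, simp del: add.nat_pow_Suc)
  then show ?thesis using Suc True by (simp add: peval_ppow)
 qed (use Suc in \<open>simp add: peval_ppow\<close>)
qed simp

lemma peval_pd_mexp:
 assumes x: "x \<in> pts n"
 shows "m \<le> n ==> peval (pd j (mexp m \<alpha>)) x = (if j < m then [\<alpha> j] \<cdot> mo m (\<alpha>(j := \<alpha> j - 1)) x else \<zero>)"
proof (induction m)
 case (Suc m)
 have C: "mo m \<beta> x \<in> carrier R" "x m \<in> carrier R" for \<beta> using Suc.prems x mo_closed[of m x] by (auto simp: pts_def)
 note IH = Suc.IH[OF Suc_leD[OF Suc.prems]]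
 have E: "peval (pd j (mexp (Suc m) \<alpha>)) x = peval (pd j (mexp m \<alpha>)) x \<otimes> x m [^] \<alpha> m \<oplus>
   mo m \<alpha> x \<otimes> (if m = j then [\<alpha> m] \<cdot> (x m [^] (\<alpha> m - 1)) else \<zero>)"
  using peval_pd_ppow[of x m j "\<alpha> m"] C by (simp add: peval_ppow peval_mexp)
 consider "j < m" | "j = m" | "j > m" by linarith
 then show ?case
 proof cases
  case 1
  then show ?thesis unfolding E IH using C by (simp add: add_pow_ldistr)
 next
  case 2
  have "mo m (\<alpha>(m := \<alpha> m - 1)) x = mo m \<alpha> x" by (rule mo_cong) auto
  then show ?thesis unfolding E IH using 2 C by (simp add: add_pow_rdistr)
 next
  case 3
  then show ?thesis unfolding E IH using C by simp
 qed
qed simp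

definition bx :: "nat \<Rightarrow> nat \<Rightarrow> (nat \<Rightarrow> nat) set" where "bx n N = {..<n} \<rightarrow>\<^sub>E {..N}"

lemma bx_finite: "finite (bx n N)" unfolding bx_def by (rule finite_PiE) auto

lemma bx_card: "card (bx n N) = Suc N ^ n" unfolding bx_def by (simp add: card_PiE)

lemma bx_upd: "\<beta> \<in> bx n N ==> k < n ==> \<beta>(k := Suc (\<beta> k)) \<in> bx n (Suc N)"
 unfolding bx_def by (auto simp: PiE_iff extensional_def le_SucI)

text \<open>Polynomial functions with exponents at most \<open>N\<close> in each variable. Adding
  one monomial at a time makes the closure properties inductions; the coefficients are recovered in
  \<open>span_coeffs\<close>.\<close>

inductive span :: "nat \<Rightarrow> nat \<Rightarrow> ((nat \<Rightarrow> 'a) \<Rightarrow> 'a) \<Rightarrow> bool" for n where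
 span_zero: "(\<forall>x \<in> pts n. f x = \<zero>) ==> span n N f"
| span_step: "span n N f ==> a \<in> carrier R ==> \<beta> \<in> bx n N ==> (\<forall>x \<in> pts n. g x = f x \<oplus> a \<otimes> mo n \<beta> x) ==> span n N g"

lemma span_closed: "span n N f ==> x \<in> pts n ==> f x \<in> carrier R"
 by (induction rule: span.induct) (auto simp: ptsD intro!: mo_closed m_closed)

lemma span_cong: "span n N f ==> (\<forall>x \<in> pts n. g x = f x) ==> span n N g"
 by (induction rule: span.induct) (auto intro: span.intros)

lemma span_mono: "span n N f ==> N \<le> N' ==> span n N' f"
proof (induction rule: span.induct)
 case (span_step N f a \<beta> g)
 have "\<beta> \<in> bx n N'" using span_step.hyps(3) span_step.prems unfolding bx_def by (auto simp: PiE_iff intro: order_trans)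
 then show ?case using span_step span.span_step by blast
qed (auto intro: span.span_zero)

lemma span_add: "span n N f ==> span n N g ==> span n N (\<lambda>x. f x \<oplus> g x)"
proof (induction rule: span.induct)
 case (span_zero f N)
 then show ?case using span_cong[of n N g "\<lambda>x. f x \<oplus> g x"] span_closed[of n N g] by auto
next
 case (span_step N f a \<beta> h)
 have "span n N (\<lambda>x. f x \<oplus> g x)" using span_step by blast
 then show ?case
 proof (rule span.span_step[OF _ span_step.hyps(2,3)])
  show "\<forall>x \<in> pts n. h x \<oplus> g x = f x \<oplus> g x \<oplus> a \<otimes> mo n \<beta> x"
  proof
   fix x assume x: "x \<in> pts n"
   have "mo n \<beta> x \<in> carrier R" by (rule mo_closed) (rule ptsD[OF x])
   then show "h x \<oplus> g x = f x \<oplus> g x \<oplus> a \<otimes> mo n \<beta> x"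
    using span_step.hyps(2,4) x span_closed[OF span_step.hyps(1) x] span_closed[OF span_step.prems x] by (simp add: a_ac)
  qed
 qed
qed

lemma span_scale: "span n N f ==> c \<in> carrier R ==> span n N (\<lambda>x. c \<otimes> f x)"
proof (induction rule: span.induct)
 case (span_step N f a \<beta> h)
 have "span n N (\<lambda>x. c \<otimes> f x)" using span_step by blast
 then show ?case
 proof (rule span.span_step[OF _ _ span_step.hyps(3)])
  show "c \<otimes> a \<in> carrier R" using span_step by simp
  show "\<forall>x \<in> pts n. c \<otimes> h x = c \<otimes> f x \<oplus> c \<otimes> a \<otimes> mo n \<beta> x"
  proof
   fix x assume x: "x \<in> pts n"
   have "mo n \<beta> x \<in> carrier R" by (rule mo_closed) (rule ptsD[OF x])
   then show "c \<otimes> h x = c \<otimes> f x \<oplus> c \<otimes> a \<otimes> mo n \<beta> x"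
    using span_step.hyps(2,4) x span_closed[OF span_step.hyps(1) x] span_step.prems by (simp add: r_distr m_assoc)
  qed
 qed
qed (auto intro: span.span_zero)

lemma span_var: "span n N f ==> k < n ==> span n (Suc N) (\<lambda>x. x k \<otimes> f x)"
proof (induction rule: span.induct)
 case (span_zero f N)
 then show ?case by (intro span.span_zero) (auto simp: ptsD)
next
 case (span_step N f a \<beta> h)
 have "span n (Suc N) (\<lambda>x. x k \<otimes> f x)" using span_step by blast
 then show ?case
 proof (rule span.span_step[OF _ span_step.hyps(2) bx_upd[OF span_step.hyps(3) span_step.prems]])
  show "\<forall>x \<in> pts n. x k \<otimes> h x = x k \<otimes> f x \<oplus> a \<otimes> mo n (\<beta>(k := Suc (\<beta> k))) x"
  proof
   fix x assume x: "x \<in> pts n"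
   have m: "mo n \<beta> x \<in> carrier R" by (rule mo_closed) (rule ptsD[OF x])
   have "mo n (\<beta>(k := Suc (\<beta> k))) x = mo n \<beta> x \<otimes> x k" by (rule mo_Suc[OF ptsD[OF x] span_step.prems])
   then show "x k \<otimes> h x = x k \<otimes> f x \<oplus> a \<otimes> mo n (\<beta>(k := Suc (\<beta> k))) x"
    using m span_step.hyps(2,4) x span_closed[OF span_step.hyps(1) x] ptsD[OF x span_step.prems] by (simp add: r_distr m_ac)
  qed
 qed
qed

lemma span_coeffs: "span n N f ==> \<exists>c. (\<forall>\<beta>. c \<beta> \<in> carrier R) \<and> (\<forall>x \<in> pts n. f x = (\<Oplus>\<beta>\<in>bx n N. c \<beta> \<otimes> mo n \<beta> x))"
proof (induction rule: span.induct)
 case (span_zero f N)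
 have "(\<Oplus>\<beta>\<in>bx n N. \<zero> \<otimes> mo n \<beta> x) = \<zero>" if x: "x \<in> pts n" for x
  by (rule fsum_zero) (rule l_null, rule mo_closed, rule ptsD[OF x])
 then show ?case using span_zero by (intro exI[of _ "\<lambda>_. \<zero>"]) auto
next
 case (span_step N f a \<beta> g)
 then obtain c where c: "\<forall>\<beta>. c \<beta> \<in> carrier R" "\<forall>x \<in> pts n. f x = (\<Oplus>\<beta>\<in>bx n N. c \<beta> \<otimes> mo n \<beta> x)" by blast
 have "g x = (\<Oplus>\<gamma>\<in>bx n N. (c(\<beta> := c \<beta> \<oplus> a)) \<gamma> \<otimes> mo n \<gamma> x)" if x: "x \<in> pts n" for x
 proof -
  have m: "mo n \<gamma> x \<in> carrier R" for \<gamma> by (rule mo_closed) (rule ptsD[OF x])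
  have "(\<Oplus>\<gamma>\<in>bx n N. (c(\<beta> := c \<beta> \<oplus> a)) \<gamma> \<otimes> mo n \<gamma> x) =
    (\<Oplus>\<gamma>\<in>bx n N. c \<gamma> \<otimes> mo n \<gamma> x \<oplus> (if \<gamma> = \<beta> then a else \<zero>) \<otimes> mo n \<gamma> x)"
   by (rule fsum_cong) (use c(1) m span_step.hyps(2) in \<open>auto simp: l_distr\<close>)
  also have "\<dots> = (\<Oplus>\<gamma>\<in>bx n N. c \<gamma> \<otimes> mo n \<gamma> x) \<oplus> (\<Oplus>\<gamma>\<in>bx n N. (if \<gamma> = \<beta> then a else \<zero>) \<otimes> mo n \<gamma> x)"
   by (rule fsum_add) (use c(1) m span_step.hyps(2) in auto)
  also have "(\<Oplus>\<gamma>\<in>bx n N. (if \<gamma> = \<beta> then a else \<zero>) \<otimes> mo n \<gamma> x) = (if \<beta> = \<beta> then a else \<zero>) \<otimes> mo n \<beta> x"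
   by (rule fsum_single) (use bx_finite span_step.hyps(2,3) m in auto)
  finally show ?thesis using span_step.hyps(4) c(2) x by simp
 qed
 then show ?case using c(1) span_step.hyps(2) by (intro exI[of _ "c(\<beta> := c \<beta> \<oplus> a)"]) simp
qed

lemma span_px: "pwf n e ==> \<exists>d. \<forall>N f. span n N f --> span n (N + d) (\<lambda>x. peval e x \<otimes> f x)"
proof (induction e)
 case (PC a)
 then show ?case using span_scale by (intro exI[of _ 0]) simp
next
 case (PV i)
 then show ?case using span_var by (intro exI[of _ 1]) simp
next
 case (PA e f)
 then obtain d d' where d: "\<forall>N h. span n N h --> span n (N + d) (\<lambda>x. peval e x \<otimes> h x)"
  "\<forall>N h. span n N h --> span n (N + d') (\<lambda>x. peval f x \<otimes> h x)" by auto
 have "span n (N + (d + d')) (\<lambda>x. peval (PA e f) x \<otimes> h x)" if h: "span n N h" for N h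
 proof -
  have "span n (N + (d + d')) (\<lambda>x. peval e x \<otimes> h x \<oplus> peval f x \<otimes> h x)"
  proof (rule span_add)
   show "span n (N + (d + d')) (\<lambda>x. peval e x \<otimes> h x)" by (rule span_mono[OF d(1)[rule_format, OF h]]) simp
   show "span n (N + (d + d')) (\<lambda>x. peval f x \<otimes> h x)" by (rule span_mono[OF d(2)[rule_format, OF h]]) simp
  qed
  then show ?thesis by (rule span_cong) (use PA.prems peval_closed span_closed[OF h] in \<open>auto simp: l_distr\<close>)
 qed
 then show ?case by blast
next
 case (PM e f)
 then obtain d d' where d: "\<forall>N h. span n N h --> span n (N + d) (\<lambda>x. peval e x \<otimes> h x)"
  "\<forall>N h. span n N h --> span n (N + d') (\<lambda>x. peval f x \<otimes> h x)" by auto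
 have "span n (N + (d' + d)) (\<lambda>x. peval (PM e f) x \<otimes> h x)" if h: "span n N h" for N h
 proof -
  have "span n (N + d' + d) (\<lambda>x. peval e x \<otimes> (peval f x \<otimes> h x))" using h d by blast
  then show ?thesis unfolding add.assoc by (rule span_cong) (use PM.prems peval_closed span_closed[OF h] in \<open>auto simp: m_assoc\<close>)
 qed
 then show ?case by blast
qed

lemma span_one: "span n 0 (\<lambda>_. \<one>)"
proof (rule span.span_step[OF span.span_zero])
 show "(\<lambda>i\<in>{..<n}. 0) \<in> bx n 0" by (auto simp: bx_def)
 have "mo m (\<lambda>i\<in>{..<n}. 0) x = \<one>" if "m \<le> n" "x \<in> pts n" for x m
  using that by (induction m) (auto simp: pts_def)
 then show "\<forall>x \<in> pts n. \<one> = \<zero> \<oplus> \<one> \<otimes> mo n (\<lambda>i\<in>{..<n}. 0) x" by simp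
qed auto

lemma span_px_uniform:
 assumes "finite J" "\<And>j. j \<in> J ==> pwf n (\<phi> j)"
 shows "\<exists>d. \<forall>j \<in> J. \<forall>N f. span n N f --> span n (N + d) (\<lambda>x. peval (\<phi> j) x \<otimes> f x)"
 using assms
proof (induction J rule: finite_induct)
 case (insert b J)
 obtain d where d: "\<forall>j \<in> J. \<forall>N f. span n N f --> span n (N + d) (\<lambda>x. peval (\<phi> j) x \<otimes> f x)" using insert by auto
 obtain d' where d': "\<forall>N f. span n N f --> span n (N + d') (\<lambda>x. peval (\<phi> b) x \<otimes> f x)" using span_px insert.prems by blast
 show ?case
 proof (intro exI[of _ "d + d'"] ballI allI impI)
  fix j N f assume j: "j \<in> insert b J" and f: "span n N f"
  then consider "span n (N + d) (\<lambda>x. peval (\<phi> j) x \<otimes> f x)" | "span n (N + d') (\<lambda>x. peval (\<phi> j) x \<otimes> f x)" using d d' by blast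
  then show "span n (N + (d + d')) (\<lambda>x. peval (\<phi> j) x \<otimes> f x)" by cases (auto elim: span_mono)
 qed
qed simp

lemma span_pow:
 assumes e: "pwf n e" and d: "\<forall>N f. span n N f --> span n (N + d) (\<lambda>x. peval e x \<otimes> f x)" and f: "span n N f"
 shows "span n (N + k * d) (\<lambda>x. f x \<otimes> peval e x [^] k)"
proof (induction k)
 case 0
 show ?case using span_cong[OF f, of "\<lambda>x. f x \<otimes> \<one>"] span_closed[OF f] by simp
next
 case (Suc k)
 have "span n (N + k * d + d) (\<lambda>x. peval e x \<otimes> (f x \<otimes> peval e x [^] k))" using Suc d by blast
 moreover have "N + k * d + d = N + Suc k * d" by simp
 ultimately have "span n (N + Suc k * d) (\<lambda>x. peval e x \<otimes> (f x \<otimes> peval e x [^] k))" by simp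
 then show ?case
 proof (rule span_cong, intro ballI)
  fix x assume x: "x \<in> pts n"
  show "f x \<otimes> peval e x [^] Suc k = peval e x \<otimes> (f x \<otimes> peval e x [^] k)"
   using peval_closed[OF e x] span_closed[OF f x] by (simp add: m_ac)
 qed
qed

lemma span_mo:
 assumes \<phi>: "\<And>j. j < m ==> pwf n (\<phi> j)" and d: "\<And>j. j < m ==> \<forall>N f. span n N f --> span n (N + d) (\<lambda>x. peval (\<phi> j) x \<otimes> f x)"
  and \<alpha>: "\<And>j. j < m ==> \<alpha> j \<le> D"
 shows "span n (m * (D * d)) (\<lambda>x. mo m \<alpha> (\<lambda>j. peval (\<phi> j) x))"
 using assms
proof (induction m)
 case 0
 show ?case using span_one by simp
next
 case (Suc m)
 have "span n (m * (D * d)) (\<lambda>x. mo m \<alpha> (\<lambda>j. peval (\<phi> j) x))" by (rule Suc.IH) (use Suc.prems in auto)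
 then have "span n (m * (D * d) + \<alpha> m * d) (\<lambda>x. mo m \<alpha> (\<lambda>j. peval (\<phi> j) x) \<otimes> peval (\<phi> m) x [^] \<alpha> m)"
  using Suc.prems by (intro span_pow) auto
 moreover have "m * (D * d) + \<alpha> m * d \<le> Suc m * (D * d)" using Suc.prems(3)[of m] by simp
 ultimately show ?case using span_mono by simp
qed

end

context field
begin

text \<open>A count. The \<open>(D + 1)^(n + 1)\<close> monomials in the \<open>n + 1\<close> given
  polynomials take their values in a space spanned by \<open>(N + 1)^n\<close> monomials in the
  variables, and \<open>N\<close> grows only linearly with \<open>D\<close>.\<close>

lemma monomials_dependent:
 assumes \<phi>: "\<And>j. j < Suc n ==> pwf n (\<phi> j)"
 shows "\<exists>D. \<not> indep (pts n) (bx (Suc n) D) (\<lambda>\<alpha> x. mo (Suc n) \<alpha> (\<lambda>j. peval (\<phi> j) x))"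
proof -
 have "\<exists>d. \<forall>j \<in> {..<Suc n}. \<forall>N f. span n N f --> span n (N + d) (\<lambda>x. peval (\<phi> j) x \<otimes> f x)"
  by (rule span_px_uniform) (use \<phi> in auto)
 then obtain d where d: "\<And>j. j < Suc n ==> \<forall>N f. span n N f --> span n (N + d) (\<lambda>x. peval (\<phi> j) x \<otimes> f x)"
  by (meson lessThan_iff)
 define s where "s = Suc (Suc n * d)"
 \<comment> \<open>Since \<open>N + 1 \<le> s (D + 1)\<close>, the choice \<open>D = s^n\<close>
   gives \<open>(N + 1)^n \<le> D (D + 1)^n < (D + 1)^(n + 1)\<close>.\<close>
 define D where "D = s ^ n"
 define N where "N = Suc n * (D * d)"
 have "Suc N \<le> s * Suc D"
 proof -
  have "Suc N \<le> Suc (Suc n * d) * D + 1" unfolding N_def by (simp add: algebra_simps)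
  also have "\<dots> \<le> s * D + s" unfolding s_def by simp
  finally show ?thesis by simp
 qed
 then have "Suc N ^ n \<le> (s * Suc D) ^ n" by (rule power_mono) simp
 also have "\<dots> = D * Suc D ^ n" unfolding power_mult_distrib D_def[symmetric] ..
 also have "\<dots> < Suc D ^ Suc n" by simp
 finally have card: "card (bx n N) < card (bx (Suc n) D)" unfolding bx_card .
 let ?\<phi> = "\<lambda>x j. peval (\<phi> j) x"
 have "\<exists>c. (\<forall>\<beta>. c \<beta> \<in> carrier R) \<and> (\<forall>x \<in> pts n. mo (Suc n) \<alpha> (?\<phi> x) = (\<Oplus>\<beta>\<in>bx n N. c \<beta> \<otimes> mo n \<beta> x))"
  if "\<alpha> \<in> bx (Suc n) D" for \<alpha>
 proof (rule span_coeffs)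
  have a: "\<alpha> j \<le> D" if "j < Suc n" for j using \<open>\<alpha> \<in> bx (Suc n) D\<close> that unfolding bx_def by (auto simp: PiE_iff)
  show "span n N (\<lambda>x. mo (Suc n) \<alpha> (?\<phi> x))" unfolding N_def by (rule span_mo[OF \<phi> d a])
 qed
 then obtain a where a: "\<And>\<alpha> \<beta>. \<alpha> \<in> bx (Suc n) D ==> a \<alpha> \<beta> \<in> carrier R"
  "\<And>\<alpha> x. \<alpha> \<in> bx (Suc n) D ==> x \<in> pts n ==> mo (Suc n) \<alpha> (?\<phi> x) = (\<Oplus>\<beta>\<in>bx n N. a \<alpha> \<beta> \<otimes> mo n \<beta> x)" by metis
 obtain c where c: "\<forall>\<alpha> \<in> bx (Suc n) D. c \<alpha> \<in> carrier R" "\<exists>\<alpha> \<in> bx (Suc n) D. c \<alpha> ~= \<zero>"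
  "\<forall>\<beta> \<in> bx n N. (\<Oplus>\<alpha>\<in>bx (Suc n) D. c \<alpha> \<otimes> a \<alpha> \<beta>) = \<zero>"
  using elimination[OF bx_finite bx_finite card, of a] a(1) by blast
 have "(\<Oplus>\<alpha>\<in>bx (Suc n) D. c \<alpha> \<otimes> mo (Suc n) \<alpha> (?\<phi> x)) = \<zero>" if x: "x \<in> pts n" for x
 proof -
  have m: "mo n \<beta> x \<in> carrier R" for \<beta> by (rule mo_closed) (rule ptsD[OF x])
  have "(\<Oplus>\<alpha>\<in>bx (Suc n) D. c \<alpha> \<otimes> mo (Suc n) \<alpha> (?\<phi> x)) = (\<Oplus>\<alpha>\<in>bx (Suc n) D. \<Oplus>\<beta>\<in>bx n N. (c \<alpha> \<otimes> a \<alpha> \<beta>) \<otimes> mo n \<beta> x)"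
  proof (rule fsum_cong)
   fix \<alpha> assume \<alpha>: "\<alpha> \<in> bx (Suc n) D"
   have "c \<alpha> \<otimes> mo (Suc n) \<alpha> (?\<phi> x) = (\<Oplus>\<beta>\<in>bx n N. c \<alpha> \<otimes> (a \<alpha> \<beta> \<otimes> mo n \<beta> x))"
    unfolding a(2)[OF \<alpha> x] by (rule fsum_mult[symmetric]) (use bx_finite a(1)[OF \<alpha>] m c(1) \<alpha> in auto)
   also have "\<dots> = (\<Oplus>\<beta>\<in>bx n N. (c \<alpha> \<otimes> a \<alpha> \<beta>) \<otimes> mo n \<beta> x)"
    by (rule fsum_cong) (use a(1)[OF \<alpha>] m c(1) \<alpha> in \<open>auto simp: m_assoc\<close>)
   finally show "c \<alpha> \<otimes> mo (Suc n) \<alpha> (?\<phi> x) = (\<Oplus>\<beta>\<in>bx n N. (c \<alpha> \<otimes> a \<alpha> \<beta>) \<otimes> mo n \<beta> x)" .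
   show "(\<Oplus>\<beta>\<in>bx n N. (c \<alpha> \<otimes> a \<alpha> \<beta>) \<otimes> mo n \<beta> x) \<in> carrier R"
    by (rule fsum_closed) (use a(1)[OF \<alpha>] m c(1) \<alpha> in auto)
  qed simp
  also have "\<dots> = (\<Oplus>\<beta>\<in>bx n N. \<Oplus>\<alpha>\<in>bx (Suc n) D. (c \<alpha> \<otimes> a \<alpha> \<beta>) \<otimes> mo n \<beta> x)"
   by (rule fsum_swap) (use bx_finite a(1) m c(1) in auto)
  also have "\<dots> = \<zero>"
  proof (rule fsum_zero)
   fix \<beta> assume b: "\<beta> \<in> bx n N"
   have "(\<Oplus>\<alpha>\<in>bx (Suc n) D. (c \<alpha> \<otimes> a \<alpha> \<beta>) \<otimes> mo n \<beta> x) = (\<Oplus>\<alpha>\<in>bx (Suc n) D. c \<alpha> \<otimes> a \<alpha> \<beta>) \<otimes> mo n \<beta> x"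
    by (rule fsum_mult_right) (use bx_finite a(1) m c(1) in auto)
   then show "(\<Oplus>\<alpha>\<in>bx (Suc n) D. (c \<alpha> \<otimes> a \<alpha> \<beta>) \<otimes> mo n \<beta> x) = \<zero>" using c(3) b m by simp
  qed
  finally show ?thesis .
 qed
 then show ?thesis using c(1,2) unfolding indep_def by blast
qed

lemma indep_reindex:
 assumes inj: "inj_on f A" and I: "indep Xs (f ` A) u" and u: "\<And>a x. a \<in> A ==> x \<in> Xs ==> u (f a) x \<in> carrier R"
 shows "indep Xs A (\<lambda>a. u (f a))"
 unfolding indep_def
proof (intro allI impI ballI)
 fix c a assume c: "\<forall>i\<in>A. c i \<in> carrier R" and z: "\<forall>x\<in>Xs. (\<Oplus>i\<in>A. c i \<otimes> u (f i) x) = \<zero>" and a: "a \<in> A"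
 define d where "d b = c (inv_into A f b)" for b
 have df: "d (f i) = c i" if "i \<in> A" for i using inv_into_f_f[OF inj that] by (simp add: d_def)
 have "(\<Oplus>b\<in>f ` A. d b \<otimes> u b x) = \<zero>" if x: "x \<in> Xs" for x
 proof -
  have "(\<Oplus>b\<in>f ` A. d b \<otimes> u b x) = (\<Oplus>i\<in>A. d (f i) \<otimes> u (f i) x)"
   by (rule add.finprod_reindex[OF _ inj]) (use df c u x in auto)
  also have "\<dots> = (\<Oplus>i\<in>A. c i \<otimes> u (f i) x)" by (rule fsum_cong) (use df c u x in auto)
  finally show ?thesis using z x by simp
 qed
 moreover have "\<forall>b \<in> f ` A. d b \<in> carrier R" using df c by simp
 ultimately have "d (f a) = \<zero>" using I[unfolded indep_def, rule_format, of d "f a"] a by blast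
 then show "c a = \<zero>" using df[OF a] by simp
qed

lemma px_sum:
 assumes "finite A" "\<And>a. a \<in> A ==> pwf m (E a)"
 shows "\<exists>e. pwf m e \<and> (\<forall>x \<in> pts m. peval e x = (\<Oplus>a\<in>A. peval (E a) x)) \<and>
  (\<forall>j. \<forall>x \<in> pts m. peval (pd j e) x = (\<Oplus>a\<in>A. peval (pd j (E a)) x))"
 using assms
proof (induction A rule: finite_induct)
 case empty
 show ?case by (intro exI[of _ "PC \<zero>"]) simp
next
 case (insert b A)
 then obtain e where e: "pwf m e" "\<forall>x \<in> pts m. peval e x = (\<Oplus>a\<in>A. peval (E a) x)"
  "\<forall>j. \<forall>x \<in> pts m. peval (pd j e) x = (\<Oplus>a\<in>A. peval (pd j (E a)) x)" by auto
 have C: "peval (E a) x \<in> carrier R" "peval (pd j (E a)) x \<in> carrier R" if "a \<in> insert b A" "x \<in> pts m" for a x j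
  using peval_closed[OF insert.prems[OF that(1)] that(2)] peval_closed[OF pwf_pd[OF insert.prems[OF that(1)]] that(2)] by auto
 have "(\<Oplus>a\<in>insert b A. peval (E a) x) = peval (E b) x \<oplus> (\<Oplus>a\<in>A. peval (E a) x)" if "x \<in> pts m" for x
  by (rule fsum_insert) (use insert.hyps C that in auto)
 moreover have "(\<Oplus>a\<in>insert b A. peval (pd j (E a)) x) = peval (pd j (E b)) x \<oplus> (\<Oplus>a\<in>A. peval (pd j (E a)) x)" if "x \<in> pts m" for x j
  by (rule fsum_insert) (use insert.hyps C that in auto)
 ultimately show ?case using e insert.prems[of b] by (intro exI[of _ "PA (E b) e"]) simp
qed

end

context valuation_subring
begin

text \<open>Total degree rather than a bound in each variable, because a minimal relation is
  compared with its partial derivatives, which lower just one exponent. Extensionality lets an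
  exponent be determined by its entries below \<open>m\<close>.\<close>

definition tot :: "nat \<Rightarrow> nat \<Rightarrow> (nat \<Rightarrow> nat) set" where
 "tot m D = {\<alpha>. \<alpha> \<in> extensional {..<m} \<and> (\<Sum>i<m. \<alpha> i) \<le> D}"

lemma tot_le: "\<alpha> \<in> tot m D ==> i < m ==> \<alpha> i \<le> D"
 using member_le_sum[of i "{..<m}" \<alpha>] unfolding tot_def by auto

lemma tot_finite: "finite (tot m D)"
proof (rule finite_subset[OF _ bx_finite[of m D]], rule subsetI)
 fix \<alpha> assume a: "\<alpha> \<in> tot m D"
 then have "\<alpha> \<in> extensional {..<m}" by (simp add: tot_def)
 then show "\<alpha> \<in> bx m D" using tot_le[OF a] by (auto simp: bx_def PiE_iff)
qed

lemma bx_tot: "bx m D \<subseteq> tot m (m * D)"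
proof
 fix \<alpha> assume a: "\<alpha> \<in> bx m D"
 have "(\<Sum>i<m. \<alpha> i) \<le> of_nat (card {..<m}) * D" by (rule sum_bounded_above) (use a in \<open>auto simp: bx_def PiE_iff\<close>)
 then show "\<alpha> \<in> tot m (m * D)" using a by (auto simp: tot_def bx_def PiE_iff)
qed

lemma algebraic_relation:
 assumes p: "\<pi> \<in> M" "\<pi> ~= \<zero>" and P: "\<And>i. i < n ==> pwf n (P i)"
  and det: "\<exists>x \<in> pts n. det n (\<lambda>i j. peval (pd j (P i)) x) ~= \<zero>" and i0: "i0 < n"
  and \<phi>: "\<phi> = (\<lambda>j. if j < n then P j else PV i0)"
 shows "\<exists>Q. pwf (Suc n) Q \<and> (\<forall>x \<in> pts n. peval Q (\<lambda>j. peval (\<phi> j) x) = \<zero>) \<and>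
  (\<exists>x \<in> pts n. peval (pd n Q) (\<lambda>j. peval (\<phi> j) x) ~= \<zero>)"
proof -
 let ?m = "Suc n" and ?\<phi> = "\<lambda>x j. peval (\<phi> j) x"
 let ?u = "\<lambda>\<alpha> x. mo ?m \<alpha> (?\<phi> x)"
 have \<phi>w: "pwf n (\<phi> j)" for j using P i0 by (simp add: \<phi>)
 have \<phi>c: "?\<phi> x \<in> pts ?m" if "x \<in> pts n" for x by (rule ptsI) (rule peval_closed[OF \<phi>w that])
 have uc: "?u \<alpha> x \<in> carrier R" if "x \<in> pts n" for \<alpha> x by (rule mo_closed) (rule ptsD[OF \<phi>c[OF that]])
 let ?ind = "\<lambda>D. indep (pts n) (tot ?m D) ?u"
 obtain D0 where "\<not> indep (pts n) (bx ?m D0) ?u" using monomials_dependent[of n \<phi>] \<phi>w by blast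
 moreover have "indep (pts n) (bx ?m D0) ?u" if "?ind (?m * D0)"
  by (rule indep_subset[OF tot_finite bx_tot that]) (rule uc)
 ultimately have D0: "\<not> ?ind (?m * D0)" by blast
 define D where "D = (LEAST D. \<not> ?ind D)"
 have D: "\<not> ?ind D" unfolding D_def by (rule LeastI[of "\<lambda>D. \<not> ?ind D", OF D0])
 have Dm: "?ind d" if "d < D" for d using not_less_Least[of d "\<lambda>D. \<not> ?ind D"] that unfolding D_def by blast
 obtain c \<alpha>0 where c: "\<And>\<alpha>. \<alpha> \<in> tot ?m D ==> c \<alpha> \<in> carrier R" "\<And>x. x \<in> pts n ==> (\<Oplus>\<alpha>\<in>tot ?m D. c \<alpha> \<otimes> ?u \<alpha> x) = \<zero>"
  and a0: "\<alpha>0 \<in> tot ?m D" "c \<alpha>0 ~= \<zero>" using D unfolding indep_def by blast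
 have origin: "(\<lambda>_. \<zero>) \<in> pts n" by (simp add: pts_def)
 \<comment> \<open>Otherwise the relation would consist of a non-zero constant, which is refuted at
   the origin. It follows that \<open>D\<close> is positive, so passing to \<open>D - 1\<close> is a
   genuine descent.\<close>
 have nz: "\<exists>\<alpha> \<in> tot ?m D. c \<alpha> ~= \<zero> \<and> (\<exists>j<?m. \<alpha> j ~= 0)"
 proof (rule ccontr)
  assume n: "\<not> (\<exists>\<alpha> \<in> tot ?m D. c \<alpha> ~= \<zero> \<and> (\<exists>j<?m. \<alpha> j ~= 0))"
  then have a0z: "\<alpha>0 j = 0" if "j < ?m" for j using a0 that by blast
  have eq: "\<alpha> = \<alpha>0" if a: "\<alpha> \<in> tot ?m D" "c \<alpha> ~= \<zero>" for \<alpha>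
  proof (rule extensionalityI[of _ "{..<?m}"])
   show "\<alpha> \<in> extensional {..<?m}" "\<alpha>0 \<in> extensional {..<?m}" using a a0 by (auto simp: tot_def)
   show "\<alpha> j = \<alpha>0 j" if "j \<in> {..<?m}" for j using n a a0z that by auto
  qed
  let ?o = "\<lambda>_. \<zero>"
  have "mo k \<alpha>0 (?\<phi> ?o) = \<one>" if "k \<le> ?m" for k using that by (induction k) (use a0z in auto)
  then have one: "?u \<alpha>0 ?o = \<one>" by blast
  have "(\<Oplus>\<alpha>\<in>tot ?m D. c \<alpha> \<otimes> ?u \<alpha> ?o) = c \<alpha>0 \<otimes> ?u \<alpha>0 ?o"
  proof (rule fsum_single[OF tot_finite a0(1)])
   show "c \<alpha>0 \<otimes> ?u \<alpha>0 ?o \<in> carrier R" using c(1)[OF a0(1)] uc[OF origin] by blast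
   show "c \<alpha> \<otimes> ?u \<alpha> ?o = \<zero>" if "\<alpha> \<in> tot ?m D" "\<alpha> ~= \<alpha>0" for \<alpha>
   proof -
    have "c \<alpha> = \<zero>" using eq that by blast
    then show ?thesis using uc[OF origin, of \<alpha>] by simp
   qed
  qed
  then have "c \<alpha>0 = \<zero>" using c(2)[OF origin] c(1)[OF a0(1)] unfolding one by simp
  then show False using a0(2) by blast
 qed
 then have D1: "D \<ge> 1" using tot_le by fastforce
 define E where "E \<alpha> = PM (PC (c \<alpha>)) (mexp ?m \<alpha>)" for \<alpha>
 have Ew: "pwf ?m (E \<alpha>)" if "\<alpha> \<in> tot ?m D" for \<alpha> using c(1)[OF that] pwf_mexp[of ?m ?m \<alpha>] unfolding E_def by simp
 have "\<exists>Q. pwf ?m Q \<and> (\<forall>y \<in> pts ?m. peval Q y = (\<Oplus>\<alpha>\<in>tot ?m D. peval (E \<alpha>) y)) \<and>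
  (\<forall>j. \<forall>y \<in> pts ?m. peval (pd j Q) y = (\<Oplus>\<alpha>\<in>tot ?m D. peval (pd j (E \<alpha>)) y))"
  by (rule px_sum[OF tot_finite Ew])
 then obtain Q where Q': "pwf ?m Q" "\<forall>y \<in> pts ?m. peval Q y = (\<Oplus>\<alpha>\<in>tot ?m D. peval (E \<alpha>) y)"
  "\<forall>j. \<forall>y \<in> pts ?m. peval (pd j Q) y = (\<Oplus>\<alpha>\<in>tot ?m D. peval (pd j (E \<alpha>)) y)"
  by (elim exE conjE) (rule that)
 note Q = Q'(1) Q'(2)[rule_format] Q'(3)[rule_format]
 have Q0: "peval Q (?\<phi> x) = \<zero>" if x: "x \<in> pts n" for x
  using Q(2)[OF \<phi>c[OF x]] c(2)[OF x] by (simp add: E_def peval_mexp del: mo.simps mexp.simps)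
 show ?thesis
 proof (cases "\<exists>x \<in> pts n. peval (pd n Q) (?\<phi> x) ~= \<zero>")
  case True
  then show ?thesis using Q(1) Q0 by blast
 next
  case False
  then have Rn: "peval (pd n Q) (?\<phi> x) = \<zero>" if "x \<in> pts n" for x using that by blast
  have Rc: "peval (pd j Q) (?\<phi> x) \<in> carrier R" if "x \<in> pts n" for j x using peval_closed[OF pwf_pd[OF Q(1)] \<phi>c[OF that]] .
  have psw: "pwf n (psub e \<phi>)" if "pwf ?m e" for e by (rule pwf_psub[OF that \<phi>w])
  have Rp: "polyf n (\<lambda>x. peval (pd j Q) (?\<phi> x))" for j
   by (rule polyf_cong[OF polyf_peval[OF psw[OF pwf_pd[OF Q(1)]]]]) (rule peval_psub[symmetric])
  have dp: "polyf n (\<lambda>x. det n (\<lambda>i j. peval (pd j (P i)) x))"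
   by (rule polyf_det) (use polyf_peval[OF pwf_pd[OF P]] in blast)
  \<comment> \<open>The chain rule for the vanishing function \<open>Q(P(x), x i0)\<close>. The term
    of index \<open>n\<close>, which belongs to \<open>x i0\<close>, drops out by the assumption on
    the last partial derivative.\<close>
  have lin: "(\<Oplus>j\<in>{..<n}. peval (pd j Q) (?\<phi> x) \<otimes> peval (pd k (P j)) x) = \<zero>" if k: "k < n" and x: "x \<in> pts n" for k x
  proof -
   have "peval (psub Q \<phi>) y = \<zero>" if "y \<in> pts n" for y using Q0[OF that] by (simp add: peval_psub)
   then have "peval (pd k (psub Q \<phi>)) x = \<zero>" by (rule pd_zero[OF p psw[OF Q(1)] _ k x])
   moreover have "peval (pd k (psub Q \<phi>)) x = (\<Oplus>j\<in>{..<?m}. peval (pd j Q) (?\<phi> x) \<otimes> peval (pd k (\<phi> j)) x)"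
    by (rule peval_pd_psub[OF \<phi>w x Q(1)])
   ultimately have z: "(\<Oplus>j\<in>{..<?m}. peval (pd j Q) (?\<phi> x) \<otimes> peval (pd k (\<phi> j)) x) = \<zero>" by metis
   have C: "peval (pd j Q) (?\<phi> x) \<otimes> peval (pd k (\<phi> j)) x \<in> carrier R" for j
    using Rc[OF x] peval_closed[OF pwf_pd[OF \<phi>w] x] by simp
   have "(\<Oplus>j\<in>insert n {..<n}. peval (pd j Q) (?\<phi> x) \<otimes> peval (pd k (\<phi> j)) x) =
     peval (pd n Q) (?\<phi> x) \<otimes> peval (pd k (\<phi> n)) x \<oplus> (\<Oplus>j\<in>{..<n}. peval (pd j Q) (?\<phi> x) \<otimes> peval (pd k (\<phi> j)) x)"
    by (rule fsum_insert) (use C in auto)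
   moreover have "(\<Oplus>j\<in>{..<n}. peval (pd j Q) (?\<phi> x) \<otimes> peval (pd k (\<phi> j)) x) = (\<Oplus>j\<in>{..<n}. peval (pd j Q) (?\<phi> x) \<otimes> peval (pd k (P j)) x)"
    by (rule fsum_cong) (use Rc[OF x] peval_closed[OF pwf_pd[OF P] x] in \<open>auto simp: \<phi>\<close>)
   moreover have "(\<Oplus>j\<in>{..<n}. peval (pd j Q) (?\<phi> x) \<otimes> peval (pd k (\<phi> j)) x) \<in> carrier R" by (rule fsum_closed) (rule C)
   ultimately show ?thesis using z Rn[OF x] peval_closed[OF pwf_pd[OF \<phi>w] x] by (simp add: lessThan_Suc)
  qed
  \<comment> \<open>Along the graph the remaining partial derivatives form a linear dependence
    between the rows of the Jacobian matrix, so each of them times the determinant vanishes at every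
    point. If one of them were non-zero somewhere, it would be so at a point where the determinant
    is non-zero too.\<close>
  have R0: "peval (pd j Q) (?\<phi> x) = \<zero>" if j: "j < ?m" and x: "x \<in> pts n" for j x
  proof (cases "j = n")
   case True then show ?thesis using Rn[OF x] by simp
  next
   case False
   then have jn: "j < n" using j by simp
   have prod: "peval (pd j Q) (?\<phi> y) \<otimes> det n (\<lambda>i j. peval (pd j (P i)) y) = \<zero>" if y: "y \<in> pts n" for y
    by (rule det_row_dependent[OF _ _ jn]) (use peval_closed[OF pwf_pd[OF P] y] Rc[OF y] lin[OF _ y] in auto)
   show ?thesis
   proof (rule ccontr)
    assume nz: "peval (pd j Q) (?\<phi> x) ~= \<zero>"
    obtain w where w: "w \<in> pts n" "det n (\<lambda>i j. peval (pd j (P i)) w) ~= \<zero>" using det by blast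
    obtain y where y: "y \<in> pts n" "peval (pd j Q) (?\<phi> y) ~= \<zero>" "det n (\<lambda>i j. peval (pd j (P i)) y) ~= \<zero>"
     using polyf_common_nonzero[OF p Rp x nz dp w] by (elim bexE conjE) (rule that)
    show False using integral[OF prod[OF y(1)] Rc[OF y(1)] polyf_closed[OF dp y(1)]] y(2,3) by blast
   qed
  qed
  \<comment> \<open>The \<open>j\<close>-th partial derivative of \<open>Q\<close> is again a
    relation and has total degree below \<open>D\<close>, so by minimality its coefficients vanish.
    The map \<open>f\<close> is the shift of exponents, which is injective where
    \<open>\<alpha> j \<noteq> 0\<close>.\<close>
  have mult0: "[\<alpha> j] \<cdot> c \<alpha> = \<zero>" if a: "\<alpha> \<in> tot ?m D" and j: "j < ?m" for \<alpha> j
  proof (cases "\<alpha> j = 0")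
   case True then show ?thesis by simp
  next
   case False
   define A where "A = {\<alpha> \<in> tot ?m D. \<alpha> j ~= 0}"
   define f where "f \<beta> = \<beta>(j := \<beta> j - 1)" for \<beta> :: "nat \<Rightarrow> nat"
   have inj: "inj_on f A"
   proof (rule inj_onI)
    fix \<beta> \<gamma> assume bg: "\<beta> \<in> A" "\<gamma> \<in> A" "f \<beta> = f \<gamma>"
    show "\<beta> = \<gamma>"
    proof
     fix i
     show "\<beta> i = \<gamma> i" using fun_cong[OF bg(3), of i] bg(1,2) by (cases "i = j") (auto simp: f_def A_def)
    qed
   qed
   have sub: "f ` A \<subseteq> tot ?m (D - 1)"
   proof
    fix \<gamma> assume "\<gamma> \<in> f ` A"
    then obtain \<beta> where b: "\<beta> \<in> tot ?m D" "\<beta> j ~= 0" "\<gamma> = f \<beta>" by (auto simp: A_def)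
    have "(\<Sum>i<?m. \<beta> i) = \<beta> j + (\<Sum>i\<in>{..<?m} - {j}. \<beta> i)" "(\<Sum>i<?m. \<gamma> i) = \<gamma> j + (\<Sum>i\<in>{..<?m} - {j}. \<gamma> i)"
     by (rule sum.remove; use j in simp)+
    moreover have "(\<Sum>i\<in>{..<?m} - {j}. \<gamma> i) = (\<Sum>i\<in>{..<?m} - {j}. \<beta> i)" by (rule sum.cong) (auto simp: b(3) f_def)
    moreover have "\<gamma> j = \<beta> j - 1" by (simp add: b(3) f_def)
    moreover have "\<gamma> \<in> extensional {..<?m}" using b(1) j unfolding b(3) f_def tot_def by (auto simp: extensional_def)
    moreover have "(\<Sum>i<?m. \<beta> i) \<le> D" using b(1) unfolding tot_def by blast
    ultimately have "\<gamma> \<in> extensional {..<?m} \<and> (\<Sum>i<?m. \<gamma> i) \<le> D - 1" using b(2) by linarith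
    then show "\<gamma> \<in> tot ?m (D - 1)" unfolding tot_def by blast
   qed
   have "?ind (D - 1)" using Dm D1 by simp
  then have "indep (pts n) (f ` A) ?u" by (rule indep_subset[OF tot_finite sub]) (rule uc)
   then have I: "indep (pts n) A (\<lambda>\<beta>. ?u (f \<beta>))" by (rule indep_reindex[OF inj]) (rule uc)
   have cA: "[\<beta> j] \<cdot> c \<beta> \<in> carrier R" if "\<beta> \<in> tot ?m D" for \<beta> using c(1)[OF that] by (rule add.nat_pow_closed)
   have "(\<Oplus>\<beta>\<in>A. ([\<beta> j] \<cdot> c \<beta>) \<otimes> ?u (f \<beta>) x) = \<zero>" if x: "x \<in> pts n" for x
   proof -
    have t: "peval (pd j (E \<beta>)) (?\<phi> x) = ([\<beta> j] \<cdot> c \<beta>) \<otimes> ?u (f \<beta>) x" if b: "\<beta> \<in> tot ?m D" for \<beta>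
    proof -
     have "peval (pd j (mexp ?m \<beta>)) (?\<phi> x) = [\<beta> j] \<cdot> ?u (f \<beta>) x"
      using peval_pd_mexp[OF \<phi>c[OF x] order_refl, of j \<beta>] j unfolding f_def by simp
     moreover have "mo ?m \<beta> (?\<phi> x) \<in> carrier R" by (rule uc[OF x])
     ultimately have "peval (pd j (E \<beta>)) (?\<phi> x) = c \<beta> \<otimes> ([\<beta> j] \<cdot> ?u (f \<beta>) x)"
      using c(1)[OF b] uc[OF x, of "f \<beta>"] unfolding E_def pd.simps peval.simps peval_mexp by (simp del: mo.simps)
     also have "\<dots> = [\<beta> j] \<cdot> (c \<beta> \<otimes> ?u (f \<beta>) x)" by (rule add_pow_rdistr[OF c(1)[OF b] uc[OF x]])
     also have "\<dots> = ([\<beta> j] \<cdot> c \<beta>) \<otimes> ?u (f \<beta>) x" by (rule add_pow_ldistr[OF c(1)[OF b] uc[OF x], symmetric])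
     finally show ?thesis .
    qed
    have "(\<Oplus>\<beta>\<in>A. ([\<beta> j] \<cdot> c \<beta>) \<otimes> ?u (f \<beta>) x) = (\<Oplus>\<beta>\<in>tot ?m D. ([\<beta> j] \<cdot> c \<beta>) \<otimes> ?u (f \<beta>) x)"
    proof (rule add.finprod_mono_neutral_cong_left[OF tot_finite])
     show "([\<beta> j] \<cdot> c \<beta>) \<otimes> ?u (f \<beta>) x = \<zero>" if "\<beta> \<in> tot ?m D - A" for \<beta>
     proof -
      have "\<beta> j = 0" using that by (simp add: A_def)
      then show "([\<beta> j] \<cdot> c \<beta>) \<otimes> ?u (f \<beta>) x = \<zero>" using uc[OF x, of "f \<beta>"] by (simp del: mo.simps)
     qed
     show "(\<lambda>\<beta>. ([\<beta> j] \<cdot> c \<beta>) \<otimes> ?u (f \<beta>) x) \<in> tot ?m D \<rightarrow> carrier R" by (rule Pi_I) (rule m_closed[OF cA uc[OF x]])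
    qed (auto simp: A_def)
    also have "\<dots> = (\<Oplus>\<beta>\<in>tot ?m D. peval (pd j (E \<beta>)) (?\<phi> x))"
    proof (rule fsum_cong[OF refl])
     show "([\<beta> j] \<cdot> c \<beta>) \<otimes> ?u (f \<beta>) x = peval (pd j (E \<beta>)) (?\<phi> x)" if "\<beta> \<in> tot ?m D" for \<beta> by (rule t[OF that, symmetric])
     show "peval (pd j (E \<beta>)) (?\<phi> x) \<in> carrier R" if "\<beta> \<in> tot ?m D" for \<beta> by (rule peval_closed[OF pwf_pd[OF Ew[OF that]] \<phi>c[OF x]])
    qed
    also have "\<dots> = \<zero>" using Q(3)[OF \<phi>c[OF x], of j] R0[OF j x] by simp
    finally show ?thesis .
   qed
   moreover have "\<alpha> \<in> A" using a False by (simp add: A_def)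
   moreover have "\<forall>\<beta> \<in> A. [\<beta> j] \<cdot> c \<beta> \<in> carrier R" using cA by (simp add: A_def)
   ultimately show ?thesis using I[unfolded indep_def, rule_format, of "\<lambda>\<beta>. [\<beta> j] \<cdot> c \<beta>" \<alpha>] by blast
  qed
  have ch: "[\<alpha> j] \<cdot> \<one> = \<zero>" if a: "\<alpha> \<in> tot ?m D" "c \<alpha> ~= \<zero>" and j: "j < ?m" for \<alpha> j
  proof -
   have "([\<alpha> j] \<cdot> \<one>) \<otimes> c \<alpha> = \<zero>" using mult0[OF a(1) j] add_pow_one[OF c(1)[OF a(1)], of "\<alpha> j"] by simp
   then show ?thesis using integral[OF _ add.nat_pow_closed[OF one_closed] c(1)[OF a(1)]] a(2) by blast
  qed
  obtain \<beta> j where b: "\<beta> \<in> tot ?m D" "c \<beta> ~= \<zero>" "j < ?m" "\<beta> j ~= 0" using nz by blast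
  obtain q :: nat where q: "Factorial_Ring.prime q" "[q] \<cdot> \<one> = \<zero>" "\<And>k :: nat. [k] \<cdot> \<one> = \<zero> ==> q dvd k"
   using characteristic[OF _ ch[OF b(1,2,3)]] b(4) by blast
  \<comment> \<open>All exponents that occur are divisible by \<open>q\<close>, so the relation is
    one between \<open>q\<close>-th powers of the monomials with exponents
    \<open>f \<alpha>\<close>. Those have total degree at most \<open>D / 2\<close> and are
    independent by minimality; by \<open>indep_powers\<close> their powers are independent as
    well.\<close>
  define B where "B = {\<alpha> \<in> tot ?m D. \<forall>j<?m. q dvd \<alpha> j}"
  define f where "f \<alpha> = (\<lambda>i\<in>{..<?m}. \<alpha> i div q)" for \<alpha>
  have inj: "inj_on f B"
  proof (rule inj_onI)
   fix \<beta> \<gamma> assume bg: "\<beta> \<in> B" "\<gamma> \<in> B" "f \<beta> = f \<gamma>"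
   show "\<beta> = \<gamma>"
   proof (rule extensionalityI[of _ "{..<?m}"])
    show "\<beta> \<in> extensional {..<?m}" "\<gamma> \<in> extensional {..<?m}" using bg by (auto simp: B_def tot_def)
    fix i assume i: "i \<in> {..<?m}"
    have "\<beta> i div q = \<gamma> i div q" using fun_cong[OF bg(3), of i] i by (simp add: f_def)
    then show "\<beta> i = \<gamma> i" using bg(1,2) i dvd_div_eq_iff[of q "\<beta> i" "\<gamma> i"] by (auto simp: B_def)
   qed
  qed
  have q2: "2 \<le> q" using prime_ge_2_nat[OF q(1)] .
  have sub: "f ` B \<subseteq> tot ?m (D - 1)"
  proof
   fix \<gamma> assume "\<gamma> \<in> f ` B"
   then obtain \<beta> where b: "\<beta> \<in> tot ?m D" "\<gamma> = f \<beta>" by (auto simp: B_def)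
   have "2 * (\<beta> i div q) \<le> \<beta> i" for i
    using mult_le_mono1[OF q2, of "\<beta> i div q"] times_div_less_eq_dividend[of q "\<beta> i"] by linarith
   then have "(\<Sum>i<?m. 2 * (\<beta> i div q)) \<le> (\<Sum>i<?m. \<beta> i)" by (intro sum_mono) simp
   moreover have "(\<Sum>i<?m. \<beta> i) \<le> D" using b(1) unfolding tot_def by blast
   moreover have "(\<Sum>i<?m. 2 * (\<beta> i div q)) = 2 * (\<Sum>i<?m. \<beta> i div q)" by (rule sum_distrib_left[symmetric])
   ultimately have "2 * (\<Sum>i<?m. \<beta> i div q) \<le> D" by linarith
   moreover have "(\<Sum>i<?m. \<gamma> i) = (\<Sum>i<?m. \<beta> i div q)" by (rule sum.cong) (auto simp: b(2) f_def)
   ultimately have "(\<Sum>i<?m. \<gamma> i) \<le> D - 1" using D1 by linarith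
   moreover have "\<gamma> \<in> extensional {..<?m}" unfolding b(2) f_def by simp
   ultimately show "\<gamma> \<in> tot ?m (D - 1)" unfolding tot_def by blast
  qed
  have "?ind (D - 1)" using Dm D1 by simp
  then have "indep (pts n) (f ` B) ?u" by (rule indep_subset[OF tot_finite sub]) (rule uc)
  then have I: "indep (pts n) B (\<lambda>\<beta>. ?u (f \<beta>))" by (rule indep_reindex[OF inj]) (rule uc)
  have Bf: "finite B" unfolding B_def using tot_finite by simp
  have I': "indep (pts n) B (\<lambda>\<beta> x. ?u (f \<beta>) x [^] q)" by (rule indep_powers[OF q(1,2) Bf I]) (rule uc)
  have "(\<Oplus>\<beta>\<in>B. c \<beta> \<otimes> ?u (f \<beta>) x [^] q) = \<zero>" if x: "x \<in> pts n" for x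
  proof -
   have t: "?u (f \<beta>) x [^] q = ?u \<beta> x" if b: "\<beta> \<in> B" for \<beta>
   proof -
    have "?u (f \<beta>) x [^] q = mo ?m (\<lambda>i. q * f \<beta> i) (?\<phi> x)" by (rule mo_power[symmetric]) (rule ptsD[OF \<phi>c[OF x]])
    also have "\<dots> = ?u \<beta> x" by (rule mo_cong) (use b in \<open>auto simp: f_def B_def\<close>)
    finally show ?thesis .
   qed
   have "(\<Oplus>\<beta>\<in>B. c \<beta> \<otimes> ?u (f \<beta>) x [^] q) = (\<Oplus>\<beta>\<in>B. c \<beta> \<otimes> ?u \<beta> x)"
    by (rule fsum_cong) (use t c(1) uc[OF x] in \<open>auto simp: B_def simp del: mo.simps\<close>)
   also have "\<dots> = (\<Oplus>\<beta>\<in>tot ?m D. c \<beta> \<otimes> ?u \<beta> x)"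
   proof (rule add.finprod_mono_neutral_cong_left[OF tot_finite])
    show "c \<beta> \<otimes> ?u \<beta> x = \<zero>" if b: "\<beta> \<in> tot ?m D - B" for \<beta>
    proof -
     from b have "c \<beta> = \<zero>" using ch[of \<beta>] q(3) by (auto simp: B_def)
     then show "c \<beta> \<otimes> ?u \<beta> x = \<zero>" using uc[OF x, of \<beta>] by (simp del: mo.simps)
    qed
    show "(\<lambda>\<beta>. c \<beta> \<otimes> ?u \<beta> x) \<in> tot ?m D \<rightarrow> carrier R" by (rule Pi_I) (rule m_closed[OF c(1) uc[OF x]])
   qed (auto simp: B_def)
   finally show ?thesis using c(2)[OF x] by simp
  qed
  moreover have "\<forall>\<beta> \<in> B. c \<beta> \<in> carrier R" using c(1) by (simp add: B_def)
  moreover have "\<beta> \<in> B" using b(1) ch[OF b(1,2)] q(3) by (simp add: B_def)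
  ultimately have "c \<beta> = \<zero>" using I'[unfolded indep_def, rule_format, of c \<beta>] by blast
  then show ?thesis using b(2) by blast
 qed
qed

end

section \<open>Images of open sets under polynomial maps\<close>

definition comb :: "nat \<Rightarrow> (nat \<Rightarrow> 'a) \<Rightarrow> 'a \<Rightarrow> nat \<Rightarrow> 'a" where
 "comb n y t j = (if j < n then y j else t)"

context cring
begin

lemma comb_pts: "y \<in> pts n ==> t \<in> carrier R ==> comb n y t \<in> pts (Suc n)"
 by (rule ptsI) (simp add: comb_def ptsD)

lemma minus_self: "a \<in> carrier R ==> a \<ominus> a = \<zero>" by (simp add: a_minus_def r_neg)

end

context valuation_subring
begin

text \<open>Otherwise \<open>q'\<close> and \<open>q' - q\<close> would both be smaller than
  \<open>l\<close>, and so would \<open>q\<close>, although \<open>q\<close> divides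
  \<open>l\<close>.\<close>

lemma unit_perturbation:
 assumes q: "q \<in> carrier R" "q' \<in> carrier R" and l: "l \<in> carrier R" "l ~= \<zero>" and d: "dv q l" "sdv l (q' \<ominus> q)"
 shows "q' ~= \<zero> \<and> dv q' l"
proof -
 have "dv q' l"
 proof (rule ccontr)
  assume "\<not> dv q' l"
  then have s: "sdv l q'" using dv_total[OF q(2) l(1)] by blast
  have id: "q' \<ominus> (q' \<ominus> q) = q" using q by - (rule ring_identity, (rule ring_rep | assumption | (simp; fail))+, (simp_all add: l_distr r_distr a_ac m_ac)?)
  have "sdv l q" using sdv_diff[OF s d(2) l(1)] unfolding id .
  then have "q = \<zero>" using sdv_self[OF dv_sdv_trans[OF d(1) _ q(1)] q(1)] by blast
  then show False using dv_zeroD d(1) l(2) by blast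
 qed
 then show ?thesis using dv_zeroD l(2) by blast
qed

section \<open>A common scale of radii; solving and comparing the separate equations\<close>

context
 fixes \<rho> \<pi> :: 'a
 assumes bigr: "big \<rho>" and pi: "\<pi> \<in> M"
begin

definition lam where "lam = inv \<rho>"
text \<open>A scale of radii in which a factor \<open>\<rho>\<close> lowers the index by one, while
  the factor \<open>\<pi>\<close> makes \<open>th k\<close> smaller than \<open>lam^k\<close>.
  Estimates and divisions by derivatives cost factors \<open>\<rho>\<close>; the losses lead from
  \<open>th 10\<close>, the radius for \<open>y\<close>, down to \<open>th 1\<close> in
  \<open>local_surjectivity_bound\<close>, which still lies in \<open>M\<close>.\<close>

definition th where "th (k :: nat) = lam [^] k \<otimes> \<pi>"

lemma rho: "\<rho> \<in> carrier R" "\<rho> ~= \<zero>" "dv \<rho> \<one>" using bigr unfolding big_def by auto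

lemma lam: "lam \<in> carrier R" "\<rho> \<otimes> lam = \<one>" "lam \<otimes> \<rho> = \<one>" "lam ~= \<zero>"
 unfolding lam_def by (rule inv_carr[OF rho(1,2)] r_inv'[OF rho(1,2)] l_inv'[OF rho(1,2)] inv_nonzero[OF rho(1,2)])+

lemma lam_cancel: "x \<in> carrier R ==> lam \<otimes> (\<rho> \<otimes> x) = x" "x \<in> carrier R ==> \<rho> \<otimes> (lam \<otimes> x) = x"
 using m_assoc[OF lam(1) rho(1), of x] m_assoc[OF rho(1) lam(1), of x] unfolding lam(2,3) by simp_all

lemma lam_mult_V: assumes "dv \<rho> a" shows "lam \<otimes> a \<in> V"
proof -
 obtain b where b: "b \<in> V" "a = \<rho> \<otimes> b" using assms unfolding dv_def by blast
 show ?thesis unfolding b(2) lam_cancel(1)[OF V_carr[OF b(1)]] by (rule b(1))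
qed

lemma lam_V: "lam \<in> V" using lam_mult_V[OF rho(3)] lam(1) by simp

lemma dv_inv_flip: assumes x: "x \<in> carrier R" "x ~= \<zero>" and d: "dv \<rho> (inv x)" shows "dv x lam"
proof -
 have i: "inv x \<in> carrier R" using inv_carr[OF x] .
 have "x \<otimes> (lam \<otimes> inv x) = lam \<otimes> (x \<otimes> inv x)" by (rule m_lcomm[OF x(1) lam(1) i])
 then have "lam = x \<otimes> (lam \<otimes> inv x)" unfolding r_inv'[OF x] using lam(1) by simp
 then show ?thesis unfolding dv_def using lam_mult_V[OF d] by (rule bexI)
qed

lemma th_M: "th k \<in> M" unfolding th_def by (rule M_mult(1)[OF V_pow[OF lam_V] pi])

lemma th_V: "th k \<in> V" by (rule M_V[OF th_M])

lemma th_carr: "th k \<in> carrier R" by (rule V_carr[OF th_V])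

lemma th_Suc: "th (Suc k) = lam \<otimes> th k"
proof -
 have id: "(a \<otimes> l) \<otimes> p = l \<otimes> (a \<otimes> p)" if "a \<in> carrier R" "l \<in> carrier R" "p \<in> carrier R" for a l p
  using that by - (rule ring_identity, (rule ring_rep | assumption | (simp; fail))+, (simp_all add: l_distr r_distr a_ac m_ac)?)
 show ?thesis unfolding th_def nat_pow_Suc by (rule id[OF nat_pow_closed[OF lam(1)] lam(1) V_carr[OF M_V[OF pi]]])
qed

lemma rho_th: "m = Suc k ==> \<rho> \<otimes> th m = th k"
 unfolding th_Suc by (simp add: th_Suc lam_cancel(2)[OF th_carr])

lemma rho_th_mult: "m = Suc k ==> \<delta> \<in> carrier R ==> \<rho> \<otimes> (th m \<otimes> \<delta>) = th k \<otimes> \<delta>"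
 using m_assoc[OF rho(1) th_carr[of m], of \<delta>] rho_th[of m k] by simp

lemma dv_th: "k \<le> m ==> dv (th k) (th m)"
proof (induction m)
 case 0
 then show ?case using dv_refl[OF th_carr] by simp
next
 case (Suc m)
 show ?case
 proof (cases "k = Suc m")
  case True then show ?thesis using dv_refl[OF th_carr] by simp
 next
  case False
  then have "dv (th k) (th m)" using Suc by simp
  then show ?thesis unfolding th_Suc by (rule dv_V[OF _ lam_V th_carr])
 qed
qed

lemma dv_th_trans: "dv (th m) x ==> k \<le> m ==> dv (th k) x"
 using dv_trans[OF dv_th _ th_carr] by blast

lemma dv_th_mult: "k \<le> m ==> \<delta> \<in> carrier R ==> dv (th m \<otimes> \<delta>) x ==> dv (th k \<otimes> \<delta>) x"
 by (rule dv_trans[OF dv_mult[OF dv_th dv_refl]]) (use th_carr in auto)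

lemma sdv_lam_th: assumes "k \<le> m" shows "sdv (lam [^] k) (th m)"
proof -
 have "sdv (lam [^] k) (th k)" unfolding sdv_def th_def using pi by blast
 then show ?thesis by (rule sdv_dv_trans[OF _ dv_th[OF assms] nat_pow_closed[OF lam(1)]])
qed

lemma sdv_lam: assumes "dv (th m) x" "1 \<le> m" shows "sdv lam x"
proof -
 have "sdv (lam [^] (1 :: nat)) (th m)" by (rule sdv_lam_th[OF assms(2)])
 moreover have "lam [^] (1 :: nat) = lam" using lam(1) by simp
 ultimately have "sdv lam (th m)" by simp
 then show ?thesis by (rule sdv_dv_trans[OF _ assms(1) lam(1)])
qed

text \<open>Hensel's lemma for \<open>Q(y, -)\<close> near \<open>a n\<close>. Replacing the first
  coordinates of \<open>a\<close> by \<open>y\<close> changes value and derivative by at most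
  \<open>th 9\<close>, so the derivative still divides \<open>lam\<close>. The distance to the zero
  is the value divided by the derivative, which costs one more index.\<close>

lemma slice_root:
 assumes SP and Q: "pwf (Suc n) Q" and l: "lb (Suc n) Q a \<rho>" "lb (Suc n) (pd n Q) a \<rho>" and a: "a \<in> pts (Suc n)"
  and z0: "peval Q a = \<zero>" and q: "peval (pd n Q) a ~= \<zero>" "dv \<rho> (inv (peval (pd n Q) a))"
  and y: "y \<in> pts n" "\<And>j. j < n ==> dv (th 10) (y j \<ominus> a j)"
 shows "\<exists>z \<in> carrier R. dv (th 8) (z \<ominus> a n) \<and> peval Q (comb n y z) = \<zero>"
proof -
 have an: "a n \<in> carrier R" using ptsD[OF a] by simp
 define u where "u = comb n y (a n)"
 have u: "u \<in> pts (Suc n)" unfolding u_def by (rule comb_pts[OF y(1) an])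
 have ud: "dv (th 10) (u i \<ominus> a i)" if "i < Suc n" for i
 proof (cases "i < n")
  case True then show ?thesis using y(2) by (simp add: u_def comb_def)
 next
  case False
  then have "i = n" using that by simp
  then show ?thesis using minus_self[OF an] dv_zero[OF th_carr] by (simp add: u_def comb_def)
 qed
 have aa: "a i \<ominus> a i \<in> V" if "i < Suc n" for i using minus_self[OF ptsD[OF a that]] by simp
 have ua: "u i \<ominus> a i \<in> V" if "i < Suc n" for i by (rule dv_in_V[OF ud[OF that] th_V])
 have r9: "\<rho> \<otimes> th 10 = th 9" by (rule rho_th) simp
 have Qu: "dv (th 9) (peval Q u)"
  using lb_estimates(1)[OF Q l(1) rho(1) a aa u ud th_V] peval_closed[OF Q u] unfolding r9 z0 by (simp add: a_minus_def)
 have qd: "dv (th 9) (peval (pd n Q) u \<ominus> peval (pd n Q) a)"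
  using lb_estimates(1)[OF pwf_pd[OF Q] l(2) rho(1) a aa u ud th_V] unfolding r9 .
 define q' where "q' = peval (pd n Q) u"
 have qc: "peval (pd n Q) a \<in> carrier R" "q' \<in> carrier R" unfolding q'_def using peval_closed[OF pwf_pd[OF Q]] a u by auto
 have q': "q' ~= \<zero> \<and> dv q' lam" unfolding q'_def
  by (rule unit_perturbation[OF qc(1) qc(2)[unfolded q'_def] lam(1,4) dv_inv_flip[OF qc(1) q] sdv_lam[OF qd]]) simp
 define w where "w j = (if j = n then \<one> else \<zero>)" for j
 have w: "w \<in> pts (Suc n)" "\<And>i. w i \<in> V" by (auto simp: w_def pts_def)
 let ?l = "linel u w Q"
 have lc: "set ?l \<subseteq> carrier R" by (rule linel_carr[OF Q u w(1)])
 have ld: "\<forall>x \<in> set ?l. dv \<rho> x" using l(1) u w ua unfolding lb_def by blast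
 \<comment> \<open>Multiplication by \<open>lam\<close>, the inverse of \<open>\<rho>\<close>, makes
   the coefficients integral, as required by \<open>hensel_newton\<close>.\<close>
 let ?f = "map ((\<otimes>) lam) ?l"
 have fV: "set ?f \<subseteq> V" using ld lam_mult_V by auto
 have Qc: "peval Q (\<lambda>i. u i \<oplus> t \<otimes> w i) \<in> carrier R" if "t \<in> carrier R" for t by (rule peval_closed[OF Q line_pts[OF u w(1) that]])
 have fl: "lpoly ?f t = lam \<otimes> peval Q (\<lambda>i. u i \<oplus> t \<otimes> w i)" if t: "t \<in> carrier R" for t
  unfolding lpoly_scale[OF lc lam(1) t] lpoly_linel[OF Q u w(1) t] ..
 have f0: "lpoly ?f \<zero> = lam \<otimes> peval Q u"
 proof -
  have "peval Q (\<lambda>i. u i \<oplus> \<zero> \<otimes> w i) = peval Q u" by (rule peval_cong[OF Q]) (use ptsD[OF u] ptsD[OF w(1)] in simp)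
  then show ?thesis using fl[OF zero_closed] by simp
 qed
 have "lderiv ?l \<zero> = (\<Oplus>j\<in>{..<Suc n}. peval (pd j Q) (\<lambda>i. u i \<oplus> \<zero> \<otimes> w i) \<otimes> w j)" by (rule lderiv_linel[OF u w(1) zero_closed Q])
 also have "\<dots> = peval (pd n Q) (\<lambda>i. u i \<oplus> \<zero> \<otimes> w i) \<otimes> w n"
 proof (rule fsum_single)
  have c: "peval (pd j Q) (\<lambda>i. u i \<oplus> \<zero> \<otimes> w i) \<in> carrier R" for j by (rule peval_closed[OF pwf_pd[OF Q] line_pts[OF u w(1) zero_closed]])
  show "peval (pd n Q) (\<lambda>i. u i \<oplus> \<zero> \<otimes> w i) \<otimes> w n \<in> carrier R" using c[of n] V_carr[OF w(2)] by simp
  show "peval (pd j Q) (\<lambda>i. u i \<oplus> \<zero> \<otimes> w i) \<otimes> w j = \<zero>" if "j ~= n" for j using c[of j] that by (simp add: w_def)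
 qed auto
 also have "peval (pd n Q) (\<lambda>i. u i \<oplus> \<zero> \<otimes> w i) = q'" unfolding q'_def
  by (rule peval_cong[OF pwf_pd[OF Q]]) (use ptsD[OF u] ptsD[OF w(1)] in simp)
 finally have L: "lderiv ?l \<zero> = q' \<otimes> w n" .
 have "w n = \<one>" by (simp add: w_def)
 then have "lderiv ?l \<zero> = q'" using L r_one[OF qc(2)] by metis
 then have fd: "lderiv ?f \<zero> = lam \<otimes> q'" using lderiv_scale[OF lc lam(1) zero_closed] by simp
 have nz: "lderiv ?f \<zero> ~= \<zero>" unfolding fd using integral[OF _ lam(1) qc(2)] lam(4) q' by blast
 \<comment> \<open>As \<open>q'\<close> divides \<open>lam\<close>, the squared derivative divides
   \<open>lam^4\<close>, and \<open>th 9\<close> is smaller than \<open>lam^4\<close>.\<close>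
 have s: "sdv (lderiv ?f \<zero> \<otimes> lderiv ?f \<zero>) (lpoly ?f \<zero>)"
 proof -
  have lq: "lam \<otimes> q' \<in> carrier R" using lam(1) qc(2) by simp
  have 1: "dv (lam \<otimes> q') (lam \<otimes> lam)" by (rule dv_mult[OF dv_refl[OF lam(1)] conjunct2[OF q'] lam(1) qc(2)])
  have 2: "dv ((lam \<otimes> q') \<otimes> (lam \<otimes> q')) ((lam \<otimes> lam) \<otimes> (lam \<otimes> lam))" by (rule dv_mult[OF 1 1 lq lq])
  have "lam [^] (4 :: nat) = (lam \<otimes> lam) \<otimes> (lam \<otimes> lam)" using lam(1) by (simp add: numeral_eq_Suc m_assoc)
  then have "sdv ((lam \<otimes> lam) \<otimes> (lam \<otimes> lam)) (th 9)" using sdv_lam_th[of 4 9] by simp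
  then have 3: "sdv ((lam \<otimes> q') \<otimes> (lam \<otimes> q')) (th 9)" by (rule dv_sdv_trans[OF 2 _ m_closed[OF lq lq]])
  show ?thesis unfolding fd f0 by (rule sdv_dv_trans[OF 3 dv_V[OF Qu lam_V th_carr] m_closed[OF lq lq]])
 qed
 obtain r where r: "r \<in> V" "lpoly ?f r = \<zero>" "dv (lpoly ?f \<zero>) (lderiv ?f \<zero> \<otimes> (r \<ominus> \<zero>))"
  using hensel_newton[OF \<open>SP\<close> fV V_zero nz s] by (elim bexE conjE) (rule that)
 have rc: "r \<in> carrier R" using r(1) by (rule V_carr)
 have r0: "r \<ominus> \<zero> = r" using rc by (simp add: a_minus_def)
 have "dv (lam \<otimes> peval Q u) (lam \<otimes> (q' \<otimes> r))"
  using r(3) unfolding f0 fd r0 m_assoc[OF lam(1) qc(2) rc] .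
 then have "dv (peval Q u) (q' \<otimes> r)" by (rule dv_cancel[OF _ lam(1,4) peval_closed[OF Q u] m_closed[OF qc(2) rc]])
 then have d9: "dv (th 9) (q' \<otimes> r)" by (rule dv_trans[OF Qu _ th_carr])
 obtain s where s: "s \<in> V" "lam = q' \<otimes> s" using conjunct2[OF q'] unfolding dv_def by blast
 have "s \<otimes> (q' \<otimes> r) = lam \<otimes> r" unfolding s(2) using qc(2) rc V_carr[OF s(1)] by (simp add: m_ac)
 then have "dv (th 9) (lam \<otimes> r)" using dv_V[OF d9 s(1) th_carr] by simp
 moreover have "th 9 = lam \<otimes> th 8" using th_Suc[of 8] by simp
 ultimately have "dv (lam \<otimes> th 8) (lam \<otimes> r)" by simp
 then have d8: "dv (th 8) r" by (rule dv_cancel[OF _ lam(1,4) th_carr rc])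
 let ?z = "a n \<oplus> r"
 have "peval Q (comb n y ?z) = peval Q (\<lambda>i. u i \<oplus> r \<otimes> w i)"
 proof (rule peval_cong[OF Q])
  fix i assume "i < Suc n"
  show "comb n y ?z i = u i \<oplus> r \<otimes> w i"
  proof (cases "i < n")
   case True then show ?thesis using ptsD[OF y(1) True] rc by (simp add: u_def comb_def w_def)
  next
   case False then show ?thesis using \<open>i < Suc n\<close> rc an by (simp add: u_def comb_def w_def)
  qed
 qed
 moreover have "peval Q (\<lambda>i. u i \<oplus> r \<otimes> w i) = \<zero>"
  using integral[OF _ lam(1) Qc[OF rc]] fl[OF rc] r(2) lam(4) by simp
 ultimately have "peval Q (comb n y ?z) = \<zero>" by simp
 moreover have "?z \<ominus> a n = r" by (rule add_diff_cancel_left[OF an rc])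
 ultimately show ?thesis using d8 an rc by (intro bexI[of _ ?z]) simp_all
qed

text \<open>Zeros depend on \<open>y\<close> in a Lipschitz way. Since \<open>b\<close> is a zero
  for \<open>y'\<close>, the value \<open>Q(y, b)\<close> has size at most
  \<open>\<rho> \<tau>\<close>. The second-order expansion at the zero \<open>z\<close> writes it as
  \<open>q3 (b - z)\<close>, where \<open>q3\<close> is the derivative up to a small error and hence
  divides \<open>lam\<close>; removing it costs the second factor \<open>\<rho>\<close>.\<close>

lemma slice_unique:
 assumes Q: "pwf (Suc n) Q" and l: "lb (Suc n) Q a \<rho>" "lb (Suc n) (pd n Q) a \<rho>" and a: "a \<in> pts (Suc n)"
  and q: "peval (pd n Q) a ~= \<zero>" "dv \<rho> (inv (peval (pd n Q) a))"
  and y: "y \<in> pts n" "\<And>j. j < n ==> dv (th 10) (y j \<ominus> a j)"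
  and z: "z \<in> carrier R" "dv (th 8) (z \<ominus> a n)" "peval Q (comb n y z) = \<zero>"
  and y': "y' \<in> pts n" "\<And>j. j < n ==> dv \<tau> (y' j \<ominus> y j)" "\<tau> \<in> V"
  and b: "b \<in> carrier R" "dv (th 6) (b \<ominus> z)" "peval Q (comb n y' b) = \<zero>"
 shows "dv (\<rho> \<otimes> (\<rho> \<otimes> \<tau>)) (b \<ominus> z)"
proof -
 have an: "a n \<in> carrier R" using ptsD[OF a] by simp
 have tc: "\<tau> \<in> carrier R" using y'(3) by (rule V_carr)
 have split: "b \<ominus> a n = (b \<ominus> z) \<oplus> (z \<ominus> a n)" 
 proof -
  have "x \<ominus> t = (x \<ominus> s) \<oplus> (s \<ominus> t)" if "x \<in> carrier R" "s \<in> carrier R" "t \<in> carrier R" for x s t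
   using that by - (rule ring_identity, (rule ring_rep | assumption | (simp; fail))+, (simp_all add: l_distr r_distr a_ac m_ac)?)
  then show ?thesis using an z(1) b(1) by blast
 qed
 have ba: "dv (th 6) (b \<ominus> a n)" unfolding split by (rule dv_add[OF b(2) dv_th_trans[OF z(2)] th_carr]) simp
 have near: "dv (th 6) (comb n y t i \<ominus> a i)" if "i < Suc n" "dv (th 6) (t \<ominus> a n)" for t i
 proof (cases "i < n")
  case True then show ?thesis using dv_th_trans[OF y(2)[OF True], of 6] by (simp add: comb_def)
 next
  case False then show ?thesis using that by (auto simp: comb_def less_Suc_eq)
 qed
 have near8: "dv (th 8) (comb n y z i \<ominus> a i)" if "i < Suc n" for i
 proof (cases "i < n")
  case True then show ?thesis using dv_th_trans[OF y(2)[OF True], of 8] by (simp add: comb_def)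
 next
  case False then show ?thesis using that z(2) by (auto simp: comb_def less_Suc_eq)
 qed
 note yb = comb_pts[OF y(1) b(1)] and yz = comb_pts[OF y(1) z(1)] and y'b = comb_pts[OF y'(1) b(1)]
 have ybV: "comb n y b i \<ominus> a i \<in> V" if "i < Suc n" for i by (rule dv_in_V[OF near[OF that ba] th_V])
 have yzV: "comb n y z i \<ominus> a i \<in> V" if "i < Suc n" for i by (rule dv_in_V[OF near8[OF that] th_V])
 have aa: "a i \<ominus> a i \<in> V" if "i < Suc n" for i using minus_self[OF ptsD[OF a that]] by simp
 have y'y: "dv \<tau> (comb n y' b i \<ominus> comb n y b i)" for i
  using y'(2) minus_self[OF b(1)] dv_zero[OF tc] by (simp add: comb_def)
 have Qb: "peval Q (comb n y b) \<in> carrier R" by (rule peval_closed[OF Q yb])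
 have "dv (\<rho> \<otimes> \<tau>) (\<zero> \<ominus> peval Q (comb n y b))"
  using lb_estimates(1)[OF Q l(1) rho(1) yb ybV y'b y'y y'(3)] unfolding b(3) .
 then have "dv (\<rho> \<otimes> \<tau>) (\<ominus> (\<zero> \<ominus> peval Q (comb n y b)))" by (rule dv_minus[OF _ m_closed[OF rho(1) tc]])
 then have Qd: "dv (\<rho> \<otimes> \<tau>) (peval Q (comb n y b))" using Qb by (simp add: a_minus_def)
 define h where "h = b \<ominus> z"
 have hc: "h \<in> carrier R" unfolding h_def using b(1) z(1) by simp
 have h6: "dv (th 6) h" unfolding h_def by (rule b(2))
 have hV: "h \<in> V" by (rule dv_in_V[OF h6 th_V])
 have bz: "dv h (comb n y b i \<ominus> comb n y z i)" if "i < Suc n" for i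
 proof (cases "i < n")
  case True then show ?thesis using minus_self[OF ptsD[OF y(1) True]] dv_zero[OF hc] by (simp add: comb_def)
 next
  case False then show ?thesis using dv_refl[OF hc] by (simp add: comb_def h_def)
 qed
 define q'' where "q'' = peval (pd n Q) (comb n y z)"
 have qc: "peval (pd n Q) a \<in> carrier R" "q'' \<in> carrier R" unfolding q''_def using peval_closed[OF pwf_pd[OF Q]] a yz by auto
 have S: "(\<Oplus>j\<in>{..<Suc n}. peval (pd j Q) (comb n y z) \<otimes> (comb n y b j \<ominus> comb n y z j)) = q'' \<otimes> h"
 proof -
  have c: "peval (pd j Q) (comb n y z) \<in> carrier R" for j by (rule peval_closed[OF pwf_pd[OF Q] yz])
  have "(\<Oplus>j\<in>{..<Suc n}. peval (pd j Q) (comb n y z) \<otimes> (comb n y b j \<ominus> comb n y z j)) =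
    peval (pd n Q) (comb n y z) \<otimes> (comb n y b n \<ominus> comb n y z n)"
  proof (rule fsum_single)
   show "peval (pd n Q) (comb n y z) \<otimes> (comb n y b n \<ominus> comb n y z n) \<in> carrier R" using c[of n] b(1) z(1) by (simp add: comb_def)
   show "peval (pd j Q) (comb n y z) \<otimes> (comb n y b j \<ominus> comb n y z j) = \<zero>" if "j \<in> {..<Suc n}" "j ~= n" for j
   proof -
    have "j < n" using that by auto
    then show ?thesis using minus_self[OF ptsD[OF y(1)]] c[of j] by (simp add: comb_def)
   qed
  qed auto
  then show ?thesis by (simp add: q''_def h_def comb_def)
 qed
 have "dv (\<rho> \<otimes> (h \<otimes> h)) (peval Q (comb n y b) \<ominus> \<zero> \<ominus> q'' \<otimes> h)"
  using lb_estimates(2)[OF Q l(1) rho(1) yz yzV yb bz hV] unfolding S z(3) .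
 then obtain v where v: "v \<in> V" "peval Q (comb n y b) \<ominus> \<zero> \<ominus> q'' \<otimes> h = \<rho> \<otimes> (h \<otimes> h) \<otimes> v" unfolding dv_def by blast
 have vc: "v \<in> carrier R" using v(1) by (rule V_carr)
 define q3 where "q3 = q'' \<oplus> \<rho> \<otimes> h \<otimes> v"
 have q3c: "q3 \<in> carrier R" unfolding q3_def using qc(2) rho(1) hc vc by simp
 have q3h: "q3 \<otimes> h = peval Q (comb n y b)"
 proof -
  have id1: "(q \<oplus> r \<otimes> h \<otimes> v) \<otimes> h = q \<otimes> h \<oplus> r \<otimes> (h \<otimes> h) \<otimes> v"
   if "q \<in> carrier R" "r \<in> carrier R" "h \<in> carrier R" "v \<in> carrier R" for q r h v
   using that by - (rule ring_identity, (rule ring_rep | assumption | (simp; fail))+, (simp_all add: l_distr r_distr a_ac m_ac)?)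
  have id2: "g \<oplus> (f \<ominus> \<zero> \<ominus> g) = f" if "g \<in> carrier R" "f \<in> carrier R" for f g
   using that by - (rule ring_identity, (rule ring_rep | assumption | (simp; fail))+, (simp_all add: l_distr r_distr a_ac m_ac)?)
  have "q3 \<otimes> h = q'' \<otimes> h \<oplus> \<rho> \<otimes> (h \<otimes> h) \<otimes> v" unfolding q3_def by (rule id1[OF qc(2) rho(1) hc vc])
  also have "\<dots> = peval Q (comb n y b)" unfolding v(2)[symmetric] by (rule id2[OF m_closed[OF qc(2) hc] Qb])
  finally show ?thesis .
 qed
 have r7: "\<rho> \<otimes> th 8 = th 7" by (rule rho_th) simp
 have r5: "\<rho> \<otimes> th 6 = th 5" by (rule rho_th) simp
 have d7: "dv (th 7) (q'' \<ominus> peval (pd n Q) a)"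
  using lb_estimates(1)[OF pwf_pd[OF Q] l(2) rho(1) a aa yz near8 th_V] unfolding r7 q''_def .
 have "dv (\<rho> \<otimes> th 6) (\<rho> \<otimes> h)" by (rule dv_mult[OF dv_refl[OF rho(1)] h6 rho(1) th_carr])
 then have "dv (th 5) (v \<otimes> (\<rho> \<otimes> h))" unfolding r5 by (rule dv_V[OF _ v(1) th_carr])
 then have d5: "dv (th 5) (\<rho> \<otimes> h \<otimes> v)" using m_comm[OF vc m_closed[OF rho(1) hc]] by simp
 have "q3 \<ominus> peval (pd n Q) a = (q'' \<ominus> peval (pd n Q) a) \<oplus> \<rho> \<otimes> h \<otimes> v"
 proof -
  have "(x \<oplus> s) \<ominus> t = (x \<ominus> t) \<oplus> s" if "x \<in> carrier R" "s \<in> carrier R" "t \<in> carrier R" for x s t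
   using that by - (rule ring_identity, (rule ring_rep | assumption | (simp; fail))+, (simp_all add: l_distr r_distr a_ac m_ac)?)
  then show ?thesis unfolding q3_def using qc rho(1) hc vc by simp
 qed
 then have "dv (th 5) (q3 \<ominus> peval (pd n Q) a)" using dv_add[OF dv_th_trans[OF d7, of 5] d5 th_carr] by simp
 then have "sdv lam (q3 \<ominus> peval (pd n Q) a)" by (rule sdv_lam) simp
 then have q3d: "q3 ~= \<zero> \<and> dv q3 lam"
  by (rule unit_perturbation[OF qc(1) q3c lam(1,4) dv_inv_flip[OF qc(1) q]])
 then obtain s where s: "s \<in> V" "lam = q3 \<otimes> s" unfolding dv_def by blast
 have "lam \<otimes> h = s \<otimes> peval Q (comb n y b)"
  unfolding q3h[symmetric] s(2) using q3c hc V_carr[OF s(1)] by (simp add: m_ac)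
 then have "dv (\<rho> \<otimes> \<tau>) (lam \<otimes> h)" using dv_V[OF Qd s(1) m_closed[OF rho(1) tc]] by simp
 then have "dv (\<rho> \<otimes> (\<rho> \<otimes> \<tau>)) (\<rho> \<otimes> (lam \<otimes> h))" by (rule dv_mult[OF dv_refl[OF rho(1)] _ rho(1) m_closed[OF rho(1) tc]])
 then have "dv (\<rho> \<otimes> (\<rho> \<otimes> \<tau>)) h" unfolding lam_cancel(2)[OF hc] .
 then show ?thesis unfolding h_def .
qed

text \<open>Suppose the largest residual \<open>\<delta>\<close> of \<open>P(z) - y\<close> is
  non-zero. A Newton step with \<open>B\<close> gives \<open>b\<close> with residuals at most
  \<open>th 4 \<delta>\<close>. By the relation, \<open>b i\<close> is a zero of \<open>Q i\<close>
  over the point \<open>P(b)\<close>, so \<open>slice_unique\<close> with \<open>y' = P(b)\<close>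
  bounds \<open>b - z\<close> by \<open>th 2 \<delta>\<close>. Then \<open>P(b) - P(z)\<close>, and
  with it \<open>P(z) - y\<close>, is bounded by \<open>th 1 \<delta>\<close>, so
  \<open>\<delta>\<close> would be smaller than itself.\<close>

lemma local_surjectivity_bound:
 assumes SP
  and P: "\<And>i. i < n ==> pwf n (P i)" "\<And>i. i < n ==> lb n (P i) x0 \<rho>" "\<And>i k. i < n ==> k < n ==> lb n (pd k (P i)) x0 \<rho>"
  and x0: "x0 \<in> pts n"
  and B: "\<And>i j. i < n ==> j < n ==> B i j \<in> carrier R" "\<And>i j. i < n ==> j < n ==> dv \<rho> (B i j)"
   "\<And>i j. i < n ==> j < n ==> (\<Oplus>k\<in>{..<n}. peval (pd k (P i)) x0 \<otimes> B k j) = (if i = j then \<one> else \<zero>)"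
  and a: "\<And>i. a i = comb n (\<lambda>j. peval (P j) x0) (x0 i)"
  and Q: "\<And>i. i < n ==> pwf (Suc n) (Q i)" "\<And>i. i < n ==> lb (Suc n) (Q i) (a i) \<rho>" "\<And>i. i < n ==> lb (Suc n) (pd n (Q i)) (a i) \<rho>"
   "\<And>i x. i < n ==> x \<in> pts n ==> peval (Q i) (comb n (\<lambda>j. peval (P j) x) (x i)) = \<zero>"
   "\<And>i. i < n ==> peval (pd n (Q i)) (a i) ~= \<zero>" "\<And>i. i < n ==> dv \<rho> (inv (peval (pd n (Q i)) (a i)))"
  and y: "y \<in> pts n" "\<And>i. i < n ==> dv (th 10) (y i \<ominus> peval (P i) x0)"
 shows "\<exists>z \<in> pts n. (\<forall>i<n. dv (th 8) (z i \<ominus> x0 i)) \<and> (\<forall>i<n. peval (P i) z = y i)"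
proof -
 have Px: "(\<lambda>j. peval (P j) x) \<in> pts n" if "x \<in> pts n" for x by (rule ptsI) (rule peval_closed[OF P(1) that])
 have ap: "a i \<in> pts (Suc n)" if "i < n" for i unfolding a by (rule comb_pts[OF Px[OF x0] ptsD[OF x0 that]])
 have an: "a i n = x0 i" for i by (simp add: a comb_def)
 have ya: "dv (th 10) (y j \<ominus> a i j)" if "j < n" for i j using y(2)[OF that] that by (simp add: a comb_def)
 have "\<exists>z \<in> carrier R. dv (th 8) (z \<ominus> x0 i) \<and> peval (Q i) (comb n y z) = \<zero>" if i: "i < n" for i
  using slice_root[OF \<open>SP\<close> Q(1)[OF i] Q(2)[OF i] Q(3)[OF i] ap[OF i] Q(4)[OF i x0, folded a] Q(5)[OF i] Q(6)[OF i] y(1) ya] unfolding an .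
 then have "\<forall>i. \<exists>z. i < n --> z \<in> carrier R \<and> dv (th 8) (z \<ominus> x0 i) \<and> peval (Q i) (comb n y z) = \<zero>" by blast
 then obtain z where z: "\<And>i. i < n ==> z i \<in> carrier R \<and> dv (th 8) (z i \<ominus> x0 i) \<and> peval (Q i) (comb n y (z i)) = \<zero>"
  by (elim choice[THEN exE]) (rule that, blast)
 have zp: "z \<in> pts n" by (rule ptsI) (use z in blast)
 have z8: "dv (th 8) (z i \<ominus> x0 i)" if "i < n" for i using z[OF that] by blast
 have zV: "z i \<ominus> x0 i \<in> V" if "i < n" for i by (rule dv_in_V[OF z8[OF that] th_V])
 have xx: "x0 i \<ominus> x0 i \<in> V" if "i < n" for i using minus_self[OF ptsD[OF x0 that]] by simp
 define r where "r i = peval (P i) z \<ominus> y i" for i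
 have Pz: "peval (P i) z \<in> carrier R" "peval (P i) x0 \<in> carrier R" "y i \<in> carrier R" if "i < n" for i
  using peval_closed[OF P(1)[OF that] zp] peval_closed[OF P(1)[OF that] x0] ptsD[OF y(1) that] by auto
 have rc: "r i \<in> carrier R" if "i < n" for i unfolding r_def using Pz[OF that] by simp
 have "\<forall>i<n. r i = \<zero>"
 proof (rule ccontr)
  assume nz: "\<not> (\<forall>i<n. r i = \<zero>)"
  then have ne: "{..<n} ~= {}" by auto
  obtain i1 where i1: "i1 \<in> {..<n}" "\<forall>j \<in> {..<n}. dv (r i1) (r j)"
   using dv_min[of "{..<n}" r, OF finite_lessThan ne] rc by blast
  define \<delta> where "\<delta> = r i1"
  have i1n: "i1 < n" using i1(1) by simp
  have rd: "dv \<delta> (r j)" if "j < n" for j unfolding \<delta>_def using i1(2) that by blast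
  have dc: "\<delta> \<in> carrier R" unfolding \<delta>_def by (rule rc[OF i1n])
  have dnz: "\<delta> ~= \<zero>"
  proof
   assume "\<delta> = \<zero>"
   then have "r j = \<zero>" if "j < n" for j using rd[OF that] dv_zeroD by blast
   then show False using nz by blast
  qed
  have r7: "\<rho> \<otimes> th 8 = th 7" by (rule rho_th) simp
  have r7d: "dv (th 7) (r i)" if i: "i < n" for i
  proof -
   have 1: "dv (th 7) (peval (P i) z \<ominus> peval (P i) x0)"
    using lb_estimates(1)[OF P(1)[OF i] P(2)[OF i] rho(1) x0 xx zp z8 th_V] unfolding r7 .
   have 2: "dv (th 7) (y i \<ominus> peval (P i) x0)" by (rule dv_th_trans[OF y(2)[OF i]]) simp
   have "(p \<ominus> q) \<ominus> (t \<ominus> q) = p \<ominus> t" if "p \<in> carrier R" "q \<in> carrier R" "t \<in> carrier R" for p q t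
    using that by - (rule ring_identity, (rule ring_rep | assumption | (simp; fail))+, (simp_all add: l_distr r_distr a_ac m_ac)?)
   then have "r i = (peval (P i) z \<ominus> peval (P i) x0) \<ominus> (y i \<ominus> peval (P i) x0)" unfolding r_def using Pz[OF i] by simp
   then show ?thesis using dv_diff[OF 1 2 th_carr] by simp
  qed
  have d7: "dv (th 7) \<delta>" unfolding \<delta>_def by (rule r7d[OF i1n])
  define e where "e = \<rho> \<otimes> \<delta>"
  have ec: "e \<in> carrier R" unfolding e_def using rho(1) dc by simp
  have r6: "\<rho> \<otimes> th 7 = th 6" by (rule rho_th) simp
  have e6: "dv (th 6) e" using dv_mult[OF dv_refl[OF rho(1)] d7 rho(1) th_carr] unfolding r6 e_def .
  have eV: "e \<in> V" by (rule dv_in_V[OF e6 th_V])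
  \<comment> \<open>The step uses the inverse of the Jacobian matrix at \<open>x0\<close>, not at
    \<open>z\<close>. The entries change by at most \<open>th 7\<close> between these points, and
    this change enters the error as \<open>?S\<close>.\<close>
  define h where "h i = \<ominus> (\<Oplus>j\<in>{..<n}. B i j \<otimes> r j)" for i
  have he: "dv e (h i)" if i: "i < n" for i unfolding h_def
  proof (rule dv_minus[OF dv_finsum ec])
   show "dv e (B i j \<otimes> r j)" if "j \<in> {..<n}" for j unfolding e_def
    by (rule dv_mult[OF B(2)[OF i] rd rho(1) dc]) (use that in auto)
  qed (use ec in auto)
  have hc: "h i \<in> carrier R" if "i < n" for i by (rule dv_carr[OF he[OF that] ec])
  define b where "b i = z i \<oplus> h i" for i
  have bp: "b \<in> pts n" by (rule ptsI) (use ptsD[OF zp] hc in \<open>simp add: b_def\<close>)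
  have bz: "b i \<ominus> z i = h i" if "i < n" for i unfolding b_def by (rule add_diff_cancel_left[OF ptsD[OF zp that] hc[OF that]])
  have bze: "dv e (b i \<ominus> z i)" if "i < n" for i unfolding bz[OF that] by (rule he[OF that])
  have tdc: "th k \<otimes> \<delta> \<in> carrier R" for k using th_carr dc by simp
  have err: "dv (th 4 \<otimes> \<delta>) (peval (P i) b \<ominus> y i)" if i: "i < n" for i
  proof -
   let ?J = "\<lambda>k x. peval (pd k (P i)) x"
   have Jc: "?J k x \<in> carrier R" if "x \<in> pts n" for k x by (rule peval_closed[OF pwf_pd[OF P(1)[OF i]] that])
   let ?T = "peval (P i) b \<ominus> peval (P i) z \<ominus> (\<Oplus>k\<in>{..<n}. ?J k z \<otimes> (b k \<ominus> z k))"
   have T: "dv (\<rho> \<otimes> (e \<otimes> e)) ?T"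
    by (rule lb_estimates(2)[OF P(1)[OF i] P(2)[OF i] rho(1) zp zV bp bze eV])
   have "dv (th 4 \<otimes> \<delta>) (\<rho> \<otimes> (e \<otimes> e))"
   proof -
    have id: "r \<otimes> ((r \<otimes> d) \<otimes> (r \<otimes> d)) = (r \<otimes> (r \<otimes> (r \<otimes> d))) \<otimes> d" if "r \<in> carrier R" "d \<in> carrier R" for r d
     using that by - (rule ring_identity, (rule ring_rep | assumption | (simp; fail))+, (simp_all add: l_distr r_distr a_ac m_ac)?)
    have 1: "dv (\<rho> \<otimes> th 6) (\<rho> \<otimes> e)" by (rule dv_mult[OF dv_refl[OF rho(1)] e6 rho(1) th_carr])
    have 2: "dv (\<rho> \<otimes> (\<rho> \<otimes> th 6)) (\<rho> \<otimes> (\<rho> \<otimes> e))" by (rule dv_mult[OF dv_refl[OF rho(1)] 1 rho(1)]) (use rho(1) th_carr in simp)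
    have "\<rho> \<otimes> th 6 = th 5" "\<rho> \<otimes> th 5 = th 4" by (rule rho_th, simp)+
    then have "dv (th 4) (\<rho> \<otimes> (\<rho> \<otimes> e))" using 2 by simp
    then have "dv (th 4 \<otimes> \<delta>) ((\<rho> \<otimes> (\<rho> \<otimes> e)) \<otimes> \<delta>)" by (rule dv_mult[OF _ dv_refl[OF dc] th_carr dc])
    then show ?thesis unfolding e_def id[OF rho(1) dc] .
   qed
   then have T4: "dv (th 4 \<otimes> \<delta>) ?T" by (rule dv_trans[OF _ T tdc])
   let ?S = "\<Oplus>k\<in>{..<n}. (?J k z \<ominus> ?J k x0) \<otimes> h k"
   have S4: "dv (th 4 \<otimes> \<delta>) ?S"
   proof (rule dv_finsum)
    fix k assume "k \<in> {..<n}"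
    then have k: "k < n" by simp
    have 1: "dv (th 7) (?J k z \<ominus> ?J k x0)"
     using lb_estimates(1)[OF pwf_pd[OF P(1)[OF i]] P(3)[OF i k] rho(1) x0 xx zp z8 th_V] unfolding r7 .
    have "dv (th 7 \<otimes> e) ((?J k z \<ominus> ?J k x0) \<otimes> h k)" by (rule dv_mult[OF 1 he[OF k] th_carr ec])
    moreover have "th 7 \<otimes> e = th 6 \<otimes> \<delta>"
    proof -
     have "th 7 \<otimes> e = \<rho> \<otimes> (th 7 \<otimes> \<delta>)" unfolding e_def by (rule m_lcomm[OF th_carr rho(1) dc])
     then show ?thesis using rho_th_mult[of 7 6, OF _ dc] by simp
    qed
    ultimately have "dv (th 6 \<otimes> \<delta>) ((?J k z \<ominus> ?J k x0) \<otimes> h k)" by simp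
    then show "dv (th 4 \<otimes> \<delta>) ((?J k z \<ominus> ?J k x0) \<otimes> h k)" by (rule dv_th_mult[rotated 2]) (use dc in auto)
   qed (use tdc in auto)
   have lin: "(\<Oplus>k\<in>{..<n}. ?J k x0 \<otimes> h k) = \<ominus> r i"
   proof -
    have "(\<Oplus>k\<in>{..<n}. ?J k x0 \<otimes> h k) = (\<Oplus>k\<in>{..<n}. \<ominus> (\<Oplus>j\<in>{..<n}. (?J k x0 \<otimes> B k j) \<otimes> r j))"
    proof (rule fsum_cong)
     fix k assume "k \<in> {..<n}"
     then have k: "k < n" by simp
     have sc: "(\<Oplus>j\<in>{..<n}. B k j \<otimes> r j) \<in> carrier R" by (rule fsum_closed) (use B(1)[OF k] rc in auto)
     have "?J k x0 \<otimes> h k = \<ominus> (?J k x0 \<otimes> (\<Oplus>j\<in>{..<n}. B k j \<otimes> r j))" unfolding h_def by (rule r_minus[OF Jc[OF x0] sc])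
     also have "?J k x0 \<otimes> (\<Oplus>j\<in>{..<n}. B k j \<otimes> r j) = (\<Oplus>j\<in>{..<n}. ?J k x0 \<otimes> (B k j \<otimes> r j))"
      by (rule fsum_mult[symmetric]) (use Jc[OF x0] B(1)[OF k] rc in auto)
     also have "\<dots> = (\<Oplus>j\<in>{..<n}. (?J k x0 \<otimes> B k j) \<otimes> r j)"
      by (rule fsum_cong) (use Jc[OF x0] B(1)[OF k] rc in \<open>auto simp: m_assoc\<close>)
     finally show "?J k x0 \<otimes> h k = \<ominus> (\<Oplus>j\<in>{..<n}. (?J k x0 \<otimes> B k j) \<otimes> r j)" .
     show "\<ominus> (\<Oplus>j\<in>{..<n}. (?J k x0 \<otimes> B k j) \<otimes> r j) \<in> carrier R"
      by (rule a_inv_closed, rule fsum_closed) (use Jc[OF x0] B(1)[OF k] rc in auto)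
    qed simp
    also have "\<dots> = \<ominus> (\<Oplus>k\<in>{..<n}. \<Oplus>j\<in>{..<n}. (?J k x0 \<otimes> B k j) \<otimes> r j)"
     by (rule fsum_minus) (use Jc[OF x0] B(1) rc in \<open>auto intro!: fsum_closed\<close>)
    also have "(\<Oplus>k\<in>{..<n}. \<Oplus>j\<in>{..<n}. (?J k x0 \<otimes> B k j) \<otimes> r j) = (\<Oplus>j\<in>{..<n}. \<Oplus>k\<in>{..<n}. (?J k x0 \<otimes> B k j) \<otimes> r j)"
     by (rule fsum_swap) (use Jc[OF x0] B(1) rc in auto)
    also have "\<dots> = (\<Oplus>j\<in>{..<n}. (if i = j then \<one> else \<zero>) \<otimes> r j)"
    proof (rule fsum_cong)
     fix j assume "j \<in> {..<n}"
     then have j: "j < n" by simp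
     have "(\<Oplus>k\<in>{..<n}. (?J k x0 \<otimes> B k j) \<otimes> r j) = (\<Oplus>k\<in>{..<n}. ?J k x0 \<otimes> B k j) \<otimes> r j"
      by (rule fsum_mult_right) (use Jc[OF x0] B(1)[OF _ j] rc[OF j] in auto)
     then show "(\<Oplus>k\<in>{..<n}. (?J k x0 \<otimes> B k j) \<otimes> r j) = (if i = j then \<one> else \<zero>) \<otimes> r j" unfolding B(3)[OF i j] .
     show "(if i = j then \<one> else \<zero>) \<otimes> r j \<in> carrier R" using rc[OF j] by simp
    qed simp
    also have "\<dots> = (if i = i then \<one> else \<zero>) \<otimes> r i" by (rule fsum_single) (use i rc in auto)
    finally show ?thesis using rc[OF i] by simp
   qed
   have sum: "(\<Oplus>k\<in>{..<n}. ?J k z \<otimes> (b k \<ominus> z k)) = ?S \<oplus> \<ominus> r i"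
   proof -
    have "(\<Oplus>k\<in>{..<n}. ?J k z \<otimes> (b k \<ominus> z k)) = (\<Oplus>k\<in>{..<n}. (?J k z \<ominus> ?J k x0) \<otimes> h k \<oplus> ?J k x0 \<otimes> h k)"
    proof (rule fsum_cong)
     fix k assume "k \<in> {..<n}"
     then have k: "k < n" by simp
     have "p \<otimes> t = (p \<ominus> q) \<otimes> t \<oplus> q \<otimes> t" if "p \<in> carrier R" "q \<in> carrier R" "t \<in> carrier R" for p q t
      using that by - (rule ring_identity, (rule ring_rep | assumption | (simp; fail))+, (simp_all add: l_distr r_distr a_ac m_ac)?)
     then show "?J k z \<otimes> (b k \<ominus> z k) = (?J k z \<ominus> ?J k x0) \<otimes> h k \<oplus> ?J k x0 \<otimes> h k"
      unfolding bz[OF k] using Jc[OF zp] Jc[OF x0] hc[OF k] by blast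
     show "(?J k z \<ominus> ?J k x0) \<otimes> h k \<oplus> ?J k x0 \<otimes> h k \<in> carrier R" using Jc[OF zp] Jc[OF x0] hc[OF k] by simp
    qed simp
    also have "\<dots> = ?S \<oplus> (\<Oplus>k\<in>{..<n}. ?J k x0 \<otimes> h k)"
     by (rule fsum_add) (use Jc[OF zp] Jc[OF x0] hc in auto)
    finally show ?thesis unfolding lin .
   qed
   have Sc: "?S \<in> carrier R" by (rule dv_carr[OF S4 tdc])
   have Pb: "peval (P i) b \<in> carrier R" by (rule peval_closed[OF P(1)[OF i] bp])
   have id: "pb \<ominus> y = (pb \<ominus> pz \<ominus> (s \<oplus> \<ominus> (pz \<ominus> y))) \<oplus> s"
    if "pb \<in> carrier R" "y \<in> carrier R" "pz \<in> carrier R" "s \<in> carrier R" for pb y pz s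
    using that by - (rule ring_identity, (rule ring_rep | assumption | (simp; fail))+, (simp_all add: l_distr r_distr a_ac m_ac)?)
   \<comment> \<open>The linear part at \<open>x0\<close> cancels the residual exactly. What is left
     is the second-order remainder \<open>?T\<close> and the effect \<open>?S\<close> of the change
     of the Jacobian matrix.\<close>
   have "peval (P i) b \<ominus> y i = ?T \<oplus> ?S" unfolding sum r_def by (rule id[OF Pb Pz(3)[OF i] Pz(1)[OF i] Sc])
   then show ?thesis using dv_add[OF T4 S4 tdc] by simp
  qed
  have hd: "dv (th 2 \<otimes> \<delta>) (h i)" if i: "i < n" for i
  proof -
   have tV: "th 4 \<otimes> \<delta> \<in> V" by (rule V_mult[OF th_V dv_in_V[OF d7 th_V]])
   have "dv (\<rho> \<otimes> (\<rho> \<otimes> (th 4 \<otimes> \<delta>))) (b i \<ominus> z i)"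
   proof (rule slice_unique[OF Q(1)[OF i] Q(2)[OF i] Q(3)[OF i] ap[OF i] Q(5)[OF i] Q(6)[OF i] y(1) ya])
    show "z i \<in> carrier R" "peval (Q i) (comb n y (z i)) = \<zero>" using z[OF i] by blast+
    show "dv (th 8) (z i \<ominus> a i n)" unfolding an by (rule z8[OF i])
    show "(\<lambda>j. peval (P j) b) \<in> pts n" by (rule Px[OF bp])
    show "dv (th 4 \<otimes> \<delta>) (peval (P j) b \<ominus> y j)" if "j < n" for j by (rule err[OF that])
    show "th 4 \<otimes> \<delta> \<in> V" by (rule tV)
    show "b i \<in> carrier R" by (rule ptsD[OF bp i])
    show "dv (th 6) (b i \<ominus> z i)" by (rule dv_trans[OF e6 bze[OF i] th_carr])
    show "peval (Q i) (comb n (\<lambda>j. peval (P j) b) (b i)) = \<zero>" by (rule Q(4)[OF i bp])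
   qed
   moreover have "\<rho> \<otimes> (th 4 \<otimes> \<delta>) = th 3 \<otimes> \<delta>" "\<rho> \<otimes> (th 3 \<otimes> \<delta>) = th 2 \<otimes> \<delta>"
    by (rule rho_th_mult, simp, rule dc)+
   ultimately show ?thesis unfolding bz[OF i] by simp
  qed
  have t2V: "th 2 \<otimes> \<delta> \<in> V" by (rule V_mult[OF th_V dv_in_V[OF d7 th_V]])
  have bzd: "dv (th 2 \<otimes> \<delta>) (b i \<ominus> z i)" if "i < n" for i unfolding bz[OF that] by (rule hd[OF that])
  have "\<rho> \<otimes> (th 2 \<otimes> \<delta>) = th 1 \<otimes> \<delta>" by (rule rho_th_mult, simp, rule dc)
  then have 1: "dv (th 1 \<otimes> \<delta>) (peval (P i1) b \<ominus> peval (P i1) z)"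
   using lb_estimates(1)[OF P(1)[OF i1n] P(2)[OF i1n] rho(1) zp zV bp bzd t2V] by simp
  have 2: "dv (th 1 \<otimes> \<delta>) (peval (P i1) b \<ominus> y i1)" by (rule dv_th_mult[OF _ dc err[OF i1n]]) simp
  have id: "(pb \<ominus> y) \<ominus> (pb \<ominus> pz) = pz \<ominus> y" if "pb \<in> carrier R" "y \<in> carrier R" "pz \<in> carrier R" for pb y pz
   using that by - (rule ring_identity, (rule ring_rep | assumption | (simp; fail))+, (simp_all add: l_distr r_distr a_ac m_ac)?)
  have "dv (th 1 \<otimes> \<delta>) \<delta>"
   using dv_diff[OF 2 1 tdc] unfolding id[OF peval_closed[OF P(1)[OF i1n] bp] Pz(3)[OF i1n] Pz(1)[OF i1n]] \<delta>_def r_def .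
  then have "dv (\<delta> \<otimes> th 1) (\<delta> \<otimes> \<one>)" using m_comm[OF th_carr dc] dc by simp
  then have "dv (th 1) \<one>" by (rule dv_cancel[OF _ dc dnz th_carr one_closed])
  then have "\<one> \<in> M" by (rule dv_in_M[OF _ th_M])
  then show False using one_notin_M by blast
 qed
 then have "peval (P i) z = y i" if "i < n" for i
  using that Pz[OF that] r_right_minus_eq[OF Pz(1)[OF that] Pz(3)[OF that]] unfolding r_def by blast
 then show ?thesis using zp z8 by blast
qed

end

text \<open>Conditions on the constant that some \<open>\<rho>\<close> fulfils and that persist when
  it is enlarged. They are closed under finite conjunctions, which yields one constant for all
  estimates at once.\<close>

definition adm where "adm \<phi> \<longleftrightarrow> (\<exists>\<rho>. big \<rho> \<and> \<phi> \<rho>) \<and> (\<forall>\<rho> \<rho>'. \<phi> \<rho> --> big \<rho> --> big \<rho>' --> dv \<rho>' \<rho> --> \<phi> \<rho>')"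

lemma adm_lb: assumes "pwf n e" "x \<in> pts n" shows "adm (lb n e x)"
 unfolding adm_def
proof (intro conjI allI impI)
 show "\<exists>\<rho>. big \<rho> \<and> lb n e x \<rho>" by (rule lb_exists[OF assms])
 show "lb n e x \<rho>'" if "lb n e x \<rho>" "big \<rho>'" "dv \<rho>' \<rho>" for \<rho> \<rho>' by (rule lb_mono[OF that(1,3) bigD(1)[OF that(2)]])
qed

lemma adm_dv: assumes "c \<in> carrier R" shows "adm (\<lambda>\<rho>. dv \<rho> c)"
 unfolding adm_def
proof (intro conjI allI impI)
 show "\<exists>\<rho>. big \<rho> \<and> dv \<rho> c" by (rule big_elt[OF assms])
 show "dv \<rho>' c" if "dv \<rho> c" "big \<rho>'" "dv \<rho>' \<rho>" for \<rho> \<rho>' by (rule dv_trans[OF that(3,1) bigD(1)[OF that(2)]])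
qed

lemma adm_conj: assumes "adm \<phi>" "adm \<psi>" shows "adm (\<lambda>\<rho>. \<phi> \<rho> \<and> \<psi> \<rho>)"
proof -
 obtain r s where r: "big r" "\<phi> r" and s: "big s" "\<psi> s" using assms unfolding adm_def by blast
 have m: "big (r \<otimes> s)" "dv (r \<otimes> s) r" "dv (r \<otimes> s) s" using big_mult[OF r(1) s(1)] by auto
 have "\<phi> (r \<otimes> s)" "\<psi> (r \<otimes> s)" using assms r s m unfolding adm_def by blast+
 then show ?thesis using m(1) assms unfolding adm_def by blast
qed

lemma adm_all: "(\<And>i. i < (n :: nat) ==> adm (\<phi> i)) ==> adm (\<lambda>\<rho>. \<forall>i<n. \<phi> i \<rho>)"
proof (induction n)
 case 0
 show ?case unfolding adm_def using big_one by blast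
next
 case (Suc n)
 have "adm (\<lambda>\<rho>. (\<forall>i<n. \<phi> i \<rho>) \<and> \<phi> n \<rho>)" by (rule adm_conj) (use Suc in auto)
 moreover have "(\<lambda>\<rho>. (\<forall>i<n. \<phi> i \<rho>) \<and> \<phi> n \<rho>) = (\<lambda>\<rho>. \<forall>i<Suc n. \<phi> i \<rho>)" by (auto simp: less_Suc_eq)
 ultimately show ?case by simp
qed

lemma local_surjectivity:
 assumes SP and p: "\<pi> \<in> M" "\<pi> ~= \<zero>"
  and P: "\<And>i. i < n ==> pwf n (P i)" and x0: "x0 \<in> pts n"
  and det: "det n (\<lambda>i j. peval (pd j (P i)) x0) ~= \<zero>"
  and Q: "\<And>i. i < n ==> pwf (Suc n) (Q i)"
   "\<And>i x. i < n ==> x \<in> pts n ==> peval (Q i) (comb n (\<lambda>j. peval (P j) x) (x i)) = \<zero>"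
   "\<And>i. i < n ==> peval (pd n (Q i)) (comb n (\<lambda>j. peval (P j) x0) (x0 i)) ~= \<zero>"
  and c: "c \<in> carrier R - {\<zero>}"
 shows "\<exists>d \<in> carrier R - {\<zero>}. \<forall>y \<in> pts n. (\<forall>i<n. sdv d (y i \<ominus> peval (P i) x0)) -->
  (\<exists>z \<in> pts n. (\<forall>i<n. sdv c (z i \<ominus> x0 i)) \<and> (\<forall>i<n. peval (P i) z = y i))"
proof -
 have "\<exists>B. (\<forall>i<n. \<forall>j<n. B i j \<in> carrier R) \<and>
   (\<forall>i<n. \<forall>j<n. (\<Oplus>k\<in>{..<n}. peval (pd k (P i)) x0 \<otimes> B k j) = (if i = j then \<one> else \<zero>))"
  by (rule right_inverse[OF _ det]) (rule peval_closed[OF pwf_pd[OF P] x0])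
 then obtain B where B: "\<forall>i<n. \<forall>j<n. B i j \<in> carrier R"
  "\<forall>i<n. \<forall>j<n. (\<Oplus>k\<in>{..<n}. peval (pd k (P i)) x0 \<otimes> B k j) = (if i = j then \<one> else \<zero>)"
  by (elim exE conjE) (rule that)
 define a where "a i = comb n (\<lambda>j. peval (P j) x0) (x0 i)" for i
 have ap: "a i \<in> pts (Suc n)" if "i < n" for i unfolding a_def
  by (rule comb_pts[OF ptsI ptsD[OF x0 that]]) (rule peval_closed[OF P x0])
 have q: "peval (pd n (Q i)) (a i) \<in> carrier R" "peval (pd n (Q i)) (a i) ~= \<zero>" if "i < n" for i
  using peval_closed[OF pwf_pd[OF Q(1)[OF that]] ap[OF that]] Q(3)[OF that] unfolding a_def by auto
 have ci: "inv c \<in> carrier R" "c \<in> carrier R" "c ~= \<zero>" using inv_carr[of c] c by auto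
 \<comment> \<open>The last condition makes \<open>c\<close> divide \<open>lam\<close>. Solutions
   within \<open>th 8\<close> of \<open>x0\<close> then lie in the prescribed ball of radius
   \<open>c\<close>.\<close>
 have "adm (\<lambda>\<rho>. (\<forall>i<n. lb n (P i) x0 \<rho>) \<and> (\<forall>i<n. \<forall>k<n. lb n (pd k (P i)) x0 \<rho>) \<and> (\<forall>i<n. \<forall>j<n. dv \<rho> (B i j)) \<and>
  (\<forall>i<n. lb (Suc n) (Q i) (a i) \<rho>) \<and> (\<forall>i<n. lb (Suc n) (pd n (Q i)) (a i) \<rho>) \<and>
  (\<forall>i<n. dv \<rho> (inv (peval (pd n (Q i)) (a i)))) \<and> dv \<rho> (inv c))"
  by (intro adm_conj adm_all adm_lb adm_dv P x0 pwf_pd Q(1) ap B(1)[rule_format] inv_carr q ci) assumption+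
 then obtain \<rho> where bigr: "big \<rho>" and r: "\<forall>i<n. lb n (P i) x0 \<rho>" "\<forall>i<n. \<forall>k<n. lb n (pd k (P i)) x0 \<rho>" "\<forall>i<n. \<forall>j<n. dv \<rho> (B i j)"
  "\<forall>i<n. lb (Suc n) (Q i) (a i) \<rho>" "\<forall>i<n. lb (Suc n) (pd n (Q i)) (a i) \<rho>"
  "\<forall>i<n. dv \<rho> (inv (peval (pd n (Q i)) (a i)))" "dv \<rho> (inv c)" unfolding adm_def by (elim conjE exE) (rule that)
 note ctx = bigr p(1)
 let ?th = "th \<rho> \<pi>"
 have lc: "lam \<rho> \<in> carrier R" "lam \<rho> ~= \<zero>" using lam[OF ctx] by auto
 have pc: "\<pi> \<in> carrier R" by (rule V_carr[OF M_V[OF p(1)]])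
 have "?th 10 ~= \<zero>" unfolding th_def[OF ctx]
  using integral[OF _ nat_pow_closed[OF lc(1)] pc, of 10] pow_nonzero[OF lc, of 10] p(2) by blast
 then have d: "?th 10 \<in> carrier R - {\<zero>}" using th_carr[OF ctx] by simp
 show ?thesis
 proof (rule bexI[OF _ d], rule ballI, rule impI)
  fix y assume y: "y \<in> pts n" "\<forall>i<n. sdv (?th 10) (y i \<ominus> peval (P i) x0)"
  have yd: "dv (?th 10) (y i \<ominus> peval (P i) x0)" if "i < n" for i using y(2) that sdv_dv by blast
  have "\<exists>z \<in> pts n. (\<forall>i<n. dv (?th 8) (z i \<ominus> x0 i)) \<and> (\<forall>i<n. peval (P i) z = y i)"
   by (rule local_surjectivity_bound[OF ctx \<open>SP\<close> P r(1)[rule_format] r(2)[rule_format] x0 B(1)[rule_format] r(3)[rule_format] B(2)[rule_format]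
     a_def Q(1) r(4)[rule_format] r(5)[rule_format] Q(2) q(2) r(6)[rule_format] y(1) yd])
  then obtain z where z: "z \<in> pts n" "\<forall>i<n. dv (?th 8) (z i \<ominus> x0 i)" "\<forall>i<n. peval (P i) z = y i" by (elim bexE conjE) (rule that)
  have cl: "dv c (lam \<rho>)" by (rule dv_inv_flip[OF ctx ci(2,3) r(7)])
  have "sdv c (z i \<ominus> x0 i)" if "i < n" for i
   by (rule dv_sdv_trans[OF cl sdv_lam[OF ctx z(2)[rule_format, OF that]] ci(2)]) simp
  then show "\<exists>z \<in> pts n. (\<forall>i<n. sdv c (z i \<ominus> x0 i)) \<and> (\<forall>i<n. peval (P i) z = y i)"
   using z(1,3) by (intro bexI[OF _ z(1)] conjI allI impI) simp_all
 qed
qed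

end

section \<open>Interiors of images\<close>

context valued_field
begin

lemma box_openin:
 assumes x: "x \<in> {..<n} \<rightarrow>\<^sub>E carrier K" and c: "c \<in> carrier K - {\<zero>\<^bsub>K\<^esub>}"
 shows "openin (val_topology_pow K G v n) (box n x c)" "x \<in> box n x c"
proof -
 interpret VS: valuation_subring K "val_set K G v" by (rule valuation_subring_val_set)
 have cc: "c \<in> carrier K" using c by simp
 show "openin (val_topology_pow K G v n) (box n x c)"
  unfolding openin_val_topology_pow
 proof (intro conjI ballI)
  show "box n x c \<subseteq> {..<n} \<rightarrow>\<^sub>E carrier K" unfolding box_def by blast
  fix y assume y: "y \<in> box n x c"
  then have yp: "y \<in> {..<n} \<rightarrow>\<^sub>E carrier K" and yx: "\<And>i. i < n ==> VS.sdv c (y i \<ominus>\<^bsub>K\<^esub> x i)" unfolding box_def by blast+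
  have "box n y c \<subseteq> box n x c"
  proof
   fix w assume w: "w \<in> box n y c"
   then have wp: "w \<in> {..<n} \<rightarrow>\<^sub>E carrier K" and wy: "\<And>i. i < n ==> VS.sdv c (w i \<ominus>\<^bsub>K\<^esub> y i)" unfolding box_def by blast+
   have id: "a \<ominus>\<^bsub>K\<^esub> d = (a \<ominus>\<^bsub>K\<^esub> b) \<oplus>\<^bsub>K\<^esub> (b \<ominus>\<^bsub>K\<^esub> d)" if "a \<in> carrier K" "b \<in> carrier K" "d \<in> carrier K" for a b d
    using that by - (rule K.ring_identity, (rule K.ring_rep | assumption | (simp; fail))+, (simp_all add: K.l_distr K.r_distr K.a_ac K.m_ac)?)
   have "VS.sdv c (w i \<ominus>\<^bsub>K\<^esub> x i)" if i: "i < n" for i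
   proof -
    have C: "w i \<in> carrier K" "y i \<in> carrier K" "x i \<in> carrier K" using wp yp x i by (auto simp: PiE_iff)
    show ?thesis unfolding id[OF C] by (rule VS.sdv_add[OF wy[OF i] yx[OF i] cc])
   qed
   then show "w \<in> box n x c" unfolding box_def using wp by blast
  qed
  then show "\<exists>d \<in> carrier K - {\<zero>\<^bsub>K\<^esub>}. box n y d \<subseteq> box n x c" by (rule bexI[OF _ c])
 qed
 have "VS.sdv c (x i \<ominus>\<^bsub>K\<^esub> x i)" if i: "i < n" for i
 proof -
  have xi: "x i \<in> carrier K" using x i by (auto simp: PiE_iff)
  show ?thesis unfolding K.minus_self[OF xi] by (rule VS.sdv_zero[OF cc])
 qed
 then show "x \<in> box n x c" unfolding box_def using x by blast
qed

lemma interior_nonempty: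
 assumes x: "x \<in> {..<n} \<rightarrow>\<^sub>E carrier K" and c: "c \<in> carrier K - {\<zero>\<^bsub>K\<^esub>}" and S: "box n x c \<subseteq> S"
 shows "val_topology_pow K G v n interior_of S ~= {}"
 using interior_of_maximal[OF S box_openin(1)[OF x c]] box_openin(2)[OF x c] by blast

lemma SP_interior_image:
 assumes SP: "valuation_subring.SP K (val_set K G v)"
 shows "interior_image_of_open_sets K G v"
 unfolding interior_image_of_open_sets_def
proof (intro allI impI, elim conjE bexE)
 fix n :: nat and P and U xs
 assume Pm: "\<forall>i<n. P i \<in> mpoly_set K n" and xs: "xs \<in> {..<n} \<rightarrow>\<^sub>E carrier K" "jacobian_det K n P xs ~= \<zero>\<^bsub>K\<^esub>"
  and U: "openin (val_topology_pow K G v n) U" "U ~= {}"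
 interpret VS: valuation_subring K "val_set K G v" by (rule valuation_subring_val_set)
 have "\<forall>i. \<exists>e. i < n --> K.pwf n e \<and> (\<forall>x \<in> K.pts n. mpoly_eval K n (P i) x = K.peval e x) \<and>
  (\<forall>j. \<forall>x \<in> K.pts n. mpoly_eval K n (mpoly_deriv K j (P i)) x = K.peval (K.pd j e) x)"
  using K.mpoly_expr Pm by blast
 then obtain E where E0: "\<forall>i. i < n --> K.pwf n (E i) \<and> (\<forall>x \<in> K.pts n. mpoly_eval K n (P i) x = K.peval (E i) x) \<and>
  (\<forall>j. \<forall>x \<in> K.pts n. mpoly_eval K n (mpoly_deriv K j (P i)) x = K.peval (K.pd j (E i)) x)"
  by (elim choice[THEN exE]) (rule that)
 have E: "K.pwf n (E i)" "\<And>x. x \<in> K.pts n ==> mpoly_eval K n (P i) x = K.peval (E i) x"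
  "\<And>j x. x \<in> K.pts n ==> mpoly_eval K n (mpoly_deriv K j (P i)) x = K.peval (K.pd j (E i)) x" if "i < n" for i
  using E0[rule_format, OF that] by blast+
 have PiE_pts: "x \<in> K.pts n" if "x \<in> {..<n} \<rightarrow>\<^sub>E carrier K" for x
  using that by (auto simp: PiE_iff K.pts_def)
 have pm: "poly_map K n P x \<in> {..<n} \<rightarrow>\<^sub>E carrier K" "\<And>i. i < n ==> poly_map K n P x i = K.peval (E i) x" if x: "x \<in> K.pts n" for x
 proof -
  show 1: "poly_map K n P x i = K.peval (E i) x" if "i < n" for i using E(2)[OF that x] that by (simp add: poly_map_def)
  have "poly_map K n P x \<in> extensional {..<n}" by (simp add: poly_map_def)
  then show "poly_map K n P x \<in> {..<n} \<rightarrow>\<^sub>E carrier K" using 1 K.peval_closed[OF E(1) x] by (simp add: PiE_iff)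
 qed
 have sub: "U \<subseteq> {..<n} \<rightarrow>\<^sub>E carrier K" and op: "\<forall>x \<in> U. \<exists>c \<in> carrier K - {\<zero>\<^bsub>K\<^esub>}. box n x c \<subseteq> U"
  using U(1) unfolding openin_val_topology_pow by blast+
 obtain u where u: "u \<in> U" using U(2) by blast
 have uE: "u \<in> {..<n} \<rightarrow>\<^sub>E carrier K" using sub u by blast
 note up = PiE_pts[OF uE]
 obtain c where c: "c \<in> carrier K - {\<zero>\<^bsub>K\<^esub>}" "box n u c \<subseteq> U" using op u by blast
 have cc: "c \<in> carrier K" using c(1) by simp
 show "val_topology_pow K G v n interior_of (poly_map K n P ` U) ~= {}"
 proof (cases "\<exists>\<pi> \<in> VS.M. \<pi> ~= \<zero>\<^bsub>K\<^esub>")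
  \<comment> \<open>For the trivial valuation the topology is discrete, so a one-point set has
    interior. The arguments with generic points need the small non-zero elements of the other
    case.\<close>
  case False
  let ?y = "poly_map K n P u"
  have "box n ?y \<one>\<^bsub>K\<^esub> \<subseteq> poly_map K n P ` U"
  proof
   fix w assume "w \<in> box n ?y \<one>\<^bsub>K\<^esub>"
   then have wE: "w \<in> {..<n} \<rightarrow>\<^sub>E carrier K" and ws: "\<And>i. i < n ==> VS.sdv \<one>\<^bsub>K\<^esub> (w i \<ominus>\<^bsub>K\<^esub> ?y i)" unfolding box_def by blast+
   have "w = ?y"
   proof (rule PiE_ext[OF wE pm(1)[OF up]])
    fix i assume "i \<in> {..<n}"
    then have i: "i < n" by simp
    have C: "w i \<in> carrier K" "?y i \<in> carrier K" using wE pm(1)[OF up] i by (auto simp: PiE_iff)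
    have "w i \<ominus>\<^bsub>K\<^esub> ?y i \<in> VS.M" using ws[OF i] VS.sdv_one by blast
    then have "w i \<ominus>\<^bsub>K\<^esub> ?y i = \<zero>\<^bsub>K\<^esub>" using False by blast
    then show "w i = ?y i" by (rule K.eqd[OF _ C])
   qed
   then show "w \<in> poly_map K n P ` U" using u by blast
  qed
  then show ?thesis by (rule interior_nonempty[OF pm(1)[OF up], rotated]) simp
 next
  case True
  then obtain \<pi> where p: "\<pi> \<in> VS.M" "\<pi> ~= \<zero>\<^bsub>K\<^esub>" by blast
  let ?det = "\<lambda>x. K.det n (\<lambda>i j. K.peval (K.pd j (E i)) x)"
  have jac: "jacobian_det K n P x = ?det x" if x: "x \<in> K.pts n" for x
   unfolding jacobian_det_def K.det_def
  proof (rule K.fsum_cong[OF refl])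
   fix \<sigma> assume "\<sigma> \<in> {\<sigma>. \<sigma> permutes {..<n}}"
   have C: "K.peval (K.pd j (E i)) x \<in> carrier K" if "i < n" for i j by (rule K.peval_closed[OF K.pwf_pd[OF E(1)[OF that]] x])
   have "(\<Otimes>\<^bsub>K\<^esub>i\<in>{..<n}. mpoly_eval K n (mpoly_deriv K (\<sigma> i) (P i)) x) = (\<Otimes>\<^bsub>K\<^esub>i\<in>{..<n}. K.peval (K.pd (\<sigma> i) (E i)) x)"
    by (rule K.finprod_cong') (use E(3)[OF _ x] C in auto)
   then show "[sign \<sigma>] \<cdot>\<^bsub>K\<^esub> (\<Otimes>\<^bsub>K\<^esub>i\<in>{..<n}. mpoly_eval K n (mpoly_deriv K (\<sigma> i) (P i)) x) =
    [sign \<sigma>] \<cdot>\<^bsub>K\<^esub> (\<Otimes>\<^bsub>K\<^esub>i\<in>{..<n}. K.peval (K.pd (\<sigma> i) (E i)) x)" by (rule arg_cong)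
   show "[sign \<sigma>] \<cdot>\<^bsub>K\<^esub> (\<Otimes>\<^bsub>K\<^esub>i\<in>{..<n}. K.peval (K.pd (\<sigma> i) (E i)) x) \<in> carrier K"
    by (intro K.add.int_pow_closed K.finprod_closed) (use C in auto)
  qed
  have dnz: "\<exists>x \<in> K.pts n. ?det x ~= \<zero>\<^bsub>K\<^esub>" using xs(2) jac[OF PiE_pts[OF xs(1)]] PiE_pts[OF xs(1)] by auto
  define \<phi> where "\<phi> i = (\<lambda>j. if j < n then E j else PV i)" for i
  have \<phi>c: "(\<lambda>j. K.peval (\<phi> i j) x) = comb n (\<lambda>j. K.peval (E j) x) (x i)" for i x
   by (rule ext) (simp add: \<phi>_def comb_def)
  have \<phi>w: "K.pwf n (\<phi> i j)" if "i < n" for i j using E(1) that by (simp add: \<phi>_def)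
  let ?a = "\<lambda>i x. comb n (\<lambda>j. K.peval (E j) x) (x i)"
  have "\<exists>Q. K.pwf (Suc n) Q \<and> (\<forall>x \<in> K.pts n. K.peval Q (?a i x) = \<zero>\<^bsub>K\<^esub>) \<and>
   (\<exists>x \<in> K.pts n. K.peval (K.pd n Q) (?a i x) ~= \<zero>\<^bsub>K\<^esub>)" if i: "i < n" for i
   by (rule VS.algebraic_relation[OF p E(1) dnz i \<phi>_def, unfolded \<phi>c])
  then have "\<forall>i. \<exists>Q. i < n --> K.pwf (Suc n) Q \<and> (\<forall>x \<in> K.pts n. K.peval Q (?a i x) = \<zero>\<^bsub>K\<^esub>) \<and>
   (\<exists>x \<in> K.pts n. K.peval (K.pd n Q) (?a i x) ~= \<zero>\<^bsub>K\<^esub>)" by blast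
  then obtain Q where Q0: "\<forall>i. i < n --> K.pwf (Suc n) (Q i) \<and> (\<forall>x \<in> K.pts n. K.peval (Q i) (?a i x) = \<zero>\<^bsub>K\<^esub>) \<and>
   (\<exists>x \<in> K.pts n. K.peval (K.pd n (Q i)) (?a i x) ~= \<zero>\<^bsub>K\<^esub>)" by (elim choice[THEN exE]) (rule that)
  have Q: "K.pwf (Suc n) (Q i)" "\<And>x. x \<in> K.pts n ==> K.peval (Q i) (?a i x) = \<zero>\<^bsub>K\<^esub>"
   "\<exists>x \<in> K.pts n. K.peval (K.pd n (Q i)) (?a i x) ~= \<zero>\<^bsub>K\<^esub>" if "i < n" for i using Q0[rule_format, OF that] by blast+
  \<comment> \<open>Indices below \<open>n\<close> stand for the separability of the relations
    \<open>Q k\<close>, index \<open>n\<close> for the Jacobian determinant. Each condition holds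
    somewhere, hence all of them hold together at a point \<open>x0\<close> as close to
    \<open>u\<close> as desired, even if the determinant vanishes at \<open>u\<close>.\<close>
  define f where "f k x = (if k < n then K.peval (K.pd n (Q k)) (?a k x) else ?det x)" for k x
  have "\<exists>x \<in> K.pts n. (\<forall>i<n. VS.sdv c (x i \<ominus>\<^bsub>K\<^esub> u i)) \<and> (\<forall>k \<in> {..n}. f k x ~= \<zero>\<^bsub>K\<^esub>)"
  proof (rule VS.polyf_family_nonzero_near[OF p finite_atMost _ _ up c(1)])
   fix k
   show "K.polyf n (f k)"
   proof (cases "k < n")
    case True
    have "K.polyf n (K.peval (psub (K.pd n (Q k)) (\<phi> k)))"
     by (rule K.polyf_peval, rule K.pwf_psub[OF K.pwf_pd[OF Q(1)[OF True]]], rule \<phi>w[OF True])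
    then show ?thesis by (rule K.polyf_cong) (use True in \<open>simp add: f_def K.peval_psub \<phi>c\<close>)
   next
    case False
    have "K.polyf n ?det" by (rule K.polyf_det, rule K.polyf_peval, rule K.pwf_pd, rule E(1))
    then show ?thesis by (rule K.polyf_cong) (use False in \<open>simp add: f_def\<close>)
   qed
   show "\<exists>x \<in> K.pts n. f k x ~= \<zero>\<^bsub>K\<^esub>"
   proof (cases "k < n")
    case True then show ?thesis using Q(3)[OF True] by (simp add: f_def)
   next
    case False then show ?thesis using dnz by (simp add: f_def)
   qed
  qed
  then obtain x0 where x0: "x0 \<in> K.pts n" "\<forall>i<n. VS.sdv c (x0 i \<ominus>\<^bsub>K\<^esub> u i)" "\<forall>k \<in> {..n}. f k x0 ~= \<zero>\<^bsub>K\<^esub>" by (elim bexE conjE) (rule that)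
  have det0: "?det x0 ~= \<zero>\<^bsub>K\<^esub>" using x0(3)[rule_format, of n] by (simp add: f_def)
  have q0: "K.peval (K.pd n (Q i)) (?a i x0) ~= \<zero>\<^bsub>K\<^esub>" if "i < n" for i using x0(3)[rule_format, of i] that by (simp add: f_def)
  have "\<exists>d \<in> carrier K - {\<zero>\<^bsub>K\<^esub>}. \<forall>y \<in> K.pts n. (\<forall>i<n. VS.sdv d (y i \<ominus>\<^bsub>K\<^esub> K.peval (E i) x0)) -->
   (\<exists>z \<in> K.pts n. (\<forall>i<n. VS.sdv c (z i \<ominus>\<^bsub>K\<^esub> x0 i)) \<and> (\<forall>i<n. K.peval (E i) z = y i))"
   by (rule VS.local_surjectivity[OF SP p E(1) x0(1) det0 Q(1) Q(2) q0 c(1)])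
  then obtain d where d: "d \<in> carrier K - {\<zero>\<^bsub>K\<^esub>}" "\<And>y. y \<in> K.pts n ==> \<forall>i<n. VS.sdv d (y i \<ominus>\<^bsub>K\<^esub> K.peval (E i) x0) ==>
   \<exists>z \<in> K.pts n. (\<forall>i<n. VS.sdv c (z i \<ominus>\<^bsub>K\<^esub> x0 i)) \<and> (\<forall>i<n. K.peval (E i) z = y i)" by blast
  have "box n (poly_map K n P x0) d \<subseteq> poly_map K n P ` U"
  proof
   fix y assume "y \<in> box n (poly_map K n P x0) d"
   then have yE: "y \<in> {..<n} \<rightarrow>\<^sub>E carrier K" and ys: "\<And>i. i < n ==> VS.sdv d (y i \<ominus>\<^bsub>K\<^esub> poly_map K n P x0 i)" unfolding box_def by blast+
   have "\<forall>i<n. VS.sdv d (y i \<ominus>\<^bsub>K\<^esub> K.peval (E i) x0)" using ys pm(2)[OF x0(1)] by simp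
   then obtain z where z: "z \<in> K.pts n" "\<forall>i<n. VS.sdv c (z i \<ominus>\<^bsub>K\<^esub> x0 i)" "\<forall>i<n. K.peval (E i) z = y i"
    using d(2)[OF PiE_pts[OF yE]] by blast
   \<comment> \<open>Solutions are functions with arbitrary values beyond \<open>n\<close>;
     restriction turns them into points of the topology.\<close>
   define z' where "z' = (\<lambda>i\<in>{..<n}. z i)"
   have z'i: "z' i = z i" if "i < n" for i using that by (simp add: z'_def)
   have z'E: "z' \<in> {..<n} \<rightarrow>\<^sub>E carrier K" using K.ptsD[OF z(1)] by (simp add: z'_def PiE_iff)
   have "VS.sdv c (z' i \<ominus>\<^bsub>K\<^esub> u i)" if i: "i < n" for i
   proof -
    have id: "a \<ominus>\<^bsub>K\<^esub> d = (a \<ominus>\<^bsub>K\<^esub> b) \<oplus>\<^bsub>K\<^esub> (b \<ominus>\<^bsub>K\<^esub> d)" if "a \<in> carrier K" "b \<in> carrier K" "d \<in> carrier K" for a b d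
     using that by - (rule K.ring_identity, (rule K.ring_rep | assumption | (simp; fail))+, (simp_all add: K.l_distr K.r_distr K.a_ac K.m_ac)?)
    show ?thesis unfolding z'i[OF i] id[OF K.ptsD[OF z(1) i] K.ptsD[OF x0(1) i] K.ptsD[OF up i]]
     by (rule VS.sdv_add[OF z(2)[rule_format, OF i] x0(2)[rule_format, OF i] cc])
   qed
   then have "z' \<in> box n u c" unfolding box_def using z'E by blast
   then have z'U: "z' \<in> U" using c(2) by blast
   have "poly_map K n P z' = y"
   proof (rule PiE_ext[OF pm(1)[OF PiE_pts[OF z'E]] yE])
    fix i assume "i \<in> {..<n}"
    then have i: "i < n" by simp
    have "K.peval (E i) z' = K.peval (E i) z" by (rule K.peval_cong[OF E(1)[OF i] z'i])
    then show "poly_map K n P z' i = y i" using pm(2)[OF PiE_pts[OF z'E] i] z(3) i by simp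
   qed
   then show "y \<in> poly_map K n P ` U" using z'U by blast
  qed
  then show ?thesis by (rule interior_nonempty[OF pm(1)[OF x0(1)] d(1)])
 qed
qed

end

lemma regular_points_of_open_sets:
 "interior_image_of_open_sets F G v ==> interior_image_at_regular_points F G v"
 unfolding interior_image_of_open_sets_def interior_image_at_regular_points_def by blast

text \<open>Quantifying over value groups whose elements are subsets of the field covers all
  coarsenings up to equivalence, by \<open>coarsening_value_group\<close>; the coarsening built in
  \<open>SP_of_coarsenings\<close> is of this kind.\<close>

theorem theorem7p5:
 fixes K :: "('a, 'k) ring_scheme" and G :: "('g, 'h) ogroup_scheme" and v :: "'a \<Rightarrow> 'g"
 assumes "valued_field K G v"
 shows "(henselian K G v \<longleftrightarrow>
   (\<forall>(H :: 'a set ogroup) w. coarsening K G v H w \<longrightarrow>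
    t_henselian (residue_field K H w) G (induced_val v)))
  \<and> (henselian K G v \<longleftrightarrow>
   (\<forall>(H :: 'a set ogroup) w. coarsening K G v H w \<longrightarrow>
    interior_image_at_regular_points (residue_field K H w) G (induced_val v)))
  \<and> (henselian K G v \<longleftrightarrow>
   (\<forall>(H :: 'a set ogroup) w. coarsening K G v H w \<longrightarrow>
    interior_image_of_open_sets (residue_field K H w) G (induced_val v)))"
proof -
 interpret V: valued_field K G v by fact
 note h = V.henselian_iff_SP
 have F: "valued_field (residue_field K H w) G (induced_val v)"
  if "coarsening K G v H w" for H :: "'a set ogroup" and w
  by (rule valued_field_induced_val[OF assms that])
 have SPF: "valuation_subring.SP (residue_field K H w) (val_set (residue_field K H w) G (induced_val v))"
  if c: "coarsening K G v H w" and "henselian K G v" for H :: "'a set ogroup" and w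
  by (rule residue_setting.SP_residue[OF residue_setting.intro[OF assms residue_setting_axioms.intro[OF c]]])
   (use \<open>henselian K G v\<close> h in blast)
 have 2: "t_henselian (residue_field K H w) G (induced_val v)"
  if "coarsening K G v H w" "henselian K G v" for H :: "'a set ogroup" and w
  by (rule valued_field.SP_t_henselian[OF F[OF that(1)] SPF[OF that]])
 have 4: "interior_image_of_open_sets (residue_field K H w) G (induced_val v)"
  if "coarsening K G v H w" "henselian K G v" for H :: "'a set ogroup" and w
  by (rule valued_field.SP_interior_image[OF F[OF that(1)] SPF[OF that]])
 have from_t: "henselian K G v" if t: "\<And>(H :: 'a set ogroup) w. coarsening K G v H w ==> t_henselian (residue_field K H w) G (induced_val v)"
  unfolding h
 proof (rule V.SP_of_coarsenings)
  fix H :: "'a set ogroup" and w assume c: "coarsening K G v H w"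
  show "valuation_subring.approximate_SP (residue_field K H w) (val_set (residue_field K H w) G (induced_val v))"
   by (rule valuation_subring.t_SP_approximate[OF valued_field.valuation_subring_val_set[OF F[OF c]]
     valued_field.t_henselian_t_SP[OF F[OF c] t[OF c]]])
 qed
 have from_regular: "henselian K G v" if t: "\<And>(H :: 'a set ogroup) w. coarsening K G v H w ==> interior_image_at_regular_points (residue_field K H w) G (induced_val v)"
  unfolding h
 proof (rule V.SP_of_coarsenings)
  fix H :: "'a set ogroup" and w assume c: "coarsening K G v H w"
  show "valuation_subring.approximate_SP (residue_field K H w) (val_set (residue_field K H w) G (induced_val v))"
   by (rule valued_field.regular_approximate_SP[OF F[OF c] t[OF c]])
 qed
 \<comment> \<open>Henselianity passes to the residue fields and yields the t-henselian condition
   and the one on open sets. The latter contains the one on regular points, and this as well as the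
   t-henselian condition leads back through approximate zeros.\<close>
 show ?thesis
 proof (intro conjI)
  show "henselian K G v \<longleftrightarrow> (\<forall>(H :: 'a set ogroup) w. coarsening K G v H w -->
    t_henselian (residue_field K H w) G (induced_val v))" using 2 from_t by blast
  show "henselian K G v \<longleftrightarrow> (\<forall>(H :: 'a set ogroup) w. coarsening K G v H w -->
    interior_image_at_regular_points (residue_field K H w) G (induced_val v))"
   using regular_points_of_open_sets[OF 4] from_regular by blast
  show "henselian K G v \<longleftrightarrow> (\<forall>(H :: 'a set ogroup) w. coarsening K G v H w -->
    interior_image_of_open_sets (residue_field K H w) G (induced_val v))"
   using 4 from_regular[OF regular_points_of_open_sets] by blast
 qed
qed

end
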